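(* Let $d\geq 2$ and $s\in(0,d)$ with $s\geq d-2$. Let $W_s(x)=|x|^{-s}\Phi(x/|x|)$ for $x\neq0$, $W_s(0)=+\infty$, where $\Phi:\mathbb{S}^{d-1}\to\mathbb{R}$ is continuous, even and strictly positive, and assume that $\widehat{W_s}$ is continuous and non-negative on $\mathbb{S}^{d-1}$. Let $E=RDB_1$ with $R\in \mathrm{SO}(d)$ and $D$ a positive-definite $d\times d$ diagonal matrix, and let $T^E(x)=RDx$. Then the functional $I_s^E$ has a unique minimizer over $\mathcal{P}(\mathbb{R}^d)$, namely the push-forward of $\mu_{\mathrm{iso},s}$ by $T^E$, which is the probability measure \[ \mu_s^E=\begin{cases}|E|^{-1}\dfrac{\Gamma(1+\frac s2)}{\Gamma(1+\frac d2)\Gamma(1+\frac{s-d}{2})}\big(1-|D^{-1}R^Tx|^2\big)^{\frac{s-d}{2}}\,\mathcal{L}^d(x)\llcorner E & \text{if } d-2<s<d,\\[2mm] \big(\mathcal{H}^{d-1}(\partial B_1)\det D\big)^{-1}|D^{-2}R^Tx|^{-1}\,\mathcal{H}^{d-1}(x)\llcorner\partial E & \text{if } 0<s=d-2.\end{cases} \] In particular the minimizer does not depend on $\Phi$.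
   Context: $\mathcal{P}(\mathbb{R}^d)$ is the set of Borel probability measures on $\mathbb{R}^d$, $B_1$ the closed unit ball centered at the origin. The Fourier transform is $\widehat f(\xi)=\int_{\mathbb{R}^d}f(x)e^{-ix\cdot\xi}\,dx$, extended to tempered distributions by duality; $W_s$ is a tempered distribution and its Fourier transform is $(-d+s)$-homogeneous, $\widehat{W_s}(\xi)=|\xi|^{s-d}\Psi(\xi/|\xi|)$; "$\widehat{W_s}$ continuous and non-negative on $\mathbb{S}^{d-1}$" means that $\Psi$ is a continuous non-negative function on $\mathbb{S}^{d-1}$. For a compact set $E$, $V_E(x)=0$ if $x\in E$ and $V_E(x)=+\infty$ otherwise, and $I_s^E(\mu)=\int\!\!\int W_s(x-y)\,d\mu(x)d\mu(y)+\int V_E\,d\mu$ for $\mu\in\mathcal{P}(\mathbb{R}^d)$ (equivalently, minimizing $I_s(\mu)=\iint W_s(x-y)d\mu d\mu$ over probability measures supported in $E$). $\mu_{\mathrm{iso},s}=c_{s,d}(1-|x|^2)^{\frac{s-d}{2}}\mathcal{L}^d\llcorner B_1$ if $d-2<s<d$ and $\mu_{\mathrm{iso},s}=c_{s,d}\mathcal{H}^{d-1}\llcorner\partial B_1$ if $s\le d-2$, with $c_{s,d}$ the normalizing constant making it a probability measure. *)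

theory Defs
  imports "HOL-Probability.Probability"
begin

definition hausdorff_outer :: "real \<Rightarrow> ('a::euclidean_space) set \<Rightarrow> ennreal" where
  "hausdorff_outer k A =
     (SUP \<delta>\<in>{0<..}.
        INF C\<in>{C :: nat \<Rightarrow> 'a set. A \<subseteq> (\<Union>i. C i) \<and> (\<forall>i. bounded (C i) \<and> diameter (C i) < \<delta>)}.
          (\<Sum>i. ennreal (pi powr (k / 2) / Gamma (k / 2 + 1) * (diameter (C i) / 2) powr k)))"

definition hausdorff_measure :: "real \<Rightarrow> ('a::euclidean_space) measure" where
  "hausdorff_measure k = measure_of UNIV (sets borel) (hausdorff_outer k)"

text \<open>Smooth functions all of whose iterated partial derivatives decay faster than any
  polynomial.  D l is the iterated partial derivative along the coordinate directions
  listed in l.\<close>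
definition schwartz :: "(real^'n \<Rightarrow> complex) \<Rightarrow> bool" where
  "schwartz f \<longleftrightarrow>
     (\<exists>D :: 'n list \<Rightarrow> real^'n \<Rightarrow> complex.
        D [] = f \<and>
        (\<forall>l i x. ((\<lambda>t. D l (x + t *\<^sub>R axis i 1)) has_vector_derivative D (i # l) x) (at 0)) \<and>
        (\<forall>l. continuous_on UNIV (D l)) \<and>
        (\<forall>l (m::nat). bounded (range (\<lambda>x. (1 + norm x) ^ m *\<^sub>R D l x))))"

definition fourier :: "(real^'n \<Rightarrow> complex) \<Rightarrow> real^'n \<Rightarrow> complex" where
  "fourier f \<xi> = (\<integral>x. f x * cis (- (x \<bullet> \<xi>)) \<partial>lborel)"

definition Wker :: "real \<Rightarrow> (real^'n \<Rightarrow> real) \<Rightarrow> real^'n \<Rightarrow> ennreal" where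
  "Wker s \<Phi> x = (if x = 0 then \<infinity> else ennreal (norm x powr (- s) * \<Phi> (x /\<^sub>R norm x)))"

text \<open>The same kernel as a locally integrable real function (value at 0 irrelevant).\<close>
definition Wfun :: "real \<Rightarrow> (real^'n \<Rightarrow> real) \<Rightarrow> real^'n \<Rightarrow> real" where
  "Wfun s \<Phi> x = norm x powr (- s) * \<Phi> (sgn x)"

text \<open>Fourier transform of the tempered distribution W_s is the (s-d)-homogeneous function
  |xi|^{s-d} Psi(xi/|xi|) with Psi continuous and nonnegative on the sphere.\<close>
definition hat_cont_nonneg :: "real \<Rightarrow> (real^'n \<Rightarrow> real) \<Rightarrow> bool" where
  "hat_cont_nonneg s \<Phi> \<longleftrightarrow>
     (\<exists>\<Psi> :: real^'n \<Rightarrow> real.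
        continuous_on (sphere 0 1) \<Psi> \<and> (\<forall>\<xi>\<in>sphere 0 1. 0 \<le> \<Psi> \<xi>) \<and>
        (\<forall>\<phi>. schwartz \<phi> \<longrightarrow>
           (\<integral>x. complex_of_real (Wfun s \<Phi> x) * fourier \<phi> x \<partial>lborel) =
           (\<integral>\<xi>. complex_of_real (norm \<xi> powr (s - real CARD('n)) * \<Psi> (sgn \<xi>)) * \<phi> \<xi> \<partial>lborel)))"

definition energyE :: "real \<Rightarrow> (real^'n \<Rightarrow> real) \<Rightarrow> (real^'n) set \<Rightarrow> (real^'n) measure \<Rightarrow> ennreal" where
  "energyE s \<Phi> E \<mu> =
     (\<integral>\<^sup>+x. (\<integral>\<^sup>+y. Wker s \<Phi> (x - y) \<partial>\<mu>) \<partial>\<mu>) + (\<integral>\<^sup>+x. (if x \<in> E then 0 else \<infinity>) \<partial>\<mu>)"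

definition prob_measures :: "('a::topological_space) measure set" where
  "prob_measures = {\<mu>. prob_space \<mu> \<and> sets \<mu> = sets borel}"

definition mu_iso :: "real \<Rightarrow> (real^'n) measure" where
  "mu_iso s =
     (let d = real CARD('n) in
      if d - 2 < s then
        (let f = (\<lambda>x::real^'n. ennreal (indicator (cball 0 1) x * (1 - (norm x)\<^sup>2) powr ((s - d) / 2)))
         in density lborel (\<lambda>x. f x / (\<integral>\<^sup>+y. f y \<partial>lborel)))
      else
        density (hausdorff_measure (d - 1))
          (\<lambda>x. indicator (sphere 0 1) x / emeasure (hausdorff_measure (d - 1)) (sphere (0::real^'n) 1)))"

end

theory Submission
 imports
  Defs
  "HOL-Complex_Analysis.Cauchy_Integral_Theorem"
  "HOL-Real_Asymp.Real_Asymp"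
  "HOL-Computational_Algebra.Polynomial"
begin

text \<open>Let \<open>w\<close> be the Fourier transform of the kernel.  Testing it against Gaussians and writing
 \<open>e\<^sup>-\<^sup>\<epsilon>\<^sup>|\<^sup>\<xi>\<^sup>|\<close> as a mixture of Gaussians shows that \<open>V \<epsilon> x = \<integral> w(\<xi>) e\<^sup>-\<^sup>\<epsilon>\<^sup>|\<^sup>\<xi>\<^sup>| cos(x \<bullet> \<xi>) d\<xi>\<close> is nonnegative,
 is dominated by a multiple of the kernel, and tends to \<open>(2\<pi>)\<^sup>d\<close> times the kernel.  In polar
 coordinates the \<open>V \<epsilon>\<close>-potential of the image of the isotropic measure under \<open>\<lambda>T\<close>, \<open>\<lambda> > 1\<close>, is an
 angular average of integrals of \<open>r\<^sup>s\<^sup>-\<^sup>1 e\<^sup>-\<^sup>\<epsilon>\<^sup>r m(a r) cos(r x \<bullet> \<omega>)\<close>, where the radial profile \<open>m\<close> of the transform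
 of the isotropic measure solves \<open>r m'' + (s + 1) m' + r m = 0\<close>.  Because of this equation the limit
 \<open>\<epsilon> \<rightarrow> 0\<close> does not depend on \<open>x\<close> inside the ellipsoid, whatever the angular profile of the kernel is.
 So the potential is a constant \<open>\<lambda>\<^sup>-\<^sup>s c\<close> on the ellipsoid, and expanding the nonnegative quadratic form
 \<open>\<integral> w |\<nu>\<^sup>^ - \<mu>\<^sup>^|\<^sup>2\<close> and letting \<open>\<epsilon> \<rightarrow> 0\<close>, \<open>\<lambda> \<rightarrow> 1\<close> bounds \<open>(2\<pi>)\<^sup>d I(\<nu>)\<close> below by \<open>c \<ge> (2\<pi>)\<^sup>d I(\<mu>)\<close> plus this form.
 In the case of equality the transforms agree on the open cone \<open>w > 0\<close>, which determines a
 compactly supported measure.\<close>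

section \<open>Lebesgue measure under linear maps and in polar coordinates\<close>

text \<open>The damping \<open>exp (- \<epsilon> * norm \<xi>)\<close> meets two competing needs.
  Gaussians are Schwartz functions and can be tested against the Fourier hypothesis, which the
  exponential, not smooth at 0, cannot; but only exponential damping turns the radial integral into
  a Laplace transform, holomorphic in w = b + i \<epsilon>, on which the equation of m can act. The
  dilation is forced by the singularities at w = 1 and w = -1: boundary points of the ellipsoid
  reach |b| = 1, whereas dilating the measure by l > 1 keeps |b| at most 1/l. Since the kernel is
  homogeneous, energies of the dilated measure are known multiples of the original one, so that
  nothing is lost as l tends to 1. The ball and sphere cases are not separated in the energy
  argument: besides rotation invariance and support in the unit ball, the isotropic measure enters
  through one relation between its moments, in which the dimension cancels and s survives. What
  separates the cases is the explicit density. On the boundary of the ellipsoid it requires an area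
  formula for Hausdorff measure, obtained here from Lebesgue volumes of oblique cylinders.\<close>

lemma matrix_inv_mult:
 fixes A :: "'a::semiring_1^'n^'n"
 assumes "invertible A"
 shows "A ** matrix_inv A = mat 1" "matrix_inv A ** A = mat 1"
 using assms someI_ex[of "\<lambda>A'. A ** A' = mat 1 \<and> A' ** A = mat 1"]
 unfolding invertible_def matrix_inv_def by auto

lemma measurable_matrix_vector_mult[measurable]:
 fixes A :: "real^'n^'m"
 shows "(\<lambda>x. A *v x) \<in> borel_measurable borel"
 by (intro borel_measurable_continuous_onI matrix_vector_mult_linear_continuous_on)

text \<open>Uniqueness of Haar measure by a double integral: 1_A(x) 1_B(y - x) is integrated in both
  orders, using invariance of \<open>lborel\<close> in y and of M in x. The substitution x -> y + x
  leaves B evaluated at -x, hence the reflected set on the right.\<close>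

lemma translation_invariant_measure:
 fixes M :: "'a::euclidean_space measure"
 assumes sf: "sigma_finite_measure M" and [measurable_cong]: "sets M = sets borel"
  and inv: "\<And>a. distr M borel (\<lambda>x. a + x) = M"
  and [measurable]: "A \<in> sets borel" "B \<in> sets borel"
 shows "emeasure M A * emeasure lborel B = emeasure M (uminus -` B) * emeasure lborel A"
proof -
 interpret M: sigma_finite_measure M by fact
 interpret pair_sigma_finite M "lborel :: 'a measure" ..
 have spM: "space M = UNIV" using sets_eq_imp_space_eq[of M borel] assms(2) by simp
 have negB[measurable]: "uminus -` B \<in> sets borel"
  using measurable_sets[of uminus borel borel B] by simp
 have "emeasure M A * emeasure lborel B = (\<integral>\<^sup>+x. indicator A x * (\<integral>\<^sup>+y. indicator B y \<partial>lborel) \<partial>M)"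
  by (simp add: nn_integral_multc)
 also have "\<dots> = (\<integral>\<^sup>+x. (\<integral>\<^sup>+y. indicator A x * indicator B (y - x) \<partial>lborel) \<partial>M)"
 proof (rule nn_integral_cong)
  fix x
  have "(\<integral>\<^sup>+y. indicator B y \<partial>lborel) = (\<integral>\<^sup>+y. indicator B y \<partial>distr lborel borel (\<lambda>y. - x + y))"
   by (simp only: lborel_distr_plus)
  also have "\<dots> = (\<integral>\<^sup>+y. indicator B (y - x) \<partial>lborel)"
   by (subst nn_integral_distr) auto
  finally show "indicator A x * (\<integral>\<^sup>+y. indicator B y \<partial>lborel) = (\<integral>\<^sup>+y. indicator A x * indicator B (y - x) \<partial>lborel)"
   by (simp add: nn_integral_cmult)
 qed
 also have "\<dots> = (\<integral>\<^sup>+y. (\<integral>\<^sup>+x. indicator A x * indicator B (y - x) \<partial>M) \<partial>lborel)"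
  by (rule Fubini'[symmetric]) measurable
 also have "\<dots> = (\<integral>\<^sup>+y. (\<integral>\<^sup>+x. indicator A (y + x) * indicator B (- x) \<partial>M) \<partial>lborel)"
 proof (rule nn_integral_cong)
  fix y
  have "(\<integral>\<^sup>+x. indicator A x * indicator B (y - x) \<partial>M) = (\<integral>\<^sup>+x. indicator A x * indicator B (y - x) \<partial>distr M borel (\<lambda>x. y + x))"
   by (simp only: inv)
  also have "\<dots> = (\<integral>\<^sup>+x. indicator A (y + x) * indicator B (- x) \<partial>M)"
   by (subst nn_integral_distr) auto
  finally show "(\<integral>\<^sup>+x. indicator A x * indicator B (y - x) \<partial>M) = (\<integral>\<^sup>+x. indicator A (y + x) * indicator B (- x) \<partial>M)" .
 qed
 also have "\<dots> = (\<integral>\<^sup>+x. (\<integral>\<^sup>+y. indicator A (y + x) * indicator B (- x) \<partial>lborel) \<partial>M)"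
  by (rule Fubini') measurable
 also have "\<dots> = (\<integral>\<^sup>+x. emeasure lborel A * indicator (uminus -` B) x \<partial>M)"
 proof (rule nn_integral_cong)
  fix x
  have "emeasure lborel A = (\<integral>\<^sup>+y. indicator A y \<partial>distr lborel borel (\<lambda>y. x + y))"
   by (simp add: lborel_distr_plus)
  also have "\<dots> = (\<integral>\<^sup>+y. indicator A (y + x) \<partial>lborel)"
   by (subst nn_integral_distr) (auto simp: add.commute)
  finally show "(\<integral>\<^sup>+y. indicator A (y + x) * indicator B (- x) \<partial>lborel) = emeasure lborel A * indicator (uminus -` B) x"
   by (simp add: nn_integral_multc indicator_def)
 qed
 also have "\<dots> = emeasure M (uminus -` B) * emeasure lborel A"
  by (simp add: nn_integral_cmult_indicator mult.commute)
 finally show ?thesis .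
qed

lemma emeasure_lborel_unit_ball:
 "emeasure lborel (ball (0::'a::euclidean_space) 1) = ennreal (measure lborel (ball (0::'a) 1))"
 "measure lborel (ball (0::'a) 1) > 0"
 using emeasure_lborel_ball_finite[of "0::'a" 1] by (auto simp: emeasure_eq_ennreal_measure content_ball_pos)

text \<open>The image of Lebesgue measure under A is again translation invariant, because a + A x =
  A (A^-1 a + x), and it is finite on balls, because A^-1 maps bounded sets to bounded sets.
  Uniqueness of Haar measure then leaves a single unknown factor.\<close>

lemma distr_lborel_matrix_const:
 fixes A :: "real^'n^'n"
 assumes A: "invertible A"
 shows "\<exists>c>0. distr lborel borel (\<lambda>x. A *v x) = density lborel (\<lambda>_. ennreal c)"
proof -
 define M where "M = distr lborel borel (\<lambda>x. A *v x)"
 let ?B = "ball 0 1 :: (real^'n) set"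
 note AB = matrix_inv_mult[OF A]
 have sets[measurable_cong, simp]: "sets M = sets borel" by (simp add: M_def)
 have em: "emeasure M S = emeasure lborel ((\<lambda>x. A *v x) -` S)" if "S \<in> sets borel" for S
  using that by (simp add: M_def emeasure_distr)
 have fin: "emeasure M (ball 0 r) < \<infinity>" for r
 proof -
  have "bounded ((\<lambda>x. matrix_inv A *v x) ` ball 0 r)"
   by (intro bounded_linear_image) auto
  moreover have "(\<lambda>x. A *v x) -` ball 0 r \<subseteq> (\<lambda>x. matrix_inv A *v x) ` ball 0 r"
  proof
   fix x assume "x \<in> (\<lambda>x. A *v x) -` ball 0 r"
   then show "x \<in> (\<lambda>x. matrix_inv A *v x) ` ball 0 r"
    by (intro image_eqI[of _ _ "A *v x"]) (auto simp: matrix_vector_mul_assoc AB)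
  qed
  ultimately have "bounded ((\<lambda>x. A *v x) -` ball 0 r)" by (rule bounded_subset)
  then show ?thesis by (simp add: em emeasure_bounded_finite del: infinity_ennreal_def)
 qed
 have "sigma_finite_measure M"
 proof
  have "(\<Union>n::nat. ball (0::real^'n) (real n)) = UNIV"
   by (auto simp: reals_Archimedean2)
  then show "\<exists>A. countable A \<and> A \<subseteq> sets M \<and> \<Union> A = space M \<and> (\<forall>a\<in>A. emeasure M a \<noteq> \<infinity>)"
   using fin by (intro exI[of _ "range (\<lambda>n::nat. ball (0::real^'n) (real n))"]) (auto simp: M_def less_top)
 qed
 moreover have "distr M borel (\<lambda>x. a + x) = M" for a
 proof -
  have "(\<lambda>x. a + A *v x) = (\<lambda>x. A *v (matrix_inv A *v a + x))"
   by (auto simp: matrix_vector_right_distrib matrix_vector_mul_assoc AB)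
  then have "distr M borel (\<lambda>x. a + x) = distr (distr lborel borel (\<lambda>x. matrix_inv A *v a + x)) borel (\<lambda>x. A *v x)"
   unfolding M_def by (subst (1 2) distr_distr) (auto simp: comp_def)
  then show ?thesis by (simp only: lborel_distr_plus M_def)
 qed
 \<comment> \<open>The reference set is a ball, so the reflection in
   \<open>translation_invariant_measure\<close> leaves it unchanged.\<close>
 ultimately have main: "emeasure M S * emeasure lborel ?B = emeasure M ?B * emeasure lborel S" if "S \<in> sets borel" for S
 proof -
  have "uminus -` ?B = ?B" by auto
  then show ?thesis
   using translation_invariant_measure[of M S ?B] \<open>sigma_finite_measure M\<close> \<open>\<And>a. distr M borel (\<lambda>x. a + x) = M\<close> that by simp
 qed
 have B: "emeasure lborel ?B = ennreal (measure lborel ?B)" "measure lborel ?B > 0"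
  by (rule emeasure_lborel_unit_ball)+
 define c where "c = measure M ?B / measure lborel ?B"
 have MB: "emeasure M ?B = ennreal (measure M ?B)"
  using fin[of 1] by (simp add: emeasure_eq_ennreal_measure less_top[symmetric])
 have eq: "emeasure M S = ennreal c * emeasure lborel S" if "S \<in> sets borel" for S
 proof -
  have "ennreal (1 / measure lborel ?B) * (emeasure M S * emeasure lborel ?B) = ennreal (1 / measure lborel ?B) * (emeasure M ?B * emeasure lborel S)"
   using main[OF that] by simp
  moreover have "ennreal (1 / measure lborel ?B) * (emeasure M S * emeasure lborel ?B) =
    emeasure M S * ennreal (1 / measure lborel ?B * measure lborel ?B)"
   by (subst B(1)) (simp only: ennreal_mult' measure_nonneg divide_nonneg_nonneg zero_le_one mult_ac)
  moreover have "ennreal (1 / measure lborel ?B) * (emeasure M ?B * emeasure lborel S) = ennreal c * emeasure lborel S"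
   using MB B by (simp add: c_def ennreal_mult[symmetric] mult.assoc[symmetric])
  ultimately show ?thesis using B by simp
 qed
 have "c > 0"
 proof -
  have "c \<noteq> 0"
  proof
   assume "c = 0"
   then have "emeasure M UNIV = 0" using eq[of UNIV] by simp
   then show False by (simp add: em)
  qed
  moreover have "c \<ge> 0" by (simp add: c_def)
  ultimately show ?thesis by simp
 qed
 moreover have "M = density lborel (\<lambda>_. ennreal c)"
  by (intro measure_eqI) (auto simp: eq emeasure_density_const)
 ultimately show ?thesis unfolding M_def by blast
qed

lemma density_lborel_const_eqD:
 assumes "density lborel (\<lambda>_::'a::euclidean_space. ennreal a) = density lborel (\<lambda>_. ennreal b)" "a \<ge> 0" "b \<ge> 0"
 shows "a = b"
proof -
 let ?B = "ball (0::'a) 1"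
 have B: "emeasure lborel ?B = ennreal (measure lborel ?B)" "measure lborel ?B > 0"
  by (rule emeasure_lborel_unit_ball)+
 have "emeasure (density lborel (\<lambda>_. ennreal a)) ?B = emeasure (density lborel (\<lambda>_. ennreal b)) ?B"
  using assms by simp
 then have "ennreal (a * measure lborel ?B) = ennreal (b * measure lborel ?B)"
  using B assms(2,3) by (simp only: emeasure_density_const ennreal_mult measure_nonneg sets_lborel borel_open open_ball)
 then show ?thesis using B assms(2,3) by simp
qed

text \<open>The unknown factor is multiplicative under composition, like the determinant, so it is
  enough to identify it on elementary matrices: diagonal matrices by scaling each coordinate, a
  transposition because it is an involution and its factor squares to 1, a shear by the conjugation
  below.\<close>

lemma distr_lborel_matrix:
 fixes A :: "real^'n^'n"
 assumes A: "det A \<noteq> 0"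
 shows "distr lborel borel (\<lambda>x. A *v x) = density lborel (\<lambda>_. ennreal (1 / \<bar>det A\<bar>))"
proof -
 define dl where "dl A = distr lborel borel (\<lambda>x::real^'n. A *v x)" for A :: "real^'n^'n"
 have compose: "dl (A ** B) = density lborel (\<lambda>_. ennreal (a * b))"
  if "dl A = density lborel (\<lambda>_. ennreal a)" "dl B = density lborel (\<lambda>_. ennreal b)" "a > 0" "b > 0" for A B a b
 proof (rule measure_eqI)
  show "sets (dl (A ** B)) = sets (density lborel (\<lambda>_. ennreal (a * b)))" by (simp add: dl_def)
  fix S assume "S \<in> sets (dl (A ** B))"
  then have S[measurable]: "S \<in> sets borel" by (simp add: dl_def)
  then have S'[measurable]: "(\<lambda>x. A *v x) -` S \<in> sets borel"
   by (rule measurable_sets_borel[OF measurable_matrix_vector_mult])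
  have "emeasure (dl (A ** B)) S = emeasure (dl B) ((\<lambda>x. A *v x) -` S)"
   by (simp add: dl_def emeasure_distr matrix_vector_mul_assoc vimage_def)
  also have "\<dots> = ennreal b * emeasure (dl A) S"
   unfolding that(2) by (simp add: emeasure_density_const dl_def emeasure_distr)
  finally show "emeasure (dl (A ** B)) S = emeasure (density lborel (\<lambda>_. ennreal (a * b))) S"
   using that by (simp add: emeasure_density_const ennreal_mult mult_ac)
 qed
 have dlI: "dl (mat 1) = density lborel (\<lambda>_. ennreal 1)"
  by (simp add: dl_def density_1 distr_id2)
 have ex: "\<exists>a>0. dl A = density lborel (\<lambda>_. ennreal a)" if "det A \<noteq> 0" for A
  using that distr_lborel_matrix_const[of A] by (simp add: dl_def invertible_det_nz)
 have "det A \<noteq> 0 \<longrightarrow> dl A = density lborel (\<lambda>_. ennreal (1 / \<bar>det A\<bar>))"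
 proof (induct rule: induct_matrix_elementary_alt)
  fix A B :: "real^'n^'n"
  assume *: "det A \<noteq> 0 \<longrightarrow> dl A = density lborel (\<lambda>_. ennreal (1 / \<bar>det A\<bar>))"
   "det B \<noteq> 0 \<longrightarrow> dl B = density lborel (\<lambda>_. ennreal (1 / \<bar>det B\<bar>))"
  show "det (A ** B) \<noteq> 0 \<longrightarrow> dl (A ** B) = density lborel (\<lambda>_. ennreal (1 / \<bar>det (A ** B)\<bar>))"
   using compose[of A "1 / \<bar>det A\<bar>" B "1 / \<bar>det B\<bar>"] * by (auto simp: det_mul abs_mult)
 next
  fix A :: "real^'n^'n" and i
  assume "row i A = 0"
  then show "det A \<noteq> 0 \<longrightarrow> dl A = density lborel (\<lambda>_. ennreal (1 / \<bar>det A\<bar>))"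
   using det_zero_row by blast
 next
  fix A :: "real^'n^'n"
  assume diag: "\<And>i j. i \<noteq> j \<Longrightarrow> A$i$j = 0"
  have dA: "det A = (\<Prod>i\<in>UNIV. A$i$i)" by (rule det_diagonal) (use diag in auto)
  show "det A \<noteq> 0 \<longrightarrow> dl A = density lborel (\<lambda>_. ennreal (1 / \<bar>det A\<bar>))"
  proof
   assume nz: "det A \<noteq> 0"
   obtain a where a: "a > 0" "dl A = density lborel (\<lambda>_. ennreal a)" using ex[OF nz] by auto
   have *: "A *v x = 0 + (\<Sum>j\<in>Basis. (((j \<bullet> (A *v j))) * (x \<bullet> j)) *\<^sub>R j)" for x
   proof -
    have "A *v x = (\<chi> i. A$i$i * x$i)"
    proof -
     have "(\<Sum>j\<in>UNIV. A$i$j * x$j) = A$i$i * x$i" for i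
      using diag by (subst sum.remove[of _ i]) auto
     then show ?thesis by (simp add: matrix_vector_mult_def vec_eq_iff)
    qed
    show ?thesis
     unfolding euclidean_eq_iff[where 'a="real^'n"]
    proof
     fix b :: "real^'n" assume b: "b \<in> Basis"
     then obtain k where k: "b = axis k 1" by (auto simp: Basis_vec_def)
     have "(\<Sum>j\<in>Basis. (j \<bullet> (A *v j) * (x \<bullet> j)) *\<^sub>R j) \<bullet> b = b \<bullet> (A *v b) * (x \<bullet> b)"
      using b by (simp add: inner_sum_left inner_Basis if_distrib cong: if_cong)
     moreover have "b \<bullet> (A *v b) = A$k$k"
      unfolding k by (simp add: matrix_vector_mult_basis inner_axis' column_def)
     moreover have "(A *v x) \<bullet> b = A$k$k * x$k"
      unfolding k inner_axis using \<open>A *v x = _\<close> by simp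
     ultimately show "(A *v x) \<bullet> b = (0 + (\<Sum>j\<in>Basis. (j \<bullet> (A *v j) * (x \<bullet> j)) *\<^sub>R j)) \<bullet> b"
      by (simp add: k inner_axis)
    qed
   qed
   have eqd: "axis k 1 \<bullet> (A *v axis k 1) = A$k$k" for k
    by (simp add: matrix_vector_mult_basis inner_axis' column_def)
   have nzk: "A$k$k \<noteq> 0" for k using nz dA by auto
   have "lborel = density (distr lborel borel (\<lambda>x. 0 + (\<Sum>j\<in>Basis. (((j \<bullet> (A *v j))) * (x \<bullet> j)) *\<^sub>R j))) (\<lambda>_. (\<Prod>j\<in>Basis. \<bar>j \<bullet> (A *v j)\<bar>))"
    by (rule lborel_affine_euclidean) (auto simp: Basis_vec_def eqd nzk)
   also have "(\<Prod>j\<in>Basis. \<bar>j \<bullet> (A *v j)\<bar>) = \<bar>det A\<bar>"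
   proof -
    have "(\<Prod>j\<in>(Basis::(real^'n) set). \<bar>j \<bullet> (A *v j)\<bar>) = (\<Prod>i\<in>UNIV. \<bar>axis i 1 \<bullet> (A *v axis i 1)\<bar>)"
     unfolding Basis_vec_def
     by (subst prod.reindex[symmetric, of "\<lambda>i. axis i 1" UNIV, unfolded comp_def])
       (auto simp: inj_on_def axis_eq_axis intro!: prod.cong)
    then show ?thesis by (simp add: eqd dA abs_prod)
   qed
   finally have "density lborel (\<lambda>_. ennreal 1) = density (dl A) (\<lambda>_. ennreal \<bar>det A\<bar>)"
    unfolding dl_def *[symmetric] by (simp add: density_1)
   also have "\<dots> = density lborel (\<lambda>_. ennreal (a * \<bar>det A\<bar>))"
    unfolding a using a by (subst density_density_eq) (auto simp: ennreal_mult)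
   finally have "1 = a * \<bar>det A\<bar>"
    by (rule density_lborel_const_eqD) (use a in auto)
   then have "a = 1 / \<bar>det A\<bar>" using nz by (simp add: field_simps)
   then show "dl A = density lborel (\<lambda>_. ennreal (1 / \<bar>det A\<bar>))" using a by simp
  qed
 next
  fix m n :: 'n assume "m \<noteq> n"
  let ?A = "\<chi> i j. mat 1 $ i $ Transposition.transpose m n j :: real^'n^'n"
  have AA: "?A ** ?A = mat 1"
  proof -
   have "?A *v x = (\<chi> i. x $ Transposition.transpose m n i)" for x :: "real^'n"
   proof -
    have "(\<Sum>j\<in>UNIV. ?A $ i $ j * x $ j) = x $ Transposition.transpose m n i" for i
    proof -
     have "(\<Sum>j\<in>UNIV. ?A $ i $ j * x $ j) = (\<Sum>j\<in>{Transposition.transpose m n i}. x $ j)"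
      by (rule sum.mono_neutral_cong_right) (auto simp: mat_def)
     then show ?thesis by simp
    qed
    then show ?thesis by (simp add: vec_eq_iff matrix_vector_mult_def)
   qed
   then show ?thesis
    by (simp add: matrix_eq matrix_vector_mul_assoc[symmetric] vec_eq_iff)
  qed
  show "det ?A \<noteq> 0 \<longrightarrow> dl ?A = density lborel (\<lambda>_. ennreal (1 / \<bar>det ?A\<bar>))"
  proof
   assume nz: "det ?A \<noteq> 0"
   obtain a where a: "a > 0" "dl ?A = density lborel (\<lambda>_. ennreal a)" using ex[OF nz] by auto
   have "density lborel (\<lambda>_::real^'n. ennreal 1) = density lborel (\<lambda>_. ennreal (a * a))"
    using compose[OF a(2) a(2) a(1) a(1)] unfolding AA dlI .
   then have "1 = a * a" by (rule density_lborel_const_eqD) (use a in auto)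
   then have "a = 1" using a(1) by (simp add: square_eq_1_iff)
   moreover have "det ?A * det ?A = 1" using AA by (metis det_mul det_I)
   then have "\<bar>det ?A\<bar> = 1" by (auto simp: square_eq_1_iff)
   ultimately show "dl ?A = density lborel (\<lambda>_. ennreal (1 / \<bar>det ?A\<bar>))" using a by simp
  qed
 next
  fix m n :: 'n assume mn: "m \<noteq> n"
  let ?S = "\<chi> i j. of_bool (i = m \<and> j = n \<or> i = j) :: real^'n^'n"
  let ?D = "\<chi> i j. (if i = j then if i = m then 2 else 1 else 0) :: real^'n^'n"
  \<comment> \<open>A shear is conjugate to its square, so its scaling factor is 1.\<close>
  have comm: "?D ** ?S = (?S ** ?S) ** ?D"
  proof -
   have S: "?S *v x = (\<chi> i. if i = m then x$m + x$n else x$i)" for x :: "real^'n"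
   proof -
    have "(\<Sum>j\<in>UNIV. of_bool (i = m \<and> j = n \<or> i = j) * x $ j :: real) = (if i = m then x$m + x$n else x$i)" for i
    proof (cases "i = m")
     case True
     have "(\<Sum>j\<in>UNIV. of_bool (i = m \<and> j = n \<or> i = j) * x $ j :: real) = (\<Sum>j\<in>{m,n}. x $ j)"
      by (rule sum.mono_neutral_cong_right) (auto simp: True)
     then show ?thesis using mn True by simp
    next
     case False
     have "(\<Sum>j\<in>UNIV. of_bool (i = m \<and> j = n \<or> i = j) * x $ j :: real) = (\<Sum>j\<in>{i}. x $ j)"
      by (rule sum.mono_neutral_cong_right) (auto simp: False)
     then show ?thesis using False by simp
    qed
    then show ?thesis by (simp add: vec_eq_iff matrix_vector_mult_def)
   qed
   have D: "?D *v x = (\<chi> i. if i = m then 2 * x$m else x$i)" for x :: "real^'n"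
    by (auto simp: vec_eq_iff matrix_vector_mult_def if_distrib[where f="\<lambda>c. c * _"] cong: if_cong)
   show ?thesis
    unfolding matrix_eq matrix_vector_mul_assoc[symmetric] S D using mn by (auto simp: vec_eq_iff)
  qed
  show "det ?S \<noteq> 0 \<longrightarrow> dl ?S = density lborel (\<lambda>_. ennreal (1 / \<bar>det ?S\<bar>))"
  proof
   assume nz: "det ?S \<noteq> 0"
   have dD: "det ?D \<noteq> 0" by (subst det_diagonal) auto
   obtain a where a: "a > 0" "dl ?S = density lborel (\<lambda>_. ennreal a)" using ex[OF nz] by auto
   obtain b where b: "b > 0" "dl ?D = density lborel (\<lambda>_. ennreal b)" using ex[OF dD] by auto
   have "density lborel (\<lambda>_::real^'n. ennreal (b * a)) = density lborel (\<lambda>_. ennreal (a * a * b))"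
    using compose[OF b(2) a(2) b(1) a(1)] compose[OF compose[OF a(2) a(2) a(1) a(1)] b(2)] a b
    unfolding comm by simp
   then have "b * a = a * a * b" by (rule density_lborel_const_eqD) (use a b in auto)
   then have "a = 1" using a b by simp
   moreover have "det ?D * det ?S = det ?S * det ?S * det ?D" using arg_cong[OF comm, of det] by (simp only: det_mul)
   then have "det ?S = 1" using dD nz by simp
   ultimately show "dl ?S = density lborel (\<lambda>_. ennreal (1 / \<bar>det ?S\<bar>))" using a by simp
  qed
 qed
 then show ?thesis using A by (simp add: dl_def)
qed

lemma nn_integral_lborel_matrix:
 fixes A :: "real^'n^'n"
 assumes A: "det A \<noteq> 0" and f[measurable]: "f \<in> borel_measurable borel"
 shows "(\<integral>\<^sup>+x. f (A *v x) \<partial>lborel) = ennreal (1 / \<bar>det A\<bar>) * (\<integral>\<^sup>+x. f x \<partial>lborel)"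
proof -
 have "(\<integral>\<^sup>+x. f (A *v x) \<partial>lborel) = (\<integral>\<^sup>+x. f x \<partial>distr lborel borel (\<lambda>x. A *v x))"
  by (subst nn_integral_distr) auto
 also have "\<dots> = ennreal (1 / \<bar>det A\<bar>) * (\<integral>\<^sup>+x. f x \<partial>lborel)"
  unfolding distr_lborel_matrix[OF A] by (subst nn_integral_density) (auto simp: nn_integral_cmult)
 finally show ?thesis .
qed

lemma nn_integral_lborel_scaleR:
 fixes f :: "real^'n \<Rightarrow> ennreal"
 assumes c: "c > 0" and f[measurable]: "f \<in> borel_measurable borel"
 shows "(\<integral>\<^sup>+x. f (c *\<^sub>R x) \<partial>lborel) = ennreal (1 / c ^ CARD('n)) * (\<integral>\<^sup>+x. f x \<partial>lborel)"
proof -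
 have "(\<lambda>x::real^'n. (c *\<^sub>R mat 1) *v x) = (\<lambda>x. c *\<^sub>R x)"
  by (auto simp: scaleR_matrix_vector_assoc[symmetric])
 moreover have "det (c *\<^sub>R mat 1 :: real^'n^'n) = c ^ CARD('n)"
  by (subst det_diagonal) (auto simp: mat_def)
 ultimately show ?thesis
  using nn_integral_lborel_matrix[of "c *\<^sub>R mat 1 :: real^'n^'n" f] c by (simp add: fun_eq_iff)
qed

section \<open>Polar decomposition of homogeneous weights\<close>

text \<open>The radial-angular decomposition is checked on the sets \<open>{..t} \<times> A\<close>, where it amounts to the
 scaling law of \<open>w\<close>.\<close>

definition angular_measure :: "real \<Rightarrow> (real^'n \<Rightarrow> ennreal) \<Rightarrow> (real^'n) measure" where
 "angular_measure s w = distr (density lborel (\<lambda>x. ennreal s * w x * indicator (ball 0 1 - {0}) x)) borel sgn"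

lemma borel_measurable_sgn_vec[measurable]: "(sgn :: real^'n \<Rightarrow> real^'n) \<in> borel_measurable borel"
 unfolding sgn_div_norm by measurable

lemma sets_angular_measure[simp, measurable_cong]: "sets (angular_measure s w) = sets borel"
 by (simp add: angular_measure_def)

lemma space_angular_measure[simp]: "space (angular_measure s w) = UNIV"
 by (simp add: angular_measure_def)

lemma emeasure_angular_measure:
 assumes [measurable]: "w \<in> borel_measurable borel" "A \<in> sets borel"
 shows "emeasure (angular_measure s w) A =
  ennreal s * (\<integral>\<^sup>+x. w x * indicator {x. 0 < norm x \<and> norm x < 1 \<and> sgn x \<in> A} x \<partial>lborel)"
proof -
 have [measurable]: "sgn -` A \<in> sets borel"
  using assms(2) by (rule measurable_sets_borel[OF borel_measurable_sgn_vec])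
 have [measurable]: "ball 0 1 - {0::real^'n} \<in> sets borel" by auto
 have "(\<lambda>x. ennreal s * w x * indicator (ball 0 1 - {0}) x) \<in> borel_measurable lborel"
  by measurable
 then have "emeasure (angular_measure s w) A =
   (\<integral>\<^sup>+x. ennreal s * w x * indicator (ball 0 1 - {0}) x * indicator (sgn -` A) x \<partial>lborel)"
  unfolding angular_measure_def by (simp add: emeasure_distr emeasure_density)
 also have "\<dots> = (\<integral>\<^sup>+x. ennreal s * (w x * indicator {x. 0 < norm x \<and> norm x < 1 \<and> sgn x \<in> A} x) \<partial>lborel)"
  by (intro nn_integral_cong) (auto split: split_indicator simp: mult.assoc)
 finally show ?thesis by (simp add: nn_integral_cmult)
qed

lemma AE_angular_measure:
 assumes [measurable]: "w \<in> borel_measurable borel"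
 shows "AE x in angular_measure s w. norm x = 1"
proof -
 have "{x::real^'n. norm x \<noteq> 1} \<in> sets borel" by measurable
 moreover have "emeasure (angular_measure s w) {x. norm x \<noteq> 1} = 0"
  by (subst emeasure_angular_measure) (auto simp: norm_sgn)
 ultimately show ?thesis by (intro AE_I[where N="{x. norm x \<noteq> 1}"]) auto
qed

context
 fixes s :: real and w :: "real^'n \<Rightarrow> ennreal"
 assumes s: "s > 0" and w[measurable]: "w \<in> borel_measurable borel"
  and hom: "\<And>c x. c > 0 \<Longrightarrow> w (c *\<^sub>R x) = ennreal (c powr (s - real CARD('n))) * w x"
  and fin: "(\<integral>\<^sup>+x. w x * indicator (ball 0 1) x \<partial>lborel) < \<infinity>"
begin

lemma finite_angular_measure: "finite_measure (angular_measure s w)"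
proof
 have "emeasure (angular_measure s w) UNIV \<le> ennreal s * (\<integral>\<^sup>+x. w x * indicator (ball 0 1) x \<partial>lborel)"
  by (subst emeasure_angular_measure) (auto intro!: mult_left_mono nn_integral_mono split: split_indicator)
 also have "\<dots> < \<infinity>" using fin by (simp add: ennreal_mult_less_top)
 finally show "emeasure (angular_measure s w) (space (angular_measure s w)) \<noteq> \<infinity>" by simp
qed

text \<open>Rescaling x -> t x gives t^s times the value at t = 1. The factor s built into
  \<open>angular_measure\<close> turns this into t^s / s, which is the integral of r^(s - 1) over
  (0, t); this is what fixes the normalisation of the angular part.\<close>

lemma emeasure_cone_homogeneous:
 assumes t: "t > 0" and [measurable]: "A \<in> sets borel"
 shows "(\<integral>\<^sup>+x. w x * indicator {x. 0 < norm x \<and> norm x < t \<and> sgn x \<in> A} x \<partial>lborel) =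
  ennreal (t powr s / s) * emeasure (angular_measure s w) A"
proof -
 let ?f = "\<lambda>t x. w x * indicator {x. 0 < norm x \<and> norm x < t \<and> sgn x \<in> A} x"
 have 1: "?f t (t *\<^sub>R x) = ennreal (t powr (s - real CARD('n))) * ?f 1 x" for x
  using t by (auto simp: hom sgn_scaleR split: split_indicator)
 have "(\<integral>\<^sup>+x. ?f 1 x \<partial>lborel) * ennreal (t powr (s - real CARD('n))) = (\<integral>\<^sup>+x. ?f t (t *\<^sub>R x) \<partial>lborel)"
  unfolding 1 by (subst nn_integral_cmult) (auto simp: mult.commute)
 also have "\<dots> = ennreal (1 / t ^ CARD('n)) * (\<integral>\<^sup>+x. ?f t x \<partial>lborel)"
  by (rule nn_integral_lborel_scaleR[OF t]) measurable
 finally have "ennreal (t ^ CARD('n)) * ((\<integral>\<^sup>+x. ?f 1 x \<partial>lborel) * ennreal (t powr (s - real CARD('n))))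
   = ennreal (t ^ CARD('n)) * (ennreal (1 / t ^ CARD('n)) * (\<integral>\<^sup>+x. ?f t x \<partial>lborel))"
  by simp
 also have "\<dots> = (\<integral>\<^sup>+x. ?f t x \<partial>lborel)"
 proof -
  have "ennreal (t ^ CARD('n)) * ennreal (1 / t ^ CARD('n)) = 1"
   using t by (subst ennreal_mult[symmetric]) auto
  then show ?thesis unfolding mult.assoc[symmetric] by simp
 qed
 also have "ennreal (t ^ CARD('n)) * ((\<integral>\<^sup>+x. ?f 1 x \<partial>lborel) * ennreal (t powr (s - real CARD('n)))) =
   ennreal (t powr s) * (\<integral>\<^sup>+x. ?f 1 x \<partial>lborel)"
 proof -
  have "t ^ CARD('n) * t powr (s - real CARD('n)) = t powr s"
   using t by (simp add: powr_realpow[symmetric] powr_add[symmetric])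
  then have "ennreal (t ^ CARD('n)) * ennreal (t powr (s - real CARD('n))) = ennreal (t powr s)"
   using t by (simp add: ennreal_mult[symmetric])
  moreover have "a * (b * c) = (a * c) * b" for a b c :: ennreal by (simp add: mult_ac)
  ultimately show ?thesis by simp
 qed
 also have "ennreal (t powr s) * (\<integral>\<^sup>+x. ?f 1 x \<partial>lborel) =
   ennreal (t powr s / s) * emeasure (angular_measure s w) A"
 proof -
  have "ennreal (t powr s / s) * ennreal s = ennreal (t powr s)"
   using s by (subst ennreal_mult[symmetric]) auto
  then show ?thesis
   by (subst emeasure_angular_measure) (simp_all add: mult.assoc[symmetric])
 qed
 finally show ?thesis by simp
qed

text \<open>Formulated for an arbitrary homogeneous weight, with its own angular measure, so that
  one statement serves the Fourier weight of the kernel, the constant 1 (radial integrals) and the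
  even monomials (moments of the isotropic measure).\<close>

theorem polar_decomposition_homogeneous:
 "distr (density lborel (\<lambda>x. w x * indicator (- {0}) x)) (borel \<Otimes>\<^sub>M borel) (\<lambda>x. (norm x, sgn x)) =
  density lborel (\<lambda>r. ennreal (r powr (s - 1)) * indicator {0<..} r) \<Otimes>\<^sub>M angular_measure s w"
 (is "?L = ?R1 \<Otimes>\<^sub>M ?R2")
proof -
 interpret R2: finite_measure ?R2 by (rule finite_angular_measure)
 have c0[measurable]: "- {0::real^'n} \<in> sets borel" by auto
 have R1: "emeasure ?R1 {..<t} = ennreal (t powr s / s)" if "t > 0" for t
 proof -
  have "emeasure ?R1 {..<t} = (\<integral>\<^sup>+r. ennreal (r powr (s - 1)) * indicator {0<..} r * indicator {..<t} r \<partial>lborel)"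
   by (simp add: emeasure_density)
  also have "\<dots> = (\<integral>\<^sup>+r. ennreal (r powr (s - 1)) * indicator {0..t} r \<partial>lborel)"
   by (rule nn_integral_cong_AE, rule AE_mp[OF AE_lborel_singleton[of t]], rule AE_I2) (auto split: split_indicator)
  also have "\<dots> = (\<integral>\<^sup>+r. ennreal (indicator {0..t} r * r powr (s - 1)) \<partial>lborel)"
   by (intro nn_integral_cong) (auto split: split_indicator)
  also have "\<dots> = ennreal (t powr s / s)"
   using has_integral_powr_from_0[of "s - 1" t] s that
   by (intro nn_integral_has_integral_lebesgue) auto
  finally show ?thesis by simp
 qed
 have UN: "(\<Union>n::nat. {..<real (Suc n)}) = (UNIV :: real set)"
 proof (intro set_eqI iffI)
  fix x :: real
  obtain n :: nat where "x < real n" using reals_Archimedean2 by blast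
  then show "x \<in> (\<Union>n::nat. {..<real (Suc n)})" by (intro UN_I[of n]) auto
 qed auto
 have rmeas[measurable]: "(\<lambda>r::real. ennreal (r powr (s - 1)) * indicator {0<..} r) \<in> borel_measurable borel"
  by measurable
 interpret R1: sigma_finite_measure ?R1
 proof
  show "\<exists>A. countable A \<and> A \<subseteq> sets ?R1 \<and> \<Union> A = space ?R1 \<and> (\<forall>a\<in>A. emeasure ?R1 a \<noteq> \<infinity>)"
   using R1 UN by (intro exI[of _ "range (\<lambda>n::nat. {..<real (Suc n)})"]) (auto simp del: of_nat_Suc)
 qed
 interpret R: pair_sigma_finite ?R1 ?R2 ..
 have Lrect: "emeasure ?L ({..<t} \<times> A) = emeasure ?R1 {..<t} * emeasure ?R2 A"
  if [measurable]: "A \<in> sets borel" for t A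
 proof -
  have "emeasure ?L ({..<t} \<times> A) = emeasure (density lborel (\<lambda>x. w x * indicator (- {0}) x)) {x. norm x < t \<and> sgn x \<in> A}"
   by (subst emeasure_distr) (auto intro!: arg_cong2[where f=emeasure])
  also have "\<dots> = (\<integral>\<^sup>+x. w x * indicator {x. 0 < norm x \<and> norm x < t \<and> sgn x \<in> A} x \<partial>lborel)"
   by (subst emeasure_density) (auto intro!: nn_integral_cong split: split_indicator)
  finally have 1: "emeasure ?L ({..<t} \<times> A) = \<dots>" .
  show ?thesis
  proof (cases "t > 0")
   case True
   then show ?thesis unfolding 1 R1[OF True] using emeasure_cone_homogeneous[OF True, of A] by simp
  next
   case False
   then have "{x::real^'n. 0 < norm x \<and> norm x < t \<and> sgn x \<in> A} = {}" by (auto simp: not_less intro: order_trans)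
   moreover have "emeasure ?R1 {..<t} = 0"
    using False by (simp add: emeasure_density) (intro nn_integral_0_iff_AE[THEN iffD2] AE_I2; auto split: split_indicator)
   ultimately show ?thesis unfolding 1 by simp
  qed
 qed
 have rect: "emeasure ?R1 A * emeasure ?R2 B = emeasure ?L (A \<times> B)"
  if [measurable]: "A \<in> sets borel" "B \<in> sets borel" for A B
 proof -
  have bor: "sets borel = sigma_sets (UNIV::real set) (range lessThan)"
   by (subst borel_Iio) simp
  \<comment> \<open>For a fixed angular set B both sides are measures in the radial set. They agree
    on the rays \<open>{..<t}\<close>, which are closed under intersection and generate the Borel
    sets.\<close>
  define M where "M = distr (density ?L (indicator (UNIV \<times> B))) borel fst"
  have [measurable]: "(UNIV :: real set) \<times> B \<in> sets (borel \<Otimes>\<^sub>M borel)" by measurable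
  have M: "emeasure M A = emeasure ?L (A \<times> B)" if [measurable]: "A \<in> sets borel" for A
  proof -
   have "emeasure M A = emeasure (density ?L (indicator (UNIV \<times> B))) (A \<times> UNIV)"
   proof -
    have "fst -` A \<inter> space (density ?L (indicator (UNIV \<times> B))) = A \<times> UNIV"
     by (auto simp: space_pair_measure)
    moreover have "fst \<in> measurable (density ?L (indicator (UNIV \<times> B))) borel"
     by (simp add: measurable_fst)
    ultimately show ?thesis unfolding M_def using that by (simp add: emeasure_distr)
   qed
   also have "\<dots> = (\<integral>\<^sup>+x. indicator (A \<times> B) x \<partial>?L)"
   proof (subst emeasure_density)
    show "A \<times> UNIV \<in> sets ?L" by simp
    show "(\<integral>\<^sup>+x. indicator (UNIV \<times> B) x * indicator (A \<times> UNIV) x \<partial>?L) = (\<integral>\<^sup>+x. indicator (A \<times> B) x \<partial>?L)"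
     by (intro nn_integral_cong) (auto split: split_indicator)
   qed simp
   finally show ?thesis by simp
  qed
  define N where "N = density ?R1 (\<lambda>_. emeasure ?R2 B)"
  have N: "emeasure N A = emeasure ?R1 A * emeasure ?R2 B" if "A \<in> sets borel" for A
   using that unfolding N_def by (subst emeasure_density_const) (simp_all add: mult.commute)
  have sN: "sets N = sets borel" and sM: "sets M = sets borel" by (simp_all add: N_def M_def)
  have "N = M"
  proof (rule measure_eqI_generator_eq[where E="range lessThan" and \<Omega>=UNIV and A="\<lambda>n. {..<real (Suc n)}"])
   show "Int_stable (range (lessThan :: real \<Rightarrow> _))"
   proof (rule Int_stableI)
    fix a b :: "real set" assume "a \<in> range lessThan" "b \<in> range lessThan"
    then obtain x y where "a = {..<x}" "b = {..<y}" by auto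
    then have "a \<inter> b = {..<min x y}" by auto
    then show "a \<inter> b \<in> range lessThan" by blast
   qed
   show "(\<Union>i. {..<real (Suc i)}) = UNIV"
    by (rule UN)
   fix i
   have "emeasure N {..<real (Suc i)} = ennreal (real (Suc i) powr s / s) * emeasure ?R2 B"
    by (subst N, simp, subst R1, simp, rule refl)
   also have "\<dots> < \<infinity>"
    unfolding infinity_ennreal_def
    by (intro ennreal_mult_less_top[THEN iffD2] disjI2 conjI) (use R2.emeasure_finite[of B] in \<open>auto simp: less_top[symmetric]\<close>)
   finally show "emeasure N {..<real (Suc i)} \<noteq> \<infinity>" by simp
  next
   show "sets N = sigma_sets UNIV (range lessThan)" "sets M = sigma_sets UNIV (range lessThan)"
    unfolding sN sM by (rule bor)+
   fix X :: "real set" assume "X \<in> range lessThan"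
   then obtain t where X: "X = {..<t}" by auto
   show "emeasure N X = emeasure M X"
    unfolding X by (subst N, simp, subst M, simp, rule Lrect[OF that(2), symmetric])
  next
   show "range (\<lambda>n. {..<real (Suc n)}) \<subseteq> range lessThan" by blast
  qed simp
  then show ?thesis using N[OF that(1)] M[OF that(1)] by simp
 qed
 show ?thesis
 proof (rule pair_measure_eqI[symmetric])
  show "sigma_finite_measure ?R1" "sigma_finite_measure ?R2"
   by (rule R1.sigma_finite_measure_axioms R2.sigma_finite_measure_axioms)+
  have "sets (?R1 \<Otimes>\<^sub>M ?R2) = sets (borel \<Otimes>\<^sub>M borel)"
   by (rule sets_pair_measure_cong) simp_all
  then show "sets (?R1 \<Otimes>\<^sub>M ?R2) = sets ?L" by simp
  show "emeasure ?R1 A * emeasure ?R2 B = emeasure ?L (A \<times> B)"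
   if "A \<in> sets ?R1" "B \<in> sets ?R2" for A B
   by (rule rect) (use that in simp_all)
 qed
qed

end

section \<open>Hausdorff measure\<close>

definition hgauge :: "real \<Rightarrow> 'a::euclidean_space set \<Rightarrow> ennreal" where
 "hgauge k C = ennreal (pi powr (k / 2) / Gamma (k / 2 + 1) * (diameter C / 2) powr k)"

definition hcovers :: "real \<Rightarrow> 'a::euclidean_space set \<Rightarrow> (nat \<Rightarrow> 'a set) set" where
 "hcovers \<delta> A = {C. A \<subseteq> (\<Union>i. C i) \<and> (\<forall>i. bounded (C i) \<and> diameter (C i) < \<delta>)}"

definition hpre :: "real \<Rightarrow> real \<Rightarrow> 'a::euclidean_space set \<Rightarrow> ennreal" where
 "hpre k \<delta> A = (INF C\<in>hcovers \<delta> A. \<Sum>i. hgauge k (C i))"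

lemma hausdorff_outer_eq: "hausdorff_outer k A = (SUP \<delta>\<in>{0<..}. hpre k \<delta> A)"
 by (simp add: hausdorff_outer_def hpre_def hcovers_def hgauge_def)

lemma hpre_le_outer: "\<delta> > 0 \<Longrightarrow> hpre k \<delta> A \<le> hausdorff_outer k A"
 unfolding hausdorff_outer_eq by (rule SUP_upper) auto

text \<open>The diameter of the empty set is 0 and \<open>0 powr k = 0\<close> for every k, even for
  k = 0, so padding a finite cover with empty sets costs nothing.\<close>

lemma hgauge_empty[simp]: "hgauge k {} = 0"
 by (simp add: hgauge_def)

lemma hpre_antimono: "\<delta> \<le> \<delta>' \<Longrightarrow> hpre k \<delta>' A \<le> hpre k \<delta> A"
 unfolding hpre_def hcovers_def by (rule INF_superset_mono) (auto intro: less_le_trans)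

lemma hpre_mono: "A \<subseteq> B \<Longrightarrow> hpre k \<delta> A \<le> hpre k \<delta> B"
 unfolding hpre_def hcovers_def by (rule INF_superset_mono) auto

lemma hausdorff_outer_mono: "A \<subseteq> B \<Longrightarrow> hausdorff_outer k A \<le> hausdorff_outer k B"
 unfolding hausdorff_outer_eq by (intro SUP_mono) (use hpre_mono in blast)

lemma hausdorff_outer_empty[simp]: "hausdorff_outer k {} = 0"
proof -
 have "hpre k \<delta> {} = 0" if "\<delta> > 0" for \<delta>
 proof -
  have "(\<lambda>_. {}) \<in> hcovers \<delta> {}" using that by (auto simp: hcovers_def)
  from INF_lower[OF this, of "\<lambda>C. \<Sum>i. hgauge k (C i)"] show ?thesis by (simp add: hpre_def)
 qed
 then show ?thesis unfolding hausdorff_outer_eq by (intro antisym SUP_least) auto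
qed

lemma hpre_countable_subadditive: "hpre k \<delta> (\<Union>n::nat. A n) \<le> (\<Sum>n. hpre k \<delta> (A n))"
proof (rule ennreal_le_epsilon)
 fix e :: real assume fin: "(\<Sum>n. hpre k \<delta> (A n)) < top" and e: "e > 0"
 have "\<exists>C\<in>hcovers \<delta> (A n). (\<Sum>i. hgauge k (C i)) \<le> hpre k \<delta> (A n) + ennreal (e * (1/2) ^ Suc n)" for n
 proof -
  have "hpre k \<delta> (A n) < top"
   using ennreal_suminf_lessD[OF fin, of n] by simp
  moreover have "(0::ennreal) < ennreal (e * (1/2) ^ Suc n)" using e by (simp add: ennreal_less_zero_iff)
  ultimately have "hpre k \<delta> (A n) < hpre k \<delta> (A n) + ennreal (e * (1/2) ^ Suc n)"
   using ennreal_add_left_cancel_less[of "hpre k \<delta> (A n)" 0 "ennreal (e * (1/2) ^ Suc n)"] by (simp add: less_top)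
  then show ?thesis unfolding hpre_def by (subst (asm) INF_less_iff) (auto intro: less_imp_le)
 qed
 then obtain C where C: "\<And>n. C n \<in> hcovers \<delta> (A n)" and Cs: "\<And>n. (\<Sum>i. hgauge k (C n i)) \<le> hpre k \<delta> (A n) + ennreal (e * (1/2) ^ Suc n)"
  by metis
 define D where "D i = (case prod_decode i of (n, j) \<Rightarrow> C n j)" for i
 have "D \<in> hcovers \<delta> (\<Union>n. A n)"
  unfolding hcovers_def
 proof (intro CollectI conjI subsetI allI)
  fix x assume "x \<in> (\<Union>n. A n)"
  then obtain n j where "x \<in> C n j" using C unfolding hcovers_def by blast
  then have "x \<in> D (prod_encode (n, j))" by (simp add: D_def)
  then show "x \<in> (\<Union>i. D i)" by blast
 qed (use C in \<open>auto simp: D_def hcovers_def split: prod.split\<close>)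
 then have "hpre k \<delta> (\<Union>n. A n) \<le> (\<Sum>i. hgauge k (D i))"
  unfolding hpre_def by (rule INF_lower)
 also have "\<dots> = (\<Sum>i. (\<lambda>(n, j). hgauge k (C n j)) (prod_decode i))"
  by (intro suminf_cong) (simp add: D_def split: prod.split)
 also have "\<dots> = (\<Sum>n. \<Sum>j. hgauge k (C n j))"
  by (rule suminf_ennreal_2dimen) simp
 also have "\<dots> \<le> (\<Sum>n. hpre k \<delta> (A n) + ennreal (e * (1/2) ^ Suc n))"
  by (intro suminf_le Cs) auto
 also have "\<dots> = (\<Sum>n. hpre k \<delta> (A n)) + (\<Sum>n. ennreal (e * (1/2) ^ Suc n))"
  by (intro suminf_add[symmetric]) auto
 also have "(\<Sum>n. ennreal (e * (1/2) ^ Suc n)) = ennreal e"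
  using sums_mult[OF power_half_series, of e] e
  by (intro suminf_ennreal_eq) auto
 finally show "hpre k \<delta> (\<Union>n. A n) \<le> (\<Sum>n. hpre k \<delta> (A n)) + ennreal e" .
qed

lemma hausdorff_outer_countable_subadditive:
 "hausdorff_outer k (\<Union>n::nat. A n) \<le> (\<Sum>n. hausdorff_outer k (A n))"
 unfolding hausdorff_outer_eq[of _ "\<Union>n. A n"]
proof (rule SUP_least)
 fix \<delta> :: real assume "\<delta> \<in> {0<..}"
 then have "(\<Sum>n. hpre k \<delta> (A n)) \<le> (\<Sum>n. hausdorff_outer k (A n))"
  by (intro suminf_le hpre_le_outer) auto
 then show "hpre k \<delta> (\<Union>n. A n) \<le> (\<Sum>n. hausdorff_outer k (A n))"
  using hpre_countable_subadditive order_trans by blast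
qed

lemma hausdorff_outer_subadditive: "hausdorff_outer k (A \<union> B) \<le> hausdorff_outer k A + hausdorff_outer k B"
proof -
 have "hausdorff_outer k (A \<union> B) = hausdorff_outer k (\<Union>n::nat. (if n = 0 then A else if n = 1 then B else {}))"
  by (rule arg_cong[where f="hausdorff_outer k"]) (auto split: if_splits)
 also have "\<dots> \<le> (\<Sum>n::nat. hausdorff_outer k (if n = 0 then A else if n = 1 then B else {}))"
  by (rule hausdorff_outer_countable_subadditive)
 also have "\<dots> = (\<Sum>n\<in>{0,1::nat}. hausdorff_outer k (if n = 0 then A else if n = 1 then B else {}))"
  by (rule suminf_finite) auto
 finally show ?thesis by simp
qed

text \<open>Once the allowed diameter is at most \<eta>, no covering set meets both A and B, so a
  cover of the union splits into a cover of each with no gauge counted twice.\<close>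

lemma hausdorff_outer_separated:
 assumes \<eta>: "\<eta> > 0" and sep: "\<And>a b. a \<in> A \<Longrightarrow> b \<in> B \<Longrightarrow> dist a b \<ge> \<eta>"
 shows "hausdorff_outer k A + hausdorff_outer k B \<le> hausdorff_outer k (A \<union> B)"
proof -
 have main: "hpre k \<delta> A + hpre k \<delta> B \<le> hpre k \<delta> (A \<union> B)" if \<delta>: "0 < \<delta>" "\<delta> \<le> \<eta>" for \<delta>
  unfolding hpre_def[of _ _ "A \<union> B"]
 proof (rule INF_greatest)
  fix C assume C: "C \<in> hcovers \<delta> (A \<union> B)"
  define C1 where "C1 i = (if C i \<inter> A \<noteq> {} then C i else {})" for i
  define C2 where "C2 i = (if C i \<inter> A \<noteq> {} then {} else C i)" for i
  have "C1 \<in> hcovers \<delta> A" using C \<delta> unfolding hcovers_def C1_def by (auto split: if_splits) blast+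
  then have 1: "hpre k \<delta> A \<le> (\<Sum>i. hgauge k (C1 i))" unfolding hpre_def by (rule INF_lower)
  have "C2 \<in> hcovers \<delta> B"
   unfolding hcovers_def
  proof (intro CollectI conjI subsetI allI)
   fix b assume b: "b \<in> B"
   then obtain i where i: "b \<in> C i" using C unfolding hcovers_def by blast
   have "C i \<inter> A = {}"
   proof (rule ccontr)
    assume "C i \<inter> A \<noteq> {}"
    then obtain a where a: "a \<in> C i" "a \<in> A" by blast
    have "dist a b \<le> diameter (C i)"
     using C a i unfolding hcovers_def by (intro diameter_bounded_bound) auto
    also have "\<dots> < \<delta>" using C unfolding hcovers_def by auto
    finally show False using sep[OF a(2) b] \<delta> by linarith
   qed
   then show "b \<in> (\<Union>i. C2 i)" using i by (auto simp: C2_def)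
  qed (use C \<delta> in \<open>auto simp: hcovers_def C2_def\<close>)
  then have 2: "hpre k \<delta> B \<le> (\<Sum>i. hgauge k (C2 i))" unfolding hpre_def by (rule INF_lower)
  have "(\<Sum>i. hgauge k (C1 i)) + (\<Sum>i. hgauge k (C2 i)) = (\<Sum>i. hgauge k (C1 i) + hgauge k (C2 i))"
   by (rule suminf_add) auto
  also have "\<dots> = (\<Sum>i. hgauge k (C i))" by (intro suminf_cong) (auto simp: C1_def C2_def)
  finally show "hpre k \<delta> A + hpre k \<delta> B \<le> (\<Sum>i. hgauge k (C i))" using add_mono[OF 1 2] by simp
 qed
 have "hpre k \<delta>1 A + hpre k \<delta>2 B \<le> hausdorff_outer k (A \<union> B)" if "\<delta>1 > 0" "\<delta>2 > 0" for \<delta>1 \<delta>2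
 proof -
  define \<delta> where "\<delta> = min \<eta> (min \<delta>1 \<delta>2)"
  have "hpre k \<delta>1 A + hpre k \<delta>2 B \<le> hpre k \<delta> A + hpre k \<delta> B"
   by (intro add_mono hpre_antimono) (auto simp: \<delta>_def)
  also have "\<dots> \<le> hpre k \<delta> (A \<union> B)" by (rule main) (use that \<eta> in \<open>auto simp: \<delta>_def\<close>)
  also have "\<dots> \<le> hausdorff_outer k (A \<union> B)" by (rule hpre_le_outer) (use that \<eta> in \<open>auto simp: \<delta>_def\<close>)
  finally show ?thesis .
 qed
 then have "(SUP \<delta>1\<in>{0<..}. hpre k \<delta>1 A) + hpre k \<delta>2 B \<le> hausdorff_outer k (A \<union> B)" if "\<delta>2 > 0" for \<delta>2
  using that by (subst ennreal_SUP_add_left[symmetric]) (auto intro!: SUP_least)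
 then have "(SUP \<delta>1\<in>{0<..}. hpre k \<delta>1 A) + (SUP \<delta>2\<in>{0<..}. hpre k \<delta>2 B) \<le> hausdorff_outer k (A \<union> B)"
  by (subst add.commute, subst ennreal_SUP_add_left[symmetric]) (auto intro!: SUP_least simp: add.commute)
 then show ?thesis by (simp add: hausdorff_outer_eq[of _ A] hausdorff_outer_eq[of _ B])
qed

lemma hausdorff_outer_separated_sum:
 assumes sep: "\<And>i j. i < j \<Longrightarrow> \<exists>\<eta>>0. \<forall>a\<in>R i. \<forall>b\<in>(R (j::nat)). dist a b \<ge> \<eta>"
 shows "(\<Sum>j<N. hausdorff_outer k (R j)) \<le> hausdorff_outer k (\<Union>j<N. R j)"
proof (induction N)
 case (Suc N)
 obtain \<eta> where \<eta>: "\<And>i. i < N \<Longrightarrow> \<eta> i > 0 \<and> (\<forall>a\<in>R i. \<forall>b\<in>R N. dist a b \<ge> \<eta> i)"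
  using sep[of _ N] by metis
 define e where "e = Min (insert 1 (\<eta> ` {..<N}))"
 have e: "e > 0" "\<And>i. i < N \<Longrightarrow> e \<le> \<eta> i" using \<eta> by (auto simp: e_def)
 have "hausdorff_outer k (\<Union>j<N. R j) + hausdorff_outer k (R N) \<le> hausdorff_outer k ((\<Union>j<N. R j) \<union> R N)"
  by (rule hausdorff_outer_separated[OF e(1)]) (use e(2) \<eta> in fastforce)
 also have "(\<Union>j<N. R j) \<union> R N = (\<Union>j<Suc N. R j)" by (auto simp: less_Suc_eq)
 finally show ?case using Suc by (simp add: order_trans[OF add_right_mono])
qed simp

text \<open>Caratheodory's criterion for metric outer measures. \<open>Y n\<close> is at positive
  distance from F, so additivity holds for \<open>F \<inter> X\<close> and \<open>Y n\<close>; the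
  shells \<open>R n\<close> are what \<open>Y n\<close> still misses of X - F. Neighbouring shells
  may touch, but shells two steps apart are separated, so the shells of each parity have total
  measure at most that of X. Hence the series over all shells converges and its tails
  vanish.\<close>

lemma hausdorff_outer_closed_caratheodory:
 assumes F: "closed F"
 shows "hausdorff_outer k (F \<inter> X) + hausdorff_outer k (X - F) \<le> hausdorff_outer k X"
proof (cases "F = {} \<or> hausdorff_outer k X = \<infinity>")
 case False
 then have ne: "F \<noteq> {}" and fin: "hausdorff_outer k X < \<infinity>" by (auto simp: less_top)
 let ?H = "hausdorff_outer k"
 define Y where "Y n = {x\<in>X. infdist x F \<ge> 1 / real (Suc n)}" for n
 define R where "R n = {x\<in>X. infdist x F < 1 / real (Suc n) \<and> infdist x F \<ge> 1 / real (Suc (Suc n))}" for n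
 have YX: "Y n \<subseteq> X" and RX: "R n \<subseteq> X" for n by (auto simp: Y_def R_def)
 have step: "?H (F \<inter> X) + ?H (Y n) \<le> ?H X" for n
 proof -
  have "?H (F \<inter> X) + ?H (Y n) \<le> ?H ((F \<inter> X) \<union> Y n)"
  proof (rule hausdorff_outer_separated[of "1 / real (Suc n)"])
   fix a b assume "a \<in> F \<inter> X" "b \<in> Y n"
   then have "infdist b F \<le> dist b a" "infdist b F \<ge> 1 / real (Suc n)" by (auto simp: Y_def infdist_le)
   then show "dist a b \<ge> 1 / real (Suc n)" by (simp add: dist_commute)
  qed simp
  also have "\<dots> \<le> ?H X" by (rule hausdorff_outer_mono) (use YX in auto)
  finally show ?thesis .
 qed
 have Rsep: "\<exists>\<eta>>0. \<forall>a\<in>R i. \<forall>b\<in>R j. dist a b \<ge> \<eta>" if "Suc i < j" for i j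
 proof (intro exI conjI ballI)
  have "1 / real (Suc j) < 1 / real (Suc (Suc i))" using that by (intro divide_strict_left_mono) auto
  then show "1 / real (Suc (Suc i)) - 1 / real (Suc j) > 0" by linarith
  fix a b assume "a \<in> R i" "b \<in> R j"
  then have "infdist a F \<ge> 1 / real (Suc (Suc i))" "infdist b F < 1 / real (Suc j)" by (auto simp: R_def)
  moreover have "infdist a F \<le> infdist b F + dist a b" by (rule infdist_triangle)
  ultimately show "dist a b \<ge> 1 / real (Suc (Suc i)) - 1 / real (Suc j)" by linarith
 qed
 have half: "(\<Sum>j. ?H (R (2 * j + p))) \<le> ?H X" for p
 proof (rule suminf_le_const)
  fix N
  have "(\<Sum>j<N. ?H (R (2 * j + p))) \<le> ?H (\<Union>j<N. R (2 * j + p))"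
   by (rule hausdorff_outer_separated_sum) (use Rsep in auto)
  also have "\<dots> \<le> ?H X" by (rule hausdorff_outer_mono) (use RX in auto)
  finally show "(\<Sum>j<N. ?H (R (2 * j + p))) \<le> ?H X" .
 qed auto
 have sumR: "(\<Sum>j. ?H (R j)) < top"
 proof -
  have "(\<Sum>j<2 * N. ?H (R j)) = (\<Sum>j<N. ?H (R (2 * j))) + (\<Sum>j<N. ?H (R (2 * j + 1)))" for N
   by (induction N) (simp_all add: add_ac)
  then have "(\<Sum>j<N. ?H (R j)) \<le> ?H X + ?H X" for N
  proof -
   have "(\<Sum>j<N. ?H (R j)) \<le> (\<Sum>j<2 * N. ?H (R j))" by (intro sum_mono2) auto
   also have "\<dots> = (\<Sum>j<N. ?H (R (2 * j))) + (\<Sum>j<N. ?H (R (2 * j + 1)))" by fact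
   also have "\<dots> \<le> (\<Sum>j. ?H (R (2 * j + 0))) + (\<Sum>j. ?H (R (2 * j + 1)))"
    by (intro add_mono order_trans[OF _ sum_le_suminf]) auto
   also have "\<dots> \<le> ?H X + ?H X" by (intro add_mono half)
   finally show ?thesis .
  qed
  then have "(\<Sum>j. ?H (R j)) \<le> ?H X + ?H X" by (intro suminf_le_const) auto
  also have "\<dots> < top" using fin by simp
  finally show ?thesis .
 qed
 have tail: "?H (X - F) \<le> ?H (Y n) + (\<Sum>j. ?H (R (j + n)))" for n
 proof -
  have "X - F \<subseteq> Y n \<union> (\<Union>j. R (j + n))"
  proof
   fix x assume x: "x \<in> X - F"
   then have pos: "infdist x F > 0" using F ne infdist_pos_not_in_closed by blast
   show "x \<in> Y n \<union> (\<Union>j. R (j + n))"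
   proof (cases "x \<in> Y n")
    case False
    then have lt: "infdist x F < 1 / real (Suc n)" using x by (auto simp: Y_def)
    define m where "m = (LEAST m. 1 / real (Suc m) \<le> infdist x F)"
    have ex: "\<exists>m. 1 / real (Suc m) \<le> infdist x F"
     using reals_Archimedean[OF pos] by (auto simp: inverse_eq_divide intro: less_imp_le)
    have m: "1 / real (Suc m) \<le> infdist x F" unfolding m_def using ex by (rule LeastI_ex)
    have "n < m"
    proof (rule ccontr)
     assume "\<not> n < m"
     then have "1 / real (Suc n) \<le> 1 / real (Suc m)" by (intro divide_left_mono) auto
     then show False using m lt by linarith
    qed
    then obtain q where q: "m = Suc q" "n \<le> q" by (cases m) auto
    have "\<not> 1 / real (Suc q) \<le> infdist x F" using not_less_Least[of q "\<lambda>m. 1 / real (Suc m) \<le> infdist x F"] q unfolding m_def by simp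
    then have "x \<in> R q" using x m q by (auto simp: R_def)
    then show ?thesis using q by (auto intro!: exI[of _ "q - n"])
   qed simp
  qed
  then have "?H (X - F) \<le> ?H (Y n \<union> (\<Union>j. R (j + n)))" by (rule hausdorff_outer_mono)
  also have "\<dots> \<le> ?H (Y n) + ?H (\<Union>j. R (j + n))" by (rule hausdorff_outer_subadditive)
  also have "\<dots> \<le> ?H (Y n) + (\<Sum>j. ?H (R (j + n)))" by (intro add_left_mono hausdorff_outer_countable_subadditive)
  finally show ?thesis .
 qed
 have tl0: "(\<lambda>n. \<Sum>j. ?H (R (j + n))) \<longlonglongrightarrow> 0"
 proof -
  have r: "?H (R j) = ennreal (enn2real (?H (R j)))" for j
   using ennreal_suminf_lessD[OF sumR, of j] by simp
  have sm: "summable (\<lambda>j. enn2real (?H (R j)))"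
   by (rule summable_suminf_not_top) (use r sumR in auto)
  have "(\<Sum>j. ?H (R (j + n))) = ennreal (\<Sum>j. enn2real (?H (R (j + n))))" for n
  proof -
   have "(\<Sum>j. ?H (R (j + n))) = (\<Sum>j. ennreal (enn2real (?H (R (j + n)))))" by (subst r) simp
   also have "\<dots> = ennreal (\<Sum>j. enn2real (?H (R (j + n))))"
    by (rule suminf_ennreal2) (use sm summable_iff_shift[of "\<lambda>j. enn2real (?H (R j))" n] in auto)
   finally show ?thesis .
  qed
  moreover have "(\<lambda>n. \<Sum>j. enn2real (?H (R (j + n)))) \<longlonglongrightarrow> 0"
   by (rule suminf_exist_split2[OF sm])
  ultimately show ?thesis using tendsto_ennrealI[of _ 0] by simp
 qed
 have "?H (F \<inter> X) + ?H (X - F) \<le> ?H X + (\<Sum>j. ?H (R (j + n)))" for n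
 proof -
  have "?H (F \<inter> X) + ?H (X - F) \<le> ?H (F \<inter> X) + (?H (Y n) + (\<Sum>j. ?H (R (j + n))))"
   by (intro add_left_mono tail)
  also have "\<dots> \<le> ?H X + (\<Sum>j. ?H (R (j + n)))"
   unfolding add.assoc[symmetric] by (intro add_right_mono step)
  finally show ?thesis .
 qed
 moreover have "(\<lambda>n. ?H X + (\<Sum>j. ?H (R (j + n)))) \<longlonglongrightarrow> ?H X + 0"
  by (intro tendsto_add tl0 tendsto_const)
 ultimately show ?thesis by (intro LIMSEQ_le_const[of _ "?H X"]) auto
qed auto

lemma space_hausdorff_measure[simp]: "space (hausdorff_measure k) = UNIV"
 by (simp add: hausdorff_measure_def space_measure_of_conv)

lemma sets_hausdorff_measure[simp, measurable_cong]: "sets (hausdorff_measure k) = sets borel"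
 using sets.sigma_sets_eq[of borel] by (simp add: hausdorff_measure_def)

text \<open>\<open>measure_of\<close> gives the prescribed values only if they form a measure on the
  Borel sets, and 0 otherwise; this is what has to be verified. Closed sets satisfy the Caratheodory
  condition, and the sets satisfying it form a sigma-algebra on which the outer measure is countably
  additive.\<close>

theorem emeasure_hausdorff_measure:
 assumes "A \<in> sets borel"
 shows "emeasure (hausdorff_measure k) A = hausdorff_outer k (A :: 'a::euclidean_space set)"
proof -
 let ?H = "hausdorff_outer k :: 'a set \<Rightarrow> ennreal"
 let ?L = "lambda_system UNIV (Pow UNIV) ?H"
 interpret P: sigma_algebra UNIV "Pow (UNIV :: 'a set)" by (rule sigma_algebra_Pow)
 have "outer_measure_space (Pow UNIV) ?H"
  unfolding outer_measure_space_def positive_def increasing_def countably_subadditive_def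
  by (auto intro: hausdorff_outer_mono hausdorff_outer_countable_subadditive)
 then have ms: "measure_space UNIV ?L ?H" by (rule P.caratheodory_lemma)
 then have sa: "sigma_algebra UNIV ?L" by (simp add: measure_space_def)
 have cl: "F \<in> ?L" if "closed F" for F
  unfolding P.lambda_system_eq
 proof (intro CollectI conjI ballI)
  fix X :: "'a set"
  have "?H X \<le> ?H (X \<inter> F) + ?H (X - F)"
   using hausdorff_outer_subadditive[of k "X \<inter> F" "X - F"] by (simp add: Int_Diff_Un)
  then show "?H (X \<inter> F) + ?H (X - F) = ?H X"
   using hausdorff_outer_closed_caratheodory[OF that, of k X] by (simp add: Int_commute antisym)
 qed simp
 have "sigma_sets UNIV (Collect closed) \<subseteq> ?L"
  by (rule sigma_algebra.sigma_sets_subset[OF sa]) (use cl in auto)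
 then have "sets borel \<subseteq> ?L" by (simp add: borel_eq_closed)
 then have "measure_space UNIV (sets borel) ?H"
  using measure_down[OF ms] sets.sigma_algebra_axioms[of "borel :: 'a measure"] by simp
 then show ?thesis
  unfolding hausdorff_measure_def
  by (intro emeasure_measure_of[OF refl] ) (use assms sets.sigma_sets_eq[of "borel :: 'a measure"] in \<open>auto simp: measure_space_def\<close>)
qed

lemma hausdorff_outer_lipschitz_image:
 fixes f :: "'a::euclidean_space \<Rightarrow> 'b::euclidean_space"
 assumes L: "L > 0" and k: "k > 0" and lip: "\<And>x y. x \<in> A \<Longrightarrow> y \<in> A \<Longrightarrow> dist (f x) (f y) \<le> L * dist x y"
 shows "hausdorff_outer k (f ` A) \<le> ennreal (L powr k) * hausdorff_outer k A"
 unfolding hausdorff_outer_eq[of _ "f ` A"]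
proof (rule SUP_least)
 fix \<delta> :: real assume "\<delta> \<in> {0<..}"
 then have \<delta>: "\<delta> > 0" by simp
 have *: "hpre k \<delta> (f ` A) \<le> ennreal (L powr k) * (\<Sum>i. hgauge k (C i))" if C: "C \<in> hcovers (\<delta> / L) A" for C
 proof -
  define D where "D i = f ` (C i \<inter> A)" for i
  have Cb: "bounded (C i)" "diameter (C i) < \<delta> / L" for i using C by (auto simp: hcovers_def)
  have diam: "diameter (D i) \<le> L * diameter (C i)" for i
  proof (rule diameter_le)
   show "D i \<noteq> {} \<or> 0 \<le> L * diameter (C i)" using L diameter_ge_0[OF Cb(1)[of i]] by simp
   fix x y assume "x \<in> D i" "y \<in> D i"
   then obtain a b where ab: "a \<in> C i \<inter> A" "b \<in> C i \<inter> A" "x = f a" "y = f b" by (auto simp: D_def)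
   have "dist x y \<le> L * dist a b" using lip ab by auto
   also have "\<dots> \<le> L * diameter (C i)" using L ab by (intro mult_left_mono diameter_bounded_bound Cb) auto
   finally show "norm (x - y) \<le> L * diameter (C i)" by (simp add: dist_norm)
  qed
  have bD: "bounded (D i)" for i
   unfolding bounded_two_points
  proof (intro exI ballI)
   fix x y assume "x \<in> D i" "y \<in> D i"
   then obtain a b where ab: "a \<in> C i \<inter> A" "b \<in> C i \<inter> A" "x = f a" "y = f b" by (auto simp: D_def)
   have "dist x y \<le> L * dist a b" using lip ab by auto
   also have "\<dots> \<le> L * diameter (C i)" using L ab by (intro mult_left_mono diameter_bounded_bound Cb) auto
   finally show "dist x y \<le> L * diameter (C i)" .
  qed
  have "D \<in> hcovers \<delta> (f ` A)"
   unfolding hcovers_def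
  proof (intro CollectI conjI allI)
   show "f ` A \<subseteq> (\<Union>i. D i)" using C unfolding D_def hcovers_def by blast
   fix i show "bounded (D i)" by (rule bD)
   have "L * diameter (C i) < \<delta>" using Cb(2)[of i] L by (simp add: field_simps)
   then show "diameter (D i) < \<delta>" using diam[of i] by linarith
  qed
  then have "hpre k \<delta> (f ` A) \<le> (\<Sum>i. hgauge k (D i))" unfolding hpre_def by (rule INF_lower)
  also have "\<dots> \<le> (\<Sum>i. ennreal (L powr k) * hgauge k (C i))"
  proof (intro suminf_le)
   fix i
   have "(diameter (D i) / 2) powr k \<le> (L * (diameter (C i) / 2)) powr k"
    using diam[of i] k diameter_ge_0[OF bD[of i]] by (intro powr_mono2) auto
   also have "\<dots> = L powr k * (diameter (C i) / 2) powr k"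
    using L diameter_ge_0[OF Cb(1)[of i]] by (intro powr_mult)
   finally have "pi powr (k / 2) / Gamma (k / 2 + 1) * (diameter (D i) / 2) powr k \<le>
     pi powr (k / 2) / Gamma (k / 2 + 1) * (L powr k * (diameter (C i) / 2) powr k)"
    using k by (intro mult_left_mono) (auto intro!: divide_nonneg_nonneg Gamma_real_nonneg)
   then show "hgauge k (D i) \<le> ennreal (L powr k) * hgauge k (C i)"
    unfolding hgauge_def using k by (subst ennreal_mult'[symmetric]) (auto intro!: ennreal_leI simp: mult_ac)
  qed auto
  also have "\<dots> = ennreal (L powr k) * (\<Sum>i. hgauge k (C i))" by (rule ennreal_suminf_cmult)
  finally show ?thesis .
 qed
 \<comment> \<open>Multiplying by \<open>L powr (- k)\<close> and back carries the constant past the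
   infimum over covers.\<close>
 have inv: "ennreal (L powr (- k)) * ennreal (L powr k) = 1"
  using L by (simp add: ennreal_mult[symmetric] powr_add[symmetric])
 have "ennreal (L powr (- k)) * hpre k \<delta> (f ` A) \<le> hpre k (\<delta> / L) A"
  unfolding hpre_def[of _ "\<delta> / L"]
 proof (rule INF_greatest)
  fix C assume "C \<in> hcovers (\<delta> / L) A"
  from mult_left_mono[OF *[OF this], of "ennreal (L powr (- k))"]
  show "ennreal (L powr (- k)) * hpre k \<delta> (f ` A) \<le> (\<Sum>i. hgauge k (C i))"
   unfolding mult.assoc[symmetric] inv by simp
 qed
 from mult_left_mono[OF this, of "ennreal (L powr k)"]
 have "hpre k \<delta> (f ` A) \<le> ennreal (L powr k) * hpre k (\<delta> / L) A"
  unfolding mult.assoc[symmetric] mult.commute[of "ennreal (L powr k)" "ennreal (L powr (- k))"] inv by simp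
 also have "\<dots> \<le> ennreal (L powr k) * hausdorff_outer k A"
  using L \<delta> by (intro mult_left_mono hpre_le_outer) auto
 finally show "hpre k \<delta> (f ` A) \<le> ennreal (L powr k) * hausdorff_outer k A" .
qed

lemma hpre_finite_cover:
 assumes \<delta>: "\<delta> > 0" and I: "finite I" and cov: "A \<subseteq> (\<Union>i\<in>I. C i)"
  and C: "\<And>i. i \<in> I \<Longrightarrow> bounded (C i) \<and> diameter (C i) < \<delta>"
 shows "hpre k \<delta> A \<le> (\<Sum>i\<in>I. hgauge k (C i))"
proof -
 obtain f where f: "bij_betw f {0..<card I} I" using ex_bij_betw_nat_finite[OF I] by blast
 define D where "D j = (if j < card I then C (f j) else {})" for j
 have fI: "f j \<in> I" if "j < card I" for j using f that by (auto simp: bij_betw_def)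
 have "D \<in> hcovers \<delta> A"
  unfolding hcovers_def
 proof (intro CollectI conjI subsetI allI)
  fix x assume "x \<in> A"
  then obtain i where i: "i \<in> I" "x \<in> C i" using cov by auto
  then have "i \<in> f ` {0..<card I}" using f by (simp add: bij_betw_def)
  then obtain j where "j < card I" "f j = i" by auto
  then have "x \<in> D j" using i by (simp add: D_def)
  then show "x \<in> (\<Union>j. D j)" by blast
 qed (use C fI \<delta> in \<open>auto simp: D_def\<close>)
 then have "hpre k \<delta> A \<le> (\<Sum>j. hgauge k (D j))" unfolding hpre_def by (rule INF_lower)
 also have "\<dots> = (\<Sum>j\<in>{0..<card I}. hgauge k (D j))" by (rule suminf_finite) (auto simp: D_def)
 also have "\<dots> = (\<Sum>j\<in>{0..<card I}. hgauge k (C (f j)))" by (rule sum.cong) (auto simp: D_def)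
 also have "\<dots> = (\<Sum>i\<in>I. hgauge k (C i))" by (rule sum.reindex_bij_betw[OF f])
 finally show ?thesis .
qed

lemma hausdorff_outer_isometry:
 fixes f :: "'a::euclidean_space \<Rightarrow> 'b::euclidean_space"
 assumes k: "k > 0" and iso: "\<And>x y. dist (f x) (f y) = dist x y"
 shows "hausdorff_outer k (f ` A) = hausdorff_outer k A"
proof (rule antisym)
 show "hausdorff_outer k (f ` A) \<le> hausdorff_outer k A"
  using hausdorff_outer_lipschitz_image[of 1 k A f] k iso by simp
 have inj: "inj f" using iso by (metis dist_eq_0_iff injI)
 have "hausdorff_outer k (inv f ` (f ` A)) \<le> ennreal (1 powr k) * hausdorff_outer k (f ` A)"
  by (rule hausdorff_outer_lipschitz_image) (use k iso inj in \<open>auto simp: image_iff\<close>)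
 then show "hausdorff_outer k A \<le> hausdorff_outer k (f ` A)"
  using inj by (simp add: image_image)
qed

section \<open>Hausdorff measure on hyperplanes, compared with Lebesgue measure\<close>

definition cube_face :: "'n::finite \<Rightarrow> (real^'n) set" where
 "cube_face i = {x. x $ i = 0 \<and> (\<forall>j. 0 \<le> x $ j \<and> x $ j \<le> 1)}"

lemma closed_cube_face: "closed (cube_face i)"
proof -
 have "cube_face i = (\<Inter>j. {x. x $ i = 0} \<inter> {x. 0 \<le> x $ j} \<inter> {x. x $ j \<le> 1})"
  by (auto simp: cube_face_def)
 then show ?thesis
  by (auto intro!: closed_INT closed_Int closed_Collect_eq closed_Collect_le continuous_intros)
qed

lemma diameter_le_coordinates:
 fixes S :: "(real^'n) set"
 assumes "\<And>x y j. x \<in> S \<Longrightarrow> y \<in> S \<Longrightarrow> \<bar>x $ j - y $ j\<bar> \<le> c" and c: "c \<ge> 0"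
 shows "bounded S" "diameter S \<le> real CARD('n) * c"
proof -
 have n: "norm (x - y) \<le> real CARD('n) * c" if "x \<in> S" "y \<in> S" for x y
 proof -
  have "norm (x - y) \<le> (\<Sum>j\<in>UNIV. \<bar>(x - y) $ j\<bar>)" by (rule norm_le_l1_cart)
  also have "\<dots> \<le> (\<Sum>j\<in>(UNIV::'n set). c)" using assms that by (intro sum_mono) auto
  finally show ?thesis by simp
 qed
 then show "bounded S" unfolding bounded_two_points dist_norm by blast
 show "diameter S \<le> real CARD('n) * c" by (rule diameter_le) (use n c in auto)
qed

context
 fixes k :: real
 assumes k_def: "k = real CARD('n::finite) - 1" and d2: "CARD('n) \<ge> 2"
begin

lemma k_pos: "k > 0" using d2 by (simp add: k_def)

text \<open>A grid of N^k cells of diameter at most d/N covers the face. The gauges add up to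
  \<open>c * (d / 2) powr k\<close>, in which N cancels, so the bound is uniform as the mesh
  shrinks.\<close>

lemma hausdorff_cube_face_finite: "hausdorff_outer k (cube_face i :: (real^'n) set) < \<infinity>"
proof -
 let ?d = "real CARD('n)"
 define c where "c = pi powr (k / 2) / Gamma (k / 2 + 1)"
 have c: "c \<ge> 0" unfolding c_def using k_pos by (intro divide_nonneg_nonneg Gamma_real_nonneg) auto
 have "hpre k \<delta> (cube_face i :: (real^'n) set) \<le> ennreal (c * (?d / 2) powr k)" if \<delta>: "\<delta> > 0" for \<delta>
 proof -
  obtain N0 :: nat where N0: "?d / \<delta> < real N0" using reals_Archimedean2 by blast
  define N where "N = Suc N0"
  have N: "N > 0" "?d * (1 / real N) < \<delta>"
  proof -
   have "?d / \<delta> < real N" using N0 by (simp add: N_def)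
   then show "?d * (1 / real N) < \<delta>" using \<delta> by (simp add: N_def field_simps)
  qed (simp add: N_def)
  let ?I = "PiE (UNIV - {i}) (\<lambda>_. {..<N})"
  define C where "C f = {x::real^'n. x $ i = 0 \<and> (\<forall>j\<in>UNIV - {i}. real (f j) / N \<le> x $ j \<and> x $ j \<le> (real (f j) + 1) / N)}" for f
  have Cc: "\<bar>x $ j - y $ j\<bar> \<le> 1 / real N" if "x \<in> C f" "y \<in> C f" for x y j f
  proof (cases "j = i")
   case False
   then have "real (f j) / N \<le> x $ j" "x $ j \<le> real (f j) / N + 1 / N" "real (f j) / N \<le> y $ j" "y $ j \<le> real (f j) / N + 1 / N"
    using that by (auto simp: C_def add_divide_distrib)
   then show ?thesis by linarith
  qed (use that in \<open>auto simp: C_def\<close>)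
  have bC: "bounded (C f)" and dC: "diameter (C f) \<le> ?d * (1 / real N)" for f
   using diameter_le_coordinates[of "C f" "1 / real N"] Cc by auto
  have "hpre k \<delta> (cube_face i :: (real^'n) set) \<le> (\<Sum>f\<in>?I. hgauge k (C f))"
  proof (rule hpre_finite_cover[OF \<delta>])
   show "finite ?I" by (intro finite_PiE) auto
   show "cube_face i \<subseteq> (\<Union>f\<in>?I. C f)"
   proof
    fix x :: "real^'n" assume x: "x \<in> cube_face i"
    \<comment> \<open>The minimum with \<open>N - 1\<close> places the points with a coordinate
      equal to 1 in the last cell, which is closed.\<close>
    define f where "f = (\<lambda>j\<in>UNIV - {i}. min (N - 1) (nat \<lfloor>real N * x $ j\<rfloor>))"
    have "f \<in> ?I" using N by (auto simp: f_def)
    moreover have "x \<in> C f"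
    proof -
     have "real (f j) / N \<le> x $ j \<and> x $ j \<le> (real (f j) + 1) / N" if j: "j \<noteq> i" for j
     proof -
      have xj: "0 \<le> x $ j" "x $ j \<le> 1" using x by (auto simp: cube_face_def)
      define y where "y = real N * x $ j"
      have y: "0 \<le> y" "y \<le> real N" using xj by (auto simp: y_def mult_left_le)
      have fj: "f j = min (N - 1) (nat \<lfloor>y\<rfloor>)" using j by (simp add: f_def y_def)
      have fl: "real (nat \<lfloor>y\<rfloor>) \<le> y" "y < real (nat \<lfloor>y\<rfloor>) + 1" using y by linarith+
      have "real (f j) \<le> y" unfolding fj using fl by linarith
      moreover have "y \<le> real (f j) + 1"
      proof (cases "N - 1 \<le> nat \<lfloor>y\<rfloor>")
       case True
       then have "real (f j) = real N - 1" unfolding fj using N by (simp add: min_def of_nat_diff)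
       then show ?thesis using y by simp
      next
       case False
       then show ?thesis unfolding fj using fl by simp
      qed
      ultimately show ?thesis using N by (simp add: y_def field_simps)
     qed
     then show ?thesis using x by (auto simp: C_def cube_face_def)
    qed
    ultimately show "x \<in> (\<Union>f\<in>?I. C f)" by blast
   qed
   fix f assume "f \<in> ?I"
   show "bounded (C f) \<and> diameter (C f) < \<delta>" using bC dC[of f] N by auto
  qed
  also have "\<dots> \<le> (\<Sum>f\<in>?I. ennreal (c * (?d * (1 / real N) / 2) powr k))"
   unfolding hgauge_def c_def[symmetric] using k_pos c
   by (intro sum_mono ennreal_leI mult_left_mono powr_mono2 divide_right_mono dC)
     (auto intro: diameter_ge_0 bC)
  also have "\<dots> = ennreal (real (card ?I) * (c * (?d * (1 / real N) / 2) powr k))"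
   using c by (simp add: ennreal_mult ennreal_of_nat_eq_real_of_nat)
  also have "real (card ?I) * (c * (?d * (1 / real N) / 2) powr k) = c * (?d / 2) powr k"
  proof -
   have "real (card ?I) = real N powr k"
    using N d2 by (simp add: card_PiE k_def powr_realpow[symmetric] of_nat_diff)
   moreover have "(?d * (1 / real N) / 2) powr k = (?d / 2) powr k / real N powr k"
    by (simp add: powr_divide[symmetric] field_simps)
   ultimately show ?thesis using N by simp
  qed
  finally show ?thesis .
 qed
 then have "hausdorff_outer k (cube_face i :: (real^'n) set) \<le> ennreal (c * (?d / 2) powr k)"
  unfolding hausdorff_outer_eq by (intro SUP_least) auto
 also have "\<dots> < \<infinity>" by simp
 finally show ?thesis .
qed

text \<open>Thickening each covering set to a box of length 1 in direction i and side 2 diam in the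
  other directions covers the unit cube, so the volumes (2 diam)^k sum to at least 1. The constant 4
  arises because the gauge is built from diam / 2 and 2 diam = 4 (diam / 2).\<close>

lemma hausdorff_cube_face_pos: "hausdorff_outer k (cube_face i :: (real^'n) set) > 0"
proof -
 define c where "c = pi powr (k / 2) / Gamma (k / 2 + 1)"
 have c: "c > 0" unfolding c_def using k_pos by (intro divide_pos_pos Gamma_real_pos) auto
 have "1 \<le> ennreal (4 powr k / c) * (\<Sum>m. hgauge k (C m))" if C: "C \<in> hcovers 1 (cube_face i :: (real^'n) set)" for C
 proof -
  have Cb: "bounded (C m)" for m using C by (auto simp: hcovers_def)
  have "\<exists>a. C m \<inter> cube_face i \<subseteq> {x. \<forall>j. \<bar>x $ j - a $ j\<bar> \<le> diameter (C m)}" for m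
  proof (cases "C m = {}")
   case False
   then obtain a where a: "a \<in> C m" by blast
   show ?thesis
   proof (intro exI subsetI CollectI allI)
    fix x j assume "x \<in> C m \<inter> cube_face i"
    then have "dist x a \<le> diameter (C m)"
     using a by (auto intro!: diameter_bounded_bound Cb)
    moreover have "\<bar>(x - a) $ j\<bar> \<le> norm (x - a)" by (rule component_le_norm_cart)
    ultimately show "\<bar>x $ j - a $ j\<bar> \<le> diameter (C m)" by (simp add: dist_norm)
   qed
  qed auto
  then have "\<exists>a. \<forall>m. C m \<inter> cube_face i \<subseteq> {x. \<forall>j. \<bar>x $ j - a m $ j\<bar> \<le> diameter (C m)}"
   by (intro choice allI)
  then obtain a where a: "\<And>m. C m \<inter> cube_face i \<subseteq> {x. \<forall>j. \<bar>x $ j - a m $ j\<bar> \<le> diameter (C m)}" by blast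
  define l where "l m = (\<chi> j. if j = i then 0 else a m $ j - diameter (C m))" for m
  define u where "u m = (\<chi> j. if j = i then 1 else a m $ j + diameter (C m))" for m
  have "cbox 0 1 \<subseteq> (\<Union>m. cbox (l m) (u m))"
  proof
   fix x :: "real^'n" assume "x \<in> cbox 0 1"
   then have x: "\<And>j. 0 \<le> x $ j \<and> x $ j \<le> 1" by (auto simp: mem_box_cart)
   define y where "y = (\<chi> j. if j = i then 0 else x $ j)"
   have y: "y \<in> cube_face i" using x by (auto simp: cube_face_def y_def)
   then obtain m where "y \<in> C m" using C by (auto simp: hcovers_def)
   then have *: "\<bar>y $ j - a m $ j\<bar> \<le> diameter (C m)" for j using a[of m] y by auto
   have "l m $ j \<le> x $ j \<and> x $ j \<le> u m $ j" for j
    using *[of j] x[of j] by (cases "j = i") (auto simp: l_def u_def y_def)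
   then have "x \<in> cbox (l m) (u m)" by (simp add: mem_box_cart)
   then show "x \<in> (\<Union>m. cbox (l m) (u m))" by blast
  qed
  then have "emeasure lborel (cbox 0 (1::real^'n)) \<le> emeasure lborel (\<Union>m. cbox (l m) (u m))"
   by (intro emeasure_mono) auto
  also have "\<dots> \<le> (\<Sum>m. emeasure lborel (cbox (l m) (u m)))"
   by (rule emeasure_subadditive_countably) auto
  also have "\<dots> = (\<Sum>m. ennreal (4 powr k / c) * hgauge k (C m))"
  proof (rule suminf_cong)
   fix m
   let ?D = "diameter (C m)"
   have D: "?D \<ge> 0" by (rule diameter_ge_0[OF Cb])
   have "emeasure lborel (cbox (l m) (u m)) = ennreal (measure lborel (cbox (l m) (u m)))"
    by (rule emeasure_eq_measure2) auto
   also have "measure lborel (cbox (l m) (u m)) = (\<Prod>j\<in>UNIV. u m $ j - l m $ j)"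
   proof (rule content_cbox_cart)
    have "l m \<in> cbox (l m) (u m)" using D by (auto simp: mem_box_cart l_def u_def)
    then show "cbox (l m) (u m) \<noteq> {}" by blast
   qed
   also have "\<dots> = (\<Prod>j\<in>UNIV - {i}. 2 * ?D)"
    by (subst prod.remove[of _ i]) (auto simp: l_def u_def intro!: prod.cong)
   also have "\<dots> = (2 * ?D) powr k"
   proof (cases "?D = 0")
    case True
    then show ?thesis using d2 by (simp add: power_0_left)
   next
    case False
    then have "2 * ?D > 0" using D by simp
    then show ?thesis using d2 by (simp add: k_def powr_realpow[symmetric] of_nat_diff powr_mult)
   qed
   also have "2 * ?D = 4 * (?D / 2)" by simp
   also have "\<dots> powr k = 4 powr k * (?D / 2) powr k" using D by (intro powr_mult)
   finally show "emeasure lborel (cbox (l m) (u m)) = ennreal (4 powr k / c) * hgauge k (C m)"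
    using c unfolding hgauge_def c_def[symmetric] by (subst ennreal_mult'[symmetric]) auto
  qed
  also have "\<dots> = ennreal (4 powr k / c) * (\<Sum>m. hgauge k (C m))" by (rule ennreal_suminf_cmult)
  also have "emeasure lborel (cbox 0 (1::real^'n)) = 1"
  proof -
   have "emeasure lborel (cbox 0 (1::real^'n)) = ennreal (measure lborel (cbox 0 (1::real^'n)))"
    by (rule emeasure_eq_measure2) auto
   moreover have "measure lborel (cbox 0 (1::real^'n)) = (\<Prod>j\<in>(UNIV::'n set). 1 - 0)"
    by (subst content_cbox_cart) (auto simp: interval_ne_empty_cart)
   ultimately show ?thesis by simp
  qed
  finally show ?thesis .
 qed
 then have *: "ennreal (c / 4 powr k) \<le> (\<Sum>m. hgauge k (C m))" if "C \<in> hcovers 1 (cube_face i :: (real^'n) set)" for C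
 proof -
  have "ennreal (c / 4 powr k) * ennreal (4 powr k / c) = 1"
   using c by (subst ennreal_mult[symmetric]) auto
  then show ?thesis
   using mult_left_mono[of 1 "ennreal (4 powr k / c) * (\<Sum>m. hgauge k (C m))" "ennreal (c / 4 powr k)"] that
    \<open>\<And>C. C \<in> hcovers 1 (cube_face i) \<Longrightarrow> 1 \<le> ennreal (4 powr k / c) * (\<Sum>m. hgauge k (C m))\<close>
   by (simp add: mult.assoc[symmetric])
 qed
 have "0 < ennreal (c / 4 powr k)" using c by (simp add: ennreal_less_zero_iff)
 also have "\<dots> \<le> hpre k 1 (cube_face i :: (real^'n) set)" unfolding hpre_def using * by (rule INF_greatest)
 also have "\<dots> \<le> hausdorff_outer k (cube_face i)" by (rule hpre_le_outer) simp
 finally show ?thesis .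
qed

lemma hausdorff_translate: "hausdorff_outer k ((\<lambda>x. a + x) ` A) = hausdorff_outer k (A :: (real^'n) set)"
 by (rule hausdorff_outer_isometry[OF k_pos]) simp

definition plane_measure :: "real^'n \<Rightarrow> (real^'n) measure" where
 "plane_measure u = density (hausdorff_measure k) (indicator {x. x \<bullet> u = 0})"

lemma closed_plane: "closed {x::real^'n. x \<bullet> u = 0}"
 by (intro closed_Collect_eq continuous_intros)

lemma plane_borel[measurable]: "{x::real^'n. x \<bullet> u = 0} \<in> sets borel"
 using closed_plane by (rule borel_closed)

lemma sets_plane_measure[simp, measurable_cong]: "sets (plane_measure u) = sets borel"
 by (simp add: plane_measure_def)

lemma space_plane_measure[simp]: "space (plane_measure u) = UNIV"
 by (simp add: plane_measure_def)

lemma emeasure_plane_measure: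
 assumes [measurable]: "A \<in> sets borel"
 shows "emeasure (plane_measure u) A = hausdorff_outer k (A \<inter> {x. x \<bullet> u = 0})"
proof -
 have "emeasure (plane_measure u) A = (\<integral>\<^sup>+x. indicator (A \<inter> {x. x \<bullet> u = 0}) x \<partial>hausdorff_measure k)"
  unfolding plane_measure_def
  by (subst emeasure_density, simp, simp, rule nn_integral_cong) (auto simp: indicator_def)
 also have "\<dots> = emeasure (hausdorff_measure k) (A \<inter> {x. x \<bullet> u = 0})"
  by (intro nn_integral_indicator) simp
 finally show ?thesis by (simp add: emeasure_hausdorff_measure)
qed

lemma plane_measure_translate:
 assumes a: "a \<bullet> u = 0"
 shows "distr (plane_measure u) borel (\<lambda>x. a + x) = plane_measure u"
proof (rule measure_eqI)
 fix A assume "A \<in> sets (distr (plane_measure u) borel (\<lambda>x. a + x))"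
 then have A[measurable]: "A \<in> sets borel" by simp
 have pre: "(\<lambda>x. a + x) -` A \<in> sets borel" using measurable_sets[of "\<lambda>x. a + x" borel borel A] A by simp
 have "emeasure (distr (plane_measure u) borel (\<lambda>x. a + x)) A = emeasure (plane_measure u) ((\<lambda>x. a + x) -` A)"
  by (subst emeasure_distr) auto
 also have "\<dots> = hausdorff_outer k ((\<lambda>x. a + x) -` A \<inter> {x. x \<bullet> u = 0})"
  by (rule emeasure_plane_measure[OF pre])
 also have "\<dots> = hausdorff_outer k ((\<lambda>x. a + x) ` ((\<lambda>x. a + x) -` A \<inter> {x. x \<bullet> u = 0}))"
  by (rule hausdorff_translate[symmetric])
 also have "(\<lambda>x. a + x) ` ((\<lambda>x. a + x) -` A \<inter> {x. x \<bullet> u = 0}) = A \<inter> {x. x \<bullet> u = 0}"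
 proof (intro set_eqI iffI)
  fix y assume "y \<in> A \<inter> {x. x \<bullet> u = 0}"
  then show "y \<in> (\<lambda>x. a + x) ` ((\<lambda>x. a + x) -` A \<inter> {x. x \<bullet> u = 0})"
   using a by (intro image_eqI[of _ _ "y - a"]) (auto simp: inner_diff_left)
 qed (use a in \<open>auto simp: inner_add_left\<close>)
 finally show "emeasure (distr (plane_measure u) borel (\<lambda>x. a + x)) A = emeasure (plane_measure u) A"
  by (simp add: emeasure_plane_measure)
qed simp

context
 fixes i :: 'n and f :: "real^'n \<Rightarrow> real^'n" and u :: "real^'n"
 assumes f: "orthogonal_transformation f" and fu: "f (axis i 1) = u"
begin

lemma norm_u: "norm u = 1"
 using f fu orthogonal_transformation_norm[of f "axis i 1"] by simp

lemma u_u: "u \<bullet> u = 1" using norm_u by (simp add: dot_square_norm)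

lemma f_inner_u: "f x \<bullet> u = x $ i"
 using f fu by (metis inner_axis inner_real_def mult.right_neutral orthogonal_transformation_def)

lemma f_lin: "linear f" using f by (simp add: orthogonal_transformation_def)

lemma f_dist: "dist (f x) (f y) = dist x y"
 using f by (simp add: orthogonal_transformation_isometry)

lemma f_surj: "\<exists>x. f x = y"
 using orthogonal_transformation_surj[OF f] by (metis surjD)

text \<open>The rotated face, translated by the rotated integer points, exhausts the hyperplane with
  pieces of finite measure; the complement of the hyperplane is null for this restricted measure.
  This makes Fubini available for \<open>sweep\<close>.\<close>

lemma sigma_finite_plane_measure: "sigma_finite_measure (plane_measure u)"
proof
 define G where "G z = (\<lambda>x. f (\<chi> j. of_int (z j)) + x) ` (f ` cube_face i)" for z :: "'n \<Rightarrow> int"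
 let ?P = "{x::real^'n. x \<bullet> u = 0}"
 have Gc: "compact (G z)" for z
 proof -
  have "cube_face i \<subseteq> cbox 0 1" by (auto simp: cube_face_def mem_box_cart)
  then have "compact (cube_face i)" using closed_cube_face bounded_subset[OF bounded_cbox] compact_eq_bounded_closed by blast
  then show ?thesis unfolding G_def using f_lin
   by (intro compact_continuous_image continuous_intros linear_continuous_on linear_conv_bounded_linear[THEN iffD1])
 qed
 have Gf: "emeasure (plane_measure u) (G z) \<noteq> \<infinity>" for z
 proof -
  have "emeasure (plane_measure u) (G z) = hausdorff_outer k (G z \<inter> ?P)"
   by (rule emeasure_plane_measure[OF borel_compact[OF Gc]])
  also have "\<dots> \<le> hausdorff_outer k (G z)" by (rule hausdorff_outer_mono) auto
  also have "\<dots> = hausdorff_outer k (cube_face i :: (real^'n) set)"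
   unfolding G_def hausdorff_translate by (rule hausdorff_outer_isometry[OF k_pos f_dist])
  also have "\<dots> < \<infinity>" by (rule hausdorff_cube_face_finite)
  finally show ?thesis by simp
 qed
 have zero: "emeasure (plane_measure u) (- ?P) = 0"
  by (subst emeasure_plane_measure) auto
 have cov: "?P \<subseteq> (\<Union>z. G z)"
 proof
  fix y assume y: "y \<in> ?P"
  obtain x where x: "f x = y" using f_surj by blast
  then have xi: "x $ i = 0" using y f_inner_u[of x] by simp
  define z where "z j = \<lfloor>x $ j\<rfloor>" for j
  define r where "r = (\<chi> j. x $ j - of_int (z j))"
  have r: "r \<in> cube_face i"
   using xi by (auto simp: cube_face_def r_def z_def) linarith+
  have "x = (\<chi> j. of_int (z j)) + r" by (simp add: r_def vec_eq_iff)
  then have "y = f (\<chi> j. of_int (z j)) + f r" using x linear_add[OF f_lin] by metis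
  then show "y \<in> (\<Union>z. G z)" unfolding G_def using r by blast
 qed
 show "\<exists>A. countable A \<and> A \<subseteq> sets (plane_measure u) \<and> \<Union> A = space (plane_measure u) \<and> (\<forall>a\<in>A. emeasure (plane_measure u) a \<noteq> \<infinity>)"
 proof (intro exI conjI)
  show "countable (insert (- ?P) (range G))" by simp
  show "insert (- ?P) (range G) \<subseteq> sets (plane_measure u)" using Gc borel_compact by auto
  show "\<Union> (insert (- ?P) (range G)) = space (plane_measure u)" using cov by auto
  show "\<forall>a\<in>insert (- ?P) (range G). emeasure (plane_measure u) a \<noteq> \<infinity>" using Gf zero by auto
 qed
qed

text \<open>The product of hyperplane measure and length, laid out along v. It converts
  k-dimensional measure of a base into volume of a possibly oblique cylinder, for which Haar
  uniqueness is available.\<close>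

definition sweep :: "real^'n \<Rightarrow> (real^'n) measure" where
 "sweep v = distr (plane_measure u \<Otimes>\<^sub>M lborel) borel (\<lambda>(x, t). x + t *\<^sub>R v)"

lemma emeasure_sweep:
 assumes [measurable]: "S \<in> sets borel"
 shows "emeasure (sweep v) S = (\<integral>\<^sup>+x. (\<integral>\<^sup>+t. indicator S (x + t *\<^sub>R v) \<partial>lborel) \<partial>plane_measure u)"
proof -
 have [measurable]: "(\<lambda>(x, t). x + t *\<^sub>R v) \<in> measurable (plane_measure u \<Otimes>\<^sub>M lborel) borel" by measurable
 have "emeasure (sweep v) S = (\<integral>\<^sup>+x. indicator S x \<partial>sweep v)" by (simp add: sweep_def)
 also have "\<dots> = (\<integral>\<^sup>+p. indicator S (case p of (x, t) \<Rightarrow> x + t *\<^sub>R v) \<partial>(plane_measure u \<Otimes>\<^sub>M lborel))"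
  unfolding sweep_def by (subst nn_integral_distr) auto
 also have "\<dots> = (\<integral>\<^sup>+x. (\<integral>\<^sup>+t. indicator S (x + t *\<^sub>R v) \<partial>lborel) \<partial>plane_measure u)"
  by (subst lborel.nn_integral_fst[symmetric]) auto
 finally show ?thesis .
qed

lemma emeasure_sweep_cylinder:
 assumes v: "v \<bullet> u = 1" and q: "q \<ge> 0" and [measurable]: "A \<in> sets borel" and AP: "A \<subseteq> {x. x \<bullet> u = 0}"
 shows "emeasure (sweep v) {z. z - (z \<bullet> u) *\<^sub>R v \<in> A \<and> 0 \<le> z \<bullet> u \<and> z \<bullet> u \<le> q} = ennreal q * hausdorff_outer k A"
proof -
 let ?S = "{z. z - (z \<bullet> u) *\<^sub>R v \<in> A \<and> 0 \<le> z \<bullet> u \<and> z \<bullet> u \<le> q}"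
 have [measurable]: "?S \<in> sets borel" by measurable
 have "emeasure (sweep v) ?S = (\<integral>\<^sup>+x. (\<integral>\<^sup>+t. indicator ?S (x + t *\<^sub>R v) \<partial>lborel) \<partial>plane_measure u)"
  by (rule emeasure_sweep) simp
 also have "\<dots> = (\<integral>\<^sup>+x. ennreal q * indicator A x \<partial>plane_measure u)"
  unfolding plane_measure_def
 proof (subst (1 2) nn_integral_density)
  show "(\<integral>\<^sup>+x. indicator {x. x \<bullet> u = 0} x * (\<integral>\<^sup>+t. indicator ?S (x + t *\<^sub>R v) \<partial>lborel) \<partial>hausdorff_measure k) =
   (\<integral>\<^sup>+x. indicator {x. x \<bullet> u = 0} x * (ennreal q * indicator A x) \<partial>hausdorff_measure k)"
  proof (rule nn_integral_cong)
   fix x :: "real^'n"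
   show "indicator {x. x \<bullet> u = 0} x * (\<integral>\<^sup>+t. indicator ?S (x + t *\<^sub>R v) \<partial>lborel) =
     indicator {x. x \<bullet> u = 0} x * (ennreal q * indicator A x)"
   proof (cases "x \<bullet> u = 0")
    case True
    then have "indicator ?S (x + t *\<^sub>R v) = (indicator {0..q} t * indicator A x :: ennreal)" for t
     using v by (auto simp: inner_add_left indicator_def)
    then show ?thesis using q by (simp add: nn_integral_multc)
   qed simp
  qed
 qed measurable
 also have "\<dots> = ennreal q * emeasure (plane_measure u) A" by (simp add: nn_integral_cmult_indicator)
 also have "A \<inter> {x. x \<bullet> u = 0} = A" using AP by auto
 then have "emeasure (plane_measure u) A = hausdorff_outer k A" by (simp add: emeasure_plane_measure)
 finally show ?thesis .
qed

text \<open>The translation vector is split into its component b in the hyperplane, absorbed by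
  \<open>plane_measure_translate\<close>, and its component along u, absorbed by a shift of the
  length variable.\<close>

lemma sweep_translate: "distr (sweep u) borel (\<lambda>x. a + x) = sweep u"
proof (rule measure_eqI)
 fix S assume "S \<in> sets (distr (sweep u) borel (\<lambda>x. a + x))"
 then have S[measurable]: "S \<in> sets borel" by simp
 define b where "b = a - (a \<bullet> u) *\<^sub>R u"
 have b: "b \<bullet> u = 0" using u_u by (simp add: b_def inner_diff_left)
 have pre[measurable]: "(\<lambda>x. a + x) -` S \<in> sets borel" using measurable_sets[of "\<lambda>x. a + x" borel borel S] S by simp
 have s: "sets (sweep u) = sets borel" "space (sweep u) = UNIV" by (simp_all add: sweep_def)
 have "emeasure (distr (sweep u) borel (\<lambda>x. a + x)) S = emeasure (sweep u) ((\<lambda>x. a + x) -` S)"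
  by (subst emeasure_distr) (auto simp: s measurable_cong_sets[OF s(1) refl])
 also have "\<dots> = (\<integral>\<^sup>+x. (\<integral>\<^sup>+t. indicator ((\<lambda>x. a + x) -` S) (x + t *\<^sub>R u) \<partial>lborel) \<partial>plane_measure u)"
  by (rule emeasure_sweep) simp
 also have "\<dots> = (\<integral>\<^sup>+x. (\<integral>\<^sup>+t. indicator S ((b + x) + t *\<^sub>R u) \<partial>lborel) \<partial>plane_measure u)"
 proof (rule nn_integral_cong)
  fix x
  have "(\<integral>\<^sup>+t. indicator S ((b + x) + t *\<^sub>R u) \<partial>lborel) = (\<integral>\<^sup>+t. indicator S ((b + x) + t *\<^sub>R u) \<partial>distr lborel borel (\<lambda>t. a \<bullet> u + t))"
   by (simp add: lborel_distr_plus)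
  also have "\<dots> = (\<integral>\<^sup>+t. indicator S ((b + x) + (a \<bullet> u + t) *\<^sub>R u) \<partial>lborel)"
   by (subst nn_integral_distr) auto
  also have "\<dots> = (\<integral>\<^sup>+t. indicator ((\<lambda>x. a + x) -` S) (x + t *\<^sub>R u) \<partial>lborel)"
   by (intro nn_integral_cong) (simp add: indicator_def b_def algebra_simps)
  finally show "(\<integral>\<^sup>+t. indicator ((\<lambda>x. a + x) -` S) (x + t *\<^sub>R u) \<partial>lborel) = (\<integral>\<^sup>+t. indicator S ((b + x) + t *\<^sub>R u) \<partial>lborel)" by simp
 qed
 also have "\<dots> = (\<integral>\<^sup>+x. (\<integral>\<^sup>+t. indicator S (x + t *\<^sub>R u) \<partial>lborel) \<partial>distr (plane_measure u) borel (\<lambda>x. b + x))"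
  by (subst nn_integral_distr) auto
 also have "\<dots> = emeasure (sweep u) S"
  unfolding plane_measure_translate[OF b] by (rule emeasure_sweep[symmetric]) simp
 finally show "emeasure (distr (sweep u) borel (\<lambda>x. a + x)) S = emeasure (sweep u) S" .
qed (simp add: sweep_def)

text \<open>At height t the two layouts differ by the vector t (v - u), which lies in the hyperplane
  since v and u have the same inner product 1 with u. Fubini thus reduces the claim to translation
  invariance of each slice.\<close>

lemma emeasure_sweep_shear:
 assumes v: "v \<bullet> u = 1" and [measurable]: "S \<in> sets borel"
 shows "emeasure (sweep v) S = emeasure (sweep u) S"
proof -
 interpret M: sigma_finite_measure "plane_measure u" by (rule sigma_finite_plane_measure)
 interpret MP: pair_sigma_finite "plane_measure u" "lborel :: real measure" ..
 have "emeasure (sweep v) S = (\<integral>\<^sup>+x. (\<integral>\<^sup>+t. indicator S (x + t *\<^sub>R v) \<partial>lborel) \<partial>plane_measure u)"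
  by (rule emeasure_sweep) simp
 also have "\<dots> = (\<integral>\<^sup>+t. (\<integral>\<^sup>+x. indicator S (x + t *\<^sub>R v) \<partial>plane_measure u) \<partial>lborel)"
  by (rule MP.Fubini'[symmetric]) measurable
 also have "\<dots> = (\<integral>\<^sup>+t. (\<integral>\<^sup>+x. indicator S (x + t *\<^sub>R u) \<partial>plane_measure u) \<partial>lborel)"
 proof (rule nn_integral_cong)
  fix t :: real
  have b: "(t *\<^sub>R (v - u)) \<bullet> u = 0" using v u_u by (simp add: inner_diff_left)
  have "(\<integral>\<^sup>+x. indicator S (x + t *\<^sub>R u) \<partial>plane_measure u) = (\<integral>\<^sup>+x. indicator S (x + t *\<^sub>R u) \<partial>distr (plane_measure u) borel (\<lambda>x. t *\<^sub>R (v - u) + x))"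
   by (simp only: plane_measure_translate[OF b])
  also have "\<dots> = (\<integral>\<^sup>+x. indicator S (x + t *\<^sub>R v) \<partial>plane_measure u)"
   by (subst nn_integral_distr) (auto simp: algebra_simps)
  finally show "(\<integral>\<^sup>+x. indicator S (x + t *\<^sub>R v) \<partial>plane_measure u) = (\<integral>\<^sup>+x. indicator S (x + t *\<^sub>R u) \<partial>plane_measure u)" by simp
 qed
 also have "\<dots> = (\<integral>\<^sup>+x. (\<integral>\<^sup>+t. indicator S (x + t *\<^sub>R u) \<partial>lborel) \<partial>plane_measure u)"
  by (rule MP.Fubini') measurable
 also have "\<dots> = emeasure (sweep u) S" by (rule emeasure_sweep[symmetric]) simp
 finally show ?thesis .
qed

text \<open>By Haar uniqueness \<open>sweep u\<close> is a multiple of Lebesgue measure. The factor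
  is read off on the rotated unit cube, which has volume 1 and is the cylinder of height 1 over the
  rotated face.\<close>

lemma emeasure_sweep_eq_lborel:
 assumes S[measurable]: "S \<in> sets borel"
 shows "emeasure (sweep u) S = hausdorff_outer k (cube_face i :: (real^'n) set) * emeasure lborel S"
proof -
 let ?\<kappa> = "hausdorff_outer k (cube_face i :: (real^'n) set)"
 have s: "sets (sweep u) = sets borel" "space (sweep u) = UNIV" by (simp_all add: sweep_def)
 have cl: "closed (f ` cube_face i)"
 proof -
  have "cube_face i \<subseteq> cbox 0 1" by (auto simp: cube_face_def mem_box_cart)
  then have "compact (cube_face i)" using closed_cube_face bounded_subset[OF bounded_cbox] compact_eq_bounded_closed by blast
  then show ?thesis using f_lin
   by (intro compact_imp_closed compact_continuous_image linear_continuous_on linear_conv_bounded_linear[THEN iffD1])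
 qed
 have Q: "{z. z - (z \<bullet> u) *\<^sub>R u \<in> f ` cube_face i \<and> 0 \<le> z \<bullet> u \<and> z \<bullet> u \<le> 1} = f ` cbox 0 1"
 proof (intro set_eqI iffI)
  fix z assume "z \<in> f ` cbox 0 1"
  then obtain x where x: "x \<in> cbox 0 1" "z = f x" by auto
  have "z - (z \<bullet> u) *\<^sub>R u = f (x - (x $ i) *\<^sub>R axis i 1)"
   using fu f_inner_u x by (simp add: linear_diff[OF f_lin] linear_scale[OF f_lin])
  moreover have "x - (x $ i) *\<^sub>R axis i 1 \<in> cube_face i"
   using x by (auto simp: cube_face_def mem_box_cart axis_def)
  ultimately show "z \<in> {z. z - (z \<bullet> u) *\<^sub>R u \<in> f ` cube_face i \<and> 0 \<le> z \<bullet> u \<and> z \<bullet> u \<le> 1}"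
   using x f_inner_u by (auto simp: mem_box_cart)
 next
  fix z assume "z \<in> {z. z - (z \<bullet> u) *\<^sub>R u \<in> f ` cube_face i \<and> 0 \<le> z \<bullet> u \<and> z \<bullet> u \<le> 1}"
  then obtain y where y: "y \<in> cube_face i" "z - (z \<bullet> u) *\<^sub>R u = f y" "0 \<le> z \<bullet> u" "z \<bullet> u \<le> 1" by auto
  then have "z = f (y + (z \<bullet> u) *\<^sub>R axis i 1)"
   by (simp add: linear_add[OF f_lin] linear_scale[OF f_lin] fu algebra_simps)
  moreover have "y + (z \<bullet> u) *\<^sub>R axis i 1 \<in> cbox 0 1"
   using y by (auto simp: cube_face_def mem_box_cart axis_def)
  ultimately show "z \<in> f ` cbox 0 1" by blast
 qed
 have QN: "emeasure (sweep u) (f ` cbox 0 1) = ?\<kappa>"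
  unfolding Q[symmetric]
  by (subst emeasure_sweep_cylinder) (use cl u_u f_inner_u in \<open>auto simp: cube_face_def hausdorff_outer_isometry[OF k_pos f_dist]\<close>)
 have Qc: "compact (f ` cbox 0 1)" using f_lin
  by (intro compact_continuous_image linear_continuous_on linear_conv_bounded_linear[THEN iffD1]) auto
 have QL: "emeasure lborel (f ` cbox 0 1) = 1"
 proof -
  have om: "orthogonal_matrix (matrix f)" using f orthogonal_transformation_matrix by blast
  have det1: "\<bar>det (matrix f)\<bar> = 1" using det_orthogonal_matrix[OF om] by auto
  have inj: "inj f" by (rule orthogonal_transformation_inj[OF f])
  have "emeasure lborel (f ` cbox 0 1) = emeasure (distr lborel borel (\<lambda>x. matrix f *v x)) (f ` cbox 0 1)"
   using det1 by (subst distr_lborel_matrix) (auto simp: density_1)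
  also have "\<dots> = emeasure lborel (f -` (f ` cbox 0 1))"
   using Qc measurable_matrix_vector_mult[of "matrix f"]
   by (subst emeasure_distr) (auto simp: matrix_vector_mul(2)[OF f_lin] borel_compact)
  also have "f -` (f ` cbox 0 1) = cbox 0 1" using inj by (simp add: inj_vimage_image_eq)
  also have "emeasure lborel (cbox 0 (1::real^'n)) = 1"
  proof -
   have "emeasure lborel (cbox 0 (1::real^'n)) = ennreal (measure lborel (cbox 0 (1::real^'n)))"
    by (rule emeasure_eq_measure2) auto
   moreover have "measure lborel (cbox 0 (1::real^'n)) = (\<Prod>j\<in>(UNIV::'n set). 1 - 0)"
    by (subst content_cbox_cart) (auto simp: interval_ne_empty_cart)
   ultimately show ?thesis by simp
  qed
  finally show ?thesis .
 qed
 have sf: "sigma_finite_measure (sweep u)"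
 proof
  define G where "G z = (\<lambda>x. f (\<chi> j. of_int (z j)) + x) ` (f ` cbox 0 1)" for z :: "'n \<Rightarrow> int"
  have Gc: "G z \<in> sets borel" for z
   unfolding G_def using Qc by (intro borel_compact compact_translation)
  have cov: "(\<Union>z. G z) = UNIV"
  proof (intro set_eqI iffI)
   fix y :: "real^'n"
   obtain x where x: "f x = y" using f_surj by blast
   define z where "z j = \<lfloor>x $ j\<rfloor>" for j
   define r where "r = (\<chi> j. x $ j - of_int (z j))"
   have r: "r \<in> cbox 0 1"
    by (auto simp: mem_box_cart r_def z_def) linarith+
   have "x = (\<chi> j. of_int (z j)) + r" by (simp add: r_def vec_eq_iff)
   then have "y = f (\<chi> j. of_int (z j)) + f r" using x linear_add[OF f_lin] by metis
   then show "y \<in> (\<Union>z. G z)" unfolding G_def using r by blast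
  qed auto
  have Gf: "emeasure (sweep u) (G z) \<noteq> \<infinity>" for z
  proof -
   let ?a = "f (\<chi> j. of_int (z j))"
   have "emeasure (sweep u) (G z) = emeasure (distr (sweep u) borel (\<lambda>x. ?a + x)) (G z)"
    by (simp only: sweep_translate)
   also have "\<dots> = emeasure (sweep u) ((\<lambda>x. ?a + x) -` G z)"
    using Gc by (subst emeasure_distr) (auto simp: s measurable_cong_sets[OF s(1) refl])
   also have "(\<lambda>x. ?a + x) -` G z = f ` cbox 0 1"
    unfolding G_def by (simp add: inj_vimage_image_eq)
   also have "emeasure (sweep u) (f ` cbox 0 1) = ?\<kappa>" by (rule QN)
   finally show ?thesis using hausdorff_cube_face_finite[of i] by simp
  qed
  show "\<exists>A. countable A \<and> A \<subseteq> sets (sweep u) \<and> \<Union> A = space (sweep u) \<and> (\<forall>a\<in>A. emeasure (sweep u) a \<noteq> \<infinity>)"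
   by (intro exI[of _ "range G"]) (use Gc Gf cov s in auto)
 qed
 have neg: "uminus -` (uminus -` S) = S" "uminus -` S \<in> sets borel"
  using measurable_sets[of uminus borel borel S] S by auto
 have eq: "?\<kappa> * emeasure lborel B = emeasure (sweep u) (uminus -` B)" if "B \<in> sets borel" for B
  using translation_invariant_measure[OF sf s(1) sweep_translate borel_compact[OF Qc] that]
  by (simp add: QN QL)
 have "emeasure lborel (uminus -` S) = emeasure lborel S"
 proof -
  let ?N = "((-1) *\<^sub>R mat 1 :: real^'n^'n)"
  have "?N *v x = - x" for x by (metis scaleR_matrix_vector_assoc matrix_vector_mul_lid scaleR_minus1_left)
  then have "emeasure lborel (uminus -` S) = emeasure (distr lborel borel (\<lambda>x. ?N *v x)) S"
   by (subst emeasure_distr) (auto simp: vimage_def)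
  moreover have "\<bar>det ?N\<bar> = 1"
   by (subst det_diagonal) (auto simp: mat_def abs_prod)
  then have "distr lborel borel (\<lambda>x. ?N *v x) = lborel"
   by (subst distr_lborel_matrix) (auto simp: density_1)
  ultimately show ?thesis by simp
 qed
 then show ?thesis using eq[of "uminus -` S"] neg by simp
qed

text \<open>The form in which hyperplane measure is used later: base times height is a fixed
  constant times the volume of the cylinder, whatever the slope of its axis v. The constant cancels
  when two bases are compared.\<close>

lemma hausdorff_plane:
 assumes v: "v \<bullet> u = 1" and q: "q \<ge> 0" and A[measurable]: "A \<in> sets borel" and AP: "A \<subseteq> {x. x \<bullet> u = 0}"
 shows "ennreal q * hausdorff_outer k A = hausdorff_outer k (cube_face i :: (real^'n) set) *
  emeasure lborel {z. z - (z \<bullet> u) *\<^sub>R v \<in> A \<and> 0 \<le> z \<bullet> u \<and> z \<bullet> u \<le> q}"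
proof -
 let ?S = "{z. z - (z \<bullet> u) *\<^sub>R v \<in> A \<and> 0 \<le> z \<bullet> u \<and> z \<bullet> u \<le> q}"
 have S: "?S \<in> sets borel" by measurable
 show ?thesis
  using emeasure_sweep_cylinder[OF v q A AP] emeasure_sweep_shear[OF v S] emeasure_sweep_eq_lborel[OF S] by simp
qed

end

end

section \<open>Hausdorff measure of linear images of the sphere\<close>

text \<open>In the hyperplane orthogonal to \<open>u\<close> a matrix \<open>A\<close> scales \<open>(d - 1)\<close>-dimensional Hausdorff measure by
 \<open>\<bar>det A\<bar> \<bar>A\<^sup>-\<^sup>T u\<bar>\<close>.  Near a point \<open>u\<close> of the sphere, projecting along \<open>u\<close> onto that hyperplane changes the
 distances of image points under \<open>A\<close> only by a factor close to 1, so the same factor is the area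
 element of \<open>A\<close> on the sphere.\<close>

context
 fixes k :: real
 assumes k_def: "k = real CARD('n::finite) - 1" and d2: "CARD('n) \<ge> 2"
begin

lemma kpos: "k > 0" using d2 by (simp add: k_def)

lemma hausdorff_plane_unit:
 fixes u v :: "real^'n"
 assumes u: "norm u = 1" and v: "v \<bullet> u = 1" and q: "q \<ge> 0" and A: "A \<in> sets borel" and AP: "A \<subseteq> {x. x \<bullet> u = 0}"
 shows "ennreal q * hausdorff_outer k A = hausdorff_outer k (cube_face undefined :: (real^'n) set) *
  emeasure lborel {z. z - (z \<bullet> u) *\<^sub>R v \<in> A \<and> 0 \<le> z \<bullet> u \<and> z \<bullet> u \<le> q}"
proof -
 obtain f :: "real^'n \<Rightarrow> real^'n" where f: "orthogonal_transformation f" "f (axis undefined 1) = u"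
  by (rule orthogonal_transformation_exists[of "axis undefined 1 :: real^'n" u]) (use u in auto)
 show ?thesis by (rule hausdorff_plane[OF k_def d2 f v q A AP])
qed

text \<open>With q = |B^T u|, the vector n = B^T u / q is the unit normal of the image hyperplane,
  and v is chosen so that A v is parallel to n. Then A maps the oblique cylinder over S along v of
  height q onto the right cylinder over A S of height 1. Volumes scale by |det A|, and the ratio q
  of the heights accounts for the rest.\<close>

lemma hausdorff_linear_plane:
 fixes A B :: "real^'n^'n" and u :: "real^'n"
 assumes AB: "A ** B = mat 1" "B ** A = mat 1"
  and u: "norm u = 1" and S: "S \<in> sets borel" and SP: "S \<subseteq> {x. x \<bullet> u = 0}"
 shows "hausdorff_outer k ((\<lambda>x. A *v x) ` S) = ennreal (\<bar>det A\<bar> * norm (transpose B *v u)) * hausdorff_outer k S"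
proof -
 define q where "q = norm (transpose B *v u)"
 have tt: "transpose A *v (transpose B *v u) = u"
  by (simp only: matrix_vector_mul_assoc matrix_transpose_mul[symmetric] AB transpose_mat matrix_vector_mul_lid)
 have adj: "(M *v z) \<bullet> y = z \<bullet> (transpose M *v y)" for M :: "real^'n^'n" and z y
  by (metis dot_lmul_matrix inner_commute transpose_matrix_vector)
 have detAB: "det A * det B = 1" using AB(1) by (simp flip: det_mul)
 then have dA: "det A \<noteq> 0" by auto
 have "transpose B *v u \<noteq> 0" using tt u by auto
 then have q: "q > 0" by (simp add: q_def)
 define n where "n = (transpose B *v u) /\<^sub>R q"
 have n: "norm n = 1" using q by (simp add: n_def q_def)
 have nA: "(A *v z) \<bullet> n = (z \<bullet> u) / q" for z
 proof -
  have "(A *v z) \<bullet> n = ((A *v z) \<bullet> (transpose B *v u)) / q" by (simp add: n_def divide_inverse mult.commute)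
  also have "(A *v z) \<bullet> (transpose B *v u) = z \<bullet> (transpose A *v (transpose B *v u))"
   by (rule adj)
  finally show ?thesis unfolding tt .
 qed
 define v where "v = (B *v n) /\<^sub>R q"
 have v: "v \<bullet> u = 1"
 proof -
  have "(B *v n) \<bullet> u = n \<bullet> (transpose B *v u)"
   by (rule adj)
  also have "\<dots> = q" using n q by (simp add: n_def q_def dot_square_norm power2_eq_square)
  finally show ?thesis using q by (simp add: v_def)
 qed
 have Av: "A *v v = n /\<^sub>R q"
  by (simp add: v_def matrix_vector_mult_scaleR matrix_vector_mul_assoc AB)
 have im: "(\<lambda>x. A *v x) ` S = (\<lambda>x. B *v x) -` S" for S
 proof (intro set_eqI iffI)
  fix y assume "y \<in> (\<lambda>x. B *v x) -` S"
  then show "y \<in> (\<lambda>x. A *v x) ` S"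
   by (intro image_eqI[of _ _ "B *v y"]) (auto simp: matrix_vector_mul_assoc AB)
 qed (auto simp: matrix_vector_mul_assoc AB)
 have AS: "(\<lambda>x. A *v x) ` S \<in> sets borel"
  unfolding im using measurable_sets[OF measurable_matrix_vector_mult S] by simp
 let ?C = "{z. z - (z \<bullet> u) *\<^sub>R v \<in> S \<and> 0 \<le> z \<bullet> u \<and> z \<bullet> u \<le> q}"
 let ?D = "{z. z - (z \<bullet> n) *\<^sub>R n \<in> (\<lambda>x. A *v x) ` S \<and> 0 \<le> z \<bullet> n \<and> z \<bullet> n \<le> 1}"
 let ?\<kappa> = "hausdorff_outer k (cube_face undefined :: (real^'n) set)"
 have Cm[measurable]: "?C \<in> sets borel" using S by measurable
 have Dm[measurable]: "?D \<in> sets borel" using AS by measurable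
 have 1: "1 * hausdorff_outer k ((\<lambda>x. A *v x) ` S) = ?\<kappa> * emeasure lborel ?D"
 proof -
  have "(\<lambda>x. A *v x) ` S \<subseteq> {x. x \<bullet> n = 0}" using nA SP by auto
  moreover have "n \<bullet> n = 1" using n by (simp add: dot_square_norm)
  ultimately show ?thesis using hausdorff_plane_unit[OF n _ zero_le_one AS, of n] by simp
 qed
 have 2: "ennreal q * hausdorff_outer k S = ?\<kappa> * emeasure lborel ?C"
  using q by (intro hausdorff_plane_unit[OF u v _ S SP]) simp
 have CD: "(\<lambda>x. A *v x) -` ?D = ?C"
 proof -
  have "A *v z - ((A *v z) \<bullet> n) *\<^sub>R n = A *v (z - (z \<bullet> u) *\<^sub>R v)" for z
   by (simp add: nA matrix_vector_mult_diff_distrib matrix_vector_mult_scaleR Av divide_inverse)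
  moreover have "A *v x \<in> (\<lambda>x. A *v x) ` S \<longleftrightarrow> x \<in> S" for x
   unfolding im by (simp add: matrix_vector_mul_assoc AB)
  ultimately show ?thesis using q by (auto simp: nA zero_le_divide_iff divide_le_eq)
 qed
 have "emeasure lborel ?C = emeasure (distr lborel borel (\<lambda>x. A *v x)) ?D"
 proof -
  have "emeasure (distr lborel borel (\<lambda>x. A *v x)) ?D = emeasure lborel ((\<lambda>x. A *v x) -` ?D \<inter> space lborel)"
   using Dm by (intro emeasure_distr) auto
  then show ?thesis unfolding CD by simp
 qed
 also have "\<dots> = ennreal (1 / \<bar>det A\<bar>) * emeasure lborel ?D"
  unfolding distr_lborel_matrix[OF dA] by (subst emeasure_density_const) auto
 finally have C: "emeasure lborel ?C = ennreal (1 / \<bar>det A\<bar>) * emeasure lborel ?D" .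
 have D: "emeasure lborel ?D = ennreal \<bar>det A\<bar> * emeasure lborel ?C"
 proof -
  have "ennreal \<bar>det A\<bar> * ennreal (1 / \<bar>det A\<bar>) = 1"
   using dA by (subst ennreal_mult[symmetric]) auto
  then show ?thesis unfolding C mult.assoc[symmetric] by simp
 qed
 have "hausdorff_outer k ((\<lambda>x. A *v x) ` S) = ennreal \<bar>det A\<bar> * (?\<kappa> * emeasure lborel ?C)"
  using 1 unfolding D by (simp add: mult_ac)
 also have "\<dots> = ennreal (\<bar>det A\<bar> * q) * hausdorff_outer k S"
  unfolding 2[symmetric] using q by (simp add: ennreal_mult mult_ac)
 finally show ?thesis by (simp add: q_def)
qed

definition proj_plane :: "real^'n \<Rightarrow> real^'n \<Rightarrow> real^'n" where
 "proj_plane u x = x - (x \<bullet> u) *\<^sub>R u"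

text \<open>The chord x - y of two unit vectors is orthogonal to x + y, hence to the midpoint m.
  Only u - m contributes to the inner product with u, and m is as close to u as the two end points
  are.\<close>

lemma sphere_close_inner:
 fixes x y u :: "real^'n"
 assumes "norm x = 1" "norm y = 1" "norm (x - u) \<le> \<delta>" "norm (y - u) \<le> \<delta>"
 shows "\<bar>(x - y) \<bullet> u\<bar> \<le> \<delta> * norm (x - y)"
proof -
 let ?m = "(1/2) *\<^sub>R (x + y)"
 have m: "norm (u - ?m) \<le> \<delta>"
 proof -
  have "u - ?m = (1/2) *\<^sub>R (u - x) + (1/2) *\<^sub>R (u - y)" by (simp add: algebra_simps flip: scaleR_add_left)
  also have "norm \<dots> \<le> norm ((1/2) *\<^sub>R (u - x)) + norm ((1/2) *\<^sub>R (u - y))" by (rule norm_triangle_ineq)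
  also have "\<dots> \<le> \<delta>" using assms(3,4) by (simp add: norm_minus_commute)
  finally show ?thesis .
 qed
 have "(x - y) \<bullet> (x + y) = 0" using assms(1,2) by (simp add: algebra_simps inner_commute dot_square_norm)
 then have "(x - y) \<bullet> u = (x - y) \<bullet> (u - ?m)" by (simp add: inner_diff_right)
 then have "\<bar>(x - y) \<bullet> u\<bar> \<le> norm (x - y) * norm (u - ?m)" using Cauchy_Schwarz_ineq2[of "x - y" "u - ?m"] by simp
 also have "\<dots> \<le> norm (x - y) * \<delta>" using m by (rule mult_left_mono) simp
 finally show ?thesis by (simp add: mult.commute)
qed

lemma sphere_close_inner_pos:
 fixes x u :: "real^'n"
 assumes "norm x = 1" "norm u = 1" "norm (x - u) < 1"
 shows "x \<bullet> u > 0"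
proof -
 have "x \<bullet> x = 1" "u \<bullet> u = 1" using assms by (simp_all add: dot_square_norm)
 then have "(norm (x - u))^2 = 2 - 2 * (x \<bullet> u)"
  by (simp add: power2_norm_eq_inner inner_diff_left inner_diff_right inner_commute)
 moreover have "(norm (x - u))^2 < 1" using assms(3) by (simp add: abs_square_less_1)
 ultimately show ?thesis by linarith
qed

text \<open>Images of Borel sets are in general not Borel. On the open hemisphere around u the
  projection has the explicit inverse y -> y + sqrt (1 - |y|^2) u, so its image can be rewritten as
  a preimage under a measurable map.\<close>

lemma proj_plane_borel:
 fixes u :: "real^'n"
 assumes u: "norm u = 1" and A[measurable]: "A \<in> sets borel" and AS: "A \<subseteq> sphere 0 1" and pos: "\<And>x. x \<in> A \<Longrightarrow> x \<bullet> u > 0"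
 shows "proj_plane u ` A \<in> sets borel" "proj_plane u ` A \<subseteq> {x. x \<bullet> u = 0}"
proof -
 have uu: "u \<bullet> u = 1" using u by (simp add: dot_square_norm)
 have n2: "(norm (proj_plane u x))^2 = (norm x)^2 - (x \<bullet> u)\<^sup>2" for x
  unfolding proj_plane_def power2_norm_eq_inner using uu by (simp add: algebra_simps inner_commute power2_eq_square)
 have "proj_plane u ` A = {y. y \<bullet> u = 0 \<and> (norm y)^2 \<le> 1 \<and> y + sqrt (1 - (norm y)\<^sup>2) *\<^sub>R u \<in> A}"
 proof (intro set_eqI iffI)
  fix y assume "y \<in> proj_plane u ` A"
  then obtain x where x: "x \<in> A" "y = proj_plane u x" by auto
  have nx: "norm x = 1" using AS x by auto
  have "1 - (norm y)\<^sup>2 = (x \<bullet> u)^2" using nx x n2 by simp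
  moreover then have "sqrt (1 - (norm y)\<^sup>2) = x \<bullet> u" using pos[OF x(1)] by simp
  ultimately show "y \<in> {y. y \<bullet> u = 0 \<and> (norm y)^2 \<le> 1 \<and> y + sqrt (1 - (norm y)\<^sup>2) *\<^sub>R u \<in> A}"
   using x uu by (auto simp: proj_plane_def inner_diff_left) (smt (verit) zero_le_power2)
 next
  fix y assume y: "y \<in> {y. y \<bullet> u = 0 \<and> (norm y)^2 \<le> 1 \<and> y + sqrt (1 - (norm y)\<^sup>2) *\<^sub>R u \<in> A}"
  then have "proj_plane u (y + sqrt (1 - (norm y)\<^sup>2) *\<^sub>R u) = y"
   using uu by (simp add: proj_plane_def inner_add_left)
  then show "y \<in> proj_plane u ` A" using y by (metis (no_types, lifting) image_eqI mem_Collect_eq)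
 qed
 moreover have "{y. y \<bullet> u = 0 \<and> (norm y)^2 \<le> 1 \<and> y + sqrt (1 - (norm y)\<^sup>2) *\<^sub>R u \<in> A} \<in> sets borel"
  by measurable
 ultimately show "proj_plane u ` A \<in> sets borel" by simp
 show "proj_plane u ` A \<subseteq> {x. x \<bullet> u = 0}" using uu by (auto simp: proj_plane_def inner_diff_left)
qed

text \<open>Projecting a chord x - y along u removes ((x - y) . u) u, whose image under A has length
  at most \<delta> a |x - y|, hence at most c \<delta> |A (x - y)| because |x - y| is at most b |A
  (x - y)|. So, seen in the image under A, the projection is bi-Lipschitz with constants 1 + c
  \<delta> and 1 / (1 - c \<delta>), and the projected set is flat, where the factor of
  \<open>hausdorff_linear_plane\<close> is exact.\<close>

lemma hausdorff_local_comparison: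
 fixes A B :: "real^'n^'n" and u :: "real^'n"
 assumes AB: "A ** B = mat 1" "B ** A = mat 1"
  and cA: "\<And>x. norm (A *v x) \<le> a * norm x" and cB: "\<And>x. norm (B *v x) \<le> b * norm x"
  and c: "c = a * b" and ab: "a > 0" "b > 0"
  and u: "norm u = 1" and \<delta>: "\<delta> > 0" "\<delta> < 1" "c * \<delta> < 1"
  and S: "S \<in> sets borel" "S \<subseteq> sphere 0 1" "S \<subseteq> cball u \<delta>"
 shows "hausdorff_outer k ((\<lambda>x. A *v x) ` S) \<le> ennreal ((1 / (1 - c * \<delta>)) powr k) *
      (ennreal (\<bar>det A\<bar> * norm (transpose B *v u)) * hausdorff_outer k (proj_plane u ` S))"
  and "ennreal (\<bar>det A\<bar> * norm (transpose B *v u)) * hausdorff_outer k (proj_plane u ` S) \<le>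
      ennreal ((1 + c * \<delta>) powr k) * hausdorff_outer k ((\<lambda>x. A *v x) ` S)"
proof -
 let ?P = "proj_plane u"
 have uu: "u \<bullet> u = 1" using u by (simp add: dot_square_norm)
 have nS: "norm x = 1" "norm (x - u) \<le> \<delta>" if "x \<in> S" for x
  using S that by (auto simp: dist_norm norm_minus_commute)
 have pos: "x \<bullet> u > 0" if "x \<in> S" for x
  by (rule sphere_close_inner_pos) (use nS[OF that] u \<delta> in auto)
 note Pb = proj_plane_borel[OF u S(1,2) pos]
 have lin: "hausdorff_outer k ((\<lambda>x. A *v x) ` (?P ` S)) = ennreal (\<bar>det A\<bar> * norm (transpose B *v u)) * hausdorff_outer k (?P ` S)"
  by (rule hausdorff_linear_plane[OF AB u Pb])
 have key: "norm (A *v (x - y) - A *v (?P x - ?P y)) \<le> c * \<delta> * norm (A *v (x - y))" if "x \<in> S" "y \<in> S" for x y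
 proof -
  have "(x - y) - (?P x - ?P y) = ((x - y) \<bullet> u) *\<^sub>R u" by (simp add: proj_plane_def algebra_simps)
  then have "A *v (x - y) - A *v (?P x - ?P y) = ((x - y) \<bullet> u) *\<^sub>R (A *v u)"
   by (metis matrix_vector_mult_diff_distrib matrix_vector_mult_scaleR)
  then have "norm (A *v (x - y) - A *v (?P x - ?P y)) = \<bar>(x - y) \<bullet> u\<bar> * norm (A *v u)" by simp
  also have "\<dots> \<le> (\<delta> * norm (x - y)) * a"
   using sphere_close_inner[of x y u \<delta>] nS that cA[of u] u ab \<delta> by (intro mult_mono) auto
  also have "norm (x - y) \<le> b * norm (A *v (x - y))"
   using cB[of "A *v (x - y)"] by (simp add: matrix_vector_mul_assoc AB)
  then have "(\<delta> * norm (x - y)) * a \<le> (\<delta> * (b * norm (A *v (x - y)))) * a"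
   using \<delta> ab by (intro mult_right_mono mult_left_mono) auto
  finally show ?thesis by (simp add: c mult_ac)
 qed
 have c0: "c > 0" using c ab by simp
 have up: "dist (A *v ?P x) (A *v ?P y) \<le> (1 + c * \<delta>) * dist (A *v x) (A *v y)"
  and lo: "dist (A *v x) (A *v y) \<le> 1 / (1 - c * \<delta>) * dist (A *v ?P x) (A *v ?P y)" if "x \<in> S" "y \<in> S" for x y
 proof -
  have *: "dist (A *v x) (A *v y) = norm (A *v (x - y))" "dist (A *v ?P x) (A *v ?P y) = norm (A *v (?P x - ?P y))"
   by (simp_all add: dist_norm matrix_vector_mult_diff_distrib)
  have t: "\<bar>norm (A *v (x - y)) - norm (A *v (?P x - ?P y))\<bar> \<le> c * \<delta> * norm (A *v (x - y))"
   by (rule order_trans[OF norm_triangle_ineq3 key[OF that]])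
  show "dist (A *v ?P x) (A *v ?P y) \<le> (1 + c * \<delta>) * dist (A *v x) (A *v y)"
   unfolding * using t by (simp add: algebra_simps abs_le_iff)
  have "(1 - c * \<delta>) * norm (A *v (x - y)) \<le> norm (A *v (?P x - ?P y))"
   using t by (simp add: algebra_simps abs_le_iff)
  then show "dist (A *v x) (A *v y) \<le> 1 / (1 - c * \<delta>) * dist (A *v ?P x) (A *v ?P y)"
   unfolding * using \<delta> by (simp add: field_simps)
 qed
 have Bx: "B *v (A *v x) = x" for x by (simp add: matrix_vector_mul_assoc AB)
 have inj: "x = y" if "x \<in> S" "y \<in> S" "?P x = ?P y" for x y
 proof -
  have "A *v x = A *v y" using lo[OF that(1,2)] that(3) by simp
  then show ?thesis by (metis Bx)
 qed
 \<comment> \<open>\<open>g\<close>, and later \<open>h\<close>, are the projection and its inverse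
   transported to the images under A; these are the maps whose Lipschitz constants were
   estimated.\<close>
 define g where "g = (\<lambda>y. A *v ?P (B *v y))"
 have g: "g ` ((\<lambda>x. A *v x) ` S) = (\<lambda>x. A *v x) ` (?P ` S)" by (auto simp: g_def image_image Bx)
 have "hausdorff_outer k (g ` ((\<lambda>x. A *v x) ` S)) \<le> ennreal ((1 + c * \<delta>) powr k) * hausdorff_outer k ((\<lambda>x. A *v x) ` S)"
  by (rule hausdorff_outer_lipschitz_image) (use kpos c0 \<delta> up in \<open>auto simp: g_def Bx add_pos_pos\<close>)
 then show "ennreal (\<bar>det A\<bar> * norm (transpose B *v u)) * hausdorff_outer k (?P ` S) \<le>
      ennreal ((1 + c * \<delta>) powr k) * hausdorff_outer k ((\<lambda>x. A *v x) ` S)"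
  unfolding g lin .
 define h where "h = (\<lambda>y. A *v (inv_into S ?P (B *v y)))"
 have invP: "inv_into S ?P (?P x) = x" if "x \<in> S" for x
  using that inj by (intro inv_into_f_f inj_onI) auto
 have h: "h ` ((\<lambda>x. A *v x) ` (?P ` S)) = (\<lambda>x. A *v x) ` S"
  by (auto simp: h_def image_image Bx invP)
 have "hausdorff_outer k (h ` ((\<lambda>x. A *v x) ` (?P ` S))) \<le> ennreal ((1 / (1 - c * \<delta>)) powr k) * hausdorff_outer k ((\<lambda>x. A *v x) ` (?P ` S))"
  by (rule hausdorff_outer_lipschitz_image) (use kpos \<delta> lo in \<open>auto simp: h_def Bx invP\<close>)
 then show "hausdorff_outer k ((\<lambda>x. A *v x) ` S) \<le> ennreal ((1 / (1 - c * \<delta>)) powr k) *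
      (ennreal (\<bar>det A\<bar> * norm (transpose B *v u)) * hausdorff_outer k (?P ` S))"
  unfolding h lin .
qed

lemma ennreal_le_of_factor_limit:
 fixes X Y :: ennreal
 assumes "t \<longlonglongrightarrow> 1" and le: "\<And>n. X \<le> ennreal (t n) * Y"
 shows "X \<le> Y"
proof (cases Y)
 case (real y)
 have "(\<lambda>n. ennreal (t n * y)) \<longlonglongrightarrow> ennreal (1 * y)"
  by (intro tendsto_ennrealI tendsto_intros assms)
 moreover have "X \<le> ennreal (t n * y)" for n
  using le[of n] real by (simp add: ennreal_mult'')
 ultimately show ?thesis using real by (intro LIMSEQ_le_const) auto
qed simp

lemma sphere_finite_cover:
 assumes "\<delta> > 0"
 shows "\<exists>F. finite F \<and> F \<subseteq> sphere (0::real^'n) 1 \<and> sphere 0 1 \<subseteq> (\<Union>u\<in>F. ball u \<delta>)"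
 by (rule compactE_image[OF compact_sphere[of "0::real^'n" 1], of "sphere 0 1" "\<lambda>u. ball u \<delta>"])
   (use assms in auto)

text \<open>On a small cap the local comparison is applied twice, to A and to the identity;
  eliminating the projected set relates the measure of the image to that of the cap itself. On the
  cap the factor J is nearly constant. Summing over disjoint small pieces keeps the same
  multiplicative error, called \<theta>, which tends to 1 with the size of the caps.\<close>

theorem hausdorff_measure_linear_sphere:
 fixes A B :: "real^'n^'n"
 assumes AB: "A ** B = mat 1" "B ** A = mat 1"
  and S[measurable]: "S \<in> sets borel" and SS: "S \<subseteq> sphere 0 1"
 shows "hausdorff_outer k ((\<lambda>x. A *v x) ` S) =
  (\<integral>\<^sup>+x. ennreal (\<bar>det A\<bar> * norm (transpose B *v x)) * indicator S x \<partial>hausdorff_measure k)"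
proof -
 have bl: "\<exists>c\<ge>1. \<forall>x. norm (M *v x) \<le> c * norm x \<and> norm (transpose M *v x) \<le> c * norm x" for M :: "real^'n^'n"
 proof -
  have "\<exists>c>0. \<forall>x. norm (N *v x) \<le> c * norm x" for N :: "real^'n^'n"
   by (rule linear_bounded_pos[OF matrix_vector_mul_linear[of N]]) auto
  then obtain p q where pq: "p > 0" "\<And>x. norm (M *v x) \<le> p * norm x" "q > 0" "\<And>x. norm (transpose M *v x) \<le> q * norm x" by metis
  have le: "p * norm x \<le> (1 + p + q) * norm x" "q * norm x \<le> (1 + p + q) * norm x" for x :: "real^'n"
   using pq(1,3) by (intro mult_right_mono; simp)+
  have "norm (M *v x) \<le> (1 + p + q) * norm x \<and> norm (transpose M *v x) \<le> (1 + p + q) * norm x" for x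
   by (meson pq(2,4) le order_trans)
  moreover have "1 + p + q \<ge> 1" using pq by simp
  ultimately show ?thesis by blast
 qed
 obtain a where a: "a \<ge> 1" "\<And>x. norm (A *v x) \<le> a * norm x" "\<And>x. norm (transpose A *v x) \<le> a * norm x" using bl[of A] by blast
 obtain b where b: "b \<ge> 1" "\<And>x. norm (B *v x) \<le> b * norm x" "\<And>x. norm (transpose B *v x) \<le> b * norm x" using bl[of B] by blast
 define c where "c = a * b"
 have "1 * 1 \<le> a * b" using a(1) b(1) by (intro mult_mono) auto
 then have c1: "c \<ge> 1" by (simp add: c_def)
 define J where "J x = \<bar>det A\<bar> * norm (transpose B *v x)" for x
 have J0: "J x \<ge> 0" for x by (simp add: J_def)
 have Jm[measurable]: "J \<in> borel_measurable borel" unfolding J_def by measurable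
 have tt: "transpose A *v (transpose B *v x) = x" for x
  by (simp only: matrix_vector_mul_assoc matrix_transpose_mul[symmetric] AB transpose_mat matrix_vector_mul_lid)
 \<comment> \<open>The error B^T (x - y) is additive, of size b \<delta>. It becomes a relative one
   because 1 = |A^T B^T y| is at most a |B^T y|.\<close>
 have Jc: "J x \<le> (1 + c * \<delta>) * J y" if "norm y = 1" "norm (x - y) \<le> \<delta>" for x y \<delta>
 proof -
  have "1 \<le> a * norm (transpose B *v y)" using a(3)[of "transpose B *v y"] that unfolding tt by simp
  moreover have \<delta>: "\<delta> \<ge> 0" using that(2) norm_ge_zero order_trans by blast
  ultimately have "b * \<delta> * 1 \<le> b * \<delta> * (a * norm (transpose B *v y))"
   using b(1) by (intro mult_left_mono) auto
  moreover have "norm (transpose B *v x) \<le> norm (transpose B *v y) + norm (transpose B *v (x - y))"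
   using norm_triangle_ineq[of "transpose B *v y" "transpose B *v (x - y)"] by (simp add: matrix_vector_mult_diff_distrib)
  moreover have "norm (transpose B *v (x - y)) \<le> b * \<delta>"
   using b(3)[of "x - y"] that b(1) by (meson mult_left_mono order_trans zero_le_one)
  ultimately have "norm (transpose B *v x) \<le> (1 + c * \<delta>) * norm (transpose B *v y)"
   by (simp add: c_def algebra_simps)
  then have "\<bar>det A\<bar> * norm (transpose B *v x) \<le> \<bar>det A\<bar> * ((1 + c * \<delta>) * norm (transpose B *v y))"
   by (rule mult_left_mono) simp
  then show ?thesis by (simp add: J_def mult_ac)
 qed
 let ?H = "hausdorff_outer k :: (real^'n) set \<Rightarrow> ennreal"
 let ?A = "\<lambda>S. (\<lambda>x. A *v x) ` S"
 define R where "R S = (\<integral>\<^sup>+x. ennreal (J x) * indicator S x \<partial>hausdorff_measure k)" for S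
 define \<theta> where "\<theta> \<delta> = (1 + c * \<delta>) * ((1 / (1 - c * \<delta>)) powr k * (1 + c * \<delta>) powr k)" for \<delta>
 have Rc: "(\<integral>\<^sup>+x. ennreal z * indicator S' x \<partial>hausdorff_measure k) = ennreal z * ?H S'" if "S' \<in> sets borel" for z S'
  using that by (simp add: nn_integral_cmult_indicator emeasure_hausdorff_measure)
 have loc: "?H (?A S') \<le> ennreal (\<theta> \<delta>) * R S' \<and> R S' \<le> ennreal (\<theta> \<delta>) * ?H (?A S')"
  if \<delta>: "\<delta> > 0" "c * \<delta> < 1" and S': "S' \<in> sets borel" "S' \<subseteq> sphere 0 1" "S' \<subseteq> cball u \<delta>" and u: "norm u = 1" for \<delta> S' u
 proof -
  let ?p = "(1 / (1 - c * \<delta>)) powr k" and ?q = "(1 + c * \<delta>) powr k"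
  let ?P = "?H (proj_plane u ` S')"
  have \<delta>1: "\<delta> < 1" proof -
   have "1 * \<delta> \<le> c * \<delta>" using c1 \<delta> by (intro mult_right_mono) auto
   then show ?thesis using \<delta> by linarith
  qed
  have c0: "1 + c * \<delta> \<ge> 0" using c1 \<delta> by simp
  note l1 = hausdorff_local_comparison[OF AB a(2) b(2) c_def _ _ u \<delta>(1) \<delta>1 \<delta>(2) S', folded J_def]
  have l1: "?H (?A S') \<le> ennreal ?p * (ennreal (J u) * ?P)" "ennreal (J u) * ?P \<le> ennreal ?q * ?H (?A S')"
   using l1 a(1) b(1) by auto
  \<comment> \<open>The norm bound for the identity is weakened from 1 to c so that its comparison
    constants coincide with those for A.\<close>
  have id: "norm (mat 1 *v x :: real^'n) \<le> c * norm x" "norm (mat 1 *v x :: real^'n) \<le> 1 * norm x" for x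
   using c1 mult_right_mono[of 1 c "norm x"] by auto
  have l2: "?H S' \<le> ennreal ?p * ?P" "?P \<le> ennreal ?q * ?H S'"
   using hausdorff_local_comparison[of "mat 1" "mat 1" c 1 c u \<delta> S', OF _ _ id _ _ _ u \<delta>(1) \<delta>1 \<delta>(2) S'] c1 u
   by (auto simp: transpose_mat)
  have m1: "J u \<le> (1 + c * \<delta>) * J x" "J x \<le> (1 + c * \<delta>) * J u" if "x \<in> S'" for x
  proof -
   have "norm x = 1" "norm (u - x) \<le> \<delta>" "norm (x - u) \<le> \<delta>"
    using S'(2,3) that by (auto simp: dist_norm norm_minus_commute)
   then show "J u \<le> (1 + c * \<delta>) * J x" "J x \<le> (1 + c * \<delta>) * J u" using Jc u by blast+
  qed
  have r1: "ennreal (J u) * ?H S' \<le> ennreal (1 + c * \<delta>) * R S'"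
   unfolding Rc[OF S'(1), symmetric] R_def using c0 J0 S'(1) m1(1)
   by (subst nn_integral_cmult[symmetric])
     (auto intro!: nn_integral_mono simp: indicator_def ennreal_mult[symmetric] intro: ennreal_leI)
  have r2: "R S' \<le> ennreal (1 + c * \<delta>) * (ennreal (J u) * ?H S')"
  proof -
   have "R S' \<le> (\<integral>\<^sup>+x. ennreal ((1 + c * \<delta>) * J u) * indicator S' x \<partial>hausdorff_measure k)"
    unfolding R_def by (intro nn_integral_mono) (auto simp: indicator_def intro!: ennreal_leI m1)
   also have "\<dots> = ennreal ((1 + c * \<delta>) * J u) * ?H S'" by (rule Rc[OF S'(1)])
   finally show ?thesis using c0 J0 by (simp add: ennreal_mult mult.assoc)
  qed
  have th: "ennreal (\<theta> \<delta>) = ennreal (1 + c * \<delta>) * (ennreal ?p * ennreal ?q)"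
   unfolding \<theta>_def using c0 by (simp add: ennreal_mult)
  have "?H (?A S') \<le> ennreal ?p * (ennreal (J u) * (ennreal ?q * ?H S'))"
   by (rule order_trans[OF l1(1)]) (intro mult_left_mono l2(2); simp)
  also have "\<dots> = ennreal ?p * (ennreal ?q * (ennreal (J u) * ?H S'))" by (simp add: mult_ac)
  also have "\<dots> \<le> ennreal ?p * (ennreal ?q * (ennreal (1 + c * \<delta>) * R S'))" by (intro mult_left_mono r1) auto
  finally have 1: "?H (?A S') \<le> ennreal (\<theta> \<delta>) * R S'" unfolding th by (simp add: mult_ac)
  have "R S' \<le> ennreal (1 + c * \<delta>) * (ennreal (J u) * (ennreal ?p * ?P))"
   by (rule order_trans[OF r2]) (intro mult_left_mono l2(1); simp)
  also have "\<dots> = ennreal (1 + c * \<delta>) * (ennreal ?p * (ennreal (J u) * ?P))" by (simp add: mult_ac)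
  also have "\<dots> \<le> ennreal (1 + c * \<delta>) * (ennreal ?p * (ennreal ?q * ?H (?A S')))" by (intro mult_left_mono l1(2)) auto
  finally have 2: "R S' \<le> ennreal (\<theta> \<delta>) * ?H (?A S')" unfolding th by (simp add: mult_ac)
  from 1 2 show ?thesis by blast
 qed
 have im: "?A T = (\<lambda>x. B *v x) -` T" for T
 proof (intro set_eqI iffI)
  fix y assume "y \<in> (\<lambda>x. B *v x) -` T"
  then show "y \<in> ?A T"
   by (intro image_eqI[of _ _ "B *v y"]) (auto simp: matrix_vector_mul_assoc AB)
 qed (auto simp: matrix_vector_mul_assoc AB)
 have imb: "?A T \<in> sets borel" if "T \<in> sets borel" for T
  unfolding im using measurable_sets[OF measurable_matrix_vector_mult that] by simp
 have glob: "?H (?A S) \<le> ennreal (\<theta> \<delta>) * R S \<and> R S \<le> ennreal (\<theta> \<delta>) * ?H (?A S)"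
  if \<delta>: "\<delta> > 0" "c * \<delta> < 1" for \<delta>
 proof -
  obtain F where F: "finite F" "F \<subseteq> sphere (0::real^'n) 1" "sphere 0 1 \<subseteq> (\<Union>u\<in>F. ball u \<delta>)"
   using sphere_finite_cover[OF \<delta>(1)] by blast
  have "axis undefined 1 \<in> sphere (0::real^'n) 1" by simp
  then have "F \<noteq> {}" using F(3) by auto
  then have rF: "range (from_nat_into F) = F" using F(1) by (simp add: range_from_nat_into uncountable_infinite countable_finite)
  \<comment> \<open>The enumeration of the finite set F repeats elements; \<open>disjointed\<close>
    makes the pieces of repeated balls empty.\<close>
  define U where "U i = from_nat_into F i" for i
  have U: "norm (U i) = 1" for i using rF F(2) unfolding U_def by (metis mem_sphere_0 rangeI subsetD)
  define T where "T i = S \<inter> disjointed (\<lambda>i. cball (U i) \<delta>) i" for i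
  have db: "disjointed (\<lambda>i. cball (U i) \<delta>) i \<in> sets borel" for i
   using sets.range_disjointed_sets[of "\<lambda>i. cball (U i) \<delta>" borel] by (auto simp: image_subset_iff)
  have Tb: "T i \<in> sets borel" for i unfolding T_def using db by simp
  have Td: "disjoint_family T"
   using disjoint_family_disjointed[of "\<lambda>i. cball (U i) \<delta>"] unfolding T_def disjoint_family_on_def by blast
  have TS: "(\<Union>i. T i) = S"
  proof -
   have "S \<subseteq> (\<Union>i. cball (U i) \<delta>)"
   proof
    fix x assume "x \<in> S"
    then obtain u where u: "u \<in> F" "x \<in> ball u \<delta>" using SS F(3) by blast
    then obtain i where "U i = u" using rF unfolding U_def by (metis imageE)
    then show "x \<in> (\<Union>i. cball (U i) \<delta>)" using u by (auto intro!: exI[of _ i])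
   qed
   then show ?thesis unfolding T_def UN_disjointed_eq[symmetric, of "\<lambda>i. cball (U i) \<delta>"] by blast
  qed
  have Tl: "?H (?A (T i)) \<le> ennreal (\<theta> \<delta>) * R (T i) \<and> R (T i) \<le> ennreal (\<theta> \<delta>) * ?H (?A (T i))" for i
   by (rule loc[OF \<delta> Tb _ _ U]) (use SS disjointed_subset[of "\<lambda>i. cball (U i) \<delta>" i] in \<open>auto simp: T_def\<close>)
  have s1: "(\<Sum>i. ?H (?A (T i))) = ?H (?A S)"
  proof -
   have "disjoint_family (\<lambda>i. ?A (T i))"
    using Td unfolding im disjoint_family_on_def by (auto simp: set_eq_iff)
   then have "(\<Sum>i. emeasure (hausdorff_measure k) (?A (T i))) = emeasure (hausdorff_measure k) (\<Union>i. ?A (T i))"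
    using imb[OF Tb] by (intro suminf_emeasure) auto
   also have "(\<Union>i. ?A (T i)) = ?A S" using TS by auto
   finally show ?thesis using imb[OF Tb] imb[OF S] by (simp add: emeasure_hausdorff_measure)
  qed
  have s2: "(\<Sum>i. R (T i)) = R S"
  proof -
   let ?D = "density (hausdorff_measure k) (\<lambda>x. ennreal (J x))"
   have RD: "R T' = emeasure ?D T'" if "T' \<in> sets borel" for T'
    unfolding R_def using that by (subst emeasure_density) auto
   have "(\<Sum>i. emeasure ?D (T i)) = emeasure ?D (\<Union>i. T i)"
    using Tb Td by (intro suminf_emeasure) auto
   then show ?thesis using TS Tb S by (simp add: RD)
  qed
  have "?H (?A S) \<le> (\<Sum>i. ennreal (\<theta> \<delta>) * R (T i))" unfolding s1[symmetric] using Tl by (intro suminf_le) auto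
  then have 1: "?H (?A S) \<le> ennreal (\<theta> \<delta>) * R S" unfolding ennreal_suminf_cmult s2 .
  have "R S \<le> (\<Sum>i. ennreal (\<theta> \<delta>) * ?H (?A (T i)))" unfolding s2[symmetric] using Tl by (intro suminf_le) auto
  then have 2: "R S \<le> ennreal (\<theta> \<delta>) * ?H (?A S)" unfolding ennreal_suminf_cmult s1 .
  from 1 2 show ?thesis by blast
 qed
 define t where "t n = 1 / (c * (real n + 2))" for n :: nat
 have t: "t n > 0" "c * t n < 1" for n using c1 by (auto simp: t_def)
 have "(\<lambda>n. c * t n) \<longlonglongrightarrow> 0"
 proof -
  have "c * t n = 1 / (real n + 2)" for n using c1 by (simp add: t_def)
  moreover have "(\<lambda>n. 1 / (real n + 2)) \<longlonglongrightarrow> 0" by real_asymp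
  ultimately show ?thesis by simp
 qed
 then have "(\<lambda>n. \<theta> (t n)) \<longlonglongrightarrow> (1 + 0) * ((1 / (1 - 0)) powr k * (1 + 0) powr k)"
  unfolding \<theta>_def by (intro tendsto_intros) auto
 then have lim: "(\<lambda>n. \<theta> (t n)) \<longlonglongrightarrow> 1" by simp
 have "?H (?A S) = R S"
 proof (rule antisym)
  show "?H (?A S) \<le> R S" by (rule ennreal_le_of_factor_limit[OF lim]) (use glob[OF t] in blast)
  show "R S \<le> ?H (?A S)" by (rule ennreal_le_of_factor_limit[OF lim]) (use glob[OF t] in blast)
 qed
 then show ?thesis by (simp add: R_def J_def)
qed

text \<open>By the local comparison with the identity matrix, a cap of radius 1/2 is bounded by its
  projection, whose measure is a constant times the volume of a cylinder contained in the ball of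
  radius 3. Finitely many such caps suffice.\<close>

lemma hausdorff_sphere_finite: "hausdorff_outer k (sphere 0 1 :: (real^'n) set) < \<infinity>"
proof -
 let ?H = "hausdorff_outer k :: (real^'n) set \<Rightarrow> ennreal"
 let ?\<kappa> = "hausdorff_outer k (cube_face undefined :: (real^'n) set)"
 have loc: "?H (sphere 0 1 \<inter> cball u (1/2)) < \<infinity>" if u: "norm u = 1" for u
 proof -
  let ?S = "sphere 0 1 \<inter> cball u (1/2)"
  have S: "?S \<in> sets borel" by auto
  have uu: "u \<bullet> u = 1" using u by (simp add: dot_square_norm)
  have pos: "x \<bullet> u > 0" if "x \<in> ?S" for x
   by (rule sphere_close_inner_pos) (use that u in \<open>auto simp: dist_norm norm_minus_commute\<close>)
  let ?C = "{z. z - (z \<bullet> u) *\<^sub>R u \<in> proj_plane u ` ?S \<and> 0 \<le> z \<bullet> u \<and> z \<bullet> u \<le> 1}"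
  note P = proj_plane_borel[OF u S _ pos]
  have "?H ?S \<le> ennreal ((1 / (1 - 1 * (1/2))) powr k) * (ennreal (\<bar>det (mat 1 :: real^'n^'n)\<bar> * norm (transpose (mat 1) *v u)) * ?H (proj_plane u ` ?S))"
   using hausdorff_local_comparison(1)[of "mat 1" "mat 1" 1 1 1 u "1/2" ?S] u S by simp
  also have "\<dots> < \<infinity>"
  proof -
   have "1 * ?H (proj_plane u ` ?S) = ?\<kappa> * emeasure lborel ?C"
    using hausdorff_plane_unit[OF u uu, of 1, OF _ P] by auto
   also have "emeasure lborel ?C \<le> emeasure lborel (cball (0::real^'n) 3)"
   proof (rule emeasure_mono, rule subsetI)
    fix z assume z: "z \<in> ?C"
    then obtain x where x: "norm x = 1" "z - (z \<bullet> u) *\<^sub>R u = x - (x \<bullet> u) *\<^sub>R u" by (auto simp: proj_plane_def)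
    have "\<bar>x \<bullet> u\<bar> \<le> 1" using Cauchy_Schwarz_ineq2[of x u] x u by simp
    moreover have "z = x + (z \<bullet> u - x \<bullet> u) *\<^sub>R u" using x(2) by (simp add: algebra_simps)
    then have "norm z \<le> norm x + \<bar>z \<bullet> u - x \<bullet> u\<bar> * norm u" by (metis norm_scaleR norm_triangle_ineq)
    ultimately show "z \<in> cball 0 3" using z x u by auto
   qed simp
   then have "?\<kappa> * emeasure lborel ?C \<le> ?\<kappa> * emeasure lborel (cball (0::real^'n) 3)"
    by (rule mult_left_mono) simp
   also have "\<dots> < \<infinity>"
    using hausdorff_cube_face_finite[OF k_def d2] emeasure_lborel_cball_finite[of "0::real^'n" 3] by (auto simp: ennreal_mult_less_top)
   finally have "?H (proj_plane u ` ?S) < top" by simp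
   then show ?thesis unfolding infinity_ennreal_def
    by (intro ennreal_mult_less_top[THEN iffD2] disjI2 conjI) auto
  qed
  finally show ?thesis .
 qed
 obtain F where F: "finite F" "F \<subseteq> sphere (0::real^'n) 1" "sphere 0 1 \<subseteq> (\<Union>u\<in>F. ball u (1/2))"
  using sphere_finite_cover[of "1/2"] by auto
 have "sphere 0 1 = (\<Union>u\<in>F. sphere 0 1 \<inter> cball u (1/2))" using F(3) by force
 then have "emeasure (hausdorff_measure k) (sphere (0::real^'n) 1) = emeasure (hausdorff_measure k) (\<Union>u\<in>F. sphere (0::real^'n) 1 \<inter> cball u (1/2))" by simp
 also have "\<dots> \<le> (\<Sum>u\<in>F. emeasure (hausdorff_measure k) (sphere 0 1 \<inter> cball u (1/2)))"
  by (intro emeasure_subadditive_finite F(1)) auto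
 also have "\<dots> < \<infinity>" using loc F by (auto simp: emeasure_hausdorff_measure)
 finally show ?thesis by (simp add: emeasure_hausdorff_measure)
qed

text \<open>Points of the cube face have norm at most d, so after dividing by d they are projections
  of points of the unit sphere. The projection followed by scaling with d is Lipschitz and sends the
  sphere onto a set containing the face, which has positive measure.\<close>

lemma hausdorff_sphere_pos: "hausdorff_outer k (sphere 0 1 :: (real^'n) set) > 0"
proof -
 let ?d = "real CARD('n)" and ?F = "cube_face undefined :: (real^'n) set" and ?S = "sphere 0 1 :: (real^'n) set"
 define e :: "real^'n" where "e = axis undefined 1"
 have e: "e \<bullet> e = 1" "y \<bullet> e = y $ undefined" for y by (simp_all add: e_def inner_axis)
 define g where "g x = ?d *\<^sub>R (x - (x $ undefined) *\<^sub>R e)" for x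
 have lip: "dist (g x) (g y) \<le> ?d * dist x y" for x y
 proof -
  have "g x - g y = ?d *\<^sub>R ((x - y) - ((x - y) $ undefined) *\<^sub>R e)" by (simp add: g_def algebra_simps)
  moreover have "norm ((x - y) - ((x - y) $ undefined) *\<^sub>R e) \<le> norm (x - y)"
   by (rule norm_le_componentwise_cart) (simp add: e_def axis_def)
  ultimately show ?thesis by (simp add: dist_norm mult_left_mono)
 qed
 have "?F \<subseteq> g ` ?S"
 proof
  fix z assume z: "z \<in> ?F"
  define y where "y = z /\<^sub>R ?d"
  have z0: "z $ undefined = 0" and zj: "\<bar>z $ j\<bar> \<le> 1" for j using z by (auto simp: cube_face_def)
  have "norm z \<le> (\<Sum>j\<in>UNIV. \<bar>z $ j\<bar>)" by (rule norm_le_l1_cart)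
  also have "\<dots> \<le> ?d" using sum_mono[of UNIV "\<lambda>j. \<bar>z $ j\<bar>" "\<lambda>_. 1"] zj by simp
  finally have "norm y \<le> 1" by (simp add: y_def field_simps)
  then have y1: "(norm y)^2 \<le> 1" by (simp add: abs_square_le_1)
  have y0: "y $ undefined = 0" "y \<bullet> e = 0" by (simp_all add: y_def z0 e)
  define r where "r = sqrt (1 - (norm y)\<^sup>2)"
  have r2: "r^2 = 1 - (norm y)\<^sup>2" using y1 by (simp add: r_def)
  define x where "x = y + r *\<^sub>R e"
  have "(norm x)^2 = (norm y)^2 + r^2"
   unfolding x_def power2_norm_eq_inner using e(1) y0(2) by (simp add: inner_add_left inner_add_right inner_commute power2_eq_square)
  then have "norm x = 1" using r2 by (simp add: power2_eq_1_iff) (smt (verit) norm_ge_zero)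
  moreover have "g x = z" using y0(1) by (simp add: g_def x_def y_def e_def)
  ultimately show "z \<in> g ` ?S" by force
 qed
 then have "hausdorff_outer k ?F \<le> hausdorff_outer k (g ` ?S)" by (rule hausdorff_outer_mono)
 also have "\<dots> \<le> ennreal (?d powr k) * hausdorff_outer k ?S"
  by (rule hausdorff_outer_lipschitz_image) (use lip d2 k_def in auto)
 finally show ?thesis using hausdorff_cube_face_pos[OF k_def d2, of undefined] by (auto simp: zero_less_iff_neq_zero)
qed

end

section \<open>Integration in polar coordinates\<close>

context
 fixes s :: real and w :: "real^'n \<Rightarrow> ennreal"
 assumes s: "s > 0" and w[measurable]: "w \<in> borel_measurable borel"
  and hom: "\<And>c x. c > 0 \<Longrightarrow> w (c *\<^sub>R x) = ennreal (c powr (s - real CARD('n))) * w x"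
  and fin: "(\<integral>\<^sup>+x. w x * indicator (ball 0 1) x \<partial>lborel) < \<infinity>"
begin

lemma nn_integral_polar:
 assumes g[measurable]: "g \<in> borel_measurable (borel \<Otimes>\<^sub>M borel)"
 shows "(\<integral>\<^sup>+x. w x * g (norm x, sgn x) \<partial>lborel) =
  (\<integral>\<^sup>+\<omega>. (\<integral>\<^sup>+r. ennreal (r powr (s - 1)) * indicator {0<..} r * g (r, \<omega>) \<partial>lborel) \<partial>angular_measure s w)"
proof -
 let ?R1 = "density lborel (\<lambda>r::real. ennreal (r powr (s - 1)) * indicator {0<..} r)"
 interpret R2: finite_measure "angular_measure s w" by (rule finite_angular_measure[OF s w hom fin])
 have c0[measurable]: "- {0::real^'n} \<in> sets borel" by auto
 have rm[measurable]: "(\<lambda>r::real. ennreal (r powr (s - 1)) * indicator {0<..} r) \<in> borel_measurable borel" by measurable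
 have "(\<integral>\<^sup>+x. w x * g (norm x, sgn x) \<partial>lborel) = (\<integral>\<^sup>+x. w x * indicator (- {0}) x * g (norm x, sgn x) \<partial>lborel)"
  by (rule nn_integral_cong_AE, rule AE_mp[OF AE_lborel_singleton[of 0]], rule AE_I2) auto
 also have "\<dots> = (\<integral>\<^sup>+x. g (norm x, sgn x) \<partial>density lborel (\<lambda>x. w x * indicator (- {0}) x))"
  by (subst nn_integral_density) auto
 also have "\<dots> = (\<integral>\<^sup>+p. g p \<partial>distr (density lborel (\<lambda>x. w x * indicator (- {0}) x)) (borel \<Otimes>\<^sub>M borel) (\<lambda>x. (norm x, sgn x)))"
  by (subst nn_integral_distr) auto
 also have "\<dots> = (\<integral>\<^sup>+p. g p \<partial>(?R1 \<Otimes>\<^sub>M angular_measure s w))"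
  by (simp only: polar_decomposition_homogeneous[OF s w hom fin])
 also have "\<dots> = (\<integral>\<^sup>+r. (\<integral>\<^sup>+\<omega>. g (r, \<omega>) \<partial>angular_measure s w) \<partial>?R1)"
  by (rule R2.nn_integral_fst[symmetric]) simp
 also have "\<dots> = (\<integral>\<^sup>+r. ennreal (r powr (s - 1)) * indicator {0<..} r * (\<integral>\<^sup>+\<omega>. g (r, \<omega>) \<partial>angular_measure s w) \<partial>lborel)"
  by (subst nn_integral_density) auto
 also have "\<dots> = (\<integral>\<^sup>+r. (\<integral>\<^sup>+\<omega>. ennreal (r powr (s - 1)) * indicator {0<..} r * g (r, \<omega>) \<partial>angular_measure s w) \<partial>lborel)"
  by (intro nn_integral_cong nn_integral_cmult[symmetric]) simp
 also have "\<dots> = (\<integral>\<^sup>+\<omega>. (\<integral>\<^sup>+r. ennreal (r powr (s - 1)) * indicator {0<..} r * g (r, \<omega>) \<partial>lborel) \<partial>angular_measure s w)"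
 proof -
  interpret pair_sigma_finite "lborel :: real measure" "angular_measure s w" ..
  show ?thesis by (rule Fubini'[symmetric]) measurable
 qed
 finally show ?thesis .
qed

lemma nn_integral_polar_radial:
 assumes g[measurable]: "g \<in> borel_measurable borel"
 shows "(\<integral>\<^sup>+x. w x * g (norm x) \<partial>lborel) =
  emeasure (angular_measure s w) UNIV * (\<integral>\<^sup>+r. ennreal (r powr (s - 1)) * indicator {0<..} r * g r \<partial>lborel)"
 using nn_integral_polar[of "\<lambda>p. g (fst p)"] by (simp add: mult.commute)

lemma integral_polar:
 fixes v :: "real^'n \<Rightarrow> real" and g :: "real \<Rightarrow> real^'n \<Rightarrow> real"
 assumes v: "w = (\<lambda>x. ennreal (v x))" "\<And>x. v x \<ge> 0" and vm[measurable]: "v \<in> borel_measurable borel"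
  and g[measurable]: "case_prod g \<in> borel_measurable (borel \<Otimes>\<^sub>M borel)"
  and int: "integrable lborel (\<lambda>x. v x * g (norm x) (sgn x))"
 shows "(\<integral>x. v x * g (norm x) (sgn x) \<partial>lborel) =
  (\<integral>\<omega>. (LINT r:{0<..}|lborel. r powr (s - 1) * g r \<omega>) \<partial>angular_measure s w)"
proof -
 let ?R1 = "density lborel (\<lambda>r::real. ennreal (r powr (s - 1)) * indicator {0<..} r)"
 let ?R1' = "density lborel (\<lambda>r::real. ennreal (r powr (s - 1) * indicator {0<..} r))"
 let ?D = "density lborel (\<lambda>x. w x * indicator (- {0}) x)"
 let ?D' = "density lborel (\<lambda>x. ennreal (v x * indicator (- {0}) x))"
 interpret R2: finite_measure "angular_measure s w" by (rule finite_angular_measure[OF s w hom fin])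
 have c0[measurable]: "- {0::real^'n} \<in> sets borel" by auto
 have rm[measurable]: "(\<lambda>r::real. ennreal (r powr (s - 1)) * indicator {0<..} r) \<in> borel_measurable borel" by measurable
 have R1': "?R1 = ?R1'" by (intro density_cong) (auto split: split_indicator)
 have D': "?D = ?D'" unfolding v by (intro density_cong) (auto split: split_indicator)
 have "sigma_finite_measure ?R1"
  by (subst sigma_finite_measure.sigma_finite_iff_density_finite[OF sigma_finite_lborel]) (auto simp: indicator_def ennreal_mult_eq_top_iff)
 then interpret R1: sigma_finite_measure ?R1 .
 interpret R: pair_sigma_finite ?R1 "angular_measure s w" ..
 have AE0: "AE x in lborel. v x * g (norm x) (sgn x) = (v x * indicator (- {0}) x) *\<^sub>R g (norm x) (sgn x)"
  by (rule AE_mp[OF AE_lborel_singleton[of 0]], rule AE_I2) auto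
 have gm: "(\<lambda>x::real^'n. g (norm x) (sgn x)) \<in> borel_measurable borel"
  using measurable_compose[of "\<lambda>x::real^'n. (norm x, sgn x)" borel "borel \<Otimes>\<^sub>M borel" "case_prod g" borel] by simp
 have i1: "integrable lborel (\<lambda>x. (v x * indicator (- {0}) x) *\<^sub>R g (norm x) (sgn x))"
  by (rule integrable_cong_AE[THEN iffD1, OF _ _ AE0 int]) (use gm in measurable)
 have i2: "integrable ?D (\<lambda>x. g (norm x) (sgn x))"
  unfolding D' by (subst integrable_density) (use i1 gm v in auto)
 have i3: "integrable (?R1 \<Otimes>\<^sub>M angular_measure s w) (case_prod g)"
 proof -
  have "integrable (distr ?D (borel \<Otimes>\<^sub>M borel) (\<lambda>x. (norm x, sgn x))) (case_prod g)"
   by (subst integrable_distr_eq) (use i2 in auto)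
  then show ?thesis by (simp only: polar_decomposition_homogeneous[OF s w hom fin])
 qed
 have "(\<integral>x. v x * g (norm x) (sgn x) \<partial>lborel) = (\<integral>x. (v x * indicator (- {0}) x) *\<^sub>R g (norm x) (sgn x) \<partial>lborel)"
  by (rule integral_cong_AE[OF _ _ AE0]) (use gm in measurable)
 also have "\<dots> = (\<integral>x. g (norm x) (sgn x) \<partial>?D)"
  unfolding D' by (subst integral_density) (use gm v in auto)
 also have "\<dots> = (\<integral>p. case_prod g p \<partial>distr ?D (borel \<Otimes>\<^sub>M borel) (\<lambda>x. (norm x, sgn x)))"
  by (subst integral_distr) auto
 also have "\<dots> = (\<integral>p. case_prod g p \<partial>(?R1 \<Otimes>\<^sub>M angular_measure s w))"
  by (simp only: polar_decomposition_homogeneous[OF s w hom fin])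
 also have "\<dots> = (\<integral>\<omega>. (\<integral>r. g r \<omega> \<partial>?R1) \<partial>angular_measure s w)"
  by (rule R.integral_snd[OF i3, symmetric])
 also have "\<dots> = (\<integral>\<omega>. (LINT r:{0<..}|lborel. r powr (s - 1) * g r \<omega>) \<partial>angular_measure s w)"
 proof (rule Bochner_Integration.integral_cong[OF refl])
  fix \<omega> :: "real^'n"
  have [measurable]: "(\<lambda>r. g r \<omega>) \<in> borel_measurable borel"
   using measurable_compose[of "\<lambda>r. (r, \<omega>)" borel "borel \<Otimes>\<^sub>M borel" "case_prod g" borel] by simp
  have "(\<integral>r. g r \<omega> \<partial>?R1) = (\<integral>r. (r powr (s - 1) * indicator {0<..} r) *\<^sub>R g r \<omega> \<partial>lborel)"
   unfolding R1' by (subst integral_density) auto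
  also have "\<dots> = (LINT r:{0<..}|lborel. r powr (s - 1) * g r \<omega>)"
   unfolding set_lebesgue_integral_def by (intro Bochner_Integration.integral_cong) (auto split: split_indicator)
  finally show "(\<integral>r. g r \<omega> \<partial>?R1) = (LINT r:{0<..}|lborel. r powr (s - 1) * g r \<omega>)" .
 qed
 finally show ?thesis .
qed

end

text \<open>The area of the unit sphere, arising here as the total mass of the angular measure of
  the weight 1.\<close>

definition surface_const :: "'n::finite itself \<Rightarrow> real" where
 "surface_const _ = real CARD('n) * measure lborel (ball (0::real^'n) 1)"

lemma nn_integral_radial:
 assumes g[measurable]: "g \<in> borel_measurable borel"
 shows "(\<integral>\<^sup>+x. g (norm (x::real^'n)) \<partial>lborel) = ennreal (surface_const TYPE('n)) *
   (\<integral>\<^sup>+r. ennreal (r powr (real CARD('n) - 1)) * indicator {0<..} r * g r \<partial>lborel)"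
proof -
 let ?d = "real CARD('n)"
 have "(\<integral>\<^sup>+x. 1 * g (norm (x::real^'n)) \<partial>lborel) =
  emeasure (angular_measure ?d (\<lambda>_::real^'n. 1)) UNIV * (\<integral>\<^sup>+r. ennreal (r powr (?d - 1)) * indicator {0<..} r * g r \<partial>lborel)"
  by (rule nn_integral_polar_radial) (use emeasure_lborel_unit_ball(1)[where 'a="real^'n"] in auto)
 also have "emeasure (angular_measure ?d (\<lambda>_::real^'n. 1)) UNIV = ennreal ?d * emeasure lborel (ball (0::real^'n) 1)"
 proof -
  have "(\<integral>\<^sup>+x. 1 * indicator {x. 0 < norm x \<and> norm x < 1 \<and> sgn x \<in> UNIV} (x::real^'n) \<partial>lborel) = (\<integral>\<^sup>+x. indicator (ball (0::real^'n) 1) x \<partial>lborel)"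
   by (rule nn_integral_cong_AE, rule AE_mp[OF AE_lborel_singleton[of 0]], rule AE_I2) (auto split: split_indicator)
  then show ?thesis by (subst emeasure_angular_measure) (simp_all only: borel_measurable_const nn_integral_indicator borel_open open_ball sets_lborel open_UNIV)
 qed
 also have "\<dots> = ennreal (surface_const TYPE('n))"
  unfolding emeasure_lborel_unit_ball surface_const_def by (simp add: ennreal_mult)
 finally show ?thesis by simp
qed

lemma surface_const_pos: "surface_const TYPE('n::finite) > 0"
 unfolding surface_const_def by (simp add: emeasure_lborel_unit_ball content_ball_pos)

lemma nn_integral_powr_01:
 assumes "a > 0" "t \<ge> 0"
 shows "(\<integral>\<^sup>+r. ennreal (r powr (a - 1)) * indicator {0<..<t} r \<partial>lborel) = ennreal (t powr a / a)"
proof -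
 have "(\<integral>\<^sup>+r. ennreal (r powr (a - 1)) * indicator {0<..<t} r \<partial>lborel) = (\<integral>\<^sup>+r. ennreal (indicator {0..t} r * r powr (a - 1)) \<partial>lborel)"
  by (rule nn_integral_cong_AE, rule AE_mp[OF AE_lborel_singleton[of t]], rule AE_I2) (auto split: split_indicator)
 also have "\<dots> = ennreal (t powr a / a)"
  using has_integral_powr_from_0[of "a - 1" t] assms
  by (intro nn_integral_has_integral_lebesgue) auto
 finally show ?thesis .
qed

lemma nn_integral_norm_powr_ball:
 assumes a: "a > 0" and t: "t \<ge> 0"
 shows "(\<integral>\<^sup>+x. ennreal (norm x powr (a - real CARD('n))) * indicator (ball 0 t) (x::real^'n) \<partial>lborel) = ennreal (surface_const TYPE('n) * t powr a / a)"
proof -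
 let ?d = "real CARD('n)"
 have "(\<integral>\<^sup>+x. ennreal (norm x powr (a - ?d)) * indicator (ball 0 t) (x::real^'n) \<partial>lborel) =
   (\<integral>\<^sup>+x. (\<lambda>r. ennreal (r powr (a - ?d)) * indicator {..<t} r) (norm (x::real^'n)) \<partial>lborel)"
  by (intro nn_integral_cong) (auto split: split_indicator)
 also have "\<dots> = ennreal (surface_const TYPE('n)) *
   (\<integral>\<^sup>+r. ennreal (r powr (?d - 1)) * indicator {0<..} r * (ennreal (r powr (a - ?d)) * indicator {..<t} r) \<partial>lborel)"
  by (rule nn_integral_radial) measurable
 also have "(\<integral>\<^sup>+r. ennreal (r powr (?d - 1)) * indicator {0<..} r * (ennreal (r powr (a - ?d)) * indicator {..<t} r) \<partial>lborel) =
   (\<integral>\<^sup>+r. ennreal (r powr (a - 1)) * indicator {0<..<t} r \<partial>lborel)"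
  by (intro nn_integral_cong) (auto split: split_indicator simp: ennreal_mult[symmetric] powr_add[symmetric])
 also have "\<dots> = ennreal (t powr a / a)" by (rule nn_integral_powr_01[OF a t])
 finally show ?thesis using surface_const_pos[where 'n='n] a by (simp add: ennreal_mult[symmetric])
qed

text \<open>The Beta integral after the substitution t = r^2; the factor 2 r of the substitution
  raises r^(2 a - 2) to r^(2 a - 1) and leaves the division by 2.\<close>

lemma nn_integral_beta_square:
 assumes a: "a > 0" and b: "b > 0"
 shows "(\<integral>\<^sup>+r. ennreal (r powr (2 * a - 1)) * indicator {0<..} r * ennreal (indicator {..1} r * (1 - r\<^sup>2) powr (b - 1)) \<partial>lborel) = ennreal (Beta a b / 2)"
proof -
 let ?f = "\<lambda>t::real. t powr (a - 1) * (1 - t) powr (b - 1)"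
 have "ennreal (Beta a b) = (\<integral>\<^sup>+t. ennreal (indicator {0..1} t * ?f t) \<partial>lborel)"
  using has_integral_Beta_real[OF a b] by (intro nn_integral_has_integral_lebesgue[symmetric]) auto
 also have "\<dots> = (\<integral>\<^sup>+t. ennreal (?f t * indicator {0^2..1^2} t) \<partial>lborel)"
  by (intro nn_integral_cong) (auto split: split_indicator)
 also have "\<dots> = (\<integral>\<^sup>+r. ennreal (?f (r^2) * (2 * r) * indicator {0..1} r) \<partial>lborel)"
 proof (rule nn_integral_substitution)
  show "((\<lambda>r. r^2) has_real_derivative 2 * x) (at x)" for x :: real
   by (auto intro!: derivative_eq_intros)
 qed (auto intro!: continuous_intros simp: set_borel_measurable_def)
 also have "\<dots> = (\<integral>\<^sup>+r. ennreal 2 * (ennreal (r powr (2 * a - 1)) * indicator {0<..} r * ennreal (indicator {..1} r * (1 - r\<^sup>2) powr (b - 1))) \<partial>lborel)"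
 proof (intro nn_integral_cong)
  fix r :: real
  have key: "(r^2) powr (a - 1) * (2 * r) = 2 * r powr (2 * a - 1)" if "r > 0"
  proof -
   have r2: "r^2 = r powr 2" and r1: "r = r powr 1" using that by (simp_all add: powr_numeral)
   have "(r^2) powr (a - 1) * r = r powr (2 * (a - 1)) * r powr 1"
    by (subst r2, subst (2) r1) (simp only: powr_powr)
   also have "\<dots> = r powr (2 * (a - 1) + 1)" by (rule powr_add[symmetric])
   also have "2 * (a - 1) + 1 = 2 * a - 1" by simp
   finally show ?thesis by (simp only: mult.left_commute mult_ac)
  qed
  show "ennreal (?f (r^2) * (2 * r) * indicator {0..1} r) =
    ennreal 2 * (ennreal (r powr (2 * a - 1)) * indicator {0<..} r * ennreal (indicator {..1} r * (1 - r\<^sup>2) powr (b - 1)))"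
  proof (cases "0 < r \<and> r \<le> 1")
   case True
   have "?f (r^2) * (2 * r) = ((r^2) powr (a - 1) * (2 * r)) * (1 - r\<^sup>2) powr (b - 1)" by (simp only: mult_ac)
   also have "\<dots> = 2 * (r powr (2 * a - 1) * (1 - r\<^sup>2) powr (b - 1))" using key True by (simp only: mult.assoc)
   finally have *: "?f (r^2) * (2 * r) = 2 * (r powr (2 * a - 1) * (1 - r\<^sup>2) powr (b - 1))" .
   have "r \<in> {0..1}" "r \<in> {0<..}" "r \<in> {..1}" using True by auto
   then show ?thesis unfolding * by (simp only: indicator_simps mult_1_right mult_1_left ennreal_mult powr_ge_zero zero_le_mult_iff) (simp add: ennreal_mult)
  next
   case False
   then show ?thesis by (cases "r = 0") (auto split: split_indicator)
  qed
 qed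
 also have "\<dots> = ennreal 2 * (\<integral>\<^sup>+r. ennreal (r powr (2 * a - 1)) * indicator {0<..} r * ennreal (indicator {..1} r * (1 - r\<^sup>2) powr (b - 1)) \<partial>lborel)"
  by (rule nn_integral_cmult) measurable
 finally have *: "ennreal (Beta a b) = ennreal 2 * (\<integral>\<^sup>+r. ennreal (r powr (2 * a - 1)) * indicator {0<..} r * ennreal (indicator {..1} r * (1 - r\<^sup>2) powr (b - 1)) \<partial>lborel)" .
 define I where "I = (\<integral>\<^sup>+r. ennreal (r powr (2 * a - 1)) * indicator {0<..} r * ennreal (indicator {..1} r * (1 - r\<^sup>2) powr (b - 1)) \<partial>lborel)"
 have B: "Beta a b \<ge> 0" using a b by (simp add: Beta_def Gamma_real_pos less_imp_le)
 have "I = ennreal (1/2) * ennreal 2 * I" by (subst ennreal_mult[symmetric]) auto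
 also have "\<dots> = ennreal (1/2) * ennreal (Beta a b)" unfolding * I_def by (simp only: mult.assoc)
 also have "\<dots> = ennreal (Beta a b / 2)" using B by (subst ennreal_mult[symmetric]) auto
 finally show ?thesis unfolding I_def .
qed

section \<open>The isotropic measures and their Fourier transforms\<close>

text \<open>An interface covering the density on the ball and the uniform measure on the sphere at
  once. The last clause is the ratio of consecutive radial moments: for the ball it is the recursion
  of the Beta function, for the sphere both sides agree because |y| = 1 and s + 2 = d. It is stated
  for even n, the odd moments being zero by symmetry.\<close>

definition iso_measure :: "real \<Rightarrow> (real^'n) measure \<Rightarrow> bool" where
 "iso_measure s \<mu> \<longleftrightarrow> prob_space \<mu> \<and> sets \<mu> = sets borel \<and> (AE y in \<mu>. norm y \<le> 1) \<and>
   (\<forall>f. orthogonal_transformation f \<longrightarrow> distr \<mu> borel f = \<mu>) \<and>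
   (\<forall>i n. even n \<longrightarrow> (real n + s + 2) * (\<integral>y. (norm y)^2 * (y $ i) ^ n \<partial>\<mu>) =
    (real n + real CARD('n)) * (\<integral>y. (y $ i) ^ n \<partial>\<mu>))"

lemma orthogonal_transformation_measurable:
 assumes "orthogonal_transformation (f :: real^'n \<Rightarrow> real^'n)"
 shows "f \<in> borel_measurable borel"
proof -
 have "linear f" using assms by (simp add: orthogonal_transformation_def)
 from matrix_vector_mul(2)[OF this] measurable_matrix_vector_mult[of "matrix f"] show ?thesis by simp
qed

lemma distr_lborel_orthogonal:
 assumes f: "orthogonal_transformation (f :: real^'n \<Rightarrow> real^'n)"
 shows "distr lborel borel f = lborel"
proof -
 have lin: "linear f" using f by (simp add: orthogonal_transformation_def)
 have "orthogonal_matrix (matrix f)" using f orthogonal_transformation_matrix by blast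
 then have "\<bar>det (matrix f)\<bar> = 1" using det_orthogonal_matrix by fastforce
 then show ?thesis using distr_lborel_matrix[of "matrix f"] by (auto simp: matrix_vector_mul(2)[OF lin] density_1)
qed

context
 fixes s :: real and \<beta> :: real and fr :: "real^'n \<Rightarrow> real" and c0 :: real
 defines "\<beta> \<equiv> (s - real CARD('n)) / 2"
  and "fr \<equiv> (\<lambda>x. indicator (cball 0 1) x * (1 - (norm x)\<^sup>2) powr ((s - real CARD('n)) / 2))"
  and "c0 \<equiv> surface_const TYPE('n) * Beta (real CARD('n) / 2) ((s - real CARD('n)) / 2 + 1) / 2"
 assumes s: "real CARD('n) - 2 < s"
begin

lemma fr_measurable[measurable]: "fr \<in> borel_measurable borel"
proof -
 have [measurable]: "cball (0::real^'n) 1 \<in> sets borel" by simp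
 show ?thesis unfolding fr_def by measurable
qed

lemma fr_nonneg: "fr x \<ge> 0" by (simp add: fr_def)

lemma \<beta>: "\<beta> + 1 > 0"
proof -
 have "0 < (s - real CARD('n) + 2) / 2" using s by (intro divide_pos_pos) linarith+
 then show ?thesis by (simp add: \<beta>_def add_divide_distrib)
qed

lemma c0_pos: "c0 > 0"
proof -
 have "Beta (real CARD('n) / 2) (\<beta> + 1) > 0" using \<beta> by (simp add: Beta_def Gamma_real_pos)
 then show ?thesis using surface_const_pos[where 'n='n] by (simp add: c0_def \<beta>_def)
qed

lemma nn_integral_fr: "(\<integral>\<^sup>+x. ennreal (fr x) \<partial>lborel) = ennreal c0"
proof -
 let ?d = "real CARD('n)"
 have "(\<integral>\<^sup>+x. ennreal (fr x) \<partial>lborel) = (\<integral>\<^sup>+x. (\<lambda>r. ennreal (indicator {..1} r * (1 - r\<^sup>2) powr \<beta>)) (norm (x::real^'n)) \<partial>lborel)"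
  by (intro nn_integral_cong) (auto simp: fr_def \<beta>_def split: split_indicator)
 also have "\<dots> = ennreal (surface_const TYPE('n)) * (\<integral>\<^sup>+r. ennreal (r powr (?d - 1)) * indicator {0<..} r * ennreal (indicator {..1} r * (1 - r\<^sup>2) powr \<beta>) \<partial>lborel)"
  by (rule nn_integral_radial) measurable
 also have "\<dots> = ennreal (surface_const TYPE('n)) * ennreal (Beta (?d / 2) (\<beta> + 1) / 2)"
  using nn_integral_beta_square[of "?d / 2" "\<beta> + 1"] \<beta> by simp
 also have "\<dots> = ennreal c0"
  using surface_const_pos[where 'n='n] \<beta> by (subst ennreal_mult[symmetric]) (auto simp: c0_def \<beta>_def Beta_def Gamma_real_pos intro!: less_imp_le)
 finally show ?thesis .
qed

lemma mu_iso_ball: "mu_iso s = density lborel (\<lambda>x. ennreal (fr x / c0))"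
proof -
 have "mu_iso s = density lborel (\<lambda>x. ennreal (fr x) / (\<integral>\<^sup>+y. ennreal (fr y) \<partial>lborel))"
  using s by (simp add: mu_iso_def Let_def fr_def)
 also have "\<dots> = density lborel (\<lambda>x. ennreal (fr x / c0))"
  unfolding nn_integral_fr using c0_pos fr_nonneg by (intro arg_cong2[where f=density] refl ext) (simp add: divide_ennreal)
 finally show ?thesis .
qed

lemma nn_integral_mu_iso_ball:
 assumes [measurable]: "g \<in> borel_measurable borel"
 shows "(\<integral>\<^sup>+x. g x \<partial>mu_iso s) = ennreal (1 / c0) * (\<integral>\<^sup>+x. ennreal (fr x) * g x \<partial>lborel)"
proof -
 have "(\<integral>\<^sup>+x. g x \<partial>mu_iso s) = (\<integral>\<^sup>+x. ennreal (fr x / c0) * g x \<partial>lborel)"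
  unfolding mu_iso_ball by (subst nn_integral_density) auto
 also have "\<dots> = (\<integral>\<^sup>+x. ennreal (1 / c0) * (ennreal (fr x) * g x) \<partial>lborel)"
  using c0_pos fr_nonneg by (intro nn_integral_cong) (simp add: mult.assoc[symmetric] ennreal_mult[symmetric])
 finally show ?thesis by (simp add: nn_integral_cmult)
qed

text \<open>For even n the monomial in one coordinate is nonnegative and homogeneous of degree n, so
  it serves as the weight of the polar formula with exponent n + d. All the moments involved then
  share one angular factor \<sigma>, and their ratio is a ratio of Beta values given by
  \<open>Beta_plus1_left\<close>.\<close>

lemma iso_measure_ball: "iso_measure s (mu_iso s :: (real^'n) measure)"
 unfolding iso_measure_def
proof (intro conjI allI impI)
 let ?d = "real CARD('n)"
 let ?\<mu> = "mu_iso s :: (real^'n) measure"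
 show sets: "sets ?\<mu> = sets borel" by (simp add: mu_iso_ball)
 have sp: "space ?\<mu> = UNIV" by (simp add: mu_iso_ball)
 show "prob_space ?\<mu>"
 proof
  have "emeasure ?\<mu> UNIV = (\<integral>\<^sup>+x. 1 \<partial>?\<mu>)" by (simp add: sp)
  also have "\<dots> = ennreal (1 / c0) * ennreal c0" by (subst nn_integral_mu_iso_ball) (simp_all add: nn_integral_fr)
  finally show "emeasure ?\<mu> (space ?\<mu>) = 1" using c0_pos sp by (simp add: ennreal_mult[symmetric])
 qed
 show "AE y in ?\<mu>. norm y \<le> 1"
 proof -
  have "0 < ennreal (fr x / c0) \<longrightarrow> norm x \<le> 1" for x
   by (auto simp: fr_def indicator_def split: if_splits)
  then have "AE x in lborel. 0 < ennreal (fr x / c0) \<longrightarrow> norm x \<le> 1" by (intro AE_I2)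
  moreover have "(\<lambda>x. ennreal (fr x / c0)) \<in> borel_measurable lborel" by measurable
  ultimately show ?thesis unfolding mu_iso_ball by (simp only: AE_density)
 qed
 show "distr ?\<mu> borel f = ?\<mu>" if f: "orthogonal_transformation f" for f
 proof -
  have [measurable]: "f \<in> borel_measurable borel" by (rule orthogonal_transformation_measurable[OF f])
  have "fr (f x) = fr x" for x using f by (simp add: fr_def orthogonal_transformation_norm indicator_def)
  then have "distr ?\<mu> borel f = distr (density lborel (\<lambda>x. ennreal (fr (f x) / c0))) borel f" by (simp add: mu_iso_ball)
  also have "\<dots> = density (distr lborel borel f) (\<lambda>x. ennreal (fr x / c0))" by (rule density_distr[symmetric]) measurable
  finally show ?thesis by (simp add: distr_lborel_orthogonal[OF f] mu_iso_ball)
 qed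
 show "(real n + s + 2) * (\<integral>y. (norm y)^2 * (y $ i) ^ n \<partial>?\<mu>) = (real n + ?d) * (\<integral>y. (y $ i) ^ n \<partial>?\<mu>)"
  if n: "even n" for i and n :: nat
 proof -
  let ?w = "\<lambda>x::real^'n. ennreal ((x $ i) ^ n)"
  let ?S = "real n + ?d"
  have wpos: "(x $ i) ^ n \<ge> 0" for x :: "real^'n" using n by (simp add: zero_le_even_power)
  have hom: "?w (c *\<^sub>R x) = ennreal (c powr (?S - ?d)) * ?w x" if "c > 0" for c x
   using that wpos by (simp add: power_mult_distrib powr_realpow ennreal_mult[symmetric])
  have fin: "(\<integral>\<^sup>+x. ?w x * indicator (ball 0 1) x \<partial>lborel) < \<infinity>"
  proof -
   have "(\<integral>\<^sup>+x. ?w x * indicator (ball 0 1) x \<partial>lborel) \<le> (\<integral>\<^sup>+x. indicator (ball (0::real^'n) 1) x \<partial>lborel)"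
   proof (intro nn_integral_mono)
    fix x :: "real^'n"
    have "\<bar>x $ i\<bar> ^ n \<le> 1" if "norm x < 1"
     using component_le_norm_cart[of x i] that by (intro power_le_one) auto
    then show "?w x * indicator (ball 0 1) x \<le> indicator (ball 0 1) x"
     using n by (auto simp: power_even_abs split: split_indicator intro!: ennreal_le_1[THEN iffD2])
   qed
   then show ?thesis using emeasure_lborel_ball_finite[of "0::real^'n" 1] by (auto intro: le_less_trans)
  qed
  define \<sigma> where "\<sigma> = enn2real (emeasure (angular_measure ?S ?w) UNIV)"
  have Sp: "?S > 0" by (simp add: add_nonneg_pos)
  have wm: "?w \<in> borel_measurable borel" by measurable
  have \<sigma>: "emeasure (angular_measure ?S ?w) UNIV = ennreal \<sigma>" "\<sigma> \<ge> 0"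
   using finite_measure.emeasure_finite[OF finite_angular_measure[OF Sp wm hom fin], of UNIV] by (auto simp: \<sigma>_def less_top)
  define b where "b k = Beta ((?S + real k) / 2) (\<beta> + 1) / 2" for k :: nat
  have b: "b k \<ge> 0" for k
  proof -
   have a: "(?S + real k) / 2 > 0" by (rule divide_pos_pos, rule add_pos_nonneg[OF Sp]) auto
   show ?thesis unfolding b_def Beta_def
    by (intro divide_nonneg_nonneg mult_nonneg_nonneg less_imp_le[OF Gamma_real_pos] a \<beta> add_pos_pos) simp
  qed
  let ?u = "\<lambda>r. ennreal (indicator {..1} r * (1 - r\<^sup>2) powr \<beta>)"
  have rad: "(\<integral>\<^sup>+x. ennreal (fr x) * ennreal ((norm x) ^ k * (x $ i) ^ n) \<partial>lborel) = ennreal (\<sigma> * b k)" for k :: nat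
  proof -
   have "(\<integral>\<^sup>+x. ennreal (fr x) * ennreal ((norm x) ^ k * (x $ i) ^ n) \<partial>lborel) =
     (\<integral>\<^sup>+x. ?w x * (\<lambda>r. ?u r * ennreal (r ^ k)) (norm x) \<partial>lborel)"
    using wpos by (intro nn_integral_cong) (auto simp: fr_def \<beta>_def ennreal_mult mult_ac split: split_indicator)
   also have "\<dots> = ennreal \<sigma> * (\<integral>\<^sup>+r. ennreal (r powr (?S - 1)) * indicator {0<..} r * (?u r * ennreal (r ^ k)) \<partial>lborel)"
    unfolding \<sigma>(1)[symmetric] by (rule nn_integral_polar_radial[OF Sp wm hom fin]) measurable
   also have "(\<integral>\<^sup>+r. ennreal (r powr (?S - 1)) * indicator {0<..} r * (?u r * ennreal (r ^ k)) \<partial>lborel) =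
     (\<integral>\<^sup>+r. ennreal (r powr (2 * ((?S + real k) / 2) - 1)) * indicator {0<..} r * ennreal (indicator {..1} r * (1 - r\<^sup>2) powr (\<beta> + 1 - 1)) \<partial>lborel)"
   proof (rule nn_integral_cong)
    fix r :: real
    have "2 * ((?S + real k) / 2) - 1 = (?S - 1) + real k" by simp
    then have P: "ennreal (r powr (2 * ((?S + real k) / 2) - 1)) = ennreal (r powr (?S - 1)) * ennreal (r ^ k)" if "r > 0"
     using that by (simp only: powr_add) (simp add: powr_realpow ennreal_mult)
    have \<beta>1: "\<beta> + 1 - 1 = \<beta>" by simp
    show "ennreal (r powr (?S - 1)) * indicator {0<..} r * (?u r * ennreal (r ^ k)) =
     ennreal (r powr (2 * ((?S + real k) / 2) - 1)) * indicator {0<..} r * ennreal (indicator {..1} r * (1 - r\<^sup>2) powr (\<beta> + 1 - 1))"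
     by (cases "r > 0") (simp_all only: \<beta>1 P mult_ac, simp)
   qed
   also have "\<dots> = ennreal (b k)"
    unfolding b_def by (rule nn_integral_beta_square) (use \<beta> Sp in auto)
   finally show ?thesis by (simp only: ennreal_mult[OF \<sigma>(2) b])
  qed
  have val: "(\<integral>y. norm y ^ k * (y $ i) ^ n \<partial>?\<mu>) = 1 / c0 * (\<sigma> * b k)" for k :: nat
  proof -
   have "(\<integral>y. norm y ^ k * (y $ i) ^ n \<partial>?\<mu>) = enn2real (\<integral>\<^sup>+y. ennreal (norm y ^ k * (y $ i) ^ n) \<partial>?\<mu>)"
    by (rule integral_eq_nn_integral) (use wpos in \<open>auto simp: measurable_cong_sets[OF sets refl]\<close>)
   also have "\<dots> = enn2real (ennreal (1 / c0) * ennreal (\<sigma> * b k))"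
    by (subst nn_integral_mu_iso_ball) (simp_all add: rad)
   also have "\<dots> = 1 / c0 * (\<sigma> * b k)" using c0_pos \<sigma>(2) b[of k] by (simp add: ennreal_mult[symmetric])
   finally show ?thesis .
  qed
  have "((?S / 2) + (\<beta> + 1)) * Beta (?S / 2 + 1) (\<beta> + 1) = ?S / 2 * Beta (?S / 2) (\<beta> + 1)"
   by (rule Beta_plus1_left) (use Sp \<beta> in \<open>auto simp: nonpos_Ints_def\<close>)
  moreover have "b 2 = Beta (?S / 2 + 1) (\<beta> + 1) / 2" "b 0 = Beta (?S / 2) (\<beta> + 1) / 2"
   unfolding b_def by (simp_all add: add_divide_distrib)
  moreover have K: "real n + s + 2 = 2 * (?S / 2 + (\<beta> + 1))" by (simp add: \<beta>_def field_simps)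
  ultimately have "(real n + s + 2) * b 2 = ?S * b 0" by (simp only: K)
  moreover have "x * (1 / c0 * (\<sigma> * y)) = 1 / c0 * \<sigma> * (x * y)" for x y by simp
  ultimately have "(real n + s + 2) * (1 / c0 * (\<sigma> * b 2)) = ?S * (1 / c0 * (\<sigma> * b 0))" by (simp only:)
  then show ?thesis using val[of 2] val[of 0] by simp
 qed
qed

end

text \<open>Rotations preserve Hausdorff measure, being isometries, and map the sphere to itself.
  Positivity and finiteness of its measure make the normalisation by division meaningful in
  \<open>ennreal\<close>.\<close>

lemma iso_measure_sphere:
 assumes d2: "CARD('n::finite) \<ge> 2" and s: "s = real CARD('n) - 2"
 shows "iso_measure s (mu_iso s :: (real^'n) measure)"
proof -
 let ?k = "real CARD('n) - 1"
 let ?S = "sphere (0::real^'n) 1"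
 let ?\<mu> = "mu_iso s :: (real^'n) measure"
 define h where "h = emeasure (hausdorff_measure ?k) ?S"
 have hH: "h = hausdorff_outer ?k ?S" unfolding h_def by (rule emeasure_hausdorff_measure) simp
 have h0: "h \<noteq> 0" and hf: "h \<noteq> top"
  using hausdorff_sphere_pos[OF refl d2] hausdorff_sphere_finite[OF refl d2] unfolding hH by auto
 have mu: "?\<mu> = density (hausdorff_measure ?k) (\<lambda>x. indicator ?S x / h)"
  by (simp add: mu_iso_def s h_def Let_def)
 have sets: "sets ?\<mu> = sets borel" by (simp add: mu)
 have Sm[measurable]: "?S \<in> sets borel" by simp
 have Hm: "g \<in> borel_measurable borel \<Longrightarrow> g \<in> borel_measurable (hausdorff_measure ?k)" for g :: "real^'n \<Rightarrow> ennreal"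
  by (simp add: measurable_cong_sets[OF sets_hausdorff_measure refl])
 have im: "(\<lambda>x. indicator ?S x / h) \<in> borel_measurable (hausdorff_measure ?k)"
  by (rule Hm) measurable
 have em: "emeasure ?\<mu> A = hausdorff_outer ?k (A \<inter> ?S) / h" if [measurable]: "A \<in> sets borel" for A
 proof -
  have "emeasure ?\<mu> A = (\<integral>\<^sup>+x. indicator (A \<inter> ?S) x / h \<partial>hausdorff_measure ?k)"
   unfolding mu using im by (subst emeasure_density) (auto intro!: nn_integral_cong split: split_indicator)
  also have "\<dots> = emeasure (hausdorff_measure ?k) (A \<inter> ?S) / h"
   by (subst nn_integral_divide) (auto intro!: Hm)
  finally show ?thesis by (simp add: emeasure_hausdorff_measure)
 qed
 have AE1: "AE y in ?\<mu>. norm y = 1"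
  unfolding mu using im by (subst AE_density) (auto simp: indicator_def)
 have p: "prob_space ?\<mu>"
 proof
  show "emeasure ?\<mu> (space ?\<mu>) = 1"
   using em[of UNIV] h0 hf by (simp add: mu hH[symmetric] ennreal_divide_self less_top)
 qed
 show ?thesis
  unfolding iso_measure_def
 proof (intro conjI allI impI)
  show "prob_space ?\<mu>" "sets ?\<mu> = sets borel" by (rule p, rule sets)
  show "AE y in ?\<mu>. norm y \<le> 1" using AE1 by eventually_elim simp
  show "distr ?\<mu> borel f = ?\<mu>" if f: "orthogonal_transformation f" for f
  proof (rule measure_eqI)
   have fm[measurable]: "f \<in> borel_measurable borel" by (rule orthogonal_transformation_measurable[OF f])
   fix A assume "A \<in> sets (distr ?\<mu> borel f)"
   then have A[measurable]: "A \<in> sets borel" by simp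
   have pre: "f -` A \<in> sets borel" using measurable_sets[OF fm A] by simp
   have "emeasure (distr ?\<mu> borel f) A = emeasure ?\<mu> (f -` A)"
    by (subst emeasure_distr) (auto simp: measurable_cong_sets[OF sets refl] fm mu)
   also have "\<dots> = hausdorff_outer ?k (f -` A \<inter> ?S) / h" by (rule em[OF pre])
   also have "hausdorff_outer ?k (f -` A \<inter> ?S) = hausdorff_outer ?k (f ` (f -` A \<inter> ?S))"
    by (rule hausdorff_outer_isometry[symmetric]) (use f d2 in \<open>auto simp: orthogonal_transformation_isometry\<close>)
   also have "f ` (f -` A \<inter> ?S) = A \<inter> ?S"
   proof (intro set_eqI iffI)
    fix y assume y: "y \<in> A \<inter> ?S"
    obtain x where x: "y = f x" using orthogonal_transformation_surj[OF f] by (metis surjD)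
    then show "y \<in> f ` (f -` A \<inter> ?S)" using y orthogonal_transformation_norm[OF f, of x] by auto
   qed (use f in \<open>auto simp: orthogonal_transformation_norm\<close>)
   finally show "emeasure (distr ?\<mu> borel f) A = emeasure ?\<mu> A" by (simp add: em)
  qed (simp add: sets)
  show "(real n + s + 2) * (\<integral>y. (norm y)^2 * (y $ i) ^ n \<partial>?\<mu>) = (real n + real CARD('n)) * (\<integral>y. (y $ i) ^ n \<partial>?\<mu>)" for i and n :: nat
  proof -
   have "(\<integral>y. (norm y)^2 * (y $ i) ^ n \<partial>?\<mu>) = (\<integral>y. (y $ i) ^ n \<partial>?\<mu>)"
    by (rule integral_cong_AE) (use AE1 in \<open>auto simp: measurable_cong_sets[OF sets refl]\<close>)
   then show ?thesis by (simp add: s)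
  qed
 qed
qed

lemma iso_measure_mu_iso:
 assumes "CARD('n::finite) \<ge> 2" "real CARD('n) - 2 \<le> s"
 shows "iso_measure s (mu_iso s :: (real^'n) measure)"
 using iso_measure_ball[where 'n='n and s=s] iso_measure_sphere[where 'n='n and s=s] assms by (cases "real CARD('n) - 2 < s") auto

lemma sum_even_reindex:
 fixes g :: "nat \<Rightarrow> real"
 assumes "\<And>k. odd k \<Longrightarrow> g k = 0"
 shows "(\<Sum>k\<le>2 * p. g k) = (\<Sum>l\<le>p. g (2 * l))"
proof -
 have "(\<Sum>l\<le>p. g (2 * l)) = (\<Sum>k\<in>(\<lambda>l. 2 * l) ` {..p}. g k)"
  by (subst sum.reindex) (auto simp: inj_on_def)
 also have "\<dots> = (\<Sum>k\<le>2 * p. g k)"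
 proof (rule sum.mono_neutral_left)
  show "\<forall>i\<in>{..2 * p} - (\<lambda>l. 2 * l) ` {..p}. g i = 0"
  proof
   fix i assume i: "i \<in> {..2 * p} - (\<lambda>l. 2 * l) ` {..p}"
   have "odd i"
   proof
    assume "even i"
    then obtain l where "i = 2 * l" by (auto elim: evenE)
    then show False using i by auto
   qed
   then show "g i = 0" by (rule assms)
  qed
 qed auto
 finally show ?thesis by simp
qed

section \<open>Moments and Fourier transform of an isotropic measure\<close>

context
 fixes s :: real and \<mu> :: "(real^'n) measure"
 assumes iso: "iso_measure s \<mu>" and s_pos: "s > 0"
begin

lemma iso_prob: "prob_space \<mu>" and iso_sets: "sets \<mu> = sets borel" and iso_AE: "AE y in \<mu>. norm y \<le> 1"
 and iso_rot: "orthogonal_transformation f \<Longrightarrow> distr \<mu> borel f = \<mu>"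
 using iso by (auto simp: iso_measure_def)

lemma iso_integrable:
 assumes [measurable]: "(g :: real^'n \<Rightarrow> real) \<in> borel_measurable borel" and b: "\<And>y. norm y \<le> 1 \<Longrightarrow> \<bar>g y\<bar> \<le> B"
 shows "integrable \<mu> g"
proof -
 interpret prob_space \<mu> by (rule iso_prob)
 show ?thesis
  by (rule integrable_const_bound[of _ B]) (use iso_AE b in \<open>auto simp: measurable_cong_sets[OF iso_sets refl]\<close>)
qed

lemma iso_integral_abs_le:
 assumes m: "(g :: real^'n \<Rightarrow> real) \<in> borel_measurable borel" and b: "\<And>y. norm y \<le> 1 \<Longrightarrow> \<bar>g y\<bar> \<le> B"
 shows "\<bar>\<integral>y. g y \<partial>\<mu>\<bar> \<le> B"
proof -
 interpret prob_space \<mu> by (rule iso_prob)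
 have "\<bar>\<integral>y. g y \<partial>\<mu>\<bar> \<le> (\<integral>y. \<bar>g y\<bar> \<partial>\<mu>)" by (rule integral_abs_bound)
 also have "\<dots> \<le> B"
  by (rule integral_le_const) (use iso_integrable[OF m b] iso_AE b in \<open>auto elim!: eventually_mono\<close>)
 finally show ?thesis .
qed

lemma iso_integral_inner:
 fixes \<omega> :: "real^'n"
 assumes \<omega>: "norm \<omega> = 1" and [measurable]: "(g :: real \<Rightarrow> real) \<in> borel_measurable borel"
 shows "(\<integral>y. g (y \<bullet> \<omega>) \<partial>\<mu>) = (\<integral>y. g (y $ i) \<partial>\<mu>)"
proof -
 obtain f :: "real^'n \<Rightarrow> real^'n" where f: "orthogonal_transformation f" "f (axis i 1) = \<omega>"
  by (rule orthogonal_transformation_exists[of "axis i 1 :: real^'n" \<omega>]) (use \<omega> in auto)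
 have fm[measurable]: "f \<in> borel_measurable borel" by (rule orthogonal_transformation_measurable[OF f(1)])
 have fy: "f y \<bullet> \<omega> = y $ i" for y
  using f by (metis inner_axis inner_real_def mult.right_neutral orthogonal_transformation_def)
 have "(\<integral>y. g (y \<bullet> \<omega>) \<partial>\<mu>) = (\<integral>y. g (y \<bullet> \<omega>) \<partial>distr \<mu> borel f)" by (simp only: iso_rot[OF f(1)])
 also have "\<dots> = (\<integral>y. g (f y \<bullet> \<omega>) \<partial>\<mu>)"
  by (subst integral_distr) (auto simp: measurable_cong_sets[OF iso_sets refl])
 finally show ?thesis by (simp only: fy)
qed

lemma abs_component_le_1: "norm (y::real^'n) \<le> 1 \<Longrightarrow> \<bar>y $ i\<bar> \<le> 1"
 using component_le_norm_cart[of y i] by linarith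

text \<open>Rotation invariance gives the integral of (y . v)^(2 p) as |v|^(2 p) E for every v. For
  v = e_i + t e_j both sides are polynomials in t, the right one being (1 + t^2)^p E. Comparing the
  coefficients of t^2 yields (2 p choose 2) M_2 = p E, which is the claim for n + 2 = 2 p.\<close>

lemma iso_mixed_moment:
 assumes ij: "i \<noteq> j" and n: "even n"
 shows "(real n + 1) * (\<integral>y. (y $ i) ^ n * (y $ j)^2 \<partial>\<mu>) = (\<integral>y. (y $ i) ^ (n + 2) \<partial>\<mu>)"
proof -
 obtain p where p: "n + 2 = 2 * p" "p \<ge> 1" using n by (auto elim!: evenE intro: that[of "Suc _"])
 define E where "E = (\<integral>y. (y $ i) ^ (2 * p) \<partial>\<mu>)"
 define M where "M k = (\<integral>y. (y $ j) ^ k * (y $ i) ^ (2 * p - k) \<partial>\<mu>)" for k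
 have int: "integrable \<mu> (\<lambda>y. (y $ j) ^ k * (y $ i) ^ l)" for k l
 proof (rule iso_integrable[of _ 1])
  fix y :: "real^'n" assume "norm y \<le> 1"
  then show "\<bar>(y $ j) ^ k * (y $ i) ^ l\<bar> \<le> 1"
   unfolding abs_mult power_abs by (intro mult_le_one power_le_one abs_component_le_1) auto
 qed measurable
 have id: "(\<Sum>k\<le>2 * p. (real (2 * p choose k) * M k) * t ^ k) =
   (\<Sum>k\<le>2 * p. (if even k then real (p choose (k div 2)) * E else 0) * t ^ k)" for t
 proof -
  define v where "v = axis i 1 + t *\<^sub>R (axis j 1 :: real^'n)"
  have vv: "v \<bullet> v = 1 + t^2"
   using ij by (simp add: v_def inner_add_left inner_add_right inner_axis_axis power2_eq_square)
  define q where "q = norm v"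
  have q2: "q^2 = 1 + t^2" using vv by (simp add: q_def power2_norm_eq_inner)
  then have q: "q > 0" by (smt (verit) q_def norm_ge_zero zero_le_power2 zero_power2)
  have "(\<integral>y. (y \<bullet> v) ^ (2 * p) \<partial>\<mu>) = (\<integral>y. q ^ (2 * p) * (y \<bullet> (v /\<^sub>R q)) ^ (2 * p) \<partial>\<mu>)"
  proof (intro Bochner_Integration.integral_cong refl)
   fix y :: "real^'n"
   have "q * (y \<bullet> (v /\<^sub>R q)) = y \<bullet> v" using q by simp
   then show "(y \<bullet> v) ^ (2 * p) = q ^ (2 * p) * (y \<bullet> (v /\<^sub>R q)) ^ (2 * p)" by (simp only: power_mult_distrib[symmetric])
  qed
  also have "\<dots> = q ^ (2 * p) * (\<integral>y. (y $ i) ^ (2 * p) \<partial>\<mu>)"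
   using q by (subst integral_mult_right_zero, subst iso_integral_inner[where i=i and g="\<lambda>x. x ^ (2 * p)"]) (auto simp: q_def)
  also have "q ^ (2 * p) = (1 + t^2) ^ p" by (simp add: power_mult q2)
  also have "(1 + t^2) ^ p * (\<integral>y. (y $ i) ^ (2 * p) \<partial>\<mu>) = (\<Sum>l\<le>p. (real (p choose l) * E) * t ^ (2 * l))"
   unfolding E_def[symmetric] add.commute[of 1] binomial_ring by (simp add: sum_distrib_left power_mult[symmetric] mult_ac)
  also have "\<dots> = (\<Sum>k\<le>2 * p. (if even k then real (p choose (k div 2)) * E else 0) * t ^ k)"
   by (subst sum_even_reindex) auto
  finally have 1: "(\<integral>y. (y \<bullet> v) ^ (2 * p) \<partial>\<mu>) = \<dots>" .
  have "(\<integral>y. (y \<bullet> v) ^ (2 * p) \<partial>\<mu>) = (\<integral>y. (\<Sum>k\<le>2 * p. (real (2 * p choose k) * t ^ k) * ((y $ j) ^ k * (y $ i) ^ (2 * p - k))) \<partial>\<mu>)"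
  proof (intro Bochner_Integration.integral_cong refl)
   fix y :: "real^'n"
   have "y \<bullet> v = t * y $ j + y $ i" by (simp add: v_def inner_add_right inner_axis)
   then show "(y \<bullet> v) ^ (2 * p) = (\<Sum>k\<le>2 * p. (real (2 * p choose k) * t ^ k) * ((y $ j) ^ k * (y $ i) ^ (2 * p - k)))"
    by (simp add: binomial_ring power_mult_distrib mult_ac)
  qed
  also have "\<dots> = (\<Sum>k\<le>2 * p. (real (2 * p choose k) * t ^ k) * M k)"
   unfolding M_def by (subst Bochner_Integration.integral_sum) (auto intro!: int)
  finally show ?thesis using 1 by (simp add: mult_ac)
 qed
 have "real (2 * p choose 2) * M 2 = (if even (2::nat) then real (p choose (2 div 2)) * E else 0)"
  using polyfun_eq_coeffs[where n="2 * p" and c="\<lambda>k. real (2 * p choose k) * M k" and d="\<lambda>k. if even k then real (p choose (k div 2)) * E else 0"] id p(2) by auto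
 then have "real (2 * p choose 2) * M 2 = real p * E" by simp
 moreover have "real (2 * p choose 2) = real p * (2 * real p - 1)"
 proof -
  have "2 * p choose 2 = p * (2 * p - 1)" by (simp add: choose_two)
  then show ?thesis using p(2) by (simp add: of_nat_diff)
 qed
 ultimately have "real p * ((2 * real p - 1) * M 2) = real p * E" by (simp add: mult_ac)
 then have "(2 * real p - 1) * M 2 = E" using p(2) by simp
 moreover have "real n + 1 = 2 * real p - 1" using p(1) by linarith
 moreover have "2 * p - 2 = n" using p(1) by simp
 then have "M 2 = (\<integral>y. (y $ i) ^ n * (y $ j)^2 \<partial>\<mu>)" unfolding M_def by (simp only: mult.commute)
 ultimately show ?thesis unfolding p(1) E_def by metis
qed

text \<open>Summing the mixed moments over j expresses the integral of |y|^2 y_i^n through the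
  moment of order n + 2 with factor n + d. The defining relation of \<open>iso_measure\<close>
  contains the same factor, so the dimension cancels.\<close>

lemma iso_moment_recursion:
 assumes n: "even n"
 shows "(real n + s + 2) * (\<integral>y. (y $ i) ^ (n + 2) \<partial>\<mu>) = (real n + 1) * (\<integral>y. (y $ i) ^ n \<partial>\<mu>)"
proof -
 let ?d = "real CARD('n)"
 let ?E2 = "\<integral>y. (y $ i) ^ (n + 2) \<partial>\<mu>"
 have int: "integrable \<mu> (\<lambda>y. (y $ i) ^ n * (y $ j)^2)" for j
 proof (rule iso_integrable[of _ 1])
  fix y :: "real^'n" assume "norm y \<le> 1"
  then show "\<bar>(y $ i) ^ n * (y $ j)^2\<bar> \<le> 1"
   unfolding abs_mult power_abs by (intro mult_le_one power_le_one abs_component_le_1) auto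
 qed measurable
 have "(\<integral>y. (norm y)^2 * (y $ i) ^ n \<partial>\<mu>) = (\<integral>y. (\<Sum>j\<in>UNIV. (y $ i) ^ n * (y $ j)^2) \<partial>\<mu>)"
 proof (intro Bochner_Integration.integral_cong refl)
  fix y :: "real^'n"
  have "(norm y)^2 = (\<Sum>j\<in>UNIV. (y $ j)^2)" unfolding power2_norm_eq_inner inner_vec_def by (simp add: power2_eq_square)
  then show "(norm y)^2 * (y $ i) ^ n = (\<Sum>j\<in>UNIV. (y $ i) ^ n * (y $ j)^2)" by (simp add: sum_distrib_left mult.commute)
 qed
 also have "\<dots> = (\<Sum>j\<in>UNIV. \<integral>y. (y $ i) ^ n * (y $ j)^2 \<partial>\<mu>)"
  by (rule Bochner_Integration.integral_sum) (rule int)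
 finally have "(real n + 1) * (\<integral>y. (norm y)^2 * (y $ i) ^ n \<partial>\<mu>) = (\<Sum>j\<in>UNIV. (real n + 1) * (\<integral>y. (y $ i) ^ n * (y $ j)^2 \<partial>\<mu>))"
  by (simp add: sum_distrib_left)
 also have "\<dots> = (real n + 1) * (\<integral>y. (y $ i) ^ n * (y $ i)^2 \<partial>\<mu>) + (\<Sum>j\<in>UNIV - {i}. (real n + 1) * (\<integral>y. (y $ i) ^ n * (y $ j)^2 \<partial>\<mu>))"
  by (rule sum.remove) auto
 also have "(\<Sum>j\<in>UNIV - {i}. (real n + 1) * (\<integral>y. (y $ i) ^ n * (y $ j)^2 \<partial>\<mu>)) = (\<Sum>j\<in>UNIV - {i}. ?E2)"
  by (intro sum.cong refl iso_mixed_moment n) auto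
 also have "(\<integral>y. (y $ i) ^ n * (y $ i)^2 \<partial>\<mu>) = ?E2" by (simp only: power_add)
 also have "(real n + 1) * ?E2 + (\<Sum>j\<in>UNIV - {i}. ?E2) = (real n + ?d) * ?E2"
  by (simp add: of_nat_diff algebra_simps)
 finally have 1: "(real n + 1) * (\<integral>y. (norm y)^2 * (y $ i) ^ n \<partial>\<mu>) = (real n + ?d) * ?E2" .
 have 2: "(real n + s + 2) * (\<integral>y. (norm y)^2 * (y $ i) ^ n \<partial>\<mu>) = (real n + ?d) * (\<integral>y. (y $ i) ^ n \<partial>\<mu>)"
  using iso n by (simp add: iso_measure_def)
 have "(real n + ?d) * ((real n + s + 2) * ?E2) = (real n + s + 2) * ((real n + 1) * (\<integral>y. (norm y)^2 * (y $ i) ^ n \<partial>\<mu>))"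
  unfolding 1 by (simp only: mult_ac)
 also have "\<dots> = (real n + ?d) * ((real n + 1) * (\<integral>y. (y $ i) ^ n \<partial>\<mu>))"
  unfolding mult.left_commute[of "real n + s + 2"] 2 by (simp only: mult_ac)
 finally show ?thesis by (simp add: add_nonneg_pos less_imp_neq[THEN not_sym])
qed

text \<open>By rotation invariance the transform is radial, with profile m(r) the average of cos (r
  y_i). The moment recursion is exactly the coefficient recursion of the differential equation. The
  solution regular at 0 is a multiple of r^(-s/2) J_(s/2)(r), with J the Bessel function.\<close>

lemma iso_char_ode:
 "\<exists>m m1 m2 :: real \<Rightarrow> real. (\<forall>r. (m has_real_derivative m1 r) (at r)) \<and> (\<forall>r. (m1 has_real_derivative m2 r) (at r)) \<and>
   (\<forall>r. r * m2 r + (s + 1) * m1 r + r * m r = 0) \<and> (\<forall>r. \<bar>m r\<bar> \<le> 1) \<and> (\<forall>r. \<bar>m1 r\<bar> \<le> 1) \<and>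
   (\<forall>\<xi>. (\<integral>y. cos (\<xi> \<bullet> y) \<partial>\<mu>) = m (norm \<xi>))"
proof -
 interpret prob_space \<mu> by (rule iso_prob)
 define i :: 'n where "i = undefined"
 define E where "E n = (\<integral>y. (y $ i) ^ n \<partial>\<mu>)" for n
 define a where "a n = cos_coeff n * E n" for n
 define m where "m r = (\<integral>y. cos (r * y $ i) \<partial>\<mu>)" for r
 have mm[measurable]: "(\<lambda>y::real^'n. y $ i) \<in> borel_measurable borel" by measurable
 have cb: "integrable \<mu> (\<lambda>y. cos (r * y $ i))" for r
  by (rule iso_integrable[of _ 1]) auto
 have sm_cos: "summable (\<lambda>n. \<bar>cos_coeff n\<bar> * \<bar>r\<bar> ^ n)" for r
  using summable_norm_cos[of r] by (simp add: abs_mult power_abs)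
 have ms: "(\<lambda>n. a n * r ^ n) sums m r" for r
 proof -
  have "(\<lambda>n. \<integral>y. cos_coeff n * (r * y $ i) ^ n \<partial>\<mu>) sums (\<integral>y. (\<Sum>n. cos_coeff n * (r * y $ i) ^ n) \<partial>\<mu>)"
  proof (rule sums_integral)
   show "integrable \<mu> (\<lambda>y. cos_coeff n * (r * y $ i) ^ n)" for n
    by (rule iso_integrable[of _ "\<bar>cos_coeff n\<bar> * \<bar>r\<bar> ^ n"])
      (auto simp: abs_mult power_abs power_mult_distrib intro!: mult_left_mono mult_left_le power_le_one abs_component_le_1)
   show "AE y in \<mu>. summable (\<lambda>n. norm (cos_coeff n * (r * y $ i) ^ n))"
   proof (intro AE_I2)
    fix y show "summable (\<lambda>n. norm (cos_coeff n * (r * y $ i) ^ n))"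
     using summable_norm_cos[of "r * y $ i"] by simp
   qed
   show "summable (\<lambda>n. \<integral>y. norm (cos_coeff n * (r * y $ i) ^ n) \<partial>\<mu>)"
   proof (rule summable_comparison_test'[OF sm_cos[of r], of 0])
    fix n
    show "norm (\<integral>y. norm (cos_coeff n * (r * y $ i) ^ n) \<partial>\<mu>) \<le> \<bar>cos_coeff n\<bar> * \<bar>r\<bar> ^ n"
     unfolding real_norm_def by (rule iso_integral_abs_le)
      (auto simp: abs_mult power_abs power_mult_distrib intro!: mult_left_mono mult_left_le power_le_one abs_component_le_1)
   qed
  qed
  moreover have "(\<Sum>n. cos_coeff n * x ^ n) = cos x" for x :: real
   using cos_converges[of x] by (simp add: sums_iff)
  moreover have "(\<integral>y. cos_coeff n * (r * y $ i) ^ n \<partial>\<mu>) = a n * r ^ n" for n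
   by (simp add: a_def E_def power_mult_distrib)
  ultimately show ?thesis by (simp add: m_def)
 qed
 define m1 where "m1 r = (\<Sum>n. diffs a n * r ^ n)" for r
 define m2 where "m2 r = (\<Sum>n. diffs (diffs a) n * r ^ n)" for r
 have sm0: "summable (\<lambda>n. a n * r ^ n)" for r using ms by (rule sums_summable)
 have sm1: "summable (\<lambda>n. diffs a n * r ^ n)" for r
  by (rule termdiff_converges_all) (rule sm0)
 have sm2: "summable (\<lambda>n. diffs (diffs a) n * r ^ n)" for r
  by (rule termdiff_converges_all) (rule sm1)
 have meq: "m = (\<lambda>r. \<Sum>n. a n * r ^ n)" using ms by (auto simp: sums_iff fun_eq_iff)
 have d1: "(m has_real_derivative m1 r) (at r)" for r
  unfolding meq m1_def by (rule termdiffs_strong_converges_everywhere) (rule sm0)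
 have d2: "(m1 has_real_derivative m2 r) (at r)" for r
  unfolding m1_def m2_def by (rule termdiffs_strong_converges_everywhere) (rule sm1)
 have rec: "(real n + 2) * (real n + s + 2) * a (n + 2) + a n = 0" for n
 proof (cases "even n")
  case True
  have cc: "cos_coeff (n + 2) = - cos_coeff n / ((real n + 1) * (real n + 2))"
   using True by (auto simp: cos_coeff_def field_simps elim!: evenE)
  have r: "(real n + s + 2) * E (n + 2) = (real n + 1) * E n"
   unfolding E_def by (rule iso_moment_recursion[OF True])
  have "(real n + 2) * (real n + s + 2) * a (n + 2) = - cos_coeff n / (real n + 1) * ((real n + s + 2) * E (n + 2))"
  proof -
   have "y * K * (- c / (x * y) * F) = - c / x * (K * F)" if "y \<noteq> 0" for x y K c F :: real using that by simp
   from this[of "real n + 2" "real n + s + 2" "cos_coeff n" "real n + 1" "E (n + 2)"] show ?thesis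
    unfolding a_def cc by simp
  qed
  also have "\<dots> = - cos_coeff n * E n" unfolding r by simp
  finally show ?thesis by (simp add: a_def)
 next
  case False
  then show ?thesis by (simp add: a_def cos_coeff_def)
 qed
 have ode: "r * m2 r + (s + 1) * m1 r + r * m r = 0" for r
 proof -
  have A: "(\<lambda>n. diffs (diffs a) n * r ^ n * r) sums (m2 r * r)"
   unfolding m2_def by (intro sums_mult2 summable_sums sm2)
  \<comment> \<open>The series of \<open>m1\<close> is shifted by one index so that all three terms
    of the equation carry r^(n + 1); its constant coefficient is that of sin at 0 and
    vanishes.\<close>
  have "(\<lambda>n. diffs a n * r ^ n) sums m1 r" unfolding m1_def by (intro summable_sums sm1)
  then have "(\<lambda>n. diffs a (Suc n) * r ^ Suc n) sums (m1 r - diffs a 0 * r ^ 0)"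
   using sums_Suc_iff[of "\<lambda>n. diffs a n * r ^ n"] by (simp add: diff_eq_eq)
  moreover have "diffs a 0 = 0" by (simp add: diffs_def a_def cos_coeff_def)
  ultimately have "(\<lambda>n. diffs a (Suc n) * r ^ Suc n) sums m1 r" by simp
  then have B: "(\<lambda>n. (s + 1) * (diffs a (Suc n) * r ^ Suc n)) sums ((s + 1) * m1 r)" by (rule sums_mult)
  have C: "(\<lambda>n. a n * r ^ n * r) sums (m r * r)" by (intro sums_mult2 ms)
  have "(\<lambda>n. (diffs (diffs a) n * r ^ n * r + (s + 1) * (diffs a (Suc n) * r ^ Suc n)) + a n * r ^ n * r) sums (m2 r * r + (s + 1) * m1 r + m r * r)"
   by (intro sums_add A B C)
  moreover have "(diffs (diffs a) n * r ^ n * r + (s + 1) * (diffs a (Suc n) * r ^ Suc n)) + a n * r ^ n * r = 0" for n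
  proof -
   have "(diffs (diffs a) n * r ^ n * r + (s + 1) * (diffs a (Suc n) * r ^ Suc n)) + a n * r ^ n * r =
     ((real n + 2) * (real n + s + 2) * a (n + 2) + a n) * r ^ Suc n"
    by (simp add: diffs_def algebra_simps)
   then show ?thesis using rec[of n] by simp
  qed
  ultimately have "m2 r * r + (s + 1) * m1 r + m r * r = 0" using sums_unique2[OF _ sums_zero] by auto
  then show ?thesis by (simp add: mult_ac)
 qed
 have mb: "\<bar>m r\<bar> \<le> 1" for r unfolding m_def by (rule iso_integral_abs_le) auto
 have lip: "\<bar>m r - m t\<bar> \<le> \<bar>r - t\<bar>" for r t
 proof -
  have c: "\<bar>cos x - cos y\<bar> \<le> \<bar>x - y\<bar>" for x y :: real
  proof -
   have "cos x - cos y = 2 * sin ((x + y) / 2) * sin ((y - x) / 2)" by (rule cos_diff_cos)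
   then have "\<bar>cos x - cos y\<bar> = 2 * \<bar>sin ((x + y) / 2)\<bar> * \<bar>sin ((y - x) / 2)\<bar>" by (simp add: abs_mult)
   also have "\<dots> \<le> 2 * 1 * \<bar>(y - x) / 2\<bar>" by (intro mult_mono abs_sin_x_le_abs_x) auto
   finally show ?thesis by simp
  qed
  have "\<bar>m r - m t\<bar> = \<bar>\<integral>y. cos (r * y $ i) - cos (t * y $ i) \<partial>\<mu>\<bar>" unfolding m_def using cb by simp
  also have "\<dots> \<le> \<bar>r - t\<bar>"
  proof (rule iso_integral_abs_le)
   fix y :: "real^'n" assume y: "norm y \<le> 1"
   have "\<bar>cos (r * y $ i) - cos (t * y $ i)\<bar> \<le> \<bar>r - t\<bar> * \<bar>y $ i\<bar>"
    using c[of "r * y $ i" "t * y $ i"] by (simp add: left_diff_distrib[symmetric] abs_mult)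
   also have "\<dots> \<le> \<bar>r - t\<bar>" using abs_component_le_1[OF y] by (intro mult_left_le) auto
   finally show "\<bar>cos (r * y $ i) - cos (t * y $ i)\<bar> \<le> \<bar>r - t\<bar>" .
  qed measurable
  finally show ?thesis .
 qed
 \<comment> \<open>The profile inherits the Lipschitz constant 1 from cos, since |y_i| is at most 1;
   this bounds the difference quotients and hence the derivative.\<close>
 have m1b: "\<bar>m1 r\<bar> \<le> 1" for r
 proof -
  have "((\<lambda>h. (m (r + h) - m r) / h) \<longlongrightarrow> m1 r) (at 0)" using d1[of r] by (simp add: DERIV_def)
  then have "((\<lambda>h. \<bar>(m (r + h) - m r) / h\<bar>) \<longlongrightarrow> \<bar>m1 r\<bar>) (at 0)" by (rule tendsto_rabs)
  moreover have "\<forall>\<^sub>F h in at 0. \<bar>(m (r + h) - m r) / h\<bar> \<le> 1"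
   using eventually_neq_at_within[of 0]
  proof eventually_elim
   case (elim h)
   then show ?case using lip[of "r + h" r] by (simp add: divide_le_eq_1)
  qed
  ultimately show ?thesis by (rule tendsto_upperbound) simp
 qed
 have chr: "(\<integral>y. cos (\<xi> \<bullet> y) \<partial>\<mu>) = m (norm \<xi>)" for \<xi>
 proof (cases "\<xi> = 0")
  case True
  then show ?thesis by (simp add: m_def)
 next
  case False
  then have "(\<integral>y. cos (\<xi> \<bullet> y) \<partial>\<mu>) = (\<integral>y. cos (norm \<xi> * (y \<bullet> (\<xi> /\<^sub>R norm \<xi>))) \<partial>\<mu>)"
  proof (intro Bochner_Integration.integral_cong refl)
   fix y
   have "norm \<xi> * (y \<bullet> (\<xi> /\<^sub>R norm \<xi>)) = \<xi> \<bullet> y" using False by (simp add: inner_commute)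
   then show "cos (\<xi> \<bullet> y) = cos (norm \<xi> * (y \<bullet> (\<xi> /\<^sub>R norm \<xi>)))" by simp
  qed
  also have "\<dots> = m (norm \<xi>)"
   unfolding m_def using False by (subst iso_integral_inner[where i=i and g="\<lambda>x. cos (norm \<xi> * x)"]) auto
  finally show ?thesis .
 qed
 show ?thesis using d1 d2 ode mb m1b chr by blast
qed

lemma iso_sin: "(\<integral>y. sin (\<xi> \<bullet> y) \<partial>\<mu>) = 0"
proof -
 have f: "orthogonal_transformation (uminus :: real^'n \<Rightarrow> real^'n)"
  by (auto simp: orthogonal_transformation_def linear_uminus module_hom_uminus intro!: linearI)
 have "(\<integral>y. sin (\<xi> \<bullet> y) \<partial>\<mu>) = (\<integral>y. sin (\<xi> \<bullet> y) \<partial>distr \<mu> borel uminus)" by (simp only: iso_rot[OF f])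
 also have "\<dots> = (\<integral>y. - sin (\<xi> \<bullet> y) \<partial>\<mu>)"
  by (subst integral_distr) (auto simp: measurable_cong_sets[OF iso_sets refl])
 finally show ?thesis by simp
qed

end

section \<open>An oscillatory integral\<close>

lemma set_integrable_powr_exp:
 fixes a e :: real
 assumes a: "a > -1" and e: "e > 0"
 shows "set_integrable lborel {0<..} (\<lambda>r. r powr a * exp (- (e * r)))"
proof -
 have "(\<lambda>t. complex_of_real t powr (complex_of_real (a + 1) - 1) / of_real (exp (e * t))) absolutely_integrable_on {0<..}"
  by (rule absolutely_integrable_Gamma_integral) (use assms in auto)
 then have "set_integrable lebesgue {0<..} (\<lambda>t. norm (complex_of_real t powr (complex_of_real (a + 1) - 1) / of_real (exp (e * t))))"
  using absolutely_integrable_norm by (simp add: comp_def)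
 then have "set_integrable lebesgue {0<..} (\<lambda>r. r powr a * exp (- (e * r)))"
  by (rule set_integrable_cong[THEN iffD1, rotated -1])
    (auto simp: norm_divide norm_powr_real_powr exp_minus field_simps)
 moreover have "(\<lambda>r::real. indicator {0<..} r *\<^sub>R (r powr a * exp (- (e * r)))) \<in> borel_measurable borel"
  by measurable
 ultimately show ?thesis
  unfolding set_integrable_def by (simp add: integrable_completion)
qed

lemma norm_exp_minus_one_minus_le: "norm (exp z - 1 - z) \<le> (norm z)^2 * exp (norm z)" for z :: complex
proof -
 have "norm (exp z - 1 - z) \<le> exp \<bar>Re z\<bar> * (norm z)^2"
  using Taylor_exp[of z 1] by (simp add: power2_eq_square diff_diff_eq)
 also have "\<dots> \<le> exp (norm z) * (norm z)^2" by (intro mult_right_mono) (auto simp: abs_Re_le_cmod)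
 finally show ?thesis by (simp add: mult.commute)
qed

text \<open>A Laplace transform written on the upper half-plane: for w = b + i e the exponential is
  the damping exp (- e r) times the oscillation with frequency b, so the boundary e -> 0 is the
  undamped integral.\<close>

definition half_laplace :: "(real \<Rightarrow> complex) \<Rightarrow> complex \<Rightarrow> complex" where
 "half_laplace f w = (LINT r:{0<..}|lborel. f r * exp (\<i> * of_real r * w))"

lemma set_integrable_half_laplace:
 assumes f[measurable]: "set_borel_measurable borel {0<..} f" and fb: "\<And>r. r > 0 \<Longrightarrow> norm (f r) \<le> c * r powr a"
  and a: "a > -1" and w: "Im w > 0"
 shows "set_integrable lborel {0<..} (\<lambda>r. f r * exp (\<i> * of_real r * w))"
proof (rule set_integrable_bound[OF set_integrable_mult_right[OF set_integrable_powr_exp[OF a w], of c]])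
 have "(\<lambda>r. (indicator {0<..} r *\<^sub>R f r) * exp (\<i> * of_real r * w)) \<in> borel_measurable borel"
  using f unfolding set_borel_measurable_def by measurable
 then show "set_borel_measurable lborel {0<..} (\<lambda>r. f r * exp (\<i> * of_real r * w))"
  by (simp add: set_borel_measurable_def)
 show "AE r in lborel. r \<in> {0<..} \<longrightarrow> norm (f r * exp (\<i> * of_real r * w)) \<le> norm (c * (r powr a * exp (- (Im w * r))))"
 proof (intro AE_I2 impI)
  fix r :: real assume "r \<in> {0<..}"
  then have "norm (f r * exp (\<i> * of_real r * w)) \<le> c * r powr a * exp (- (Im w * r))"
   using fb[of r] by (auto simp: norm_mult mult_ac intro!: mult_right_mono)
  then show "norm (f r * exp (\<i> * of_real r * w)) \<le> norm (c * (r powr a * exp (- (Im w * r))))"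
   by (simp add: mult.assoc)
 qed
qed

text \<open>Differentiation under the integral sign with an explicit second-order remainder.
  Restricting |h| to less than Im w / 2 leaves half of the exponential decay, which pays for the
  growth exp (r |h|) of the remainder.\<close>

lemma has_field_derivative_half_laplace:
 assumes f: "set_borel_measurable borel {0<..} f" and fb: "\<And>r. r > 0 \<Longrightarrow> norm (f r) \<le> r powr a"
  and a: "a > -1" and w: "Im w > 0"
 shows "(half_laplace f has_field_derivative half_laplace (\<lambda>r. \<i> * of_real r * f r) w) (at w)"
proof -
 let ?e = "Im w / 2" and ?D = "half_laplace (\<lambda>r. \<i> * of_real r * f r) w"
 define C where "C = (LINT r:{0<..}|lborel. r powr (a + 2) * exp (- (?e * r)))"
 have e: "?e > 0" using w by simp
 have intC: "set_integrable lborel {0<..} (\<lambda>r. r powr (a + 2) * exp (- (?e * r)))"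
  by (rule set_integrable_powr_exp) (use a e in auto)
 have int0: "set_integrable lborel {0<..} (\<lambda>r. f r * exp (\<i> * of_real r * v))" if "Im v > 0" for v
  by (rule set_integrable_half_laplace[OF f _ a that, of 1]) (use fb in auto)
 have f1: "set_borel_measurable borel {0<..} (\<lambda>r. \<i> * of_real r * f r)"
 proof -
  have "(\<lambda>r. \<i> * of_real r * (indicator {0<..} r *\<^sub>R f r)) \<in> borel_measurable borel"
   using f unfolding set_borel_measurable_def by measurable
  then show ?thesis by (simp add: set_borel_measurable_def mult_ac)
 qed
 have int1: "set_integrable lborel {0<..} (\<lambda>r. \<i> * of_real r * f r * exp (\<i> * of_real r * w))"
 proof (rule set_integrable_half_laplace[OF f1 _ _ w, of 1 "a + 1"])
  fix r :: real assume "r > 0"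
  then show "norm (\<i> * of_real r * f r) \<le> 1 * r powr (a + 1)"
   using fb[of r] by (simp add: norm_mult powr_add mult.commute)
 qed (use a in auto)
 have est: "norm (half_laplace f (w + h) - half_laplace f w - h * ?D) \<le> (norm h)^2 * C"
  if h: "norm h < ?e" for h
 proof -
  have wh: "Im (w + h) > 0" using h abs_Im_le_cmod[of h] w by simp
  define X where "X r = f r * exp (\<i> * of_real r * (w + h))" for r :: real
  define Y where "Y r = f r * exp (\<i> * of_real r * w)" for r :: real
  define Z where "Z r = \<i> * of_real r * f r * exp (\<i> * of_real r * w)" for r :: real
  have iX: "set_integrable lborel {0<..} X" unfolding X_def by (rule int0[OF wh])
  have iY: "set_integrable lborel {0<..} Y" unfolding Y_def by (rule int0[OF w])
  have iZ: "set_integrable lborel {0<..} (\<lambda>r. h * Z r)"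
   using int1 unfolding Z_def[symmetric] by (rule set_integrable_mult_right)
  have iXYZ: "set_integrable lborel {0<..} (\<lambda>r. X r - Y r - h * Z r)" by (intro set_integral_diff(1) iX iY iZ)
  have "half_laplace f (w + h) - half_laplace f w - h * ?D = (LINT r:{0<..}|lborel. X r - Y r - h * Z r)"
   unfolding half_laplace_def X_def[symmetric] Y_def[symmetric] Z_def[symmetric]
   by (simp add: set_integral_diff(2)[OF set_integral_diff(1)[OF iX iY] iZ] set_integral_diff(2)[OF iX iY])
  also have "norm \<dots> \<le> (LINT r:{0<..}|lborel. (norm h)^2 * (r powr (a + 2) * exp (- (?e * r))))"
   unfolding set_lebesgue_integral_def
  proof (rule Bochner_Integration.integral_norm_bound_integral)
   show "integrable lborel (\<lambda>r. indicat_real {0<..} r *\<^sub>R (X r - Y r - h * Z r))"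
    using iXYZ by (simp add: set_integrable_def)
   show "integrable lborel (\<lambda>r. indicat_real {0<..} r *\<^sub>R ((norm h)^2 * (r powr (a + 2) * exp (- (?e * r)))))"
    using set_integrable_mult_right[OF intC, of "(norm h)^2"] by (simp add: set_integrable_def)
   fix r :: real
   show "norm (indicat_real {0<..} r *\<^sub>R (X r - Y r - h * Z r))
     \<le> indicat_real {0<..} r *\<^sub>R ((norm h)^2 * (r powr (a + 2) * exp (- (?e * r))))"
   proof (cases "r > 0")
    case True
    let ?z = "\<i> * of_real r * h"
    have z: "norm ?z = r * norm h" using True by (simp add: norm_mult)
    have "X r - Y r - h * Z r = f r * exp (\<i> * of_real r * w) * (exp ?z - 1 - ?z)"
     by (simp add: X_def Y_def Z_def ring_distribs exp_add)
    also have "norm \<dots> \<le> r powr a * exp (- (Im w * r)) * ((r * norm h)^2 * exp (r * norm h))"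
     unfolding norm_mult
     by (intro mult_mono) (use fb[OF True] norm_exp_minus_one_minus_le[of ?z] True in \<open>auto simp: norm_mult mult.commute\<close>)
    also have "\<dots> \<le> r powr a * exp (- (Im w * r)) * ((r * norm h)^2 * exp (r * ?e))"
     using h True by (intro mult_left_mono) auto
    also have "\<dots> = (norm h)^2 * (r powr (a + 2) * (exp (- (Im w * r)) * exp (r * ?e)))"
     using True by (simp add: powr_add power_mult_distrib powr_numeral mult_ac)
    also have "exp (- (Im w * r)) * exp (r * ?e) = exp (- (?e * r))"
     by (simp add: exp_add[symmetric] field_simps)
    finally show ?thesis using True by simp
   qed auto
  qed
  also have "\<dots> = (norm h)^2 * C" by (simp add: C_def)
  finally show ?thesis .
 qed
 have "C \<ge> 0" unfolding C_def set_lebesgue_integral_def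
  by (intro Bochner_Integration.integral_nonneg) auto
 show ?thesis
  unfolding DERIV_def
 proof (rule LIM_zero_cancel)
  show "((\<lambda>h. (half_laplace f (w + h) - half_laplace f w) / h - ?D) \<longlongrightarrow> 0) (at 0)"
  proof (rule Lim_null_comparison)
   have "\<forall>\<^sub>F h in at 0. h \<in> ball 0 ?e - {0::complex}"
    by (intro eventually_at_in_open) (use e in auto)
   then show "\<forall>\<^sub>F h in at 0. norm ((half_laplace f (w + h) - half_laplace f w) / h - ?D) \<le> norm h * C"
   proof eventually_elim
    case (elim h)
    then have "norm (half_laplace f (w + h) - half_laplace f w - h * ?D) / norm h \<le> (norm h)^2 * C / norm h"
     using est[of h] by (intro divide_right_mono) auto
    then show ?case using elim
     by (simp add: norm_divide[symmetric] diff_divide_distrib power2_eq_square)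
   qed
   show "((\<lambda>h::complex. norm h * C) \<longlongrightarrow> 0) (at 0)"
    by (rule tendsto_eq_intros refl | simp)+
  qed
 qed
qed

text \<open>An integration by parts organised as one primitive: \<open>G\<close>, equal to r^(s + 1)
  exp (i r w) (m' - i w m), vanishes at 0 and at infinity, and the equation of m eliminates m'' from
  its derivative. What remains, \<open>g\<close>, is a combination of the two integrands of the
  claim.\<close>

lemma half_laplace_ode:
 fixes m m1 m2 :: "real \<Rightarrow> real"
 assumes s: "s > 0"
  and d1: "\<And>r. r > 0 \<Longrightarrow> (m has_real_derivative m1 r) (at r)"
  and d2: "\<And>r. r > 0 \<Longrightarrow> (m1 has_real_derivative m2 r) (at r)"
  and ode: "\<And>r. r > 0 \<Longrightarrow> r * m2 r + (s + 1) * m1 r + r * m r = 0"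
  and b0: "\<And>r. r > 0 \<Longrightarrow> \<bar>m r\<bar> \<le> 1" and b1: "\<And>r. r > 0 \<Longrightarrow> \<bar>m1 r\<bar> \<le> 1"
  and w: "Im w > 0"
 shows "(1 - w\<^sup>2) * half_laplace (\<lambda>r. of_real (r powr (s + 1) * m r)) w =
   - \<i> * w * (of_real s + 1) * half_laplace (\<lambda>r. of_real (r powr s * m r)) w"
proof -
 have cm: "continuous_on {0<..} m"
  by (rule DERIV_continuous_on) (auto intro!: DERIV_subset[OF d1])
 have meas: "set_borel_measurable borel {0<..} (\<lambda>r. complex_of_real (r powr a * m r))" for a
  unfolding set_borel_measurable_def
  by (intro borel_measurable_continuous_on_indicator continuous_intros cm) auto
 have bd: "norm (complex_of_real (r powr a * m r)) \<le> 1 * r powr a" if "r > 0" for r a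
  using b0[OF that] by (simp add: norm_mult mult_left_le)
 have int: "set_integrable lborel {0<..} (\<lambda>r. of_real (r powr a * m r) * exp (\<i> * of_real r * w))" if "a > -1" for a
  by (rule set_integrable_half_laplace[OF meas bd that w])
 define E where "E r = exp (\<i> * of_real r * w)" for r :: real
 define G where "G r = of_real (r powr (s + 1)) * E r * (of_real (m1 r) - \<i> * w * of_real (m r))" for r
 define g where "g r = - (1 - w\<^sup>2) * (of_real (r powr (s + 1) * m r) * E r) - \<i> * w * (of_real s + 1) * (of_real (r powr s * m r) * E r)" for r
 have nE: "norm (E r) = exp (- (Im w * r))" for r by (simp add: E_def)
 have Gb: "norm (G r) \<le> (1 + norm w) * (r powr (s + 1) * exp (- (Im w * r)))" if "r > 0" for r
 proof -
  have "norm (of_real (m1 r) - \<i> * w * of_real (m r)) \<le> 1 + norm w"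
   using b0[OF that] b1[OF that]
   by (intro order_trans[OF norm_triangle_ineq4] add_mono) (auto simp: norm_mult mult_left_le)
  then show ?thesis
   unfolding G_def norm_mult nE
   by (subst mult.commute) (auto intro!: mult_mono)
 qed
 have "(LBINT r=ereal 0..\<infinity>. g r) = 0 - 0"
 proof (rule interval_integral_FTC_integrable)
  show "(G has_vector_derivative g r) (at r)" if "ereal 0 < ereal r" for r
  proof -
   have r: "r > 0" using that by simp
   have dm: "((\<lambda>r. complex_of_real (m r)) has_vector_derivative of_real (m1 r)) (at r)"
    using d1[OF r] by (intro has_vector_derivative_of_real) (simp add: has_real_derivative_iff_has_vector_derivative)
   have dm1: "((\<lambda>r. complex_of_real (m1 r)) has_vector_derivative of_real (m2 r)) (at r)"
    using d2[OF r] by (intro has_vector_derivative_of_real) (simp add: has_real_derivative_iff_has_vector_derivative)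
   have dp: "((\<lambda>r. complex_of_real (r powr (s + 1))) has_vector_derivative of_real ((s + 1) * r powr s)) (at r)"
    using has_real_derivative_powr[OF r, of "s + 1"] by (intro has_vector_derivative_of_real) (simp add: has_real_derivative_iff_has_vector_derivative)
   have dE: "(E has_vector_derivative (\<i> * w * E r)) (at r)"
    unfolding E_def
    by (rule has_vector_derivative_real_field) (auto intro!: derivative_eq_intros)
   have "(G has_vector_derivative
     (of_real (r powr (s + 1)) * E r * (of_real (m2 r) - \<i> * w * of_real (m1 r)) +
      (of_real (r powr (s + 1)) * (\<i> * w * E r) + of_real ((s + 1) * r powr s) * E r) * (of_real (m1 r) - \<i> * w * of_real (m r)))) (at r)"
    unfolding G_def
    by (intro has_vector_derivative_mult has_vector_derivative_diff has_vector_derivative_mult_right dm dm1 dp dE)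
   also have "(of_real (r powr (s + 1)) * E r * (of_real (m2 r) - \<i> * w * of_real (m1 r)) +
      (of_real (r powr (s + 1)) * (\<i> * w * E r) + of_real ((s + 1) * r powr s) * E r) * (of_real (m1 r) - \<i> * w * of_real (m r))) = g r"
   proof -
    have p: "r powr (s + 1) = r powr s * r" using r by (simp add: powr_add)
    have m2: "r * m2 r = - (s + 1) * m1 r - r * m r" using ode[OF r] by linarith
    have "of_real r * of_real (m2 r) = - (of_real s + 1) * complex_of_real (m1 r) - of_real r * of_real (m r)"
     using arg_cong[OF m2, of complex_of_real] by simp
    then have "of_real (r powr s) * (of_real r * of_real (m2 r)) * E r = of_real (r powr s) * (- (of_real s + 1) * complex_of_real (m1 r) - of_real r * of_real (m r)) * E r"
     by simp
    then show ?thesis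
     unfolding g_def p of_real_mult of_real_add of_real_1 by (simp add: algebra_simps power2_eq_square)
   qed
   finally show ?thesis .
  qed
  show "isCont g r" if "ereal 0 < ereal r" for r
  proof -
   have "isCont m r" using d1[of r] that by (auto intro: DERIV_isCont)
   then show ?thesis unfolding g_def E_def using that by (auto intro!: continuous_intros)
  qed
  have "set_integrable lborel {0<..} g"
   unfolding g_def E_def using s
   by (intro set_integral_diff set_integrable_mult_right int) auto
  then show "set_integrable lborel (einterval (ereal 0) \<infinity>) g"
   unfolding einterval_eq .
  have "(G \<longlongrightarrow> 0) (at_right 0)"
  proof (rule Lim_null_comparison)
   show "\<forall>\<^sub>F r in at_right 0. norm (G r) \<le> (1 + norm w) * (r powr (s + 1) * exp (- (Im w * r)))"
    using eventually_at_right_less[of "0::real"] by eventually_elim (use Gb in auto)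
   have "((\<lambda>r::real. r powr (s + 1)) \<longlongrightarrow> 0) (at_right 0)" using s by real_asymp
   then have "((\<lambda>r. (1 + norm w) * (r powr (s + 1) * exp (- (Im w * r)))) \<longlongrightarrow> (1 + norm w) * (0 * exp (- (Im w * 0)))) (at_right 0)"
    by (intro tendsto_intros)
   then show "((\<lambda>r. (1 + norm w) * (r powr (s + 1) * exp (- (Im w * r)))) \<longlongrightarrow> 0) (at_right 0)" by simp
  qed
  then show "((G \<circ> real_of_ereal) \<longlongrightarrow> 0) (at_right (ereal 0))" by (simp add: ereal_tendsto_simps)
  have "(G \<longlongrightarrow> 0) at_top"
  proof (rule Lim_null_comparison)
   show "\<forall>\<^sub>F r in at_top. norm (G r) \<le> (1 + norm w) * (r powr (s + 1) * exp (- (Im w * r)))"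
    using eventually_gt_at_top[of "0::real"] by eventually_elim (use Gb in auto)
   have "((\<lambda>r::real. r powr (s + 1) * exp (- (Im w * r))) \<longlongrightarrow> 0) at_top" using s w by real_asymp
   then show "((\<lambda>r. (1 + norm w) * (r powr (s + 1) * exp (- (Im w * r)))) \<longlongrightarrow> 0) at_top"
    by (rule tendsto_mult_right_zero)
  qed
  then show "((G \<circ> real_of_ereal) \<longlongrightarrow> 0) (at_left \<infinity>)" by (simp add: ereal_tendsto_simps)
 qed simp
 then have "(LINT r:{0<..}|lborel. g r) = 0"
  by (simp add: interval_lebesgue_integral_def einterval_eq)
 moreover have "(LINT r:{0<..}|lborel. g r) = - (1 - w\<^sup>2) * half_laplace (\<lambda>r. of_real (r powr (s + 1) * m r)) w
   - \<i> * w * (of_real s + 1) * half_laplace (\<lambda>r. of_real (r powr s * m r)) w"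
  unfolding g_def half_laplace_def E_def using s
  by (subst set_integral_diff(2))
    (auto simp del: of_real_mult intro!: set_integrable_mult_right int)
 ultimately show ?thesis by (simp add: algebra_simps)
qed

text \<open>The number 1 - w^2 meets the branch cut of the principal power only when w is real with
  |w| at least 1, so these powers are holomorphic on the upper half-plane.\<close>

lemma one_minus_square_not_nonpos:
 assumes "Im w > 0"
 shows "1 - w\<^sup>2 \<notin> \<real>\<^sub>\<le>\<^sub>0"
proof
 assume "1 - w\<^sup>2 \<in> \<real>\<^sub>\<le>\<^sub>0"
 then have *: "Im (w^2) = 0" "Re (w^2) \<ge> 1" by (auto simp: complex_nonpos_Reals_iff)
 then have "Re w = 0" using assms by (simp add: power2_eq_square)
 then show False using * by (simp add: power2_eq_square) (smt (verit) zero_le_square)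
qed

text \<open>Re-expressed through \<open>Y = half_laplace (r\<^sup>s m)\<close>, the equation of \<open>m\<close> becomes the first-order equation
 \<open>(1 - w\<^sup>2) Y' = (s + 1) w Y\<close>, so \<open>Y\<close> is a real multiple of \<open>(1 - w\<^sup>2)\<close> to the power \<open>-(s + 1) / 2\<close>,
 which is real on \<open>(-1, 1)\<close>; hence the real part of a primitive of \<open>\<i> Y\<close> is constant there.\<close>

theorem oscillatory_integral_limit:
 fixes m m1 m2 :: "real \<Rightarrow> real"
 assumes s: "s > 0"
  and d1: "\<And>r. r > 0 \<Longrightarrow> (m has_real_derivative m1 r) (at r)"
  and d2: "\<And>r. r > 0 \<Longrightarrow> (m1 has_real_derivative m2 r) (at r)"
  and ode: "\<And>r. r > 0 \<Longrightarrow> r * m2 r + (s + 1) * m1 r + r * m r = 0"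
  and b0: "\<And>r. r > 0 \<Longrightarrow> \<bar>m r\<bar> \<le> 1" and b1: "\<And>r. r > 0 \<Longrightarrow> \<bar>m1 r\<bar> \<le> 1"
 defines "F \<equiv> \<lambda>e b. LINT r:{0<..}|lborel. r powr (s - 1) * exp (- (e * r)) * (m r * cos (r * b))"
 shows "\<exists>C. (\<forall>b. \<bar>b\<bar> < 1 \<longrightarrow> ((\<lambda>e. F e b) \<longlongrightarrow> C) (at_right 0)) \<and>
   (\<forall>\<rho><1. \<exists>K. \<forall>b e. \<bar>b\<bar> \<le> \<rho> \<and> 0 < e \<and> e \<le> 1 \<longrightarrow> \<bar>F e b\<bar> \<le> K)"
proof -
 let ?U = "{w. Im w > 0}"
 let ?p = "(of_real s + 1) / 2 :: complex"
 define H where "H = half_laplace (\<lambda>r. of_real (r powr (s - 1) * m r))"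
 define Y where "Y = half_laplace (\<lambda>r. of_real (r powr s * m r))"
 have cm: "continuous_on {0<..} m"
  by (rule DERIV_continuous_on) (auto intro!: DERIV_subset[OF d1])
 have meas: "set_borel_measurable borel {0<..} (\<lambda>r. complex_of_real (r powr a * m r))" for a
  unfolding set_borel_measurable_def
  by (intro borel_measurable_continuous_on_indicator continuous_intros cm) auto
 have bd: "norm (complex_of_real (r powr a * m r)) \<le> r powr a" if "r > 0" for r a
  using b0[OF that] by (simp add: norm_mult mult_left_le)
 have shift: "half_laplace (\<lambda>r. \<i> * of_real r * of_real (r powr a * m r)) w = \<i> * half_laplace (\<lambda>r. of_real (r powr (a + 1) * m r)) w" for a w
 proof -
  have "half_laplace (\<lambda>r. \<i> * of_real r * of_real (r powr a * m r)) w =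
    (LINT r:{0<..}|lborel. \<i> * (of_real (r powr (a + 1) * m r) * exp (\<i> * of_real r * w)))"
   unfolding half_laplace_def by (intro set_lebesgue_integral_cong) (auto simp: powr_add mult_ac)
  then show ?thesis by (simp add: half_laplace_def)
 qed
 have dH: "(H has_field_derivative \<i> * Y w) (at w)" if "Im w > 0" for w
  using has_field_derivative_half_laplace[OF meas bd _ that, of "s - 1"] s
  unfolding H_def Y_def shift by simp
 have dY: "(Y has_field_derivative (of_real s + 1) * w * Y w / (1 - w\<^sup>2)) (at w)" if "Im w > 0" for w
 proof -
  have nz: "1 - w\<^sup>2 \<noteq> 0" using one_minus_square_not_nonpos[OF that] by auto
  define X where "X = half_laplace (\<lambda>r. of_real (r powr (s + 1) * m r)) w"
  have "(1 - w\<^sup>2) * X = - \<i> * w * (of_real s + 1) * Y w"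
   unfolding X_def Y_def by (rule half_laplace_ode[OF s d1 d2 ode b0 b1 that])
  then have "\<i> * ((1 - w\<^sup>2) * X) = \<i> * (- \<i> * w * (of_real s + 1) * Y w)" by simp
  also have "\<dots> = (of_real s + 1) * w * Y w" by (simp add: algebra_simps)
  finally have "\<i> * X * (1 - w\<^sup>2) = (of_real s + 1) * w * Y w" by (simp only: mult_ac)
  then have "\<i> * X = (of_real s + 1) * w * Y w / (1 - w\<^sup>2)" using nonzero_eq_divide_eq[OF nz] by blast
  then show ?thesis
   using has_field_derivative_half_laplace[OF meas bd _ that, of s] s
   unfolding Y_def shift X_def by simp
 qed
 have UC: "convex ?U" "open ?U" by (auto simp: convex_halfspace_Im_gt open_halfspace_Im_gt)
 have zero: "(of_real s + 1) * w * y / q * P + (?p * (P / q) * (- 2 * w)) * y = 0" if "q \<noteq> 0" for w y P q :: complex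
  using that by (simp add: field_simps)
 have "\<exists>\<kappa>. \<forall>w\<in>?U. Y w * (1 - w\<^sup>2) powr ?p = \<kappa>"
 proof (rule has_field_derivative_zero_constant[OF UC(1)])
  fix w assume "w \<in> ?U"
  then have w: "Im w > 0" by simp
  have np: "1 - w\<^sup>2 \<notin> \<real>\<^sub>\<le>\<^sub>0" by (rule one_minus_square_not_nonpos[OF w])
  then have nz: "1 - w\<^sup>2 \<noteq> 0" by auto
  have "((\<lambda>w. Y w * (1 - w\<^sup>2) powr ?p) has_field_derivative
    (of_real s + 1) * w * Y w / (1 - w\<^sup>2) * (1 - w\<^sup>2) powr ?p + (?p * (1 - w\<^sup>2) powr (?p - 1) * (- 2 * w)) * Y w) (at w)"
   by (rule derivative_eq_intros dY[OF w] refl np | simp)+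
  moreover have "(1 - w\<^sup>2) powr (?p - 1) = (1 - w\<^sup>2) powr ?p / (1 - w\<^sup>2)"
   using nz by (simp add: powr_diff)
  ultimately have "((\<lambda>w. Y w * (1 - w\<^sup>2) powr ?p) has_field_derivative 0) (at w)"
   using zero[OF nz, of w "Y w" "(1 - w\<^sup>2) powr ?p"] by simp
  then show "((\<lambda>w. Y w * (1 - w\<^sup>2) powr ?p) has_field_derivative 0) (at w within ?U)"
   by (rule has_field_derivative_at_within)
 qed
 then obtain \<kappa> where \<kappa>: "\<And>w. Im w > 0 \<Longrightarrow> Y w * (1 - w\<^sup>2) powr ?p = \<kappa>" by auto
 \<comment> \<open>At w = i the exponential is exp (- r) and 1 - w^2 = 2, both real and positive, so
   the constant \<kappa> is real.\<close>
 define k where "k = (LINT r:{0<..}|lborel. r powr s * m r * exp (- r)) * 2 powr ((s + 1) / 2)"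
 have kk: "\<kappa> = of_real k"
 proof -
  have "Y \<i> = (LINT r:{0<..}|lborel. complex_of_real (r powr s * m r * exp (- r)))"
  proof -
   have "exp (\<i> * of_real r * \<i>) = complex_of_real (exp (- r))" for r
   proof -
    have "\<i> * of_real r * \<i> = complex_of_real (- r)" by (simp add: complex_eq_iff)
    then show ?thesis by (simp only: exp_of_real)
   qed
   then show ?thesis unfolding Y_def half_laplace_def by simp
  qed
  also have "\<dots> = of_real (LINT r:{0<..}|lborel. r powr s * m r * exp (- r))"
   by (rule set_integral_complex_of_real)
  finally show ?thesis
   using \<kappa>[of \<i>] by (simp add: k_def powr_of_real[symmetric])
 qed
 \<comment> \<open>The plane slit along the two real rays |x| >= 1. It is starlike about 0, so
   \<open>?g\<close> has a primitive A on it. It contains the upper half-plane and, decisively, also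
   the interval (-1, 1), so A is continuous across the boundary piece on which the limit e -> 0 is
   taken.\<close>
 let ?S = "{w. 1 - w\<^sup>2 \<notin> \<real>\<^sub>\<le>\<^sub>0} :: complex set"
 let ?g = "\<lambda>w. (1 - w\<^sup>2) powr (- ?p)"
 have oS: "open ?S"
 proof -
  have "open ((\<lambda>w. 1 - w\<^sup>2) -` (- \<real>\<^sub>\<le>\<^sub>0) :: complex set)"
   by (intro open_vimage continuous_intros) auto
  then show ?thesis by (simp add: vimage_def)
 qed
 have sS: "starlike ?S"
  unfolding starlike_def
 proof (intro bexI ballI subsetI)
  show "(0::complex) \<in> ?S" by simp
  fix x y assume x: "x \<in> ?S" and "y \<in> closed_segment 0 x"
  then obtain u where u: "0 \<le> u" "u \<le> 1" "y = of_real u * x" by (auto simp: in_segment scaleR_conv_of_real)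
  show "y \<in> ?S"
  proof (rule CollectI, rule notI)
   assume "1 - y\<^sup>2 \<in> \<real>\<^sub>\<le>\<^sub>0"
   then have *: "u^2 * Im (x^2) = 0" "u^2 * Re (x^2) \<ge> 1"
    unfolding u(3) power_mult_distrib by (auto simp: complex_nonpos_Reals_iff simp flip: of_real_power)
   then have "u \<noteq> 0" by auto
   then have im: "Im (x^2) = 0" using * by simp
   have "Re (x^2) > 0" using *(2) by (smt (verit) mult_nonneg_nonpos zero_le_power2)
   then have "u^2 * Re (x^2) \<le> 1 * Re (x^2)"
    using u by (intro mult_right_mono) (auto simp: power_le_one)
   then have "Re (x^2) \<ge> 1" using *(2) by simp
   then show False using im x by (auto simp: complex_nonpos_Reals_iff)
  qed
 qed
 have gd: "?g field_differentiable at w" if "w \<in> ?S" for w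
 proof -
  have "1 - w\<^sup>2 \<notin> \<real>\<^sub>\<le>\<^sub>0" using that by simp
  then have "(?g has_field_derivative (- ?p) * (1 - w\<^sup>2) powr (- ?p - 1) * (- (2 * w))) (at w)"
   by (auto intro!: derivative_eq_intros)
  then show ?thesis by (auto simp: field_differentiable_def)
 qed
 have cg: "continuous_on ?S ?g"
  by (rule continuous_at_imp_continuous_on) (use gd field_differentiable_imp_continuous_at in blast)
 then obtain A where A: "\<And>w. w \<in> ?S \<Longrightarrow> (A has_field_derivative ?g w) (at w)"
  using holomorphic_starlike_primitive[OF cg sS oS finite.emptyI] gd by auto
 have Yg: "Y w = of_real k * ?g w" if "Im w > 0" for w
 proof -
  have "1 - w\<^sup>2 \<noteq> 0" using one_minus_square_not_nonpos[OF that] by auto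
  then show ?thesis using \<kappa>[OF that] kk by (simp add: powr_minus field_simps)
 qed
 have "\<exists>c. \<forall>w\<in>?U. H w - \<i> * of_real k * A w = c"
 proof (rule has_field_derivative_zero_constant[OF UC(1)])
  fix w assume "w \<in> ?U"
  then have w: "Im w > 0" by simp
  then have "((\<lambda>w. H w - \<i> * of_real k * A w) has_field_derivative \<i> * Y w - \<i> * of_real k * ?g w) (at w)"
   using one_minus_square_not_nonpos[OF w] by (intro derivative_intros dH A DERIV_cmult) auto
  then have "((\<lambda>w. H w - \<i> * of_real k * A w) has_field_derivative 0) (at w)"
   using Yg[OF w] by simp
  then show "((\<lambda>w. H w - \<i> * of_real k * A w) has_field_derivative 0) (at w within ?U)"
   by (rule has_field_derivative_at_within)
 qed
 then obtain c where c: "\<And>w. Im w > 0 \<Longrightarrow> H w = c + \<i> * of_real k * A w" by (force simp: diff_eq_eq)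
 have FH: "F e b = Re (H (Complex b e))" if "e > 0" for e b
 proof -
  have i: "set_integrable lborel {0<..} (\<lambda>r. of_real (r powr (s - 1) * m r) * exp (\<i> * of_real r * Complex b e))"
   by (rule set_integrable_half_laplace[OF meas, of _ 1 "s - 1"]) (use bd s that in auto)
  have "Re (H (Complex b e)) = (LINT r:{0<..}|lborel. Re (of_real (r powr (s - 1) * m r) * exp (\<i> * of_real r * Complex b e)))"
   unfolding H_def half_laplace_def set_lebesgue_integral_def
   using i unfolding set_integrable_def by (subst integral_Re[symmetric]) auto
  also have "\<dots> = F e b"
   unfolding F_def by (intro set_lebesgue_integral_cong) (auto simp: exp_eq_polar Re_exp mult_ac)
  finally show ?thesis by simp
 qed
 have Sreal: "of_real b \<in> ?S" if "\<bar>b\<bar> < 1" for b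
 proof -
  have "b^2 < 1" using that by (simp add: abs_square_less_1)
  then show ?thesis by (simp add: complex_nonpos_Reals_iff)
 qed
 have ImA: "Im (A (of_real b)) = Im (A 0)" if b: "\<bar>b\<bar> < 1" for b
 proof -
  have "\<exists>c. \<forall>x\<in>{-1<..<1::real}. Im (A (of_real x)) = c"
  proof (rule has_field_derivative_zero_constant)
   fix x :: real assume x: "x \<in> {-1<..<1}"
   then have x': "\<bar>x\<bar> < 1" by auto
   have "((\<lambda>x. A (of_real x)) has_vector_derivative ?g (of_real x)) (at x)"
    by (rule has_vector_derivative_real_field) (rule A[OF Sreal[OF x']])
   then have "((\<lambda>x. Im (A (of_real x))) has_real_derivative Im (?g (of_real x))) (at x)"
    by (rule has_vector_derivative_complex_iff[THEN iffD1, THEN conjunct2])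
   moreover have "?g (of_real x) = of_real ((1 - x\<^sup>2) powr (- ((s + 1) / 2)))"
   proof -
    have "x^2 < 1" using x' by (simp add: abs_square_less_1)
    then show ?thesis
     using powr_of_real[of "1 - x\<^sup>2" "- ((s + 1) / 2)"] by simp
   qed
   ultimately show "((\<lambda>x. Im (A (of_real x))) has_field_derivative 0) (at x within {-1<..<1})"
    by (simp add: has_field_derivative_at_within)
  qed simp
  then obtain c where "\<forall>x\<in>{-1<..<1::real}. Im (A (of_real x)) = c" by blast
  from bspec[OF this, of b] bspec[OF this, of 0] b show ?thesis by (auto simp: abs_less_iff)
 qed
 have contA: "isCont A w" if "w \<in> ?S" for w using A[OF that] by (rule DERIV_isCont)
 have cA: "continuous_on ?S A" by (rule continuous_at_imp_continuous_on) (use contA in auto)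
 show ?thesis
 proof (rule exI[of _ "Re c - k * Im (A 0)"], intro conjI allI impI)
  fix b :: real assume b: "\<bar>b\<bar> < 1"
  have "((\<lambda>e. Complex b e) \<longlongrightarrow> Complex b 0) (at_right 0)"
   by (intro tendsto_Complex tendsto_intros)
  then have "((\<lambda>e. A (Complex b e)) \<longlongrightarrow> A (Complex b 0)) (at_right 0)"
   using contA[OF Sreal[OF b]] by (intro isCont_tendsto_compose[of _ A]) (auto simp: complex_of_real_def)
  then have "((\<lambda>e. Re (c + \<i> * of_real k * A (Complex b e))) \<longlongrightarrow> Re (c + \<i> * of_real k * A (Complex b 0))) (at_right 0)"
   by (intro tendsto_intros)
  moreover have "Re (c + \<i> * of_real k * A (Complex b 0)) = Re c - k * Im (A 0)"
   using ImA[OF b] by (simp add: complex_of_real_def)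
  moreover have "\<forall>\<^sub>F e in at_right 0. Re (c + \<i> * of_real k * A (Complex b e)) = F e b"
   using eventually_at_right_less[of "0::real"] by eventually_elim (simp add: FH c)
  ultimately show "((\<lambda>e. F e b) \<longlongrightarrow> Re c - k * Im (A 0)) (at_right 0)"
   by (simp only: Lim_transform_eventually)
 next
  fix \<rho> :: real assume \<rho>: "\<rho> < 1"
  \<comment> \<open>The rectangle includes the edge e = 0. There |b| <= \<rho> < 1 keeps it off the
    slits, so it is a compact subset of the domain of A and the bound is uniform down to e =
    0.\<close>
  let ?K = "(\<lambda>(b, e). Complex b e) ` ({-\<rho>..\<rho>} \<times> {0..1})"
  have "compact ?K"
   unfolding case_prod_unfold
   by (intro compact_continuous_image compact_Times continuous_intros) auto
  moreover have "?K \<subseteq> ?S"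
  proof clarify
   fix b e :: real assume be: "b \<in> {-\<rho>..\<rho>}" "e \<in> {0..1}" "1 - (Complex b e)\<^sup>2 \<in> \<real>\<^sub>\<le>\<^sub>0"
   show False
   proof (cases "e = 0")
    case True
    have "\<bar>b\<bar> < 1" using be \<rho> by auto
    from Sreal[OF this] show False using be True by (simp add: complex_of_real_def)
   next
    case False
    then show False using one_minus_square_not_nonpos[of "Complex b e"] be by auto
   qed
  qed
  ultimately have "compact (A ` ?K)"
   by (rule compact_continuous_image[OF continuous_on_subset[OF cA], rotated])
  then have "bounded (A ` ?K)" by (rule compact_imp_bounded)
  then obtain B where B: "\<And>z. z \<in> A ` ?K \<Longrightarrow> norm z \<le> B" unfolding bounded_iff by blast
  show "\<exists>K. \<forall>b e. \<bar>b\<bar> \<le> \<rho> \<and> 0 < e \<and> e \<le> 1 \<longrightarrow> \<bar>F e b\<bar> \<le> K"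
  proof (intro exI allI impI)
   fix b e :: real assume be: "\<bar>b\<bar> \<le> \<rho> \<and> 0 < e \<and> e \<le> 1"
   have "(b, e) \<in> {-\<rho>..\<rho>} \<times> {0..1}" using be by auto
   then have nA: "norm (A (Complex b e)) \<le> B" by (intro B) force
   have "\<bar>F e b\<bar> \<le> norm (H (Complex b e))" using be by (simp add: FH abs_Re_le_cmod)
   also have "H (Complex b e) = c + \<i> * of_real k * A (Complex b e)" using be by (intro c) simp
   also have "norm \<dots> \<le> norm c + \<bar>k\<bar> * norm (A (Complex b e))"
    by (intro order_trans[OF norm_triangle_ineq]) (simp add: norm_mult)
   also have "\<dots> \<le> norm c + \<bar>k\<bar> * B" using nA by (intro add_left_mono mult_left_mono) auto
   finally show "\<bar>F e b\<bar> \<le> norm c + \<bar>k\<bar> * B" .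
  qed
 qed
qed

section \<open>Gaussian test functions\<close>

text \<open>The polynomial factor in the k-th derivative of exp (- \<tau> t^2 + i a t), of Hermite
  type; the linear polynomial i a - 2 \<tau> t is the logarithmic derivative of that
  exponential.\<close>

primrec gauss_poly :: "real \<Rightarrow> real \<Rightarrow> nat \<Rightarrow> complex poly" where
 "gauss_poly \<tau> a 0 = 1"
| "gauss_poly \<tau> a (Suc k) = pderiv (gauss_poly \<tau> a k) + [:\<i> * of_real a, - 2 * of_real \<tau>:] * gauss_poly \<tau> a k"

definition gauss1 :: "real \<Rightarrow> real \<Rightarrow> nat \<Rightarrow> real \<Rightarrow> complex" where
 "gauss1 \<tau> a k t = poly (gauss_poly \<tau> a k) (of_real t) * exp (- of_real \<tau> * (of_real t)^2 + \<i> * of_real a * of_real t)"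

lemma gauss1_deriv: "(gauss1 \<tau> a k has_vector_derivative gauss1 \<tau> a (Suc k) t) (at t)"
proof -
 have "((\<lambda>z. poly (gauss_poly \<tau> a k) z * exp (- of_real \<tau> * z^2 + \<i> * of_real a * z)) has_field_derivative
   poly (gauss_poly \<tau> a (Suc k)) (of_real t) * exp (- of_real \<tau> * (of_real t)^2 + \<i> * of_real a * of_real t)) (at (of_real t))"
  by (auto intro!: derivative_eq_intros simp: algebra_simps)
 then show ?thesis
  unfolding gauss1_def by (rule has_vector_derivative_real_field)
qed

lemma continuous_gauss1: "continuous_on S (gauss1 \<tau> a k)"
 unfolding gauss1_def by (intro continuous_intros)

lemma poly_growth_bound:
 fixes p :: "complex poly"
 shows "\<exists>C N. C \<ge> 0 \<and> (\<forall>t::real. norm (poly p (of_real t)) \<le> C * (1 + \<bar>t\<bar>) ^ N)"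
proof (induction p)
 case 0
 show ?case by (intro exI[of _ 0]) auto
next
 case (pCons a p)
 then obtain C N where C: "C \<ge> 0" "\<And>t::real. norm (poly p (of_real t)) \<le> C * (1 + \<bar>t\<bar>) ^ N" by blast
 show ?case
 proof (intro exI[of _ "norm a + C"] exI[of _ "Suc N"] conjI allI)
  fix t :: real
  have "norm (poly (pCons a p) (of_real t)) \<le> norm a + \<bar>t\<bar> * norm (poly p (of_real t))"
   by (simp add: order_trans[OF norm_triangle_ineq] norm_mult)
  also have "\<dots> \<le> norm a * (1 + \<bar>t\<bar>) ^ Suc N + (1 + \<bar>t\<bar>) * (C * (1 + \<bar>t\<bar>) ^ N)"
  proof (intro add_mono mult_mono C)
   have "1 \<le> (1 + \<bar>t\<bar>) ^ Suc N" by (rule one_le_power) simp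
   then show "norm a \<le> norm a * (1 + \<bar>t\<bar>) ^ Suc N" using mult_left_mono[of 1 _ "norm a"] by fastforce
  qed auto
  also have "\<dots> = (norm a + C) * (1 + \<bar>t\<bar>) ^ Suc N" by (simp add: algebra_simps)
  finally show "norm (poly (pCons a p) (of_real t)) \<le> (norm a + C) * (1 + \<bar>t\<bar>) ^ Suc N" .
 qed (use C in auto)
qed

text \<open>With y = \<tau> (2 + t^2), the inequality 1 + |t| <= 2 + t^2 bounds the power by (y /
  \<tau>)^N, and y^N <= N! e^y is one term of the exponential series. The Gaussian cancels all of
  e^y except exp (2 \<tau>).\<close>

lemma poly_gauss_bound:
 assumes \<tau>: "\<tau> > (0::real)"
 shows "(1 + \<bar>t\<bar>) ^ N * exp (- (\<tau> * t^2)) \<le> exp (2 * \<tau>) * fact N / \<tau> ^ N"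
proof -
 let ?y = "\<tau> * (2 + t^2)"
 have y0: "?y \<ge> 0" using \<tau> by simp
 have "1 + \<bar>t\<bar> \<le> 2 + t^2"
  using sum_power2_ge_zero[of "\<bar>t\<bar> - 1/2" 0] by (simp add: power2_eq_square algebra_simps)
 then have "(1 + \<bar>t\<bar>) ^ N \<le> (2 + t^2) ^ N" by (intro power_mono) auto
 also have "\<dots> = ?y ^ N / \<tau> ^ N" using \<tau> by (simp add: power_mult_distrib)
 also have "?y ^ N \<le> fact N * exp ?y"
 proof -
  have "?y ^ N /\<^sub>R fact N \<le> (\<Sum>n. ?y ^ n /\<^sub>R fact n)"
   using sum_le_suminf[OF summable_exp_generic[of ?y], of "{N}"] y0 by (auto simp: inverse_eq_divide)
  then show ?thesis by (simp add: exp_def field_simps)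
 qed
 finally have "(1 + \<bar>t\<bar>) ^ N \<le> fact N * exp ?y / \<tau> ^ N" using \<tau> by (simp add: divide_right_mono)
 then have "(1 + \<bar>t\<bar>) ^ N * exp (- (\<tau> * t^2)) \<le> fact N * exp ?y / \<tau> ^ N * exp (- (\<tau> * t^2))"
  by (rule mult_right_mono) simp
 also have "\<dots> = exp (2 * \<tau>) * fact N / \<tau> ^ N"
 proof -
  have "exp ?y * exp (- (\<tau> * t^2)) = exp (2 * \<tau>)" by (simp add: exp_add[symmetric] algebra_simps)
  then show ?thesis by (simp add: mult_ac)
 qed
 finally show ?thesis .
qed

lemma gauss1_bound:
 assumes \<tau>: "\<tau> > 0"
 shows "\<exists>C. C \<ge> 0 \<and> (\<forall>t. (1 + \<bar>t\<bar>) ^ m * norm (gauss1 \<tau> a k t) \<le> C)"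
proof -
 obtain C N where C: "C \<ge> 0" "\<And>t::real. norm (poly (gauss_poly \<tau> a k) (of_real t)) \<le> C * (1 + \<bar>t\<bar>) ^ N"
  using poly_growth_bound by blast
 have e: "norm (exp (- of_real \<tau> * (of_real t)^2 + \<i> * of_real a * of_real t)) = exp (- (\<tau> * t^2))" for t :: real
  by (simp add: norm_exp_eq_Re power2_eq_square)
 show ?thesis
 proof (intro exI conjI allI)
  fix t :: real
  have "(1 + \<bar>t\<bar>) ^ m * norm (gauss1 \<tau> a k t) = (1 + \<bar>t\<bar>) ^ m * (norm (poly (gauss_poly \<tau> a k) (of_real t)) * exp (- (\<tau> * t^2)))"
   unfolding gauss1_def norm_mult e ..
  also have "\<dots> \<le> (1 + \<bar>t\<bar>) ^ m * ((C * (1 + \<bar>t\<bar>) ^ N) * exp (- (\<tau> * t^2)))"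
   by (intro mult_left_mono mult_right_mono C) auto
  also have "\<dots> = C * ((1 + \<bar>t\<bar>) ^ (m + N) * exp (- (\<tau> * t^2)))" by (simp add: power_add)
  also have "\<dots> \<le> C * (exp (2 * \<tau>) * fact (m + N) / \<tau> ^ (m + N))"
   by (intro mult_left_mono poly_gauss_bound[OF \<tau>] C)
  finally show "(1 + \<bar>t\<bar>) ^ m * norm (gauss1 \<tau> a k t) \<le> C * (exp (2 * \<tau>) * fact (m + N) / \<tau> ^ (m + N))" .
 qed (use C \<tau> in auto)
qed

definition gauss_wave :: "real \<Rightarrow> real^'n \<Rightarrow> real^'n \<Rightarrow> complex" where
 "gauss_wave \<tau> x \<xi> = exp (- of_real (\<tau> * (norm \<xi>)^2) + \<i> * of_real (x \<bullet> \<xi>))"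

lemma gauss_wave_prod: "gauss_wave \<tau> x \<xi> = (\<Prod>j\<in>UNIV. exp (- of_real \<tau> * (of_real (\<xi> $ j))^2 + \<i> * of_real (x $ j) * of_real (\<xi> $ j)))"
proof -
 have "- of_real (\<tau> * (norm \<xi>)^2) + \<i> * of_real (x \<bullet> \<xi>) =
  (\<Sum>j\<in>UNIV. - of_real \<tau> * (of_real (\<xi> $ j))^2 + \<i> * of_real (x $ j) * of_real (\<xi> $ j) :: complex)"
  unfolding power2_norm_eq_inner inner_vec_def
  by (simp add: sum.distrib sum_distrib_left power2_eq_square sum_negf sum_subtractf mult.assoc)
 then show ?thesis by (simp add: gauss_wave_def exp_sum)
qed

text \<open>This lets a joint polynomial weight be distributed over the coordinates, so that rapid
  decay of a product follows from decay of its one-dimensional factors.\<close>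

lemma one_plus_norm_le_prod: "1 + norm (x::real^'n) \<le> (\<Prod>j\<in>UNIV. 1 + \<bar>x $ j\<bar>)"
proof -
 have "1 + (\<Sum>j\<in>S. \<bar>x $ j\<bar>) \<le> (\<Prod>j\<in>S. 1 + \<bar>x $ j\<bar>)" if "finite S" for S
  using that
 proof (induction S)
  case (insert i S)
  have "1 \<le> (\<Prod>j\<in>S. 1 + \<bar>x $ j\<bar>)" by (rule prod_ge_1) auto
  then have "\<bar>x $ i\<bar> * 1 \<le> \<bar>x $ i\<bar> * (\<Prod>j\<in>S. 1 + \<bar>x $ j\<bar>)" by (intro mult_left_mono) auto
  then show ?case using insert by (simp add: algebra_simps)
 qed simp
 from this[of UNIV] norm_le_l1_cart[of x] show ?thesis by simp
qed

lemma schwartz_gauss_wave: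
 assumes \<tau>: "\<tau> > 0"
 shows "schwartz (gauss_wave \<tau> (x::real^'n))"
proof -
 \<comment> \<open>The wave is a product over coordinates, so an iterated partial derivative depends
   only on how often each coordinate occurs in the list.\<close>
 define D where "D l \<xi> = (\<Prod>j\<in>UNIV. gauss1 \<tau> (x $ j) (count_list l j) (\<xi> $ j))" for l and \<xi> :: "real^'n"
 have D0: "D [] = gauss_wave \<tau> x"
  by (rule ext) (simp add: D_def gauss_wave_prod gauss1_def)
 have Dd: "((\<lambda>t. D l (\<xi> + t *\<^sub>R axis i 1)) has_vector_derivative D (i # l) \<xi>) (at 0)" for l i \<xi>
 proof -
  let ?c = "\<Prod>j\<in>UNIV - {i}. gauss1 \<tau> (x $ j) (count_list l j) (\<xi> $ j)"
  have D1: "D l (\<xi> + t *\<^sub>R axis i 1) = gauss1 \<tau> (x $ i) (count_list l i) (\<xi> $ i + t) * ?c" for t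
   unfolding D_def by (subst prod.remove[of _ i]) (auto simp: axis_def intro!: prod.cong)
  have D2: "D (i # l) \<xi> = gauss1 \<tau> (x $ i) (Suc (count_list l i)) (\<xi> $ i) * ?c"
   unfolding D_def by (subst prod.remove[of _ i]) (auto intro!: prod.cong)
  have "(gauss1 \<tau> (x $ i) (count_list l i) has_vector_derivative gauss1 \<tau> (x $ i) (Suc (count_list l i)) (\<xi> $ i + 0)) (at (\<xi> $ i + 0))"
   by (rule gauss1_deriv)
  moreover have "((\<lambda>t. \<xi> $ i + t) has_vector_derivative 1) (at 0)"
   by (auto intro!: derivative_eq_intros simp: has_real_derivative_iff_has_vector_derivative[symmetric])
  ultimately have "((\<lambda>t. gauss1 \<tau> (x $ i) (count_list l i) (\<xi> $ i + t)) has_vector_derivative gauss1 \<tau> (x $ i) (Suc (count_list l i)) (\<xi> $ i)) (at 0)"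
   using vector_diff_chain_at[of "\<lambda>t. \<xi> $ i + t" 1 0 "gauss1 \<tau> (x $ i) (count_list l i)"] by (simp add: comp_def)
  then show ?thesis unfolding D1 D2 by (rule has_vector_derivative_mult_left)
 qed
 have Dc: "continuous_on UNIV (D l)" for l
  unfolding D_def
  by (intro continuous_on_prod continuous_on_compose2[OF continuous_gauss1] continuous_intros) auto
 have Db: "bounded (range (\<lambda>\<xi>. (1 + norm \<xi>) ^ m *\<^sub>R D l \<xi>))" for l m
 proof -
  have "\<forall>j. \<exists>C. C \<ge> 0 \<and> (\<forall>t. (1 + \<bar>t\<bar>) ^ m * norm (gauss1 \<tau> (x $ j) (count_list l j) t) \<le> C)"
   using gauss1_bound[OF \<tau>] by blast
  then obtain C where C: "\<And>j t. (1 + \<bar>t\<bar>) ^ m * norm (gauss1 \<tau> (x $ j) (count_list l j) t) \<le> C j"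
   by metis
  have "norm ((1 + norm \<xi>) ^ m *\<^sub>R D l \<xi>) \<le> (\<Prod>j\<in>UNIV. C j)" for \<xi>
  proof -
   have "norm ((1 + norm \<xi>) ^ m *\<^sub>R D l \<xi>) = (1 + norm \<xi>) ^ m * (\<Prod>j\<in>UNIV. norm (gauss1 \<tau> (x $ j) (count_list l j) (\<xi> $ j)))"
    by (simp add: D_def prod_norm power_abs abs_of_nonneg)
   also have "\<dots> \<le> (\<Prod>j\<in>UNIV. 1 + \<bar>\<xi> $ j\<bar>) ^ m * (\<Prod>j\<in>UNIV. norm (gauss1 \<tau> (x $ j) (count_list l j) (\<xi> $ j)))"
    by (intro mult_right_mono power_mono one_plus_norm_le_prod prod_nonneg) auto
   also have "\<dots> = (\<Prod>j\<in>UNIV. (1 + \<bar>\<xi> $ j\<bar>) ^ m * norm (gauss1 \<tau> (x $ j) (count_list l j) (\<xi> $ j)))"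
    by (simp add: prod.distrib prod_power_distrib)
   also have "\<dots> \<le> (\<Prod>j\<in>UNIV. C j)" by (intro prod_mono) (auto intro: C)
   finally show ?thesis .
  qed
  then show ?thesis unfolding bounded_iff by blast
 qed
 show ?thesis unfolding schwartz_def
  by (intro exI[of _ D] conjI allI D0 Dd Dc Db)
qed

lemma integral_lborel_prod_vec:
 fixes h :: "'n::finite \<Rightarrow> real \<Rightarrow> complex"
 assumes int: "\<And>j. integrable lborel (h j)"
 shows "(\<integral>\<xi>. (\<Prod>j\<in>UNIV. h j (\<xi> $ j)) \<partial>(lborel :: (real^'n) measure)) = (\<Prod>j\<in>UNIV. \<integral>t. h j t \<partial>lborel)"
proof -
 \<comment> \<open>\<open>lborel\<close> is an image of a product measure indexed by basis vectors;
   \<open>ix\<close> recovers the coordinate index, which turns products over \<open>Basis\<close>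
   into products over \<open>UNIV\<close>.\<close>
 define ix where "ix b = (THE i. b = axis i (1::real))" for b :: "real^'n"
 have ix: "ix (axis i 1) = i" for i unfolding ix_def by (simp add: axis_eq_axis)
 have re: "(\<Prod>b\<in>Basis. F (ix b) b) = (\<Prod>j\<in>UNIV. F j (axis j 1))" for F :: "'n \<Rightarrow> real^'n \<Rightarrow> complex"
 proof -
  have B: "(Basis :: (real^'n) set) = (\<lambda>j. axis j 1) ` UNIV" by (auto simp: Basis_vec_def)
  show ?thesis unfolding B by (subst prod.reindex) (auto simp: inj_on_def axis_eq_axis ix)
 qed
 interpret product_sigma_finite "\<lambda>_::real^'n. lborel :: real measure" ..
 have hm[measurable]: "h j \<in> borel_measurable borel" for j using int[of j] by auto
 have m: "(\<lambda>\<xi>::real^'n. \<Prod>j\<in>UNIV. h j (\<xi> $ j)) \<in> borel_measurable borel"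
  by measurable
 have "(\<integral>\<xi>. (\<Prod>j\<in>UNIV. h j (\<xi> $ j)) \<partial>(lborel :: (real^'n) measure)) =
   (\<integral>f. (\<Prod>j\<in>UNIV. h j ((\<Sum>b\<in>Basis. f b *\<^sub>R b) $ j)) \<partial>(\<Pi>\<^sub>M b\<in>(Basis::(real^'n) set). lborel))"
  by (subst lborel_eq, subst integral_distr) (use m in auto)
 also have "\<dots> = (\<integral>f. (\<Prod>b\<in>Basis. h (ix b) (f b)) \<partial>(\<Pi>\<^sub>M b\<in>(Basis::(real^'n) set). lborel))"
 proof (rule Bochner_Integration.integral_cong[OF refl])
  fix f :: "real^'n \<Rightarrow> real"
  have "(\<Sum>b\<in>Basis. f b *\<^sub>R b) $ j = f (axis j 1)" for j
  proof -
   have "(\<Sum>b\<in>Basis. f b *\<^sub>R b) $ j = (\<Sum>b\<in>Basis. f b *\<^sub>R b) \<bullet> axis j 1" by (simp add: inner_axis)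
   also have "\<dots> = f (axis j 1)" by (subst inner_sum_left_Basis) (auto simp: axis_in_Basis_iff)
   finally show ?thesis .
  qed
  then show "(\<Prod>j\<in>UNIV. h j ((\<Sum>b\<in>Basis. f b *\<^sub>R b) $ j)) = (\<Prod>b\<in>Basis. h (ix b) (f b))"
   by (subst re[of "\<lambda>j b. h j (f b)"]) simp
 qed
 also have "\<dots> = (\<Prod>b\<in>(Basis::(real^'n) set). \<integral>t. h (ix b) t \<partial>lborel)"
  by (rule product_integral_prod) (use int in auto)
 also have "\<dots> = (\<Prod>j\<in>UNIV. \<integral>t. h j t \<partial>lborel)"
  by (rule re[of "\<lambda>j b. \<integral>t. h j t \<partial>lborel"])
 finally show ?thesis .
qed

lemma gauss_fourier_1d:
 assumes \<tau>: "\<tau> > 0"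
 shows "integrable lborel (\<lambda>t::real. exp (- of_real \<tau> * (of_real t)^2 + \<i> * of_real a * of_real t))"
  and "(\<integral>t. exp (- of_real \<tau> * (of_real t)^2 + \<i> * of_real a * of_real t) \<partial>lborel) = of_real (sqrt (pi / \<tau>) * exp (- a\<^sup>2 / (4 * \<tau>)))"
proof -
 \<comment> \<open>Since \<tau> t^2 = (c t)^2 / 2, the substitution by c reduces the integral to the
   characteristic function of the standard normal distribution at a / c.\<close>
 let ?c = "sqrt (2 * \<tau>)"
 let ?u = "a / ?c"
 have c: "?c > 0" "?c^2 = 2 * \<tau>" using \<tau> by auto
 define N where "N t = std_normal_density t *\<^sub>R iexp (?u * t)" for t
 have iN: "integrable lborel N"
  unfolding N_def
  by (rule Bochner_Integration.integrable_bound[OF integrable_normal_moment[of 1 0 0]]) auto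
 have vN: "(\<integral>t. N t \<partial>lborel) = of_real (exp (- (?u^2) / 2))"
 proof -
  have "char std_normal_distribution ?u = (\<integral>t. N t \<partial>lborel)"
   unfolding char_def N_def by (subst integral_density) (auto simp: normal_density_nonneg)
  then show ?thesis by (simp add: char_std_normal_distribution)
 qed
 have rel: "exp (- of_real \<tau> * (of_real t)^2 + \<i> * of_real a * of_real t) = of_real (sqrt (2 * pi)) * N (0 + ?c * t)" for t :: real
 proof -
  have "(?c * t)^2 / 2 = \<tau> * t^2" using c by (simp add: power_mult_distrib)
  then have "std_normal_density (?c * t) = 1 / sqrt (2 * pi) * exp (- (\<tau> * t^2))"
   by (simp add: std_normal_density_def)
  moreover have "?u * (?c * t) = a * t" using c(1) \<tau> by simp
  ultimately have "N (0 + ?c * t) = of_real (1 / sqrt (2 * pi) * exp (- (\<tau> * t^2))) * exp (\<i> * of_real (a * t))"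
   unfolding N_def by (simp only: scaleR_conv_of_real add_0)
  moreover have "exp (- of_real \<tau> * (of_real t)^2 + \<i> * of_real a * of_real t) = of_real (exp (- (\<tau> * t^2))) * exp (\<i> * of_real (a * t))"
  proof -
   have "- of_real \<tau> * (of_real t)^2 = complex_of_real (- (\<tau> * t^2))" by simp
   then show ?thesis by (simp only: exp_add exp_of_real of_real_mult mult.assoc)
  qed
  moreover have "complex_of_real (sqrt (2 * pi)) \<noteq> 0" by simp
  ultimately show ?thesis by simp
 qed
 show "integrable lborel (\<lambda>t::real. exp (- of_real \<tau> * (of_real t)^2 + \<i> * of_real a * of_real t))"
  unfolding rel by (intro Bochner_Integration.integrable_mult_right lborel_integrable_real_affine iN) (use c in auto)
 have "(\<integral>t. N t \<partial>lborel) = \<bar>?c\<bar> *\<^sub>R (\<integral>t. N (0 + ?c * t) \<partial>lborel)"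
  by (rule lborel_integral_real_affine) (use c in auto)
 then have "(\<integral>t. N (0 + ?c * t) \<partial>lborel) = of_real (exp (- (?u^2) / 2) / ?c)"
  using c(1) vN by (simp add: scaleR_conv_of_real field_simps)
 moreover have "sqrt (2 * pi) * (exp (- (?u^2) / 2) / ?c) = sqrt (pi / \<tau>) * exp (- a\<^sup>2 / (4 * \<tau>))"
  using \<tau> c by (simp add: power_divide real_sqrt_divide real_sqrt_mult field_simps)
 ultimately show "(\<integral>t. exp (- of_real \<tau> * (of_real t)^2 + \<i> * of_real a * of_real t) \<partial>lborel) = of_real (sqrt (pi / \<tau>) * exp (- a\<^sup>2 / (4 * \<tau>)))"
  unfolding rel integral_mult_right_zero by (metis of_real_mult)
qed

lemma fourier_gauss_wave:
 assumes \<tau>: "\<tau> > 0"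
 shows "fourier (gauss_wave \<tau> x) (y::real^'n) = of_real (sqrt (pi / \<tau>) ^ CARD('n) * exp (- (norm (x - y))\<^sup>2 / (4 * \<tau>)))"
proof -
 have "gauss_wave \<tau> x \<xi> * cis (- (\<xi> \<bullet> y)) = gauss_wave \<tau> (x - y) \<xi>" for \<xi>
  unfolding gauss_wave_def cis_conv_exp by (simp add: exp_add[symmetric] inner_diff_left inner_commute algebra_simps)
 then have "fourier (gauss_wave \<tau> x) y = (\<integral>\<xi>. gauss_wave \<tau> (x - y) \<xi> \<partial>lborel)"
  by (simp add: fourier_def)
 also have "\<dots> = (\<Prod>j\<in>UNIV. of_real (sqrt (pi / \<tau>) * exp (- ((x - y) $ j)\<^sup>2 / (4 * \<tau>))))"
  unfolding gauss_wave_prod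
  by (subst integral_lborel_prod_vec) (simp_all only: gauss_fourier_1d[OF \<tau>])
 also have "\<dots> = of_real (sqrt (pi / \<tau>) ^ CARD('n) * (\<Prod>j\<in>UNIV. exp (- ((x - y) $ j)\<^sup>2 / (4 * \<tau>))))"
  by (simp add: prod.distrib flip: of_real_prod)
 also have "(\<Prod>j\<in>UNIV. exp (- ((x - y) $ j)\<^sup>2 / (4 * \<tau>))) = exp (\<Sum>j\<in>UNIV. - ((x - y) $ j)\<^sup>2 / (4 * \<tau>))"
  by (simp add: exp_sum)
 also have "(\<Sum>j\<in>UNIV. - ((x - y) $ j)\<^sup>2 / (4 * \<tau>)) = - (norm (x - y))\<^sup>2 / (4 * \<tau>)"
  unfolding power2_norm_eq_inner inner_vec_def by (simp add: sum_divide_distrib power2_eq_square sum_negf)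
 finally show ?thesis .
qed

section \<open>Subordination: the exponential as a mixture of Gaussians\<close>

lemma gauss_primitive:
 "\<exists>E::real \<Rightarrow> real. (\<forall>x. (E has_real_derivative exp (- x\<^sup>2)) (at x)) \<and> (E \<longlongrightarrow> sqrt pi / 2) at_top \<and> (E \<longlongrightarrow> - (sqrt pi / 2)) at_bot"
proof -
 define E where "E x = (LBINT t=ereal 0..ereal x. exp (- t\<^sup>2))" for x :: real
 have d: "(E has_real_derivative exp (- x\<^sup>2)) (at x)" for x
 proof -
  let ?a = "- \<bar>x\<bar> - 1" and ?b = "\<bar>x\<bar> + 1"
  have "((\<lambda>u. LBINT t=ereal 0..ereal u. exp (- t\<^sup>2)) has_vector_derivative exp (- x\<^sup>2)) (at x within {?a..?b})"
   by (rule interval_integral_FTC2) (auto intro!: continuous_intros)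
  moreover have "at x within {?a..?b} = at x" by (rule at_within_interior) auto
  ultimately show ?thesis by (simp add: E_def[abs_def] has_real_derivative_iff_has_vector_derivative)
 qed
 have E0: "E 0 = 0" by (simp add: E_def)
 have odd: "E (- x) = - E x" for x
 proof -
  have "\<exists>c. \<forall>x\<in>UNIV. E x + E (- x) = c"
  proof (rule has_field_derivative_zero_constant)
   fix x :: real
   have "((\<lambda>x. E (- x)) has_real_derivative exp (- (- x)\<^sup>2) * (- 1)) (at x)"
    by (rule DERIV_chain2[OF d]) (auto intro!: derivative_eq_intros)
   then show "((\<lambda>x. E x + E (- x)) has_field_derivative 0) (at x within UNIV)"
    using DERIV_add[OF d[of x]] by fastforce
  qed simp
  then obtain c where c: "\<And>x. E x + E (- x) = c" by auto
  have "c = 0" using c[of 0] E0 by simp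
  then show ?thesis using c[of x] by simp
 qed
 have top: "(E \<longlongrightarrow> sqrt pi / 2) at_top"
 proof -
  let ?f = "\<lambda>x::real. indicator {0..} x *\<^sub>R exp (- x\<^sup>2)"
  have i: "integrable lborel ?f" and v: "(\<integral>x. ?f x \<partial>lborel) = sqrt pi / 2"
   using gaussian_moment_0 by (auto simp: has_bochner_integral_iff)
  have "((\<lambda>y. \<integral>x. indicator {..y} x *\<^sub>R ?f x \<partial>lborel) \<longlongrightarrow> sqrt pi / 2) at_top"
   unfolding v[symmetric] by (rule tendsto_integral_at_top[OF _ i]) simp
  moreover have "\<forall>\<^sub>F y in at_top. (\<integral>x. indicator {..y} x *\<^sub>R ?f x \<partial>lborel) = E y"
   using eventually_ge_at_top[of "0::real"]
  proof eventually_elim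
   case (elim y)
   have "E y = (LBINT t:{0..y}. exp (- t\<^sup>2))"
    unfolding E_def using elim by (rule interval_integral_Icc)
   also have "\<dots> = (\<integral>x. indicator {..y} x *\<^sub>R ?f x \<partial>lborel)"
    unfolding set_lebesgue_integral_def by (intro Bochner_Integration.integral_cong) (auto split: split_indicator)
   finally show ?case by simp
  qed
  ultimately show ?thesis by (rule Lim_transform_eventually)
 qed
 have bot: "(E \<longlongrightarrow> - (sqrt pi / 2)) at_bot"
 proof -
  have "((\<lambda>x. - E (- x)) \<longlongrightarrow> - (sqrt pi / 2)) at_bot"
   by (intro tendsto_minus filterlim_compose[OF top] filterlim_uminus_at_top_at_bot)
  then show ?thesis by (simp add: odd)
 qed
 show ?thesis using d top bot by blast
qed

text \<open>With c = r / 2 one has (v + c/v)^2 = v^2 + r^2 / (4 v^2) + r, and likewise with both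
  signs reversed. Hence an explicit primitive \<open>F\<close> is a combination of the Gaussian
  primitive at v + c/v and v - c/v: the terms with c / v^2 from the inner derivatives cancel. At v
  -> 0 these arguments diverge only if c > 0, which is why r = 0 is treated separately.\<close>

lemma exp_neg_subordination:
 fixes r :: real
 assumes r: "r \<ge> 0"
 shows "set_integrable lborel {0<..} (\<lambda>v. exp (- v\<^sup>2 - r\<^sup>2 / (4 * v^2)))"
  "(LINT v:{0<..}|lborel. exp (- v\<^sup>2 - r\<^sup>2 / (4 * v^2))) = sqrt pi / 2 * exp (- r)"
proof -
 let ?f = "\<lambda>v::real. exp (- v\<^sup>2 - r\<^sup>2 / (4 * v^2))"
 have "set_integrable lborel (einterval (ereal 0) \<infinity>) ?f \<and> (LBINT v=ereal 0..\<infinity>. ?f v) = sqrt pi / 2 * exp (- r)"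
 proof (cases "r = 0")
  case True
  have "set_integrable lborel {0<..} (\<lambda>v::real. exp (- v\<^sup>2)) \<and> (LINT v:{0<..}|lborel. exp (- v\<^sup>2)) = sqrt pi / 2"
  proof -
   have "has_bochner_integral lborel (\<lambda>x::real. indicator {0<..} x *\<^sub>R exp (- x\<^sup>2)) (sqrt pi / 2)"
   proof -
    have "AE x in lborel. indicator {0..} x *\<^sub>R exp (- x\<^sup>2) = indicator {0<..} x *\<^sub>R exp (- x\<^sup>2 :: real)"
     by (rule AE_mp[OF AE_lborel_singleton[of 0]], rule AE_I2) (auto split: split_indicator)
    then show ?thesis using gaussian_moment_0 by (subst has_bochner_integral_cong_AE[symmetric]) auto
   qed
   then show ?thesis by (simp add: has_bochner_integral_iff set_integrable_def set_lebesgue_integral_def)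
  qed
  then show ?thesis using True by (simp add: interval_lebesgue_integral_def einterval_eq del: zero_ereal_def)
 next
  case False
  define c where "c = r / 2"
  have c: "c > 0" using r False by (simp add: c_def)
  obtain E :: "real \<Rightarrow> real" where E: "\<And>x. (E has_real_derivative exp (- x\<^sup>2)) (at x)"
   "(E \<longlongrightarrow> sqrt pi / 2) at_top" "(E \<longlongrightarrow> - (sqrt pi / 2)) at_bot"
   using gauss_primitive by blast
  define F where "F v = (exp r * E (v + c / v) + exp (- r) * E (v - c / v)) / 2" for v
  let ?A = "(exp r * (sqrt pi / 2) + exp (- r) * (- (sqrt pi / 2))) / 2"
  let ?B = "(exp r * (sqrt pi / 2) + exp (- r) * (sqrt pi / 2)) / 2"
  have dF: "(F has_real_derivative ?f v) (at v)" if v: "v > 0" for v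
  proof -
   have s1: "- (v + c / v)\<^sup>2 = (- v\<^sup>2 - r\<^sup>2 / (4 * v^2)) - r" "- (v - c / v)\<^sup>2 = (- v\<^sup>2 - r\<^sup>2 / (4 * v^2)) + r"
    using v by (simp_all add: c_def power2_eq_square field_simps)
   have e1: "exp r * exp (- (v + c / v)\<^sup>2) = ?f v" "exp (- r) * exp (- (v - c / v)\<^sup>2) = ?f v"
    unfolding s1 by (simp_all add: exp_add[symmetric])
   have 1: "((\<lambda>v. E (v + c / v)) has_real_derivative exp (- (v + c / v)\<^sup>2) * (1 - c / v^2)) (at v)"
    by (rule DERIV_chain2[OF E(1)]) (use v in \<open>auto intro!: derivative_eq_intros simp: power2_eq_square\<close>)
   have 2: "((\<lambda>v. E (v - c / v)) has_real_derivative exp (- (v - c / v)\<^sup>2) * (1 + c / v^2)) (at v)"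
    by (rule DERIV_chain2[OF E(1)]) (use v in \<open>auto intro!: derivative_eq_intros simp: power2_eq_square\<close>)
   have "(F has_real_derivative (exp r * (exp (- (v + c / v)\<^sup>2) * (1 - c / v^2)) + exp (- r) * (exp (- (v - c / v)\<^sup>2) * (1 + c / v^2))) / 2) (at v)"
    unfolding F_def by (intro DERIV_cdivide DERIV_add DERIV_cmult 1 2)
   moreover have "(exp r * (exp (- (v + c / v)\<^sup>2) * (1 - c / v^2)) + exp (- r) * (exp (- (v - c / v)\<^sup>2) * (1 + c / v^2))) / 2 = ?f v"
    unfolding mult.assoc[symmetric] e1 by (simp add: algebra_simps)
   ultimately show ?thesis by simp
  qed
  have A: "(F \<longlongrightarrow> ?A) (at_right 0)"
  proof -
   have "filterlim (\<lambda>v. v + c / v) at_top (at_right 0)" "filterlim (\<lambda>v. v - c / v) at_bot (at_right 0)"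
    using c by real_asymp+
   then show ?thesis unfolding F_def
    by (intro tendsto_divide tendsto_add tendsto_mult tendsto_const filterlim_compose[OF E(2)] filterlim_compose[OF E(3)]) auto
  qed
  have B: "(F \<longlongrightarrow> ?B) at_top"
  proof -
   have "filterlim (\<lambda>v. v + c / v) at_top at_top" "filterlim (\<lambda>v. v - c / v) at_top at_top"
    using c by real_asymp+
   then show ?thesis unfolding F_def
    by (intro tendsto_divide tendsto_add tendsto_mult tendsto_const filterlim_compose[OF E(2)]) auto
  qed
  have "set_integrable lborel (einterval (ereal 0) \<infinity>) ?f" "(LBINT v=ereal 0..\<infinity>. ?f v) = ?B - ?A"
   by (rule interval_integral_FTC_nonneg[where F=F];
     use dF A B in \<open>auto simp: ereal_tendsto_simps intro!: continuous_intros\<close>)+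
  moreover have "?B - ?A = sqrt pi / 2 * exp (- r)" by (simp add: field_simps)
  ultimately show ?thesis by simp
 qed
 then show "set_integrable lborel {0<..} ?f" "(LINT v:{0<..}|lborel. ?f v) = sqrt pi / 2 * exp (- r)"
  by (simp_all add: interval_lebesgue_integral_def einterval_eq del: zero_ereal_def)
qed

section \<open>The heat kernel\<close>

lemma integral_exp_norm_square:
 "integrable lborel (\<lambda>z::real^'n. exp (- (norm z)\<^sup>2))" "(\<integral>z. exp (- (norm (z::real^'n))\<^sup>2) \<partial>lborel) = sqrt pi ^ CARD('n)"
proof -
 have "fourier (gauss_wave 1 (0::real^'n)) 0 = of_real (sqrt pi ^ CARD('n))"
  by (subst fourier_gauss_wave) auto
 moreover have "fourier (gauss_wave 1 (0::real^'n)) 0 = (\<integral>z. complex_of_real (exp (- (norm (z::real^'n))\<^sup>2)) \<partial>lborel)"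
  unfolding fourier_def gauss_wave_def by (simp flip: exp_of_real of_real_minus of_real_power)
 ultimately have "complex_of_real (\<integral>z. exp (- (norm (z::real^'n))\<^sup>2) \<partial>lborel) = of_real (sqrt pi ^ CARD('n))"
  by (simp only: integral_complex_of_real)
 then show v: "(\<integral>z. exp (- (norm (z::real^'n))\<^sup>2) \<partial>lborel) = sqrt pi ^ CARD('n)" by (simp only: of_real_eq_iff)
 \<comment> \<open>A non-integrable function has Bochner integral 0 by convention, so the nonzero
   value already proves integrability.\<close>
 show "integrable lborel (\<lambda>z::real^'n. exp (- (norm z)\<^sup>2))"
  by (rule ccontr) (use v not_integrable_integral_eq[of lborel "\<lambda>z::real^'n. exp (- (norm z)\<^sup>2)"] in auto)
qed

lemma nn_integral_exp_norm_square: "(\<integral>\<^sup>+z. ennreal (exp (- (norm (z::real^'n))\<^sup>2)) \<partial>lborel) = ennreal (sqrt pi ^ CARD('n))"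
 using integral_exp_norm_square[where 'n='n] by (subst nn_integral_eq_integral) auto

text \<open>The Fourier transform of the Gaussian wave, as a function of the distance to its centre.
  Its total mass is (2 pi)^d for this Fourier convention, and this is the origin of the constant (2
  pi)^d in all later limits.\<close>

definition heat :: "real \<Rightarrow> real^'n \<Rightarrow> real" where
 "heat \<tau> z = sqrt (pi / \<tau>) ^ CARD('n) * exp (- (norm z)\<^sup>2 / (4 * \<tau>))"

lemma heat_nonneg: "\<tau> > 0 \<Longrightarrow> heat \<tau> z \<ge> 0" by (simp add: heat_def)

lemma heat_measurable[measurable]: "heat \<tau> \<in> borel_measurable borel" unfolding heat_def by measurable

text \<open>The substitution y = x + 2 sqrt \<tau> z moves all dependence on \<tau> from the kernel
  into the argument of f, so the limit \<tau> -> 0 becomes a pointwise limit under a fixed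
  Gaussian.\<close>

lemma nn_integral_heat_rescale:
 fixes x :: "real^'n"
 assumes \<tau>: "\<tau> > 0" and f[measurable]: "f \<in> borel_measurable borel"
 shows "(\<integral>\<^sup>+y. f y * ennreal (heat \<tau> (x - y)) \<partial>lborel) =
  ennreal ((2 * sqrt pi) ^ CARD('n)) * (\<integral>\<^sup>+z. f (x + (2 * sqrt \<tau>) *\<^sub>R z) * ennreal (exp (- (norm z)\<^sup>2)) \<partial>lborel)"
proof -
 let ?c = "2 * sqrt \<tau>"
 let ?d = "CARD('n)"
 have c: "?c > 0" using \<tau> by simp
 have "(\<integral>\<^sup>+y. f y * ennreal (heat \<tau> (x - y)) \<partial>lborel) = (\<integral>\<^sup>+y. f y * ennreal (heat \<tau> (x - y)) \<partial>distr lborel borel (\<lambda>y. x + y))"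
  by (simp only: lborel_distr_plus)
 also have "\<dots> = (\<integral>\<^sup>+y. f (x + y) * ennreal (heat \<tau> y) \<partial>lborel)"
  by (subst nn_integral_distr) (auto simp: heat_def)
 also have "\<dots> = ennreal (?c ^ ?d) * (ennreal (1 / ?c ^ ?d) * (\<integral>\<^sup>+y. f (x + y) * ennreal (heat \<tau> y) \<partial>lborel))"
 proof -
  have "ennreal (?c ^ ?d) * ennreal (1 / ?c ^ ?d) = 1" using c by (subst ennreal_mult[symmetric]) auto
  then show ?thesis by (simp add: mult.assoc[symmetric])
 qed
 also have "ennreal (1 / ?c ^ ?d) * (\<integral>\<^sup>+y. f (x + y) * ennreal (heat \<tau> y) \<partial>lborel) = (\<integral>\<^sup>+z. f (x + ?c *\<^sub>R z) * ennreal (heat \<tau> (?c *\<^sub>R z)) \<partial>lborel)"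
  by (rule nn_integral_lborel_scaleR[OF c, symmetric]) measurable
 also have "\<dots> = (\<integral>\<^sup>+z. ennreal (sqrt (pi / \<tau>) ^ ?d) * (f (x + ?c *\<^sub>R z) * ennreal (exp (- (norm z)\<^sup>2))) \<partial>lborel)"
 proof (rule nn_integral_cong)
  fix z :: "real^'n"
  have "(norm (?c *\<^sub>R z))^2 / (4 * \<tau>) = (norm z)^2" using \<tau> by (simp add: power_mult_distrib)
  then have "heat \<tau> (?c *\<^sub>R z) = sqrt (pi / \<tau>) ^ ?d * exp (- (norm z)\<^sup>2)" by (simp add: heat_def)
  then show "f (x + ?c *\<^sub>R z) * ennreal (heat \<tau> (?c *\<^sub>R z)) = ennreal (sqrt (pi / \<tau>) ^ ?d) * (f (x + ?c *\<^sub>R z) * ennreal (exp (- (norm z)\<^sup>2)))"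
   using \<tau> by (simp add: ennreal_mult mult_ac)
 qed
 also have "\<dots> = ennreal (sqrt (pi / \<tau>) ^ ?d) * (\<integral>\<^sup>+z. f (x + ?c *\<^sub>R z) * ennreal (exp (- (norm z)\<^sup>2)) \<partial>lborel)"
  by (rule nn_integral_cmult) measurable
 finally have "(\<integral>\<^sup>+y. f y * ennreal (heat \<tau> (x - y)) \<partial>lborel) =
   (ennreal (?c ^ ?d) * ennreal (sqrt (pi / \<tau>) ^ ?d)) * (\<integral>\<^sup>+z. f (x + ?c *\<^sub>R z) * ennreal (exp (- (norm z)\<^sup>2)) \<partial>lborel)"
  by (simp only: mult.assoc)
 also have "ennreal (?c ^ ?d) * ennreal (sqrt (pi / \<tau>) ^ ?d) = ennreal ((2 * sqrt pi) ^ ?d)"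
 proof -
  have "?c * sqrt (pi / \<tau>) = 2 * sqrt pi" using \<tau> by (simp add: real_sqrt_divide)
  then have "?c ^ ?d * sqrt (pi / \<tau>) ^ ?d = (2 * sqrt pi) ^ ?d" by (simp only: power_mult_distrib[symmetric])
  then show ?thesis using c \<tau> by (subst ennreal_mult[symmetric]) auto
 qed
 finally show ?thesis .
qed

lemma nn_integral_heat:
 fixes x :: "real^'n"
 assumes \<tau>: "\<tau> > 0"
 shows "(\<integral>\<^sup>+y. ennreal (heat \<tau> (x - y)) \<partial>lborel) = ennreal ((2 * pi) ^ CARD('n))"
proof -
 have "(\<integral>\<^sup>+y. ennreal (heat \<tau> (x - y)) \<partial>lborel) = ennreal ((2 * sqrt pi) ^ CARD('n)) * ennreal (sqrt pi ^ CARD('n))"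
  using nn_integral_heat_rescale[OF \<tau>, of "\<lambda>_. 1" x] by (simp add: nn_integral_exp_norm_square)
 also have "\<dots> = ennreal ((2 * sqrt pi * sqrt pi) ^ CARD('n))"
  by (subst ennreal_mult[symmetric]) (auto simp: power_mult_distrib)
 also have "2 * sqrt pi * sqrt pi = 2 * pi" by simp
 finally show ?thesis .
qed

text \<open>By scaling, the product of \<open>heat \<tau> z\<close> and |z|^d depends only on v =
  sqrt (pi / \<tau>) |z|; it equals v^d exp (- v^2 / (4 pi)), which is bounded. This gives a
  constant independent of \<tau>.\<close>

lemma heat_le_norm_powr: "\<exists>C>0. \<forall>\<tau>>0. \<forall>z::real^'n. z \<noteq> 0 \<longrightarrow> heat \<tau> z \<le> C * norm z powr (- real CARD('n))"
proof -
 let ?d = "CARD('n)"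
 define C where "C = exp (2 * (1 / (4 * pi))) * fact ?d / (1 / (4 * pi)) ^ ?d"
 have C: "C > 0" by (simp add: C_def)
 have "heat \<tau> z \<le> C * norm z powr (- real ?d)" if \<tau>: "\<tau> > 0" and z: "z \<noteq> 0" for \<tau> and z :: "real^'n"
 proof -
  define v where "v = sqrt (pi / \<tau>) * norm z"
  have v0: "v \<ge> 0" using \<tau> by (simp add: v_def)
  have "v^2 = pi / \<tau> * (norm z)^2" using \<tau> by (simp add: v_def power_mult_distrib)
  then have e: "(norm z)^2 / (4 * \<tau>) = 1 / (4 * pi) * v^2" using \<tau> by (simp add: field_simps)
  have "heat \<tau> z * norm z ^ ?d = v ^ ?d * exp (- (1 / (4 * pi) * v^2))"
   using e by (simp add: heat_def v_def power_mult_distrib mult_ac)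
  also have "\<dots> \<le> (1 + \<bar>v\<bar>) ^ ?d * exp (- (1 / (4 * pi) * v^2))"
   using v0 by (intro mult_right_mono power_mono) auto
  also have "\<dots> \<le> C" unfolding C_def by (rule poly_gauss_bound) simp
  finally have "heat \<tau> z * norm z ^ ?d \<le> C" .
  then have "heat \<tau> z \<le> C / norm z ^ ?d" using z by (simp add: pos_le_divide_eq)
  also have "\<dots> = C * norm z powr (- real ?d)" using z by (simp add: powr_minus powr_realpow divide_inverse)
  finally show ?thesis .
 qed
 then show ?thesis using C by blast
qed

section \<open>The regularised kernel\<close>

lemma homogeneous_continuous:
 fixes F :: "real^'n \<Rightarrow> real"
 assumes F: "continuous_on (sphere 0 1) F"
 shows "continuous_on (- {0}) (\<lambda>x. norm x powr a * F (sgn x))"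
  and "(\<lambda>x. norm x powr a * F (sgn x)) \<in> borel_measurable borel"
proof -
 have sg: "continuous_on (- {0}) (sgn :: real^'n \<Rightarrow> real^'n)"
  unfolding sgn_div_norm by (intro continuous_intros) auto
 have "continuous_on (- {0}) (\<lambda>x. F (sgn x))"
  by (rule continuous_on_compose2[OF F sg]) (auto simp: norm_sgn split: if_splits)
 then show c: "continuous_on (- {0}) (\<lambda>x. norm x powr a * F (sgn x))"
  by (intro continuous_intros) auto
 have "(\<lambda>x. indicator (- {0}) x *\<^sub>R (norm x powr a * F (sgn x))) \<in> borel_measurable borel"
  by (rule borel_measurable_continuous_on_indicator[OF _ c]) auto
 moreover have "(\<lambda>x. indicator (- {0}) x *\<^sub>R (norm x powr a * F (sgn x))) = (\<lambda>x. norm x powr a * F (sgn x))"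
  by (auto simp: indicator_def)
 ultimately show "(\<lambda>x. norm x powr a * F (sgn x)) \<in> borel_measurable borel" by simp
qed

locale riesz_kernel =
 fixes s :: real and \<Phi> \<Psi> :: "real^'n \<Rightarrow> real"
 assumes s_pos: "0 < s" and s_lt: "s < real CARD('n)"
  and Phi_cont: "continuous_on (sphere 0 1) \<Phi>" and Phi_pos: "\<forall>x\<in>sphere 0 1. 0 < \<Phi> x"
  and Psi_cont: "continuous_on (sphere 0 1) \<Psi>" and Psi_nonneg: "\<forall>\<xi>\<in>sphere 0 1. 0 \<le> \<Psi> \<xi>"
  and hat: "\<And>\<phi>. schwartz \<phi> \<Longrightarrow>
    (\<integral>x. complex_of_real (Wfun s \<Phi> x) * fourier \<phi> x \<partial>lborel) =
    (\<integral>\<xi>. complex_of_real (norm \<xi> powr (s - real CARD('n)) * \<Psi> (sgn \<xi>)) * \<phi> \<xi> \<partial>lborel)"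
begin

abbreviation "W \<equiv> Wfun s \<Phi>"

definition w :: "real^'n \<Rightarrow> real" where "w \<xi> = norm \<xi> powr (s - real CARD('n)) * \<Psi> (sgn \<xi>)"

lemma W_measurable[measurable]: "W \<in> borel_measurable borel"
 using homogeneous_continuous(2)[OF Phi_cont] by (simp add: Wfun_def[abs_def])

lemma w_measurable[measurable]: "w \<in> borel_measurable borel"
 using homogeneous_continuous(2)[OF Psi_cont] by (simp add: w_def[abs_def])

lemma W_continuous: "x \<noteq> 0 \<Longrightarrow> isCont W x"
proof -
 assume "x \<noteq> 0"
 moreover have "continuous_on (- {0}) W"
  using homogeneous_continuous(1)[OF Phi_cont, of "- s"] by (simp add: Wfun_def[abs_def])
 moreover have "open (- {0::real^'n})" by auto
 ultimately show ?thesis using continuous_on_eq_continuous_at[of "- {0}" W] by auto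
qed

lemma W_bounds: "\<exists>a b. 0 < a \<and> 0 < b \<and> (\<forall>x. x \<noteq> 0 \<longrightarrow> a * norm x powr (- s) \<le> W x \<and> W x \<le> b * norm x powr (- s))"
proof -
 have ne: "sphere (0::real^'n) 1 \<noteq> {}" by simp
 obtain p where p: "p \<in> sphere 0 1" "\<And>x. x \<in> sphere 0 1 \<Longrightarrow> \<Phi> p \<le> \<Phi> x"
  using continuous_attains_inf[OF compact_sphere ne Phi_cont] by blast
 obtain q where q: "q \<in> sphere 0 1" "\<And>x. x \<in> sphere 0 1 \<Longrightarrow> \<Phi> x \<le> \<Phi> q"
  using continuous_attains_sup[OF compact_sphere ne Phi_cont] by blast
 have "\<Phi> p * norm x powr (- s) \<le> W x \<and> W x \<le> \<Phi> q * norm x powr (- s)" if "x \<noteq> 0" for x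
 proof -
  have "sgn x \<in> sphere 0 1" using that by (simp add: norm_sgn)
  then have "\<Phi> p \<le> \<Phi> (sgn x)" "\<Phi> (sgn x) \<le> \<Phi> q" using p q by auto
  then show ?thesis
   unfolding Wfun_def mult.commute[of "norm x powr (- s)"] by (auto intro!: mult_right_mono)
 qed
 then show ?thesis using Phi_pos p(1) q(1) by blast
qed

lemma W_pos: "x \<noteq> 0 \<Longrightarrow> W x > 0"
 using Phi_pos by (simp add: Wfun_def norm_sgn)

lemma W_nonneg: "W x \<ge> 0"
 by (cases "x = 0") (auto simp: Wfun_def intro: less_imp_le W_pos[unfolded Wfun_def])

lemma w_nonneg: "w \<xi> \<ge> 0"
 using Psi_nonneg by (cases "\<xi> = 0") (auto simp: w_def norm_sgn)

lemma w_bound: "\<exists>b>0. \<forall>\<xi>. w \<xi> \<le> b * norm \<xi> powr (s - real CARD('n))"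
proof -
 obtain q where q: "q \<in> sphere 0 1" "\<And>x. x \<in> sphere 0 1 \<Longrightarrow> \<Psi> x \<le> \<Psi> q"
  using continuous_attains_sup[OF compact_sphere _ Psi_cont] by auto
 have "w \<xi> \<le> (\<Psi> q + 1) * norm \<xi> powr (s - real CARD('n))" for \<xi>
 proof (cases "\<xi> = 0")
  case False
  then have "\<Psi> (sgn \<xi>) \<le> \<Psi> q + 1" using q(2)[of "sgn \<xi>"] by (simp add: norm_sgn)
  then show ?thesis
   unfolding w_def mult.commute[of "norm \<xi> powr (s - real CARD('n))"] by (intro mult_right_mono) auto
 qed (simp add: w_def)
 moreover have "\<Psi> q + 1 > 0" using Psi_nonneg q(1) by (simp add: add_nonneg_pos)
 ultimately show ?thesis by blast
qed

lemma w_hom: "c > 0 \<Longrightarrow> ennreal (w (c *\<^sub>R x)) = ennreal (c powr (s - real CARD('n))) * ennreal (w x)"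
 using w_nonneg[of x] by (subst ennreal_mult[symmetric]) (auto simp: w_def powr_mult sgn_scaleR mult_ac)

lemma w_fin: "(\<integral>\<^sup>+x. ennreal (w x) * indicator (ball 0 1) x \<partial>lborel) < \<infinity>"
proof -
 obtain b where b: "b > 0" "\<And>\<xi>. w \<xi> \<le> b * norm \<xi> powr (s - real CARD('n))" using w_bound by blast
 have [measurable]: "ball (0::real^'n) 1 \<in> sets borel" by auto
 have "(\<integral>\<^sup>+x. ennreal (w x) * indicator (ball 0 1) x \<partial>lborel) \<le>
   (\<integral>\<^sup>+x. ennreal b * (ennreal (norm x powr (s - real CARD('n))) * indicator (ball 0 1) (x::real^'n)) \<partial>lborel)"
  using b by (intro nn_integral_mono) (auto split: split_indicator simp: ennreal_mult[symmetric] intro: ennreal_leI)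
 also have "\<dots> = ennreal b * ennreal (surface_const TYPE('n) * 1 powr s / s)"
  using nn_integral_norm_powr_ball[of s 1, where 'n='n] s_pos by (subst nn_integral_cmult) auto
 also have "\<dots> < \<infinity>" by (simp add: ennreal_mult[symmetric] ennreal_mult_less_top)
 finally show ?thesis .
qed

abbreviation "sig \<equiv> angular_measure s (\<lambda>\<xi>. ennreal (w \<xi>))"

lemma finite_sig: "finite_measure sig"
 by (rule finite_angular_measure[OF s_pos _ w_hom w_fin]) measurable

lemma integrable_w_exp:
 assumes e: "e > 0"
 shows "integrable lborel (\<lambda>\<xi>. w \<xi> * exp (- (e * norm \<xi>)))"
proof (rule integrableI_nonneg)
 have "(\<integral>\<^sup>+x. ennreal (w x * exp (- (e * norm x))) \<partial>lborel) = (\<integral>\<^sup>+x. ennreal (w x) * (\<lambda>r. ennreal (exp (- (e * r)))) (norm x) \<partial>lborel)"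
  using w_nonneg by (intro nn_integral_cong) (simp add: ennreal_mult)
 also have "\<dots> = emeasure sig UNIV * (\<integral>\<^sup>+r. ennreal (r powr (s - 1)) * indicator {0<..} r * ennreal (exp (- (e * r))) \<partial>lborel)"
  by (rule nn_integral_polar_radial[OF s_pos _ w_hom w_fin]) measurable
 also have "(\<integral>\<^sup>+r. ennreal (r powr (s - 1)) * indicator {0<..} r * ennreal (exp (- (e * r))) \<partial>lborel) =
   (\<integral>\<^sup>+r. ennreal (indicator {0<..} r *\<^sub>R (r powr (s - 1) * exp (- (e * r)))) \<partial>lborel)"
  by (intro nn_integral_cong) (auto simp: ennreal_mult split: split_indicator)
 also have "\<dots> = ennreal (\<integral>r. indicator {0<..} r *\<^sub>R (r powr (s - 1) * exp (- (e * r))) \<partial>lborel)"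
  using set_integrable_powr_exp[of "s - 1" e] e s_pos unfolding set_integrable_def by (intro nn_integral_eq_integral) auto
 also have "emeasure sig UNIV * \<dots> < \<infinity>"
  using finite_measure.emeasure_finite[OF finite_sig, of UNIV] by (auto simp: ennreal_mult_less_top less_top)
 finally show "(\<integral>\<^sup>+x. ennreal (w x * exp (- (e * norm x))) \<partial>lborel) < \<infinity>" .
qed (use w_nonneg in auto)

lemma integrable_w_gauss:
 assumes t: "\<tau> > 0"
 shows "integrable lborel (\<lambda>\<xi>. w \<xi> * exp (- (\<tau> * (norm \<xi>)^2)))"
proof (rule Bochner_Integration.integrable_bound)
 show "integrable lborel (\<lambda>\<xi>. exp (1 / (4 * \<tau>)) * (w \<xi> * exp (- (1 * norm \<xi>))))"
  by (intro Bochner_Integration.integrable_mult_right integrable_w_exp) simp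
 show "AE \<xi> in lborel. norm (w \<xi> * exp (- (\<tau> * (norm \<xi>)^2))) \<le> norm (exp (1 / (4 * \<tau>)) * (w \<xi> * exp (- (1 * norm \<xi>))))"
 proof (intro AE_I2)
  fix \<xi> :: "real^'n"
  let ?r = "norm \<xi>"
  \<comment> \<open>Completing the square dominates the Gaussian weight by a multiple of exp (-
    |\<xi>|), whose integrability against w is already known.\<close>
  have "\<tau> * (?r - 1 / (2 * \<tau>))^2 = \<tau> * ?r^2 - ?r + 1 / (4 * \<tau>)" using t by (simp add: power2_eq_square field_simps)
  moreover have "\<tau> * (?r - 1 / (2 * \<tau>))^2 \<ge> 0" using t by simp
  ultimately have "- (\<tau> * ?r^2) \<le> 1 / (4 * \<tau>) - ?r" by linarith
  then have "exp (- (\<tau> * ?r^2)) \<le> exp (1 / (4 * \<tau>)) * exp (- ?r)" by (simp add: exp_add[symmetric])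
  then have "w \<xi> * exp (- (\<tau> * ?r^2)) \<le> w \<xi> * (exp (1 / (4 * \<tau>)) * exp (- ?r))" using w_nonneg by (intro mult_left_mono)
  then show "norm (w \<xi> * exp (- (\<tau> * ?r^2))) \<le> norm (exp (1 / (4 * \<tau>)) * (w \<xi> * exp (- (1 * ?r))))"
   using w_nonneg[of \<xi>] by (simp add: mult_ac)
 qed
qed measurable

lemma integrable_w_cos:
 assumes "integrable lborel (\<lambda>\<xi>. w \<xi> * g \<xi>)" and [measurable]: "g \<in> borel_measurable borel" "h \<in> borel_measurable borel"
  and "\<And>\<xi>. \<bar>h \<xi>\<bar> \<le> 1"
 shows "integrable lborel (\<lambda>\<xi>. w \<xi> * g \<xi> * h \<xi>)"
proof (rule Bochner_Integration.integrable_bound[OF assms(1)])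
 show "AE \<xi> in lborel. norm (w \<xi> * g \<xi> * h \<xi>) \<le> norm (w \<xi> * g \<xi>)"
  using assms(4) by (auto simp: abs_mult intro!: mult_left_le mult_nonneg_nonneg)
qed measurable

definition Z :: "real \<Rightarrow> real^'n \<Rightarrow> real" where
 "Z \<tau> x = (\<integral>\<xi>. w \<xi> * exp (- (\<tau> * (norm \<xi>)^2)) * cos (x \<bullet> \<xi>) \<partial>lborel)"

text \<open>The hypothesis \<open>hat\<close>, tested on a Gaussian wave with centre x. It enters
  the proof only here; everything later about w and W is derived from this identity.\<close>

lemma Z_eq_heat:
 assumes t: "\<tau> > 0"
 shows "(\<integral>y. W y * heat \<tau> (x - y) \<partial>lborel) = Z \<tau> x"
proof -
 have "(\<integral>y. complex_of_real (W y) * fourier (gauss_wave \<tau> x) y \<partial>lborel) = (\<integral>\<xi>. complex_of_real (w \<xi>) * gauss_wave \<tau> x \<xi> \<partial>lborel)"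
  unfolding w_def by (rule hat[OF schwartz_gauss_wave[OF t]])
 moreover have "(\<integral>y. complex_of_real (W y) * fourier (gauss_wave \<tau> x) y \<partial>lborel) = complex_of_real (\<integral>y. W y * heat \<tau> (x - y) \<partial>lborel)"
  unfolding fourier_gauss_wave[OF t] heat_def[symmetric] of_real_mult[symmetric] by (rule integral_complex_of_real)
 ultimately have "(\<integral>y. W y * heat \<tau> (x - y) \<partial>lborel) = Re (\<integral>\<xi>. complex_of_real (w \<xi>) * gauss_wave \<tau> x \<xi> \<partial>lborel)"
  by (metis Re_complex_of_real)
 also have "\<dots> = (\<integral>\<xi>. Re (complex_of_real (w \<xi>) * gauss_wave \<tau> x \<xi>) \<partial>lborel)"
 proof (rule integral_Re[symmetric])
  have gm: "gauss_wave \<tau> x \<in> borel_measurable borel" unfolding gauss_wave_def by measurable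
  show "integrable lborel (\<lambda>\<xi>. complex_of_real (w \<xi>) * gauss_wave \<tau> x \<xi>)"
  proof (rule Bochner_Integration.integrable_bound[OF integrable_w_gauss[OF t]])
   show "AE \<xi> in lborel. norm (complex_of_real (w \<xi>) * gauss_wave \<tau> x \<xi>) \<le> norm (w \<xi> * exp (- (\<tau> * (norm \<xi>)^2)))"
    by (auto simp: norm_mult gauss_wave_def norm_exp_eq_Re)
   show "(\<lambda>\<xi>. complex_of_real (w \<xi>) * gauss_wave \<tau> x \<xi>) \<in> borel_measurable lborel"
    using gm by measurable
  qed
 qed
 also have "\<dots> = Z \<tau> x"
  unfolding Z_def by (intro Bochner_Integration.integral_cong) (auto simp: gauss_wave_def Re_exp)
 finally show ?thesis .
qed

text \<open>The integral is split at |y| = |x| / 2. Far from the origin W is at most a multiple of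
  |x|^(-s) and the heat kernel has fixed mass. Near the origin |x - y| is at least |x| / 2, so the
  heat kernel is at most a multiple of |x|^(-d), while W has integral of order |x|^(d - s), finite
  since s < d. Both parts are of order |x|^(-s), uniformly in \<tau>.\<close>

lemma heat_W_bound:
 "\<exists>C>0. \<forall>\<tau>>0. \<forall>x. x \<noteq> 0 \<longrightarrow> (\<integral>\<^sup>+y. ennreal (W y) * ennreal (heat \<tau> (x - y)) \<partial>lborel) \<le> ennreal (C * norm x powr (- s))"
proof -
 let ?d = "real CARD('n)"
 obtain a b where ab: "0 < a" "0 < b" "\<And>x. x \<noteq> 0 \<Longrightarrow> a * norm x powr (- s) \<le> W x \<and> W x \<le> b * norm x powr (- s)"
  using W_bounds by blast
 obtain G where G: "G > 0" "\<And>\<tau> z. \<tau> > 0 \<Longrightarrow> z \<noteq> 0 \<Longrightarrow> heat \<tau> (z::real^'n) \<le> G * norm z powr (- ?d)"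
  using heat_le_norm_powr[where 'n='n] by blast
 define S where "S = surface_const TYPE('n)"
 have S: "S > 0" unfolding S_def by (rule surface_const_pos)
 define C where "C = b * 2 powr s * (2 * pi) ^ CARD('n) + G * b * S * 2 powr s / (?d - s)"
 have C: "C > 0" unfolding C_def using ab G S s_lt by (intro add_pos_pos mult_pos_pos divide_pos_pos) auto
 have "(\<integral>\<^sup>+y. ennreal (W y) * ennreal (heat \<tau> (x - y)) \<partial>lborel) \<le> ennreal (C * norm x powr (- s))" if \<tau>: "\<tau> > 0" and x: "x \<noteq> 0" for \<tau> x
 proof -
  let ?R = "norm x / 2"
  have hn: "heat \<tau> z \<ge> 0" for z :: "real^'n" by (rule heat_nonneg[OF \<tau>])
  have R: "?R > 0" using x by simp
  have pt: "ennreal (W y) * ennreal (heat \<tau> (x - y)) \<le> ennreal (b * ?R powr (- s)) * ennreal (heat \<tau> (x - y)) +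
    ennreal (G * ?R powr (- ?d) * b) * (ennreal (norm y powr ((?d - s) - ?d)) * indicator (ball 0 ?R) y)" for y
  proof (cases "norm y < ?R")
   case False
   then have "y \<noteq> 0" using R by (intro notI) simp
   then have "W y \<le> b * norm y powr (- s)" "norm y powr (- s) \<le> ?R powr (- s)"
    using ab(3)[of y] R s_pos False by (auto intro!: powr_mono2')
   then have "W y \<le> b * ?R powr (- s)" using ab(2) by (meson mult_left_mono less_imp_le order_trans)
   then have "ennreal (W y) * ennreal (heat \<tau> (x - y)) \<le> ennreal (b * ?R powr (- s)) * ennreal (heat \<tau> (x - y))"
    by (intro mult_right_mono ennreal_leI) auto
   then show ?thesis using False by (simp add: order_trans[OF _ add_increasing2])
  next
   case True
   have ge: "norm (x - y) \<ge> ?R" using True norm_triangle_ineq2[of x y] by simp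
   then have "x - y \<noteq> 0" using R by (intro notI) simp
   then have "heat \<tau> (x - y) \<le> G * norm (x - y) powr (- ?d)" "norm (x - y) powr (- ?d) \<le> ?R powr (- ?d)"
    using G(2)[OF \<tau>, of "x - y"] R ge by (auto intro!: powr_mono2')
   then have h: "heat \<tau> (x - y) \<le> G * ?R powr (- ?d)" using G(1) by (meson mult_left_mono less_imp_le order_trans)
   \<comment> \<open>At y = 0 both sides vanish, because \<open>0 powr (- s) = 0\<close>.\<close>
   have Wy: "W y \<le> b * norm y powr (- s)" using ab(3)[of y] by (cases "y = 0") (auto simp: Wfun_def)
   have "W y * heat \<tau> (x - y) \<le> (b * norm y powr (- s)) * (G * ?R powr (- ?d))"
    using Wy h W_nonneg hn ab(2) by (intro mult_mono) auto
   then have "ennreal (W y) * ennreal (heat \<tau> (x - y)) \<le> ennreal ((b * norm y powr (- s)) * (G * ?R powr (- ?d)))"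
    using W_nonneg hn by (subst ennreal_mult[symmetric]) (auto intro: ennreal_leI)
   also have "\<dots> = ennreal (G * ?R powr (- ?d) * b) * (ennreal (norm y powr ((?d - s) - ?d)) * indicator (ball 0 ?R) y)"
    using True ab G by (simp add: ennreal_mult[symmetric] mult_ac)
   finally show ?thesis by (simp add: order_trans[OF _ add_increasing])
  qed
  have "(\<integral>\<^sup>+y. ennreal (W y) * ennreal (heat \<tau> (x - y)) \<partial>lborel) \<le> (\<integral>\<^sup>+y. ennreal (b * ?R powr (- s)) * ennreal (heat \<tau> (x - y)) +
    ennreal (G * ?R powr (- ?d) * b) * (ennreal (norm y powr ((?d - s) - ?d)) * indicator (ball 0 ?R) y) \<partial>lborel)"
   by (intro nn_integral_mono pt)
  also have "\<dots> = ennreal (b * ?R powr (- s)) * (\<integral>\<^sup>+y. ennreal (heat \<tau> (x - y)) \<partial>lborel) +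
    ennreal (G * ?R powr (- ?d) * b) * (\<integral>\<^sup>+y. ennreal (norm (y::real^'n) powr ((?d - s) - ?d)) * indicator (ball 0 ?R) y \<partial>lborel)"
  proof -
   have [measurable]: "ball (0::real^'n) ?R \<in> sets borel" by auto
   have 1: "(\<lambda>y. ennreal (heat \<tau> (x - y))) \<in> borel_measurable lborel" by measurable
   have 2: "(\<lambda>y::real^'n. ennreal (norm y powr ((?d - s) - ?d)) * indicator (ball 0 ?R) y) \<in> borel_measurable lborel" by measurable
   show ?thesis
    unfolding nn_integral_cmult[OF 1, symmetric] nn_integral_cmult[OF 2, symmetric]
    by (rule nn_integral_add; measurable)
  qed
  also have "\<dots> = ennreal (b * ?R powr (- s)) * ennreal ((2 * pi) ^ CARD('n)) + ennreal (G * ?R powr (- ?d) * b) * ennreal (S * ?R powr (?d - s) / (?d - s))"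
   using nn_integral_heat[OF \<tau>, of x] nn_integral_norm_powr_ball[of "?d - s" ?R, where 'n='n] s_lt R by (simp add: S_def)
  also have "\<dots> = ennreal (b * ?R powr (- s) * (2 * pi) ^ CARD('n) + G * ?R powr (- ?d) * b * (S * ?R powr (?d - s) / (?d - s)))"
   using ab G S s_lt by (simp add: ennreal_mult[symmetric] ennreal_plus[symmetric] del: ennreal_plus)
  also have "b * ?R powr (- s) * (2 * pi) ^ CARD('n) + G * ?R powr (- ?d) * b * (S * ?R powr (?d - s) / (?d - s)) = C * norm x powr (- s)"
  proof -
   have 1: "?R powr (- s) = 2 powr s * norm x powr (- s)"
   proof -
    have "?R powr (- s) = norm x powr (- s) / 2 powr (- s)" by (rule powr_divide)
    also have "\<dots> = 2 powr s * norm x powr (- s)" by (simp only: powr_minus[of 2 s] divide_inverse inverse_inverse_eq mult.commute)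
    finally show ?thesis .
   qed
   have 2: "?R powr (- ?d) * ?R powr (?d - s) = ?R powr (- s)" using powr_add[of ?R "- ?d" "?d - s"] by simp
   have "G * ?R powr (- ?d) * b * (S * ?R powr (?d - s) / (?d - s)) = G * b * S / (?d - s) * (?R powr (- ?d) * ?R powr (?d - s))"
    by (simp only: times_divide_eq_right times_divide_eq_left mult_ac)
   also have "\<dots> = G * b * S / (?d - s) * (2 powr s * norm x powr (- s))" by (simp only: 2 1)
   finally show ?thesis unfolding 1 C_def
    by (simp only: distrib_right distrib_left times_divide_eq_right times_divide_eq_left mult_ac)
  qed
  finally show ?thesis .
 qed
 then show ?thesis using C by blast
qed

lemma heat_W_integrable:
 assumes t: "\<tau> > 0" and x: "x \<noteq> 0"
 shows "integrable lborel (\<lambda>y. W y * heat \<tau> (x - y))" "(\<integral>\<^sup>+y. ennreal (W y) * ennreal (heat \<tau> (x - y)) \<partial>lborel) = ennreal (Z \<tau> x)" "Z \<tau> x \<ge> 0"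
proof -
 have hn: "heat \<tau> z \<ge> 0" for z :: "real^'n" by (rule heat_nonneg[OF t])
 obtain C where "C > 0" "(\<integral>\<^sup>+y. ennreal (W y) * ennreal (heat \<tau> (x - y)) \<partial>lborel) \<le> ennreal (C * norm x powr (- s))"
  using heat_W_bound t x by blast
 then have f: "(\<integral>\<^sup>+y. ennreal (W y) * ennreal (heat \<tau> (x - y)) \<partial>lborel) < \<infinity>"
  unfolding infinity_ennreal_def by (intro le_less_trans[OF _ ennreal_less_top])
 have eq: "(\<integral>\<^sup>+y. ennreal (W y * heat \<tau> (x - y)) \<partial>lborel) = (\<integral>\<^sup>+y. ennreal (W y) * ennreal (heat \<tau> (x - y)) \<partial>lborel)"
  using W_nonneg hn by (intro nn_integral_cong) (simp add: ennreal_mult)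
 show i: "integrable lborel (\<lambda>y. W y * heat \<tau> (x - y))"
 proof (rule integrableI_nonneg)
  show "AE y in lborel. 0 \<le> W y * heat \<tau> (x - y)"
   by (intro AE_I2 mult_nonneg_nonneg W_nonneg heat_nonneg[OF t])
  show "(\<integral>\<^sup>+y. ennreal (W y * heat \<tau> (x - y)) \<partial>lborel) < \<infinity>" using f unfolding eq .
 qed measurable
 show "(\<integral>\<^sup>+y. ennreal (W y) * ennreal (heat \<tau> (x - y)) \<partial>lborel) = ennreal (Z \<tau> x)"
  unfolding eq[symmetric] Z_eq_heat[OF t, symmetric]
  by (rule nn_integral_eq_integral[OF i]) (intro AE_I2 mult_nonneg_nonneg W_nonneg heat_nonneg[OF t])
 show "Z \<tau> x \<ge> 0"
  unfolding Z_eq_heat[OF t, symmetric] by (intro Bochner_Integration.integral_nonneg mult_nonneg_nonneg W_nonneg hn)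
qed

lemma Z_bound: "\<exists>C>0. \<forall>\<tau>>0. \<forall>x. x \<noteq> 0 \<longrightarrow> Z \<tau> x \<le> C * norm x powr (- s)"
proof -
 obtain C where C: "C > 0" "\<And>\<tau> x. \<tau> > 0 \<Longrightarrow> x \<noteq> 0 \<Longrightarrow> (\<integral>\<^sup>+y. ennreal (W y) * ennreal (heat \<tau> (x - y)) \<partial>lborel) \<le> ennreal (C * norm x powr (- s))"
  using heat_W_bound by blast
 have "Z \<tau> x \<le> C * norm x powr (- s)" if "\<tau> > 0" "x \<noteq> 0" for \<tau> x
  using C(2)[OF that] heat_W_integrable(2)[OF that] C(1) by (simp add: ennreal_le_iff)
 then show ?thesis using C(1) by blast
qed

text \<open>The singularity of W is cut off at |y| = |x| / 2. The part \<open>f2\<close> away from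
  it is bounded and agrees with W near x, so it converges after rescaling by dominated convergence;
  the part \<open>f1\<close> is integrable and multiplied by a heat kernel that tends to 0 uniformly
  on its support.\<close>

lemma Z_tendsto:
 assumes x: "x \<noteq> 0" and t: "\<And>n. t n > 0" "t \<longlonglongrightarrow> 0"
 shows "(\<lambda>n. Z (t n) x) \<longlonglongrightarrow> (2 * pi) ^ CARD('n) * W x"
proof -
 let ?d = "real CARD('n)"
 let ?R = "norm x / 2"
 have R: "?R > 0" using x by simp
 obtain a b where ab: "0 < a" "0 < b" "\<And>x. x \<noteq> 0 \<Longrightarrow> a * norm x powr (- s) \<le> W x \<and> W x \<le> b * norm x powr (- s)"
  using W_bounds by blast
 define f1 where "f1 y = ennreal (W y) * indicator (ball 0 ?R) y" for y
 define f2 where "f2 y = W y * indicator (- ball 0 ?R) y" for y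
 have bm[measurable]: "ball (0::real^'n) ?R \<in> sets borel" "- ball (0::real^'n) ?R \<in> sets borel" by auto
 have f1m[measurable]: "f1 \<in> borel_measurable borel" unfolding f1_def by measurable
 have f2m[measurable]: "f2 \<in> borel_measurable borel" unfolding f2_def by measurable
 have f2n: "f2 y \<ge> 0" for y using W_nonneg by (simp add: f2_def)
 have f2b: "f2 y \<le> b * ?R powr (- s)" for y
 proof (cases "norm y < ?R")
  case False
  then have "y \<noteq> 0" using R by (intro notI) simp
  then have "W y \<le> b * norm y powr (- s)" "norm y powr (- s) \<le> ?R powr (- s)"
   using ab(3)[of y] R s_pos False by (auto intro!: powr_mono2')
  then have "W y \<le> b * ?R powr (- s)" using ab(2) by (meson mult_left_mono less_imp_le order_trans)
  then show ?thesis using False by (simp add: f2_def)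
 qed (use ab in \<open>simp add: f2_def\<close>)
 have split: "ennreal (Z (t n) x) = (\<integral>\<^sup>+y. f1 y * ennreal (heat (t n) (x - y)) \<partial>lborel) + (\<integral>\<^sup>+y. ennreal (f2 y) * ennreal (heat (t n) (x - y)) \<partial>lborel)" for n
  unfolding heat_W_integrable(2)[OF t(1) x, symmetric]
  by (subst nn_integral_add[symmetric]) (auto intro!: nn_integral_cong simp: f1_def f2_def split: split_indicator)
 have l2: "(\<lambda>n. \<integral>\<^sup>+y. ennreal (f2 y) * ennreal (heat (t n) (x - y)) \<partial>lborel) \<longlonglongrightarrow> ennreal ((2 * pi) ^ CARD('n) * W x)"
 proof -
  have "(\<lambda>n. \<integral>\<^sup>+z. ennreal (f2 (x + (2 * sqrt (t n)) *\<^sub>R z)) * ennreal (exp (- (norm z)\<^sup>2)) \<partial>lborel) \<longlonglongrightarrow> (\<integral>\<^sup>+z. ennreal (W x) * ennreal (exp (- (norm (z::real^'n))\<^sup>2)) \<partial>lborel)"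
  proof (rule nn_integral_dominated_convergence[where w="\<lambda>z. ennreal (b * ?R powr (- s)) * ennreal (exp (- (norm z)\<^sup>2))"])
   show "(\<integral>\<^sup>+z. ennreal (b * ?R powr (- s)) * ennreal (exp (- (norm (z::real^'n))\<^sup>2)) \<partial>lborel) < \<infinity>"
    by (subst nn_integral_cmult) (auto simp: nn_integral_exp_norm_square ennreal_mult_less_top)
   show "AE z in lborel. ennreal (f2 (x + (2 * sqrt (t n)) *\<^sub>R z)) * ennreal (exp (- (norm z)\<^sup>2)) \<le> ennreal (b * ?R powr (- s)) * ennreal (exp (- (norm z)\<^sup>2))" for n
    by (intro AE_I2 mult_right_mono ennreal_leI f2b) auto
   show "AE z in lborel. (\<lambda>n. ennreal (f2 (x + (2 * sqrt (t n)) *\<^sub>R z)) * ennreal (exp (- (norm z)\<^sup>2))) \<longlonglongrightarrow> ennreal (W x) * ennreal (exp (- (norm z)\<^sup>2))"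
   proof (intro AE_I2)
    fix z :: "real^'n"
    have "(\<lambda>n. x + (2 * sqrt (t n)) *\<^sub>R z) \<longlonglongrightarrow> x + (2 * sqrt 0) *\<^sub>R z"
     by (intro tendsto_intros t(2))
    then have lx: "(\<lambda>n. x + (2 * sqrt (t n)) *\<^sub>R z) \<longlonglongrightarrow> x" by simp
    then have "(\<lambda>n. W (x + (2 * sqrt (t n)) *\<^sub>R z)) \<longlonglongrightarrow> W x"
     by (rule isCont_tendsto_compose[OF W_continuous[OF x]])
    moreover have "open (- cball (0::real^'n) ?R)" by auto
    then have "\<forall>\<^sub>F n in sequentially. x + (2 * sqrt (t n)) *\<^sub>R z \<in> - cball 0 ?R"
     by (rule topological_tendstoD[OF lx]) (use x in auto)
    then have "\<forall>\<^sub>F n in sequentially. W (x + (2 * sqrt (t n)) *\<^sub>R z) = f2 (x + (2 * sqrt (t n)) *\<^sub>R z)"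
     by eventually_elim (auto simp: f2_def)
    ultimately have "(\<lambda>n. f2 (x + (2 * sqrt (t n)) *\<^sub>R z)) \<longlonglongrightarrow> W x"
     by (rule Lim_transform_eventually)
    then have "(\<lambda>n. ennreal (f2 (x + (2 * sqrt (t n)) *\<^sub>R z) * exp (- (norm z)\<^sup>2))) \<longlonglongrightarrow> ennreal (W x * exp (- (norm z)\<^sup>2))"
     by (intro tendsto_ennrealI tendsto_intros)
    then show "(\<lambda>n. ennreal (f2 (x + (2 * sqrt (t n)) *\<^sub>R z)) * ennreal (exp (- (norm z)\<^sup>2))) \<longlonglongrightarrow> ennreal (W x) * ennreal (exp (- (norm z)\<^sup>2))"
     using f2n W_nonneg by (simp add: ennreal_mult)
   qed
  qed measurable
  also have "(\<integral>\<^sup>+z. ennreal (W x) * ennreal (exp (- (norm (z::real^'n))\<^sup>2)) \<partial>lborel) = ennreal (W x) * ennreal (sqrt pi ^ CARD('n))"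
   by (subst nn_integral_cmult) (auto simp: nn_integral_exp_norm_square)
  finally have "(\<lambda>n. ennreal ((2 * sqrt pi) ^ CARD('n)) * (\<integral>\<^sup>+z. ennreal (f2 (x + (2 * sqrt (t n)) *\<^sub>R z)) * ennreal (exp (- (norm z)\<^sup>2)) \<partial>lborel)) \<longlonglongrightarrow>
    ennreal ((2 * sqrt pi) ^ CARD('n)) * (ennreal (W x) * ennreal (sqrt pi ^ CARD('n)))"
   by (intro ennreal_tendsto_cmult) auto
  moreover have "ennreal ((2 * sqrt pi) ^ CARD('n)) * (ennreal (W x) * ennreal (sqrt pi ^ CARD('n))) = ennreal ((2 * pi) ^ CARD('n) * W x)"
  proof -
   have "(2 * sqrt pi) ^ CARD('n) * (W x * sqrt pi ^ CARD('n)) = (2 * sqrt pi * sqrt pi) ^ CARD('n) * W x"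
    by (simp add: power_mult_distrib)
   also have "2 * sqrt pi * sqrt pi = 2 * pi" by simp
   finally show ?thesis using W_nonneg[of x] by (simp add: ennreal_mult[symmetric])
  qed
  ultimately show ?thesis
   by (subst nn_integral_heat_rescale[OF t(1)]) auto
 qed
 have l1: "(\<lambda>n. \<integral>\<^sup>+y. f1 y * ennreal (heat (t n) (x - y)) \<partial>lborel) \<longlonglongrightarrow> 0"
 proof -
  define I where "I = (\<integral>\<^sup>+y. f1 y \<partial>lborel)"
  have "I \<le> (\<integral>\<^sup>+y. ennreal b * (ennreal (norm y powr ((?d - s) - ?d)) * indicator (ball 0 ?R) (y::real^'n)) \<partial>lborel)"
   unfolding I_def
  proof (intro nn_integral_mono)
   fix y :: "real^'n"
   have "W y \<le> b * norm y powr (- s)" using ab(3)[of y] by (cases "y = 0") (auto simp: Wfun_def)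
   then show "f1 y \<le> ennreal b * (ennreal (norm y powr ((?d - s) - ?d)) * indicator (ball 0 ?R) y)"
    using ab by (auto simp: f1_def ennreal_mult[symmetric] split: split_indicator intro: ennreal_leI)
  qed
  also have "\<dots> < \<infinity>"
   using nn_integral_norm_powr_ball[of "?d - s" ?R, where 'n='n] s_lt R by (subst nn_integral_cmult) (auto simp: ennreal_mult_less_top)
  finally obtain i where i: "I = ennreal i" "i \<ge> 0" by (cases I) auto
  define h where "h n = sqrt (pi / t n) ^ CARD('n) * exp (- ?R\<^sup>2 / (4 * t n))" for n
  have le: "(\<integral>\<^sup>+y. f1 y * ennreal (heat (t n) (x - y)) \<partial>lborel) \<le> ennreal (i * h n)" for n
  proof -
   have "(\<integral>\<^sup>+y. f1 y * ennreal (heat (t n) (x - y)) \<partial>lborel) \<le> (\<integral>\<^sup>+y. f1 y * ennreal (h n) \<partial>lborel)"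
   proof (intro nn_integral_mono)
    fix y
    show "f1 y * ennreal (heat (t n) (x - y)) \<le> f1 y * ennreal (h n)"
    proof (cases "norm y < ?R")
     case True
     have "norm (x - y) \<ge> ?R" using True norm_triangle_ineq2[of x y] by simp
     then have "?R^2 \<le> (norm (x - y))^2" using R by (intro power_mono) auto
     then have "- (norm (x - y))\<^sup>2 / (4 * t n) \<le> - ?R\<^sup>2 / (4 * t n)" using t(1)[of n] by (intro divide_right_mono) auto
     then have "heat (t n) (x - y) \<le> h n"
      unfolding heat_def h_def using t(1)[of n] by (intro mult_left_mono) auto
     then show ?thesis by (intro mult_left_mono ennreal_leI) auto
    qed (simp add: f1_def)
   qed
   also have "\<dots> = I * ennreal (h n)" unfolding I_def by (rule nn_integral_multc) measurable
   also have "\<dots> = ennreal (i * h n)" using i t(1)[of n] by (simp add: h_def ennreal_mult)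
   finally show ?thesis .
  qed
  have "((\<lambda>\<tau>::real. sqrt (pi / \<tau>) ^ CARD('n) * exp (- ?R\<^sup>2 / (4 * \<tau>))) \<longlongrightarrow> 0) (at_right 0)"
  proof (rule Lim_null_comparison)
   let ?G = "\<lambda>u::real. u powr (?d / 2) * exp (- (?R^2 / (4 * pi) * u))"
   have g: "(?G \<longlongrightarrow> 0) at_top"
   proof -
    have "((\<lambda>u::real. u powr p * exp (- (c * u))) \<longlongrightarrow> 0) at_top" if "c > 0" for p c using that by real_asymp
    moreover have "?R^2 / (4 * pi) > 0" using R by (simp add: zero_less_divide_iff zero_less_mult_iff)
    ultimately show ?thesis by blast
   qed
   have inv: "filterlim (\<lambda>\<tau>::real. pi / \<tau>) at_top (at_right 0)" by real_asymp
   show "((\<lambda>\<tau>. ?G (pi / \<tau>)) \<longlongrightarrow> 0) (at_right 0)" by (rule filterlim_compose[OF g inv])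
   show "\<forall>\<^sub>F \<tau> in at_right 0. norm (sqrt (pi / \<tau>) ^ CARD('n) * exp (- ?R\<^sup>2 / (4 * \<tau>))) \<le> ?G (pi / \<tau>)"
    using eventually_at_right_less[of "0::real"]
   proof eventually_elim
    case (elim \<tau>)
    have p: "pi / \<tau> > 0" using elim by simp
    have "sqrt (pi / \<tau>) ^ CARD('n) = (pi / \<tau>) powr (?d / 2)"
    proof -
     have "sqrt (pi / \<tau>) ^ CARD('n) = ((pi / \<tau>) powr (1/2)) powr ?d"
      using p by (simp add: powr_half_sqrt powr_realpow)
     also have "\<dots> = (pi / \<tau>) powr (1/2 * ?d)" by (rule powr_powr)
     finally show ?thesis by simp
    qed
    moreover have "- ?R\<^sup>2 / (4 * \<tau>) = - (?R^2 / (4 * pi) * (pi / \<tau>))" by simp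
    ultimately show ?case by simp
   qed
  qed
  moreover have "filterlim t (at_right 0) sequentially"
   using t(2) unfolding filterlim_at by (auto intro!: always_eventually simp: t(1) less_imp_neq[OF t(1), symmetric])
  ultimately have "(\<lambda>n. sqrt (pi / t n) ^ CARD('n) * exp (- ?R\<^sup>2 / (4 * t n))) \<longlonglongrightarrow> 0"
   by (rule filterlim_compose[of "\<lambda>\<tau>::real. sqrt (pi / \<tau>) ^ CARD('n) * exp (- ?R\<^sup>2 / (4 * \<tau>))" _ "at_right 0" t])
  then have "h \<longlonglongrightarrow> 0" by (simp add: h_def[abs_def])
  then have "(\<lambda>n. ennreal (i * h n)) \<longlonglongrightarrow> ennreal (i * 0)" by (intro tendsto_ennrealI tendsto_intros)
  then have lim0: "(\<lambda>n. ennreal (i * h n)) \<longlonglongrightarrow> 0" by simp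
  show ?thesis
   by (rule tendsto_sandwich[OF always_eventually always_eventually tendsto_const[of 0] lim0]) (use le in auto)
 qed
 have "(\<lambda>n. ennreal (Z (t n) x)) \<longlonglongrightarrow> 0 + ennreal ((2 * pi) ^ CARD('n) * W x)"
  unfolding split by (intro tendsto_add l1 l2)
 then show ?thesis
  using heat_W_integrable(3)[OF t(1) x] W_nonneg[of x] by (simp add: tendsto_ennreal_iff)
qed

end

section \<open>The kernel regularised by exponential damping\<close>

lemma gauss_weight:
 "integrable lborel (\<lambda>v::real. indicator {0<..} v * (2 / sqrt pi * exp (- v\<^sup>2)))"
 "(\<integral>v. indicator {0<..} (v::real) * (2 / sqrt pi * exp (- v\<^sup>2)) \<partial>lborel) = 1"
proof -
 have "integrable lborel (\<lambda>v::real. 2 / sqrt pi * (indicator {0<..} v *\<^sub>R exp (- v\<^sup>2 - 0\<^sup>2 / (4 * v^2))))"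
  using exp_neg_subordination(1)[of 0] unfolding set_integrable_def by (intro Bochner_Integration.integrable_mult_right) simp
 then show "integrable lborel (\<lambda>v::real. indicator {0<..} v * (2 / sqrt pi * exp (- v\<^sup>2)))"
  by (simp add: mult_ac)
 have "(\<integral>v. indicator {0<..} (v::real) * (2 / sqrt pi * exp (- v\<^sup>2)) \<partial>lborel) = 2 / sqrt pi * (LINT v:{0<..}|lborel. exp (- v\<^sup>2 - 0\<^sup>2 / (4 * v^2)))"
  unfolding set_lebesgue_integral_def by (subst Bochner_Integration.integral_mult_right_zero[symmetric]) (simp add: mult_ac)
 also have "\<dots> = 1" by (subst exp_neg_subordination(2)) simp_all
 finally show "(\<integral>v. indicator {0<..} (v::real) * (2 / sqrt pi * exp (- v\<^sup>2)) \<partial>lborel) = 1" .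
qed

context riesz_kernel
begin

definition V :: "real \<Rightarrow> real^'n \<Rightarrow> real" where
 "V \<epsilon> x = (\<integral>\<xi>. w \<xi> * exp (- (\<epsilon> * norm \<xi>)) * cos (x \<bullet> \<xi>) \<partial>lborel)"

lemma V_measurable[measurable]: "V \<epsilon> \<in> borel_measurable borel"
 unfolding V_def by (intro lborel.borel_measurable_lebesgue_integral) measurable

text \<open>Subordination with r = \<epsilon> |\<xi>| writes the damping as an average over v of
  Gaussians with \<tau> = \<epsilon>^2 / (4 v^2), against a probability density in v. Nonnegativity,
  the bound by |x|^(-s) and the limit thus pass from \<open>Z\<close> to \<open>V\<close>.\<close>

lemma V_eq_Z:
 assumes e: "\<epsilon> > 0"
 shows "integrable lborel (\<lambda>v. indicator {0<..} v * (2 / sqrt pi * exp (- v\<^sup>2)) * Z (\<epsilon>^2 / (4 * v^2)) x)"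
  "V \<epsilon> x = (\<integral>v. indicator {0<..} v * (2 / sqrt pi * exp (- v\<^sup>2)) * Z (\<epsilon>^2 / (4 * v^2)) x \<partial>lborel)"
proof -
 define f where "f \<xi> v = (w \<xi> * cos (x \<bullet> \<xi>)) * (2 / sqrt pi * (indicator {0<..} v *\<^sub>R exp (- v\<^sup>2 - (\<epsilon> * norm \<xi>)\<^sup>2 / (4 * v^2))))" for \<xi> and v :: real
 have fm[measurable]: "case_prod f \<in> borel_measurable (lborel \<Otimes>\<^sub>M lborel)"
  unfolding f_def by measurable
 have iv: "integrable lborel (\<lambda>v. 2 / sqrt pi * (indicator {0<..} v *\<^sub>R exp (- v\<^sup>2 - r\<^sup>2 / (4 * v^2))))"
   "(\<integral>v. 2 / sqrt pi * (indicator {0<..} v *\<^sub>R exp (- v\<^sup>2 - r\<^sup>2 / (4 * v^2))) \<partial>lborel) = exp (- r)" if "r \<ge> 0" for r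
 proof -
  note a = exp_neg_subordination[OF that, unfolded set_integrable_def set_lebesgue_integral_def]
  show "integrable lborel (\<lambda>v. 2 / sqrt pi * (indicator {0<..} v *\<^sub>R exp (- v\<^sup>2 - r\<^sup>2 / (4 * v^2))))"
   by (rule Bochner_Integration.integrable_mult_right[OF a(1)])
  show "(\<integral>v. 2 / sqrt pi * (indicator {0<..} v *\<^sub>R exp (- v\<^sup>2 - r\<^sup>2 / (4 * v^2))) \<partial>lborel) = exp (- r)"
   unfolding Bochner_Integration.integral_mult_right_zero a(2) by simp
 qed
 have ex: "(\<integral>v. f \<xi> v \<partial>lborel) = w \<xi> * exp (- (\<epsilon> * norm \<xi>)) * cos (x \<bullet> \<xi>)" for \<xi>
 proof -
  have "\<epsilon> * norm \<xi> \<ge> 0" using e by simp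
  then show ?thesis unfolding f_def Bochner_Integration.integral_mult_right_zero by (simp only: iv(2)[unfolded Bochner_Integration.integral_mult_right_zero]) simp
 qed
 have nf: "norm (f \<xi> v) = \<bar>w \<xi> * cos (x \<bullet> \<xi>)\<bar> * (2 / sqrt pi * (indicator {0<..} v *\<^sub>R exp (- v\<^sup>2 - (\<epsilon> * norm \<xi>)\<^sup>2 / (4 * v^2))))" for \<xi> v
  by (simp add: f_def abs_mult split: split_indicator)
 have en: "(\<integral>v. norm (f \<xi> v) \<partial>lborel) = \<bar>w \<xi> * cos (x \<bullet> \<xi>)\<bar> * exp (- (\<epsilon> * norm \<xi>))" for \<xi>
 proof -
  have "\<epsilon> * norm \<xi> \<ge> 0" using e by simp
  then show ?thesis unfolding nf Bochner_Integration.integral_mult_right_zero by (simp only: iv(2)[unfolded Bochner_Integration.integral_mult_right_zero])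
 qed
 have ic: "integrable lborel (\<lambda>\<xi>. w \<xi> * exp (- (\<epsilon> * norm \<xi>)) * cos (x \<bullet> \<xi>))"
  by (rule integrable_w_cos[OF integrable_w_exp[OF e]]) auto
 have int: "integrable (lborel \<Otimes>\<^sub>M lborel) (case_prod f)"
 proof (rule lborel_pair.Fubini_integrable[OF fm])
  have "integrable lborel (\<lambda>\<xi>. norm (w \<xi> * exp (- (\<epsilon> * norm \<xi>)) * cos (x \<bullet> \<xi>)))"
   by (rule integrable_norm[OF ic])
  then show "integrable lborel (\<lambda>\<xi>. \<integral>v. norm (case_prod f (\<xi>, v)) \<partial>lborel)"
   by (simp add: en[unfolded real_norm_def] abs_mult mult_ac)
  show "AE \<xi> in lborel. integrable lborel (\<lambda>v. case_prod f (\<xi>, v))"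
   unfolding case_prod_conv f_def using e by (intro AE_I2 Bochner_Integration.integrable_mult_right iv(1)) simp
 qed
 have fz: "(\<integral>\<xi>. f \<xi> v \<partial>lborel) = indicator {0<..} v * (2 / sqrt pi * exp (- v\<^sup>2)) * Z (\<epsilon>^2 / (4 * v^2)) x" for v
 proof -
  have "f \<xi> v = indicator {0<..} v * (2 / sqrt pi * exp (- v\<^sup>2)) * (w \<xi> * exp (- (\<epsilon>^2 / (4 * v^2) * (norm \<xi>)^2)) * cos (x \<bullet> \<xi>))" for \<xi>
  proof -
   have "- v\<^sup>2 - (\<epsilon> * norm \<xi>)\<^sup>2 / (4 * v^2) = - v\<^sup>2 + - (\<epsilon>^2 / (4 * v^2) * (norm \<xi>)^2)" by (simp add: power_mult_distrib)
   then show ?thesis unfolding f_def by (simp only: exp_add real_scaleR_def mult_ac)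
  qed
  then show ?thesis unfolding Z_def by simp
 qed
 show "integrable lborel (\<lambda>v. indicator {0<..} v * (2 / sqrt pi * exp (- v\<^sup>2)) * Z (\<epsilon>^2 / (4 * v^2)) x)"
  using lborel_pair.integrable_snd[OF int] unfolding fz .
 show "V \<epsilon> x = (\<integral>v. indicator {0<..} v * (2 / sqrt pi * exp (- v\<^sup>2)) * Z (\<epsilon>^2 / (4 * v^2)) x \<partial>lborel)"
  using lborel_pair.Fubini_integral[OF int] unfolding fz ex V_def by simp
qed

lemma V_le_V0:
 assumes e: "\<epsilon> > 0"
 shows "V \<epsilon> x \<le> V \<epsilon> 0"
 unfolding V_def
proof (rule Bochner_Integration.integral_mono)
 show "w \<xi> * exp (- (\<epsilon> * norm \<xi>)) * cos (x \<bullet> \<xi>) \<le> w \<xi> * exp (- (\<epsilon> * norm \<xi>)) * cos (0 \<bullet> \<xi>)" for \<xi>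
  using w_nonneg[of \<xi>] by (intro mult_left_mono) auto
qed (intro integrable_w_cos[OF integrable_w_exp[OF e]]; simp)+

lemma V_nonneg:
 assumes e: "\<epsilon> > 0"
 shows "V \<epsilon> x \<ge> 0"
proof (cases "x = 0")
 case True
 show ?thesis unfolding V_def True using w_nonneg by (intro Bochner_Integration.integral_nonneg) simp
next
 case False
 show ?thesis unfolding V_eq_Z(2)[OF e]
 proof (rule Bochner_Integration.integral_nonneg)
  fix v :: real
  show "0 \<le> indicator {0<..} v * (2 / sqrt pi * exp (- v\<^sup>2)) * Z (\<epsilon>^2 / (4 * v^2)) x"
   using heat_W_integrable(3)[OF _ False, of "\<epsilon>^2 / (4 * v^2)"] e by (auto split: split_indicator)
 qed
qed

lemma V_bound: "\<exists>C>0. \<forall>\<epsilon>>0. \<forall>x. x \<noteq> 0 \<longrightarrow> V \<epsilon> x \<le> C * norm x powr (- s)"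
proof -
 obtain C where C: "C > 0" "\<And>\<tau> x. \<tau> > 0 \<Longrightarrow> x \<noteq> 0 \<Longrightarrow> Z \<tau> x \<le> C * norm x powr (- s)"
  using Z_bound by blast
 have "V \<epsilon> x \<le> C * norm x powr (- s)" if e: "\<epsilon> > 0" and x: "x \<noteq> 0" for \<epsilon> x
 proof -
  have "V \<epsilon> x \<le> (\<integral>v. indicator {0<..} v * (2 / sqrt pi * exp (- v\<^sup>2)) * (C * norm x powr (- s)) \<partial>lborel)"
   unfolding V_eq_Z(2)[OF e]
  proof (rule Bochner_Integration.integral_mono[OF V_eq_Z(1)[OF e]])
   show "integrable lborel (\<lambda>v. indicator {0<..} v * (2 / sqrt pi * exp (- v\<^sup>2)) * (C * norm x powr (- s)))"
    by (rule Bochner_Integration.integrable_mult_left[OF gauss_weight(1)])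
   fix v :: real
   show "indicator {0<..} v * (2 / sqrt pi * exp (- v\<^sup>2)) * Z (\<epsilon>^2 / (4 * v^2)) x \<le> indicator {0<..} v * (2 / sqrt pi * exp (- v\<^sup>2)) * (C * norm x powr (- s))"
    using C(2)[OF _ x, of "\<epsilon>^2 / (4 * v^2)"] e by (cases "v > 0") (auto intro!: mult_left_mono divide_right_mono)
  qed
  also have "\<dots> = C * norm x powr (- s)"
   by (subst Bochner_Integration.integral_mult_left_zero) (simp only: gauss_weight(2) mult_1)
  finally show ?thesis .
 qed
 then show ?thesis using C(1) by blast
qed

lemma V_tendsto:
 assumes x: "x \<noteq> 0" and e: "\<And>n. e n > 0" "e \<longlonglongrightarrow> 0"
 shows "(\<lambda>n. V (e n) x) \<longlonglongrightarrow> (2 * pi) ^ CARD('n) * W x"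
proof -
 obtain C where C: "C > 0" "\<And>\<tau> x. \<tau> > 0 \<Longrightarrow> x \<noteq> 0 \<Longrightarrow> Z \<tau> x \<le> C * norm x powr (- s)"
  using Z_bound by blast
 let ?g = "\<lambda>v::real. indicator {0<..} v * (2 / sqrt pi * exp (- v\<^sup>2))"
 have "(\<lambda>n. \<integral>v. ?g v * Z ((e n)^2 / (4 * v^2)) x \<partial>lborel) \<longlonglongrightarrow> (\<integral>v. ?g v * ((2 * pi) ^ CARD('n) * W x) \<partial>lborel)"
 proof (rule integral_dominated_convergence[where w="\<lambda>v. ?g v * (C * norm x powr (- s))"])
  show "integrable lborel (\<lambda>v. ?g v * (C * norm x powr (- s)))"
   by (rule Bochner_Integration.integrable_mult_left[OF gauss_weight(1)])
  show "(\<lambda>v. ?g v * Z ((e n)^2 / (4 * v^2)) x) \<in> borel_measurable lborel" for n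
   using V_eq_Z(1)[OF e(1)] by (rule borel_measurable_integrable)
  show "AE v in lborel. (\<lambda>n. ?g v * Z ((e n)^2 / (4 * v^2)) x) \<longlonglongrightarrow> ?g v * ((2 * pi) ^ CARD('n) * W x)"
  proof (intro AE_I2)
   fix v :: real
   show "(\<lambda>n. ?g v * Z ((e n)^2 / (4 * v^2)) x) \<longlonglongrightarrow> ?g v * ((2 * pi) ^ CARD('n) * W x)"
   proof (cases "v > 0")
    case True
    have "(\<lambda>n. (e n)^2 / (4 * v^2)) \<longlonglongrightarrow> 0^2 / (4 * v^2)" using True by (intro tendsto_intros e(2)) auto
    then have "(\<lambda>n. (e n)^2 / (4 * v^2)) \<longlonglongrightarrow> 0" by simp
    moreover have "(e n)^2 / (4 * v^2) > 0" for n using e(1)[of n] True by simp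
    ultimately have "(\<lambda>n. Z ((e n)^2 / (4 * v^2)) x) \<longlonglongrightarrow> (2 * pi) ^ CARD('n) * W x"
     using Z_tendsto[OF x, of "\<lambda>n. (e n)^2 / (4 * v^2)"] by blast
    then show ?thesis by (rule tendsto_mult_left)
   qed simp
  qed
  show "AE v in lborel. norm (?g v * Z ((e n)^2 / (4 * v^2)) x) \<le> ?g v * (C * norm x powr (- s))" for n
  proof (intro AE_I2)
   fix v :: real
   show "norm (?g v * Z ((e n)^2 / (4 * v^2)) x) \<le> ?g v * (C * norm x powr (- s))"
   proof (cases "v > 0")
    case True
    have p: "(e n)^2 / (4 * v^2) > 0" using e(1)[of n] True by simp
    have "\<bar>Z ((e n)^2 / (4 * v^2)) x\<bar> \<le> C * norm x powr (- s)" using C(2)[OF p x] heat_W_integrable(3)[OF p x] by simp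
    then show ?thesis using True by (simp add: abs_mult mult_left_mono divide_right_mono)
   qed simp
  qed
 qed measurable
 then show ?thesis
  unfolding V_eq_Z(2)[OF e(1)] by (simp only: Bochner_Integration.integral_mult_left_zero gauss_weight(2) mult_1)
qed

lemma Wker_eq: "x \<noteq> 0 \<Longrightarrow> Wker s \<Phi> x = ennreal (W x)"
 by (simp add: Wker_def Wfun_def sgn_div_norm)

lemma Wker_measurable[measurable]: "Wker s \<Phi> \<in> borel_measurable borel"
proof -
 have "Wker s \<Phi> = (\<lambda>x. if x = 0 then \<infinity> else ennreal (W x))"
  using Wker_eq by (auto simp: Wker_def)
 then show ?thesis by simp
qed

text \<open>Continuity into the extended reals, including the value infinity at 0, where the lower
  bound a |x|^(-s) drives the kernel to infinity uniformly over directions.\<close>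

lemma Wker_tendsto:
 assumes "z \<longlonglongrightarrow> z0"
 shows "(\<lambda>n. Wker s \<Phi> (z n)) \<longlonglongrightarrow> Wker s \<Phi> z0"
proof (cases "z0 = 0")
 case False
 have "\<forall>\<^sub>F n in sequentially. z n \<noteq> 0"
  using assms False by (metis tendsto_imp_eventually_ne)
 then have "\<forall>\<^sub>F n in sequentially. ennreal (W (z n)) = Wker s \<Phi> (z n)"
  by eventually_elim (simp add: Wker_eq)
 moreover have "(\<lambda>n. ennreal (W (z n))) \<longlonglongrightarrow> ennreal (W z0)"
  by (intro tendsto_ennrealI isCont_tendsto_compose[OF W_continuous[OF False] assms])
 ultimately show ?thesis using False by (simp add: Wker_eq Lim_transform_eventually)
next
 case True
 obtain a b where ab: "0 < a" "\<And>x. x \<noteq> 0 \<Longrightarrow> a * norm x powr (- s) \<le> W x"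
  using W_bounds by blast
 show ?thesis unfolding True
 proof (simp only: Wker_def if_True simp_thms infinity_ennreal_def tendsto_top_iff_ennreal, intro allI impI)
  fix l :: real assume l: "0 \<le> l"
  \<comment> \<open>Chosen so that the lower bound a |z|^(-s) exceeds l + 1 for |z| < r.\<close>
  define r where "r = (a / (l + 1)) powr (1 / s)"
  have r: "r > 0" unfolding r_def using ab l by simp
  have "\<forall>\<^sub>F n in sequentially. dist (z n) 0 < r" using assms r unfolding True by (rule tendstoD)
  then show "\<forall>\<^sub>F n in sequentially. ennreal l < (if z n = 0 then top else ennreal (norm (z n) powr (- s) * \<Phi> (z n /\<^sub>R norm (z n))))"
  proof eventually_elim
   case (elim n)
   show ?case
   proof (cases "z n = 0")
    case nz: False
    have "norm (z n) powr s < r powr s" using elim nz s_pos by (intro powr_less_mono2) auto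
    also have "r powr s = a / (l + 1)" unfolding r_def powr_powr using s_pos ab l by simp
    finally have "norm (z n) powr s < a / (l + 1)" .
    then have "l + 1 < a * norm (z n) powr (- s)" using nz l by (simp add: powr_minus field_simps)
    also have "\<dots> \<le> W (z n)" by (rule ab(2)[OF nz])
    finally have "ennreal l < ennreal (W (z n))" using l by (intro ennreal_lessI) auto
    then show ?thesis using nz by (simp add: Wfun_def sgn_div_norm)
   qed simp
  qed
 qed
qed

text \<open>At x = 0 the finite limit theorem does not apply. Since w is nonnegative,
  \<open>V \<epsilon>\<close> is largest at 0, so its value there dominates the value at nearby
  points z, whose limits (2 pi)^d W z are arbitrarily large.\<close>

lemma V_ennreal_tendsto:
 assumes e: "\<And>n. e n > 0" "e \<longlonglongrightarrow> 0"
 shows "(\<lambda>n. ennreal (V (e n) x)) \<longlonglongrightarrow> ennreal ((2 * pi) ^ CARD('n)) * Wker s \<Phi> x"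
proof (cases "x = 0")
 case False
 have "(\<lambda>n. ennreal (V (e n) x)) \<longlonglongrightarrow> ennreal ((2 * pi) ^ CARD('n) * W x)"
  by (intro tendsto_ennrealI V_tendsto False e)
 then show ?thesis using False W_nonneg by (simp add: Wker_eq ennreal_mult)
next
 case True
 let ?k = "(2 * pi) ^ CARD('n)"
 have k: "?k > 0" by simp
 have "ennreal ?k * Wker s \<Phi> x = top" using k True by (simp add: Wker_def ennreal_mult_top del: ennreal_power)
 moreover have "(\<lambda>n. ennreal (V (e n) x)) \<longlonglongrightarrow> top"
  unfolding tendsto_top_iff_ennreal
 proof (intro allI impI)
  fix l :: real assume l: "0 \<le> l"
  obtain i :: 'n where True by blast
  define z where "z n = inverse (real (Suc n)) *\<^sub>R axis i (1::real)" for n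
  have "z \<longlonglongrightarrow> 0 *\<^sub>R axis i (1::real)" unfolding z_def by (intro tendsto_intros LIMSEQ_inverse_real_of_nat)
  then have "(\<lambda>n. Wker s \<Phi> (z n)) \<longlonglongrightarrow> Wker s \<Phi> 0" using Wker_tendsto[of z 0] by simp
  then have "(\<lambda>n. Wker s \<Phi> (z n)) \<longlonglongrightarrow> top" by (simp add: Wker_def)
  then have "\<forall>\<^sub>F n in sequentially. ennreal (l / ?k) < Wker s \<Phi> (z n)"
   unfolding tendsto_top_iff_ennreal using l k by (metis divide_nonneg_pos)
  then obtain n where n: "ennreal (l / ?k) < Wker s \<Phi> (z n)" using eventually_happens'[OF sequentially_bot] by blast
  have z0: "z n \<noteq> 0" by (simp add: z_def axis_eq_0_iff)
  have "l / ?k < W (z n)" using n l k unfolding Wker_eq[OF z0] by (simp add: ennreal_less_iff del: power_mult_distrib)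
  then have "l < ?k * W (z n)" unfolding pos_divide_less_eq[OF k] by (simp only: mult.commute)
  then have "\<forall>\<^sub>F m in sequentially. l < V (e m) (z n)"
   by (rule order_tendstoD(1)[OF V_tendsto[OF z0 e]])
  then show "\<forall>\<^sub>F m in sequentially. ennreal l < ennreal (V (e m) x)"
  proof eventually_elim
   case (elim m)
   then show ?case using V_le_V0[OF e(1)[of m], of "z n"] l unfolding True by (intro ennreal_lessI) auto
  qed
 qed
 ultimately show ?thesis by simp
qed

text \<open>The upper bound for V and the lower bound for W have the same order |x|^(-s). The
  resulting majorant, uniform in \<epsilon>, is integrable for measures of finite energy.\<close>

lemma V_le_Wker: "\<exists>K>0. \<forall>\<epsilon>>0. \<forall>x. ennreal (V \<epsilon> x) \<le> ennreal K * Wker s \<Phi> x"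
proof -
 obtain C where C: "C > 0" "\<And>\<epsilon> x. \<epsilon> > 0 \<Longrightarrow> x \<noteq> 0 \<Longrightarrow> V \<epsilon> x \<le> C * norm x powr (- s)"
  using V_bound by blast
 obtain a b where ab: "0 < a" "\<And>x. x \<noteq> 0 \<Longrightarrow> a * norm x powr (- s) \<le> W x"
  using W_bounds by blast
 have "ennreal (V \<epsilon> x) \<le> ennreal (C / a) * Wker s \<Phi> x" if e: "\<epsilon> > 0" for \<epsilon> x
 proof (cases "x = 0")
  case True
  then show ?thesis using C(1) ab(1) by (simp add: Wker_def ennreal_mult_top)
 next
  case False
  have "V \<epsilon> x \<le> C / a * (a * norm x powr (- s))" using C(2)[OF e False] ab(1) by simp
  also have "\<dots> \<le> C / a * W x" using C(1) ab by (intro mult_left_mono ab(2)[OF False]) auto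
  finally show ?thesis using False C(1) ab(1) W_nonneg by (simp add: Wker_eq ennreal_mult[symmetric] ennreal_leI)
 qed
 then show ?thesis using C(1) ab(1) by (intro exI[of _ "C / a"]) auto
qed

end

section \<open>Energies through Fourier transforms\<close>

definition cos_transform :: "(real^'n) measure \<Rightarrow> real^'n \<Rightarrow> real" where
 "cos_transform \<nu> \<xi> = (\<integral>x. cos (\<xi> \<bullet> x) \<partial>\<nu>)"

definition sin_transform :: "(real^'n) measure \<Rightarrow> real^'n \<Rightarrow> real" where
 "sin_transform \<nu> \<xi> = (\<integral>x. sin (\<xi> \<bullet> x) \<partial>\<nu>)"

lemma prob_integrable_bounded:
 fixes \<nu> :: "(real^'n) measure"
 assumes "prob_space \<nu>" "sets \<nu> = sets borel" "(f :: real^'n \<Rightarrow> real) \<in> borel_measurable borel" "\<And>x. \<bar>f x\<bar> \<le> B"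
 shows "integrable \<nu> f"
proof -
 interpret prob_space \<nu> by fact
 show ?thesis
  by (rule integrable_const_bound[of _ B]) (use assms in \<open>auto simp: measurable_cong_sets[OF assms(2) refl]\<close>)
qed

lemma prob_integral_abs_le:
 fixes \<nu> :: "(real^'n) measure"
 assumes "prob_space \<nu>" "sets \<nu> = sets borel" "(f :: real^'n \<Rightarrow> real) \<in> borel_measurable borel" "\<And>x. \<bar>f x\<bar> \<le> B"
 shows "\<bar>\<integral>x. f x \<partial>\<nu>\<bar> \<le> B"
proof -
 interpret prob_space \<nu> by fact
 have i: "integrable \<nu> f" by (rule prob_integrable_bounded[OF assms])
 have "(\<integral>x. f x \<partial>\<nu>) \<le> B" using assms(4) by (intro integral_le_const[OF i] AE_I2) (simp add: abs_le_iff)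
 moreover have "(\<integral>x. f x \<partial>\<nu>) \<ge> - B" using assms(4) by (intro integral_ge_const[OF i] AE_I2) (simp add: abs_le_iff minus_le_iff)
 ultimately show ?thesis by simp
qed

lemma prob_integral_param_measurable:
 fixes \<nu> :: "(real^'n) measure" and h :: "real^'n \<Rightarrow> real^'n \<Rightarrow> real"
 assumes "prob_space \<nu>" and [measurable_cong]: "sets \<nu> = sets borel" and h: "case_prod h \<in> borel_measurable (borel \<Otimes>\<^sub>M borel)"
 shows "(\<lambda>\<xi>. \<integral>y. h y \<xi> \<partial>\<nu>) \<in> borel_measurable borel"
proof -
 interpret prob_space \<nu> by fact
 have "(\<lambda>(\<xi>, y). h y \<xi>) \<in> borel_measurable (borel \<Otimes>\<^sub>M \<nu>)" using measurable_compose[OF measurable_pair_swap' h] by (simp add: case_prod_beta)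
 then show ?thesis by (rule borel_measurable_lebesgue_integral)
qed

lemma cos_transform_measurable:
 assumes "prob_space \<nu>" "sets \<nu> = sets borel"
 shows "cos_transform \<nu> \<in> borel_measurable borel" "sin_transform \<nu> \<in> borel_measurable borel"
 unfolding cos_transform_def[abs_def] sin_transform_def[abs_def] by (intro prob_integral_param_measurable assms; measurable)+

lemma integral_cos_diff:
 fixes \<nu> :: "(real^'n) measure"
 assumes "prob_space \<nu>" "sets \<nu> = sets borel"
 shows "(\<integral>y. cos ((x - y) \<bullet> \<xi>) \<partial>\<nu>) = cos (\<xi> \<bullet> x) * cos_transform \<nu> \<xi> + sin (\<xi> \<bullet> x) * sin_transform \<nu> \<xi>"
proof -
 have i: "integrable \<nu> (\<lambda>y. cos (\<xi> \<bullet> y))" "integrable \<nu> (\<lambda>y. sin (\<xi> \<bullet> y))"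
  by (rule prob_integrable_bounded[OF assms, of _ 1]; simp)+
 have "(\<integral>y. cos ((x - y) \<bullet> \<xi>) \<partial>\<nu>) = (\<integral>y. cos (\<xi> \<bullet> x) * cos (\<xi> \<bullet> y) + sin (\<xi> \<bullet> x) * sin (\<xi> \<bullet> y) \<partial>\<nu>)"
  by (simp add: inner_commute inner_diff_right cos_diff)
 then show ?thesis unfolding cos_transform_def sin_transform_def using i by simp
qed

lemma double_integral_cos_diff:
 fixes M N :: "(real^'n) measure"
 assumes 1: "prob_space M" "sets M = sets borel" and 2: "prob_space N" "sets N = sets borel"
 shows "(\<integral>x. (\<integral>y. cos ((x - y) \<bullet> \<xi>) \<partial>N) \<partial>M) = cos_transform M \<xi> * cos_transform N \<xi> + sin_transform M \<xi> * sin_transform N \<xi>"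
  and "\<bar>cos_transform M \<xi> * cos_transform N \<xi> + sin_transform M \<xi> * sin_transform N \<xi>\<bar> \<le> 1"
proof -
 have i: "integrable M (\<lambda>y. cos (\<xi> \<bullet> y))" "integrable M (\<lambda>y. sin (\<xi> \<bullet> y))"
  by (rule prob_integrable_bounded[OF 1, of _ 1]; simp)+
 show eq: "(\<integral>x. (\<integral>y. cos ((x - y) \<bullet> \<xi>) \<partial>N) \<partial>M) = cos_transform M \<xi> * cos_transform N \<xi> + sin_transform M \<xi> * sin_transform N \<xi>"
  unfolding integral_cos_diff[OF 2] using i by (simp add: cos_transform_def[of M] sin_transform_def[of M])
 have "\<bar>\<integral>x. (\<integral>y. cos ((x - y) \<bullet> \<xi>) \<partial>N) \<partial>M\<bar> \<le> 1"
 proof (rule prob_integral_abs_le[OF 1])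
  show "(\<lambda>x. \<integral>y. cos ((x - y) \<bullet> \<xi>) \<partial>N) \<in> borel_measurable borel" unfolding integral_cos_diff[OF 2] by measurable
  show "\<bar>\<integral>y. cos ((x - y) \<bullet> \<xi>) \<partial>N\<bar> \<le> 1" for x by (rule prob_integral_abs_le[OF 2]) auto
 qed
 then show "\<bar>cos_transform M \<xi> * cos_transform N \<xi> + sin_transform M \<xi> * sin_transform N \<xi>\<bar> \<le> 1"
  unfolding eq .
qed

context riesz_kernel
begin

lemma fubini_w:
 fixes \<nu> :: "(real^'n) measure" and h :: "real^'n \<Rightarrow> real^'n \<Rightarrow> real"
 assumes p: "prob_space \<nu>" and [measurable_cong]: "sets \<nu> = sets borel" and e: "\<epsilon> > 0"
  and h[measurable]: "case_prod h \<in> borel_measurable (borel \<Otimes>\<^sub>M borel)" and b: "\<And>y \<xi>. \<bar>h y \<xi>\<bar> \<le> 1"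
 shows "(\<integral>y. (\<integral>\<xi>. w \<xi> * exp (- (\<epsilon> * norm \<xi>)) * h y \<xi> \<partial>lborel) \<partial>\<nu>) = (\<integral>\<xi>. w \<xi> * exp (- (\<epsilon> * norm \<xi>)) * (\<integral>y. h y \<xi> \<partial>\<nu>) \<partial>lborel)"
proof -
 interpret prob_space \<nu> by fact
 interpret P: pair_sigma_finite \<nu> "lborel :: (real^'n) measure" ..
 let ?g = "\<lambda>\<xi>. w \<xi> * exp (- (\<epsilon> * norm \<xi>))"
 have base: "integrable (\<nu> \<Otimes>\<^sub>M lborel) (\<lambda>z. ?g (snd z))"
 proof (rule P.Fubini_integrable)
  show "AE y in \<nu>. integrable lborel (\<lambda>\<xi>. ?g (snd (y, \<xi>)))" using integrable_w_exp[OF e] by simp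
  show "(\<lambda>z. ?g (snd z)) \<in> borel_measurable (\<nu> \<Otimes>\<^sub>M lborel)" by measurable
  show "integrable \<nu> (\<lambda>y. \<integral>\<xi>. norm (?g (snd (y, \<xi>))) \<partial>lborel)" by simp
 qed
 have hm: "(\<lambda>z. h (fst z) (snd z)) \<in> borel_measurable (\<nu> \<Otimes>\<^sub>M lborel)"
  using h by (simp add: case_prod_beta' measurable_cong_sets[OF sets_pair_measure_cong[OF assms(2) sets_lborel] refl])
 have int: "integrable (\<nu> \<Otimes>\<^sub>M lborel) (\<lambda>(y, \<xi>). ?g \<xi> * h y \<xi>)"
 proof (rule Bochner_Integration.integrable_bound[OF base])
  show "(\<lambda>(y, \<xi>). ?g \<xi> * h y \<xi>) \<in> borel_measurable (\<nu> \<Otimes>\<^sub>M lborel)" using hm by (simp add: case_prod_beta')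
  show "AE z in \<nu> \<Otimes>\<^sub>M lborel. norm (case z of (y, \<xi>) \<Rightarrow> ?g \<xi> * h y \<xi>) \<le> norm (?g (snd z))"
   using b by (intro AE_I2) (auto simp: abs_mult intro!: mult_left_le mult_nonneg_nonneg)
 qed
 show ?thesis using P.Fubini_integral[OF int] by simp
qed

lemma potential_transform:
 assumes "prob_space \<nu>" "sets \<nu> = sets borel" "\<epsilon> > 0"
 shows "(\<integral>y. V \<epsilon> (x - y) \<partial>\<nu>) = (\<integral>\<xi>. w \<xi> * exp (- (\<epsilon> * norm \<xi>)) * (\<integral>y. cos ((x - y) \<bullet> \<xi>) \<partial>\<nu>) \<partial>lborel)"
 unfolding V_def by (rule fubini_w[OF assms]) auto

lemma V_abs: "\<epsilon> > 0 \<Longrightarrow> \<bar>V \<epsilon> x\<bar> \<le> V \<epsilon> 0"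
 using V_nonneg[of \<epsilon> x] V_le_V0[of \<epsilon> x] by simp

definition J :: "real \<Rightarrow> (real^'n) measure \<Rightarrow> (real^'n) measure \<Rightarrow> real" where
 "J \<epsilon> M N = (\<integral>x. (\<integral>y. V \<epsilon> (x - y) \<partial>N) \<partial>M)"

lemma potential_measurable:
 assumes "prob_space \<nu>" "sets \<nu> = sets borel"
 shows "(\<lambda>x. \<integral>y. V \<epsilon> (x - y) \<partial>\<nu>) \<in> borel_measurable borel"
 by (rule prob_integral_param_measurable[OF assms]) measurable

lemma J_transform:
 assumes 1: "prob_space M" "sets M = sets borel" and 2: "prob_space N" "sets N = sets borel" and e: "\<epsilon> > 0"
 shows "J \<epsilon> M N = (\<integral>\<xi>. w \<xi> * exp (- (\<epsilon> * norm \<xi>)) * (cos_transform M \<xi> * cos_transform N \<xi> + sin_transform M \<xi> * sin_transform N \<xi>) \<partial>lborel)"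
proof -
 note [measurable] = cos_transform_measurable[OF 2]
 have m: "(\<lambda>(x, \<xi>). \<integral>y. cos ((x - y) \<bullet> \<xi>) \<partial>N) \<in> borel_measurable (borel \<Otimes>\<^sub>M borel)"
  unfolding integral_cos_diff[OF 2] by measurable
 show ?thesis
  unfolding J_def potential_transform[OF 2 e] double_integral_cos_diff(1)[OF 1 2, symmetric]
  by (rule fubini_w[OF 1 e m]) (rule prob_integral_abs_le[OF 2]; simp)
qed

lemma nn_integral_V:
 assumes 2: "prob_space N" "sets N = sets borel" and e: "\<epsilon> > 0"
 shows "(\<integral>\<^sup>+y. ennreal (V \<epsilon> (x - y)) \<partial>N) = ennreal (\<integral>y. V \<epsilon> (x - y) \<partial>N)" "(\<integral>y. V \<epsilon> (x - y) \<partial>N) \<ge> 0"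
proof -
 have i: "integrable N (\<lambda>y. V \<epsilon> (x - y))" by (rule prob_integrable_bounded[OF 2, of _ "V \<epsilon> 0"]) (auto simp: V_abs[OF e])
 show "(\<integral>\<^sup>+y. ennreal (V \<epsilon> (x - y)) \<partial>N) = ennreal (\<integral>y. V \<epsilon> (x - y) \<partial>N)"
  by (rule nn_integral_eq_integral[OF i]) (simp add: V_nonneg[OF e])
 show "(\<integral>y. V \<epsilon> (x - y) \<partial>N) \<ge> 0" by (simp add: V_nonneg[OF e])
qed

lemma nn_integral_J:
 assumes 1: "prob_space M" "sets M = sets borel" and 2: "prob_space N" "sets N = sets borel" and e: "\<epsilon> > 0"
 shows "(\<integral>\<^sup>+x. (\<integral>\<^sup>+y. ennreal (V \<epsilon> (x - y)) \<partial>N) \<partial>M) = ennreal (J \<epsilon> M N)" "J \<epsilon> M N \<ge> 0"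
proof -
 have i: "integrable M (\<lambda>x. \<integral>y. V \<epsilon> (x - y) \<partial>N)"
 proof (rule prob_integrable_bounded[OF 1 potential_measurable[OF 2]])
  show "\<bar>\<integral>y. V \<epsilon> (x - y) \<partial>N\<bar> \<le> V \<epsilon> 0" for x
   by (rule prob_integral_abs_le[OF 2]) (auto simp: V_abs[OF e])
 qed
 show "(\<integral>\<^sup>+x. (\<integral>\<^sup>+y. ennreal (V \<epsilon> (x - y)) \<partial>N) \<partial>M) = ennreal (J \<epsilon> M N)"
  unfolding J_def nn_integral_V(1)[OF 2 e] by (rule nn_integral_eq_integral[OF i]) (simp add: nn_integral_V(2)[OF 2 e])
 show "J \<epsilon> M N \<ge> 0" unfolding J_def by (simp add: nn_integral_V(2)[OF 2 e])
qed

text \<open>The expansion of the integral of w exp (- \<epsilon> |\<xi>|) times the squared modulus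
  of the difference of the transforms. The mixed term stands on the left because subtraction in
  \<open>ennreal\<close> truncates.\<close>

lemma J_square:
 assumes 1: "prob_space M" "sets M = sets borel" and 2: "prob_space N" "sets N = sets borel" and e: "\<epsilon> > 0"
 defines "q \<equiv> \<lambda>\<xi>. (cos_transform M \<xi> - cos_transform N \<xi>)^2 + (sin_transform M \<xi> - sin_transform N \<xi>)^2"
 shows "(\<integral>\<^sup>+\<xi>. ennreal (w \<xi> * exp (- (\<epsilon> * norm \<xi>)) * q \<xi>) \<partial>lborel) + 2 * ennreal (J \<epsilon> M N) = ennreal (J \<epsilon> M M) + ennreal (J \<epsilon> N N)"
proof -
 note [measurable] = cos_transform_measurable[OF 2] cos_transform_measurable[OF 1]
 let ?p = "\<lambda>a b \<xi>. cos_transform a \<xi> * cos_transform b \<xi> + sin_transform a \<xi> * sin_transform b \<xi>"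
 let ?g = "\<lambda>\<xi>. w \<xi> * exp (- (\<epsilon> * norm \<xi>))"
 have i: "integrable lborel (\<lambda>\<xi>. ?g \<xi> * ?p M M \<xi>)" "integrable lborel (\<lambda>\<xi>. ?g \<xi> * ?p M N \<xi>)" "integrable lborel (\<lambda>\<xi>. ?g \<xi> * ?p N N \<xi>)"
  using double_integral_cos_diff(2)[OF 1 1] double_integral_cos_diff(2)[OF 1 2] double_integral_cos_diff(2)[OF 2 2]
  by (intro integrable_w_cos[OF integrable_w_exp[OF e]]; measurable; blast)+
 have qe: "?g \<xi> * q \<xi> = ?g \<xi> * ?p M M \<xi> - 2 * (?g \<xi> * ?p M N \<xi>) + ?g \<xi> * ?p N N \<xi>" for \<xi>
  unfolding q_def power2_eq_square by algebra
 have "integrable lborel (\<lambda>\<xi>. ?g \<xi> * q \<xi>)" unfolding qe using i by simp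
 moreover have "?g \<xi> * q \<xi> \<ge> 0" for \<xi> unfolding q_def using w_nonneg by simp
 ultimately have "(\<integral>\<^sup>+\<xi>. ennreal (?g \<xi> * q \<xi>) \<partial>lborel) = ennreal (\<integral>\<xi>. ?g \<xi> * q \<xi> \<partial>lborel)" "(\<integral>\<xi>. ?g \<xi> * q \<xi> \<partial>lborel) \<ge> 0"
  by (auto intro!: nn_integral_eq_integral)
 moreover have "(\<integral>\<xi>. ?g \<xi> * q \<xi> \<partial>lborel) = J \<epsilon> M M - 2 * J \<epsilon> M N + J \<epsilon> N N"
  unfolding J_transform[OF 1 1 e] J_transform[OF 1 2 e] J_transform[OF 2 2 e] qe using i by simp
 moreover have "2 * ennreal (J \<epsilon> M N) = ennreal (2 * J \<epsilon> M N)" using nn_integral_J(2)[OF 1 2 e] by (simp add: ennreal_mult)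
 ultimately show ?thesis
  using nn_integral_J(2)[OF 1 1 e] nn_integral_J(2)[OF 1 2 e] nn_integral_J(2)[OF 2 2 e] by (simp add: ennreal_plus[symmetric] del: ennreal_plus)
qed

end

lemma inner_matrix_transpose: "(x::real^'n) \<bullet> (A *v y) = (transpose A *v x) \<bullet> y"
 by (metis dot_lmul_matrix transpose_matrix_vector)

text \<open>Passage to the limit when Q is only controlled from below, by Fatou. Each y < x is
  eventually below \<open>Q n\<close>, so only the limits of a and b are used; finiteness of b0
  permits its cancellation in the final supremum over y.\<close>

lemma liminf_add_le_ennreal:
 fixes Q a b :: "nat \<Rightarrow> ennreal"
 assumes x: "x \<le> liminf Q" and b: "b \<longlonglongrightarrow> b0" and a: "a \<longlonglongrightarrow> a0" and le: "\<And>n. Q n + b n \<le> a n" and b0: "b0 \<noteq> top"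
 shows "x + b0 \<le> a0"
proof -
 have 1: "y + b0 \<le> a0" if "y < x" for y
 proof -
  have "y < liminf Q" using that x by (rule less_le_trans)
  then have "\<forall>\<^sub>F n in sequentially. y < Q n" by (rule less_LiminfD)
  then have "\<forall>\<^sub>F n in sequentially. y + b n \<le> a n"
   by eventually_elim (meson add_right_mono less_imp_le order_trans le)
  then show ?thesis using tendsto_le[OF sequentially_bot a tendsto_add[OF tendsto_const[of y] b]] by blast
 qed
 have "\<forall>\<^sub>F n in sequentially. b n \<le> a n"
  by (intro always_eventually allI order_trans[OF _ le]) (simp add: add_increasing)
 then have 2: "b0 \<le> a0" by (rule tendsto_le[OF sequentially_bot a b])
 have "x \<le> a0 - b0"
 proof (rule dense_le)
  fix y assume "y < x"
  then have "(y + b0) - b0 \<le> a0 - b0" using 1 by (intro ennreal_minus_mono) auto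
  then show "y \<le> a0 - b0" using b0 by (simp add: ennreal_add_diff_cancel_right)
 qed
 then have "x + b0 \<le> a0 - b0 + b0" by (rule add_right_mono)
 then show ?thesis using 2 by (simp add: diff_add_cancel_ennreal)
qed

context riesz_kernel
begin

abbreviation energy2 :: "(real^'n) measure \<Rightarrow> (real^'n) measure \<Rightarrow> ennreal" where
 "energy2 M N \<equiv> (\<integral>\<^sup>+x. (\<integral>\<^sup>+y. Wker s \<Phi> (x - y) \<partial>N) \<partial>M)"

lemma energy_fatou:
 assumes 1: "prob_space M" "sets M = sets borel" and 2: "prob_space N" "sets N = sets borel"
  and e: "\<And>n. e n > 0" "e \<longlonglongrightarrow> 0"
 shows "ennreal ((2 * pi) ^ CARD('n)) * energy2 M N \<le> liminf (\<lambda>n. ennreal (J (e n) M N))"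
proof -
 interpret p1: prob_space M by fact
 interpret p2: prob_space N by fact
 note [measurable_cong] = 1(2) 2(2)
 have [measurable]: "(\<lambda>x. \<integral>\<^sup>+y. Wker s \<Phi> (x - y) \<partial>N) \<in> borel_measurable borel"
  by (intro p2.borel_measurable_nn_integral) measurable
 have "ennreal ((2 * pi) ^ CARD('n)) * energy2 M N = (\<integral>\<^sup>+x. (\<integral>\<^sup>+y. ennreal ((2 * pi) ^ CARD('n)) * Wker s \<Phi> (x - y) \<partial>N) \<partial>M)"
  by (subst nn_integral_cmult[symmetric], measurable, intro nn_integral_cong nn_integral_cmult[symmetric], measurable)
 also have "\<dots> = (\<integral>\<^sup>+x. (\<integral>\<^sup>+y. liminf (\<lambda>n. ennreal (V (e n) (x - y))) \<partial>N) \<partial>M)"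
  by (simp only: lim_imp_Liminf[OF sequentially_bot V_ennreal_tendsto[OF e]])
 also have "\<dots> \<le> (\<integral>\<^sup>+x. liminf (\<lambda>n. \<integral>\<^sup>+y. ennreal (V (e n) (x - y)) \<partial>N) \<partial>M)"
  by (intro nn_integral_mono nn_integral_liminf) measurable
 also have "\<dots> \<le> liminf (\<lambda>n. \<integral>\<^sup>+x. (\<integral>\<^sup>+y. ennreal (V (e n) (x - y)) \<partial>N) \<partial>M)"
  by (rule nn_integral_liminf) (intro p2.borel_measurable_nn_integral, measurable)
 also have "\<dots> = liminf (\<lambda>n. ennreal (J (e n) M N))" by (simp only: nn_integral_J(1)[OF 1 2 e(1)])
 finally show ?thesis .
qed

text \<open>Finite energy makes the majorant of \<open>V_le_Wker\<close> integrable over the product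
  measure, so the inequality of \<open>energy_fatou\<close> improves to convergence. Convergence is
  needed for the terms on the larger side of \<open>J_square\<close>, where Fatou points the wrong
  way.\<close>

lemma J_tendsto_energy:
 assumes 1: "prob_space \<nu>" "sets \<nu> = sets borel" and fin: "energy2 \<nu> \<nu> < \<infinity>"
  and e: "\<And>n. e n > 0" "e \<longlonglongrightarrow> 0"
 shows "(\<lambda>n. ennreal (J (e n) \<nu> \<nu>)) \<longlonglongrightarrow> ennreal ((2 * pi) ^ CARD('n)) * energy2 \<nu> \<nu>"
proof -
 interpret p1: prob_space \<nu> by fact
 note [measurable_cong] = 1(2)
 obtain K where K: "K > 0" "\<And>\<epsilon> x. \<epsilon> > 0 \<Longrightarrow> ennreal (V \<epsilon> x) \<le> ennreal K * Wker s \<Phi> x" using V_le_Wker by blast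
 have Wm[measurable]: "(\<lambda>z. Wker s \<Phi> (fst z - snd z)) \<in> borel_measurable (\<nu> \<Otimes>\<^sub>M \<nu>)" by measurable
 have Vm[measurable]: "(\<lambda>z. ennreal (V \<epsilon> (fst z - snd z))) \<in> borel_measurable (\<nu> \<Otimes>\<^sub>M \<nu>)" for \<epsilon> by measurable
 have pW: "energy2 \<nu> \<nu> = (\<integral>\<^sup>+z. Wker s \<Phi> (fst z - snd z) \<partial>(\<nu> \<Otimes>\<^sub>M \<nu>))"
  using p1.nn_integral_fst[OF Wm] by simp
 have pV: "ennreal (J (e n) \<nu> \<nu>) = (\<integral>\<^sup>+z. ennreal (V (e n) (fst z - snd z)) \<partial>(\<nu> \<Otimes>\<^sub>M \<nu>))" for n
  unfolding nn_integral_J(1)[OF 1 1 e(1), symmetric] using p1.nn_integral_fst[OF Vm] by simp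
 have "(\<lambda>n. \<integral>\<^sup>+z. ennreal (V (e n) (fst z - snd z)) \<partial>(\<nu> \<Otimes>\<^sub>M \<nu>)) \<longlonglongrightarrow> (\<integral>\<^sup>+z. ennreal ((2 * pi) ^ CARD('n)) * Wker s \<Phi> (fst z - snd z) \<partial>(\<nu> \<Otimes>\<^sub>M \<nu>))"
 proof (rule nn_integral_dominated_convergence[where w="\<lambda>z. ennreal K * Wker s \<Phi> (fst z - snd z)"])
  show "(\<integral>\<^sup>+z. ennreal K * Wker s \<Phi> (fst z - snd z) \<partial>(\<nu> \<Otimes>\<^sub>M \<nu>)) < \<infinity>"
   using fin unfolding pW by (subst nn_integral_cmult) (auto simp: ennreal_mult_less_top)
  show "AE z in \<nu> \<Otimes>\<^sub>M \<nu>. ennreal (V (e n) (fst z - snd z)) \<le> ennreal K * Wker s \<Phi> (fst z - snd z)" for n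
   by (intro AE_I2 K(2) e(1))
  show "AE z in \<nu> \<Otimes>\<^sub>M \<nu>. (\<lambda>n. ennreal (V (e n) (fst z - snd z))) \<longlonglongrightarrow> ennreal ((2 * pi) ^ CARD('n)) * Wker s \<Phi> (fst z - snd z)"
   by (intro AE_I2 V_ennreal_tendsto e)
 qed measurable
 then show ?thesis unfolding pV pW by (subst (asm) nn_integral_cmult) measurable
qed

lemma Wker_scaleR: "l > 0 \<Longrightarrow> Wker s \<Phi> (l *\<^sub>R z) = ennreal (l powr (- s)) * Wker s \<Phi> z"
proof (cases "z = 0")
 case True
 assume "l > 0"
 then show ?thesis using True by (simp add: Wker_def ennreal_mult_top)
next
 case False
 assume l: "l > 0"
 have "W (l *\<^sub>R z) = l powr (- s) * W z" using l by (simp add: Wfun_def powr_mult sgn_scaleR mult_ac)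
 then show ?thesis using False l W_nonneg by (simp add: Wker_eq ennreal_mult)
qed

text \<open>Formally (2 pi)^d times the energy of the signed measure M - N, read on the Fourier
  side, where it is visibly nonnegative.\<close>

definition gap :: "(real^'n) measure \<Rightarrow> (real^'n) measure \<Rightarrow> ennreal" where
 "gap M N = (\<integral>\<^sup>+\<xi>. ennreal (w \<xi> * ((cos_transform M \<xi> - cos_transform N \<xi>)^2 + (sin_transform M \<xi> - sin_transform N \<xi>)^2)) \<partial>lborel)"

section \<open>Potentials and energies of the dilated candidate measures\<close>

context
 fixes \<mu> :: "(real^'n) measure" and T B :: "real^'n^'n"
 assumes iso: "iso_measure s \<mu>" and TB: "T ** B = mat 1"
begin

definition dil :: "real \<Rightarrow> (real^'n) measure" where
 "dil l = distr \<mu> borel (\<lambda>y. l *\<^sub>R (T *v y))"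

lemma dil_map_measurable[measurable]: "(\<lambda>y. l *\<^sub>R (T *v y)) \<in> measurable \<mu> borel"
 using measurable_matrix_vector_mult[of T] by (simp add: measurable_cong_sets[OF iso_sets[OF iso s_pos] refl])

lemma dil_prob: "prob_space (dil l)" "sets (dil l) = sets borel"
proof -
 interpret prob_space \<mu> by (rule iso_prob[OF iso s_pos])
 show "prob_space (dil l)" unfolding dil_def by (rule prob_space_distr) measurable
 show "sets (dil l) = sets borel" by (simp add: dil_def)
qed

lemma dil_transforms:
 assumes m: "\<And>\<xi>. (\<integral>y. cos (\<xi> \<bullet> y) \<partial>\<mu>) = m (norm \<xi>)"
 shows "cos_transform (dil l) \<xi> = m (norm (l *\<^sub>R (transpose T *v \<xi>)))" "sin_transform (dil l) \<xi> = 0"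
proof -
 have eq: "\<xi> \<bullet> (l *\<^sub>R (T *v y)) = (l *\<^sub>R (transpose T *v \<xi>)) \<bullet> y" for y by (simp add: inner_matrix_transpose)
 show "cos_transform (dil l) \<xi> = m (norm (l *\<^sub>R (transpose T *v \<xi>)))"
  unfolding cos_transform_def dil_def by (subst integral_distr) (measurable, simp only: eq m)
 show "sin_transform (dil l) \<xi> = 0"
  unfolding sin_transform_def dil_def by (subst integral_distr) (measurable, simp only: eq iso_sin[OF iso s_pos])
qed

text \<open>Invertibility keeps |T^T \<omega>| away from 0 on the sphere, so rescaling the radial
  variable by it is legitimate and its negative powers stay bounded.\<close>

lemma transpose_lower_bound: "\<exists>\<alpha>>0. \<forall>\<omega>. norm \<omega> = 1 \<longrightarrow> \<alpha> \<le> norm (transpose T *v \<omega>)"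
proof -
 have "linear (\<lambda>x. transpose B *v x)" by (rule matrix_vector_mul_linear)
 then obtain b where b: "b > 0" "\<And>x. norm (transpose B *v x) \<le> b * norm x" using linear_bounded_pos by blast
 have "1 / b \<le> norm (transpose T *v \<omega>)" if "norm \<omega> = 1" for \<omega>
 proof -
  have "transpose B *v (transpose T *v \<omega>) = transpose (T ** B) *v \<omega>"
   by (simp only: matrix_vector_mul_assoc matrix_transpose_mul)
  then have "transpose B *v (transpose T *v \<omega>) = \<omega>" by (simp only: TB transpose_mat matrix_vector_mul_lid)
  then have "1 \<le> b * norm (transpose T *v \<omega>)" using b(2)[of "transpose T *v \<omega>"] that by simp
  then show ?thesis using b(1) by (simp add: field_simps)
 qed
 then show ?thesis using b(1) by (intro exI[of _ "1 / b"]) auto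
qed

lemma rescaled_oscillatory_integral:
 fixes m :: "real \<Rightarrow> real"
 assumes A: "A > 0"
 shows "(LINT r:{0<..}|lborel. r powr (s - 1) * (exp (- (\<epsilon> * r)) * (cos (r * b) * m (r * A)))) =
  A powr (- s) * (LINT r:{0<..}|lborel. r powr (s - 1) * exp (- (\<epsilon> / A * r)) * (m r * cos (r * (b / A))))"
proof -
 let ?f = "\<lambda>r. indicator {0<..} r *\<^sub>R (r powr (s - 1) * (exp (- (\<epsilon> * r)) * (cos (r * b) * m (r * A))))"
 let ?h = "\<lambda>r. indicator {0<..} r *\<^sub>R (r powr (s - 1) * exp (- (\<epsilon> / A * r)) * (m r * cos (r * (b / A))))"
 have "(\<integral>r. ?f r \<partial>lborel) = \<bar>1 / A\<bar> *\<^sub>R (\<integral>u. ?f (0 + 1 / A * u) \<partial>lborel)"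
  by (rule lborel_integral_real_affine) (use A in simp)
 also have "\<dots> = 1 / A * (\<integral>u. A powr (1 - s) * ?h u \<partial>lborel)"
 proof -
  have feq: "?f (0 + 1 / A * u) = A powr (1 - s) * ?h u" for u
  proof (cases "u > 0")
   case True
   have "(1 / A * u) powr (s - 1) = A powr (1 - s) * u powr (s - 1)"
   proof -
    have "(1 / A * u) powr (s - 1) = (1 / A) powr (s - 1) * u powr (s - 1)" by (rule powr_mult)
    also have "(1 / A) powr (s - 1) = inverse A powr (s - 1)" by (simp add: divide_inverse)
    also have "\<dots> = A powr (- (s - 1))" by (simp only: powr_minus inverse_powr)
    finally show ?thesis by simp
   qed
   then show ?thesis using True A by (simp add: mult_ac)
  qed (use A in \<open>simp add: zero_less_divide_iff\<close>)
  show ?thesis by (simp only: feq) (use A in simp)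
 qed
 also have "\<dots> = A powr (- s) * (\<integral>u. ?h u \<partial>lborel)"
 proof -
  have "1 / A * A powr (1 - s) = A powr (- s)" using A by (simp add: powr_diff powr_minus divide_inverse)
  then show ?thesis by (simp only: Bochner_Integration.integral_mult_right_zero mult.assoc[symmetric])
 qed
 finally show ?thesis unfolding set_lebesgue_integral_def .
qed

text \<open>Along the ray in direction \<omega> the transform of the dilated measure is m (r A),
  with A = l |T^T \<omega>|. After the substitution r A -> r the direction survives only in the
  factor A^(-s), the damping \<epsilon> / A and the frequency b = (x . \<omega>) / A, so the
  one-dimensional limit theorem applies for each direction.\<close>

lemma potential_polar:
 assumes m: "\<And>\<xi>. (\<integral>y. cos (\<xi> \<bullet> y) \<partial>\<mu>) = m (norm \<xi>)" and mm[measurable]: "m \<in> borel_measurable borel" and mb: "\<And>r. \<bar>m r\<bar> \<le> 1"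
  and l: "l > 0" and e: "\<epsilon> > 0"
 defines "A \<equiv> \<lambda>\<omega>. l * norm (transpose T *v \<omega>)"
 shows "(\<integral>y. V \<epsilon> (x - y) \<partial>dil l) =
  (\<integral>\<omega>. A \<omega> powr (- s) * (LINT r:{0<..}|lborel. r powr (s - 1) * exp (- (\<epsilon> / A \<omega> * r)) * (m r * cos (r * ((x \<bullet> \<omega>) / A \<omega>)))) \<partial>sig)"
proof -
 define g where "g r \<omega> = exp (- (\<epsilon> * r)) * (cos (r * (x \<bullet> \<omega>)) * m (r * A \<omega>))" for r \<omega>
 have Am[measurable]: "A \<in> borel_measurable borel" unfolding A_def using measurable_matrix_vector_mult[of "transpose T"] by measurable
 have gm: "case_prod g \<in> borel_measurable (borel \<Otimes>\<^sub>M borel)" unfolding g_def by measurable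
 have gs: "g (norm \<xi>) (sgn \<xi>) = exp (- (\<epsilon> * norm \<xi>)) * (\<integral>y. cos ((x - y) \<bullet> \<xi>) \<partial>dil l)" for \<xi>
 proof -
  have xi: "norm \<xi> *\<^sub>R sgn \<xi> = \<xi>" by (cases "\<xi> = 0") (simp_all add: sgn_div_norm)
  have "norm \<xi> * (x \<bullet> sgn \<xi>) = \<xi> \<bullet> x" using arg_cong[OF xi, of "\<lambda>z. x \<bullet> z"] by (simp add: inner_commute)
  moreover have "norm \<xi> * A (sgn \<xi>) = norm (l *\<^sub>R (transpose T *v \<xi>))"
  proof -
   have "norm (l *\<^sub>R (transpose T *v \<xi>)) = l * norm (transpose T *v (norm \<xi> *\<^sub>R sgn \<xi>))" using l xi by simp
   also have "\<dots> = norm \<xi> * A (sgn \<xi>)" by (simp add: A_def matrix_vector_mult_scaleR)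
   finally show ?thesis by simp
  qed
  ultimately show ?thesis unfolding g_def integral_cos_diff[OF dil_prob] dil_transforms[OF m] by simp
 qed
 have int: "integrable lborel (\<lambda>\<xi>. w \<xi> * g (norm \<xi>) (sgn \<xi>))"
 proof -
  have "(\<lambda>\<xi>. \<integral>y. cos ((x - y) \<bullet> \<xi>) \<partial>dil l) \<in> borel_measurable borel"
   unfolding integral_cos_diff[OF dil_prob] using cos_transform_measurable[OF dil_prob] by measurable
  then have "integrable lborel (\<lambda>\<xi>. w \<xi> * exp (- (\<epsilon> * norm \<xi>)) * (\<integral>y. cos ((x - y) \<bullet> \<xi>) \<partial>dil l))"
   by (intro integrable_w_cos[OF integrable_w_exp[OF e]] prob_integral_abs_le[OF dil_prob]) auto
  then show ?thesis unfolding gs by (simp add: mult.assoc)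
 qed
 have "(\<integral>y. V \<epsilon> (x - y) \<partial>dil l) = (\<integral>\<xi>. w \<xi> * g (norm \<xi>) (sgn \<xi>) \<partial>lborel)"
  unfolding potential_transform[OF dil_prob e] gs by (simp add: mult.assoc)
 also have "\<dots> = (\<integral>\<omega>. (LINT r:{0<..}|lborel. r powr (s - 1) * g r \<omega>) \<partial>sig)"
  by (rule integral_polar[OF s_pos _ w_hom w_fin refl w_nonneg w_measurable gm int]) measurable
 also have "\<dots> = (\<integral>\<omega>. A \<omega> powr (- s) * (LINT r:{0<..}|lborel. r powr (s - 1) * exp (- (\<epsilon> / A \<omega> * r)) * (m r * cos (r * ((x \<bullet> \<omega>) / A \<omega>)))) \<partial>sig)"
 proof (rule integral_cong_AE)
  have "AE \<omega> in sig. norm \<omega> = 1" by (rule AE_angular_measure) measurable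
  then show "AE \<omega> in sig. (LINT r:{0<..}|lborel. r powr (s - 1) * g r \<omega>) =
    A \<omega> powr (- s) * (LINT r:{0<..}|lborel. r powr (s - 1) * exp (- (\<epsilon> / A \<omega> * r)) * (m r * cos (r * ((x \<bullet> \<omega>) / A \<omega>))))"
  proof eventually_elim
   case (elim \<omega>)
   obtain \<alpha> where "\<alpha> > 0" "\<And>\<omega>. norm \<omega> = 1 \<Longrightarrow> \<alpha> \<le> norm (transpose T *v \<omega>)" using transpose_lower_bound by blast
   then have "norm (transpose T *v \<omega>) > 0" using elim by (meson less_le_trans)
   then have "A \<omega> > 0" using l unfolding A_def by simp
   then show ?case unfolding g_def by (rule rescaled_oscillatory_integral)
  qed
  show "(\<lambda>\<omega>. LINT r:{0<..}|lborel. r powr (s - 1) * g r \<omega>) \<in> borel_measurable sig"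
   unfolding set_lebesgue_integral_def g_def by (intro lborel.borel_measurable_lebesgue_integral) measurable
  show "(\<lambda>\<omega>. A \<omega> powr (- s) * (LINT r:{0<..}|lborel. r powr (s - 1) * exp (- (\<epsilon> / A \<omega> * r)) * (m r * cos (r * ((x \<bullet> \<omega>) / A \<omega>))))) \<in> borel_measurable sig"
   unfolding set_lebesgue_integral_def by (intro borel_measurable_times lborel.borel_measurable_lebesgue_integral) measurable
 qed
 finally show ?thesis .
qed

text \<open>For x = T u with |u| <= 1 one has |x . \<omega>| <= |T^T \<omega>|, so the frequency
  satisfies |b| <= 1 / l for every direction. For l > 1 this stays in the range where the radial
  limit C does not depend on b, hence not on x, with a uniform bound that permits dominated
  convergence over the angular measure. The factor l^(-s) comes out of A^(-s), which leaves c
  independent of l.\<close>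

theorem potential_limit:
 "\<exists>c\<ge>0. \<forall>l>1. \<exists>e K. (\<forall>n. e n > 0) \<and> e \<longlonglongrightarrow> 0 \<and>
   (\<forall>x\<in>(\<lambda>x. T *v x) ` cball 0 1. (\<forall>n. \<bar>\<integral>y. V (e n) (x - y) \<partial>dil l\<bar> \<le> K) \<and>
    (\<lambda>n. \<integral>y. V (e n) (x - y) \<partial>dil l) \<longlonglongrightarrow> l powr (- s) * c)"
proof -
 obtain m m1 m2 where m: "\<And>r. (m has_real_derivative m1 r) (at r)" "\<And>r. (m1 has_real_derivative m2 r) (at r)"
  "\<And>r. r * m2 r + (s + 1) * m1 r + r * m r = 0" "\<And>r. \<bar>m r\<bar> \<le> 1" "\<And>r. \<bar>m1 r\<bar> \<le> 1"
  "\<And>\<xi>. (\<integral>y. cos (\<xi> \<bullet> y) \<partial>\<mu>) = m (norm \<xi>)"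
  using iso_char_ode[OF iso s_pos] by blast
 have "continuous_on UNIV m" by (intro continuous_at_imp_continuous_on ballI DERIV_isCont[OF m(1)])
 then have mm[measurable]: "m \<in> borel_measurable borel" by (rule borel_measurable_continuous_onI)
 define F where "F e b = (LINT r:{0<..}|lborel. r powr (s - 1) * exp (- (e * r)) * (m r * cos (r * b)))" for e b
 obtain C where C: "\<And>b. \<bar>b\<bar> < 1 \<Longrightarrow> ((\<lambda>e. F e b) \<longlongrightarrow> C) (at_right 0)"
  "\<And>\<rho>. \<rho> < 1 \<Longrightarrow> \<exists>K. \<forall>b e. \<bar>b\<bar> \<le> \<rho> \<and> 0 < e \<and> e \<le> 1 \<longrightarrow> \<bar>F e b\<bar> \<le> K"
  using oscillatory_integral_limit[OF s_pos m(1) m(2) m(3) m(4) m(5)] unfolding F_def by blast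
 obtain \<alpha> where \<alpha>: "\<alpha> > 0" "\<And>\<omega>. norm \<omega> = 1 \<Longrightarrow> \<alpha> \<le> norm (transpose T *v \<omega>)" using transpose_lower_bound by blast
 interpret sig: finite_measure sig by (rule finite_sig)
 have AE1: "AE \<omega> in sig. norm \<omega> = 1" by (rule AE_angular_measure) measurable
 let ?a = "\<lambda>\<omega>. norm (transpose T *v \<omega>)"
 have [measurable]: "?a \<in> borel_measurable borel" using measurable_matrix_vector_mult[of "transpose T"] by measurable
 define c where "c = (\<integral>\<omega>. ?a \<omega> powr (- s) * C \<partial>sig)"
 \<comment> \<open>The factor \<alpha> ensures \<open>e n / A \<omega> \<le> 1\<close>, the range in
   which the uniform bound of the radial integral was proved.\<close>
 define e where "e n = \<alpha> * inverse (real (Suc n))" for n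
 have e: "e n > 0" "e n \<le> \<alpha>" for n using \<alpha>(1) by (auto simp: e_def field_simps)
 have "e \<longlonglongrightarrow> \<alpha> * 0" unfolding e_def by (intro tendsto_intros LIMSEQ_inverse_real_of_nat)
 then have e0: "e \<longlonglongrightarrow> 0" by simp
 have main: "\<exists>K. \<forall>x\<in>(\<lambda>x. T *v x) ` cball 0 1. (\<forall>n. \<bar>\<integral>y. V (e n) (x - y) \<partial>dil l\<bar> \<le> K) \<and>
    (\<lambda>n. \<integral>y. V (e n) (x - y) \<partial>dil l) \<longlonglongrightarrow> l powr (- s) * c" if l: "l > 1" for l
 proof -
  have "1 / l < 1" using l by simp
  from C(2)[OF this] obtain K0 where K0: "\<And>b e. \<bar>b\<bar> \<le> 1 / l \<Longrightarrow> 0 < e \<Longrightarrow> e \<le> 1 \<Longrightarrow> \<bar>F e b\<bar> \<le> K0" by blast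
  define A where "A \<omega> = l * ?a \<omega>" for \<omega>
  have [measurable]: "A \<in> borel_measurable borel" unfolding A_def by measurable
  have A: "A \<omega> \<ge> \<alpha>" if "norm \<omega> = 1" for \<omega>
  proof -
   have "\<alpha> \<le> ?a \<omega>" by (rule \<alpha>(2)[OF that])
   also have "?a \<omega> \<le> l * ?a \<omega>" using l by (simp add: mult_le_cancel_right1)
   finally show ?thesis by (simp add: A_def)
  qed
  define f where "f x n \<omega> = A \<omega> powr (- s) * F (e n / A \<omega>) ((x \<bullet> \<omega>) / A \<omega>)" for x n \<omega>
  have fm: "f x n \<in> borel_measurable sig" for x n
   unfolding f_def F_def set_lebesgue_integral_def by (intro borel_measurable_times lborel.borel_measurable_lebesgue_integral) measurable
  have U: "(\<integral>y. V (e n) (x - y) \<partial>dil l) = (\<integral>\<omega>. f x n \<omega> \<partial>sig)" for x n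
   unfolding f_def F_def A_def using l by (intro potential_polar m(6) mm m(4) e(1)) auto
  have b: "\<bar>(x \<bullet> \<omega>) / A \<omega>\<bar> \<le> 1 / l" if x: "x \<in> (\<lambda>x. T *v x) ` cball 0 1" and \<omega>: "norm \<omega> = 1" for x \<omega>
  proof -
   obtain u where u: "x = T *v u" "norm u \<le> 1" using x by auto
   have "\<bar>x \<bullet> \<omega>\<bar> = \<bar>(transpose T *v \<omega>) \<bullet> u\<bar>" by (simp add: u inner_commute[of _ \<omega>] inner_matrix_transpose)
   also have "\<dots> \<le> ?a \<omega> * norm u" by (rule Cauchy_Schwarz_ineq2)
   also have "\<dots> \<le> ?a \<omega>" using u(2) by (simp add: mult_left_le)
   finally have le: "\<bar>x \<bullet> \<omega>\<bar> \<le> ?a \<omega>" .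
   have a0: "?a \<omega> > 0" by (rule less_le_trans[OF \<alpha>(1) \<alpha>(2)[OF \<omega>]])
   have "\<bar>(x \<bullet> \<omega>) / A \<omega>\<bar> = \<bar>x \<bullet> \<omega>\<bar> / (l * ?a \<omega>)" using l a0 unfolding A_def abs_divide by (simp only: abs_mult abs_norm_cancel abs_of_pos)
   also have "\<dots> \<le> ?a \<omega> / (l * ?a \<omega>)" using le l by (intro divide_right_mono) auto
   also have "\<dots> = 1 / l" using a0 l by (simp del: transpose_matrix_vector)
   finally show ?thesis .
  qed
  have eA: "0 < e n / A \<omega>" "e n / A \<omega> \<le> 1" if "norm \<omega> = 1" for n \<omega>
   using A[OF that] e[of n] \<alpha>(1) by auto
  have K0p: "K0 \<ge> 0" using K0[of 0 1] l by (metis abs_ge_zero abs_zero divide_nonneg_pos le_less_trans less_imp_le order_refl order_trans zero_le_one zero_less_one)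
  have fb: "\<bar>f x n \<omega>\<bar> \<le> \<alpha> powr (- s) * K0" if x: "x \<in> (\<lambda>x. T *v x) ` cball 0 1" and \<omega>: "norm \<omega> = 1" for x n \<omega>
   unfolding f_def abs_mult using A[OF \<omega>] \<alpha>(1) s_pos K0[OF b[OF x \<omega>] eA[OF \<omega>]]
   by (intro mult_mono) (auto intro!: powr_mono2')
  have ff: "integrable sig (f x n)" if x: "x \<in> (\<lambda>x. T *v x) ` cball 0 1" for x n
   by (rule sig.integrable_const_bound[of _ "\<alpha> powr (- s) * K0"]) (use AE1 fb[OF x] fm in \<open>auto elim!: eventually_mono\<close>)
  have bound: "\<bar>\<integral>y. V (e n) (x - y) \<partial>dil l\<bar> \<le> measure sig UNIV * (\<alpha> powr (- s) * K0)" if x: "x \<in> (\<lambda>x. T *v x) ` cball 0 1" for x n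
  proof -
   have "norm (\<integral>\<omega>. f x n \<omega> \<partial>sig) \<le> (\<integral>\<omega>. norm (f x n \<omega>) \<partial>sig)" by (rule integral_norm_bound)
   also have "\<dots> \<le> (\<integral>\<omega>. \<alpha> powr (- s) * K0 \<partial>sig)"
    by (rule integral_mono_AE) (use ff[OF x, of n] AE1 fb[OF x] in \<open>auto elim!: eventually_mono\<close>)
   finally show ?thesis unfolding U by simp
  qed
  have lim: "(\<lambda>n. \<integral>y. V (e n) (x - y) \<partial>dil l) \<longlonglongrightarrow> l powr (- s) * c" if x: "x \<in> (\<lambda>x. T *v x) ` cball 0 1" for x
  proof -
   have "(\<lambda>n. \<integral>\<omega>. f x n \<omega> \<partial>sig) \<longlonglongrightarrow> (\<integral>\<omega>. l powr (- s) * (?a \<omega> powr (- s) * C) \<partial>sig)"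
   proof (rule integral_dominated_convergence[where w="\<lambda>_. \<alpha> powr (- s) * K0"])
    show "AE \<omega> in sig. norm (f x n \<omega>) \<le> \<alpha> powr (- s) * K0" for n
     using AE1 by eventually_elim (use fb[OF x] in auto)
    show "AE \<omega> in sig. (\<lambda>n. f x n \<omega>) \<longlonglongrightarrow> l powr (- s) * (?a \<omega> powr (- s) * C)"
     using AE1
    proof eventually_elim
     case (elim \<omega>)
     have Ap: "A \<omega> > 0" using A[OF elim] \<alpha>(1) by simp
     have "(\<lambda>n. e n / A \<omega>) \<longlonglongrightarrow> 0 / A \<omega>" using Ap by (intro tendsto_intros e0) auto
     then have "filterlim (\<lambda>n. e n / A \<omega>) (at_right 0) sequentially"
      unfolding filterlim_at using eA(1)[OF elim] by (auto intro!: always_eventually simp: less_imp_neq[OF e(1), symmetric])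
     moreover have "((\<lambda>e. F e ((x \<bullet> \<omega>) / A \<omega>)) \<longlongrightarrow> C) (at_right 0)"
      by (rule C(1)) (use b[OF x elim] l in \<open>simp add: le_less_trans[OF _ \<open>1 / l < 1\<close>]\<close>)
     ultimately have "(\<lambda>n. F (e n / A \<omega>) ((x \<bullet> \<omega>) / A \<omega>)) \<longlonglongrightarrow> C"
      by (rule filterlim_compose[rotated])
     then have "(\<lambda>n. f x n \<omega>) \<longlonglongrightarrow> A \<omega> powr (- s) * C" unfolding f_def by (rule tendsto_mult_left)
     also have "A \<omega> powr (- s) = l powr (- s) * ?a \<omega> powr (- s)" unfolding A_def by (rule powr_mult)
     finally show ?case by (simp only: mult.assoc)
    qed
    show "(\<lambda>\<omega>. l powr (- s) * (?a \<omega> powr (- s) * C)) \<in> borel_measurable sig" by measurable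
    show "f x n \<in> borel_measurable sig" for n by (rule fm)
    show "integrable sig (\<lambda>_. \<alpha> powr (- s) * K0)" by (rule sig.integrable_const)
   qed
   then show ?thesis unfolding U c_def by simp
  qed
  show ?thesis using bound lim by blast
 qed
 \<comment> \<open>Any point of the ellipsoid and any l > 1 would do; the potentials of V are
   nonnegative, and so is their limit.\<close>
 have "c \<ge> 0"
 proof -
  have "(0::real^'n) \<in> (\<lambda>x. T *v x) ` cball 0 1" by (rule image_eqI[of _ _ 0]) auto
  then have "(\<lambda>n. \<integral>y. V (e n) (0 - y) \<partial>dil 2) \<longlonglongrightarrow> 2 powr (- s) * c" using main[of 2] by fastforce
  then have "0 \<le> 2 powr (- s) * c"
   by (rule LIMSEQ_le_const) (use nn_integral_V(2)[OF dil_prob e(1)] in blast)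
  then show ?thesis by (simp add: zero_le_mult_iff)
 qed
 then show ?thesis using main e(1) e0 by blast
qed

lemma energy_dil: "l1 > 0 \<Longrightarrow> energy2 (dil l1) (dil l2) = (\<integral>\<^sup>+x. (\<integral>\<^sup>+y. Wker s \<Phi> (l1 *\<^sub>R (T *v x) - l2 *\<^sub>R (T *v y)) \<partial>\<mu>) \<partial>\<mu>)"
proof -
 interpret prob_space \<mu> by (rule iso_prob[OF iso s_pos])
 interpret d: prob_space "dil l2" by (rule dil_prob)
 note [measurable_cong] = iso_sets[OF iso s_pos] dil_prob(2)
 have [measurable]: "(\<lambda>x. \<integral>\<^sup>+y. Wker s \<Phi> (x - y) \<partial>dil l2) \<in> borel_measurable borel"
  by (intro d.borel_measurable_nn_integral) measurable
 have "energy2 (dil l1) (dil l2) = (\<integral>\<^sup>+x. (\<integral>\<^sup>+y. Wker s \<Phi> (l1 *\<^sub>R (T *v x) - y) \<partial>dil l2) \<partial>\<mu>)"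
  unfolding dil_def[of l1] by (subst nn_integral_distr) measurable
 also have "\<dots> = (\<integral>\<^sup>+x. (\<integral>\<^sup>+y. Wker s \<Phi> (l1 *\<^sub>R (T *v x) - l2 *\<^sub>R (T *v y)) \<partial>\<mu>) \<partial>\<mu>)"
  unfolding dil_def[of l2] by (intro nn_integral_cong, subst nn_integral_distr) measurable
 finally show ?thesis .
qed

lemma energy_dil_scaling:
 assumes l: "l > 0"
 shows "energy2 (dil l) (dil l) = ennreal (l powr (- s)) * energy2 (dil 1) (dil 1)"
proof -
 interpret prob_space \<mu> by (rule iso_prob[OF iso s_pos])
 note [measurable_cong] = iso_sets[OF iso s_pos]
 have [measurable]: "(\<lambda>x. T *v x) \<in> borel_measurable borel" by (rule measurable_matrix_vector_mult)
 have "Wker s \<Phi> (l *\<^sub>R (T *v x) - l *\<^sub>R (T *v y)) = ennreal (l powr (- s)) * Wker s \<Phi> (1 *\<^sub>R (T *v x) - 1 *\<^sub>R (T *v y))" for x y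
  using Wker_scaleR[OF l, of "T *v x - T *v y"] by (simp add: scaleR_diff_right)
 then have "energy2 (dil l) (dil l) = (\<integral>\<^sup>+x. (\<integral>\<^sup>+y. ennreal (l powr (- s)) * Wker s \<Phi> (1 *\<^sub>R (T *v x) - 1 *\<^sub>R (T *v y)) \<partial>\<mu>) \<partial>\<mu>)"
  by (simp only: energy_dil[OF l])
 also have "\<dots> = (\<integral>\<^sup>+x. ennreal (l powr (- s)) * (\<integral>\<^sup>+y. Wker s \<Phi> (1 *\<^sub>R (T *v x) - 1 *\<^sub>R (T *v y)) \<partial>\<mu>) \<partial>\<mu>)"
  by (intro nn_integral_cong nn_integral_cmult) measurable
 also have "\<dots> = ennreal (l powr (- s)) * energy2 (dil 1) (dil 1)"
  unfolding energy_dil[OF zero_less_one] by (rule nn_integral_cmult) measurable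
 finally show ?thesis .
qed

lemma J_tendsto_dil:
 assumes 1: "prob_space \<nu>" "sets \<nu> = sets borel" and E: "AE x in \<nu>. x \<in> (\<lambda>x. T *v x) ` cball 0 1"
  and b: "\<And>x n. x \<in> (\<lambda>x. T *v x) ` cball 0 1 \<Longrightarrow> \<bar>\<integral>y. V (e n) (x - y) \<partial>dil l\<bar> \<le> K"
  and lim: "\<And>x. x \<in> (\<lambda>x. T *v x) ` cball 0 1 \<Longrightarrow> (\<lambda>n. \<integral>y. V (e n) (x - y) \<partial>dil l) \<longlonglongrightarrow> L"
 shows "(\<lambda>n. J (e n) \<nu> (dil l)) \<longlonglongrightarrow> L"
proof -
 interpret prob_space \<nu> by fact
 have m: "(\<lambda>x. \<integral>y. V (e n) (x - y) \<partial>dil l) \<in> borel_measurable \<nu>" for n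
  using potential_measurable[OF dil_prob] by (simp add: measurable_cong_sets[OF 1(2) refl])
 have "(\<lambda>n. \<integral>x. (\<integral>y. V (e n) (x - y) \<partial>dil l) \<partial>\<nu>) \<longlonglongrightarrow> (\<integral>x. L \<partial>\<nu>)"
 proof (rule integral_dominated_convergence[where w="\<lambda>_. K"])
  show "AE x in \<nu>. norm (\<integral>y. V (e n) (x - y) \<partial>dil l) \<le> K" for n using E by eventually_elim (simp add: b)
  show "AE x in \<nu>. (\<lambda>n. \<integral>y. V (e n) (x - y) \<partial>dil l) \<longlonglongrightarrow> L" using E by eventually_elim (rule lim)
 qed (use m in auto)
 then show ?thesis unfolding J_def by (simp add: prob_space)
qed

lemma dil_AE: "AE x in dil 1. x \<in> (\<lambda>x. T *v x) ` cball 0 1"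
proof -
 have "compact ((\<lambda>x. T *v x) ` cball 0 1)"
  by (intro compact_continuous_image compact_cball linear_continuous_on linear_conv_bounded_linear[THEN iffD1] matrix_vector_mul_linear)
 then have [measurable]: "(\<lambda>x. T *v x) ` cball 0 1 \<in> sets borel" by (intro borel_closed compact_imp_closed)
 show ?thesis unfolding dil_def
  by (subst AE_distr_iff) (use iso_AE[OF iso s_pos] dil_map_measurable[of 1] in \<open>auto elim!: eventually_mono\<close>)
qed

text \<open>With L = l^(-s) c the limit of \<open>J_square\<close> reads: gap plus 2 L is at most (2
  pi)^d times the sum of the energies of \<nu> and of the dilated measure. By homogeneity and the
  first claim the latter term is at most L, which cancels one copy. Then l tends to 1. Only the
  upper bound by c is needed for the energy of the undilated measure; no convergence of potentials
  up to the boundary of the ellipsoid is claimed.\<close>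

theorem energy_gap:
 "\<exists>c\<ge>0. ennreal ((2 * pi) ^ CARD('n)) * energy2 (dil 1) (dil 1) \<le> ennreal c \<and>
   (\<forall>\<nu>. prob_space \<nu> \<longrightarrow> sets \<nu> = sets borel \<longrightarrow> (AE x in \<nu>. x \<in> (\<lambda>x. T *v x) ` cball 0 1) \<longrightarrow> energy2 \<nu> \<nu> < \<infinity> \<longrightarrow>
    gap \<nu> (dil 1) + ennreal c \<le> ennreal ((2 * pi) ^ CARD('n)) * energy2 \<nu> \<nu>)"
proof -
 let ?E = "(\<lambda>x. T *v x) ` cball 0 1"
 obtain c where c: "c \<ge> 0" and cl: "\<And>l. l > 1 \<Longrightarrow> \<exists>e K. (\<forall>n. e n > 0) \<and> e \<longlonglongrightarrow> 0 \<and>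
   (\<forall>x\<in>?E. (\<forall>n. \<bar>\<integral>y. V (e n) (x - y) \<partial>dil l\<bar> \<le> K) \<and> (\<lambda>n. \<integral>y. V (e n) (x - y) \<partial>dil l) \<longlonglongrightarrow> l powr (- s) * c)"
  using potential_limit by blast
 define l where "l k = 1 + inverse (real (Suc k))" for k
 have l1: "l k > 1" for k by (simp add: l_def)
 have "l \<longlonglongrightarrow> 1 + 0" unfolding l_def by (intro tendsto_intros LIMSEQ_inverse_real_of_nat)
 then have l0: "l \<longlonglongrightarrow> 1" by simp
 have "(\<lambda>k. l k powr (- s) * c) \<longlonglongrightarrow> 1 powr (- s) * c" by (intro tendsto_intros l0) auto
 then have lc: "(\<lambda>k. ennreal (l k powr (- s) * c)) \<longlonglongrightarrow> ennreal c" by (intro tendsto_ennrealI) simp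
 \<comment> \<open>The energy at l = 1 is approached through the mutual energies of
   \<open>dil 1\<close> and \<open>dil (l k)\<close>, for which the potential is known on the
   support of \<open>dil 1\<close>. Fatou is used twice, in the regularisation and in k. Finiteness
   of the energy of the candidate follows from this bound.\<close>
 have self: "ennreal ((2 * pi) ^ CARD('n)) * energy2 (dil 1) (dil 1) \<le> ennreal c"
 proof -
  interpret prob_space \<mu> by (rule iso_prob[OF iso s_pos])
  note [measurable_cong] = iso_sets[OF iso s_pos]
  have [measurable]: "(\<lambda>x. T *v x) \<in> borel_measurable borel" by (rule measurable_matrix_vector_mult)
  have k: "ennreal ((2 * pi) ^ CARD('n)) * energy2 (dil 1) (dil (l k)) \<le> ennreal (l k powr (- s) * c)" for k
  proof -
   obtain e K where e: "\<And>n. e n > 0" "e \<longlonglongrightarrow> 0" and K: "\<And>x n. x \<in> ?E \<Longrightarrow> \<bar>\<integral>y. V (e n) (x - y) \<partial>dil (l k)\<bar> \<le> K"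
    "\<And>x. x \<in> ?E \<Longrightarrow> (\<lambda>n. \<integral>y. V (e n) (x - y) \<partial>dil (l k)) \<longlonglongrightarrow> l k powr (- s) * c"
    using cl[OF l1] by blast
   have "(\<lambda>n. J (e n) (dil 1) (dil (l k))) \<longlonglongrightarrow> l k powr (- s) * c"
    by (rule J_tendsto_dil[OF dil_prob dil_AE K])
   then have "(\<lambda>n. ennreal (J (e n) (dil 1) (dil (l k)))) \<longlonglongrightarrow> ennreal (l k powr (- s) * c)" by (rule tendsto_ennrealI)
   from energy_fatou[OF dil_prob dil_prob e, of 1 "l k", unfolded lim_imp_Liminf[OF sequentially_bot this]] show ?thesis .
  qed
  have "energy2 (dil 1) (dil 1) = (\<integral>\<^sup>+x. (\<integral>\<^sup>+y. liminf (\<lambda>k. Wker s \<Phi> (1 *\<^sub>R (T *v x) - l k *\<^sub>R (T *v y))) \<partial>\<mu>) \<partial>\<mu>)"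
   unfolding energy_dil[OF zero_less_one]
   by (intro nn_integral_cong lim_imp_Liminf[OF sequentially_bot, symmetric] Wker_tendsto tendsto_intros l0)
  also have "\<dots> \<le> (\<integral>\<^sup>+x. liminf (\<lambda>k. \<integral>\<^sup>+y. Wker s \<Phi> (1 *\<^sub>R (T *v x) - l k *\<^sub>R (T *v y)) \<partial>\<mu>) \<partial>\<mu>)"
   by (intro nn_integral_mono nn_integral_liminf) measurable
  also have "\<dots> \<le> liminf (\<lambda>k. \<integral>\<^sup>+x. (\<integral>\<^sup>+y. Wker s \<Phi> (1 *\<^sub>R (T *v x) - l k *\<^sub>R (T *v y)) \<partial>\<mu>) \<partial>\<mu>)"
   by (rule nn_integral_liminf) measurable
  also have "\<dots> = liminf (\<lambda>k. energy2 (dil 1) (dil (l k)))" by (simp only: energy_dil[OF zero_less_one])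
  also have "\<dots> \<le> liminf (\<lambda>k. ennreal (l k powr (- s) * c) / ennreal ((2 * pi) ^ CARD('n)))"
  proof (intro Liminf_mono always_eventually allI)
   show "energy2 (dil 1) (dil (l n)) \<le> ennreal (l n powr (- s) * c) / ennreal ((2 * pi) ^ CARD('n))" for n
    using divide_right_mono_ennreal[OF k[of n], of "ennreal ((2 * pi) ^ CARD('n))"]
    by (simp add: mult.commute[of "ennreal _"] ennreal_mult_divide_eq del: power_mult_distrib)
  qed
  also have "\<dots> = ennreal c / ennreal ((2 * pi) ^ CARD('n))"
  proof (rule lim_imp_Liminf[OF sequentially_bot])
   have "(\<lambda>k. ennreal (l k powr (- s) * c / ((2 * pi) ^ CARD('n)))) \<longlonglongrightarrow> ennreal (1 powr (- s) * c / ((2 * pi) ^ CARD('n)))"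
    by (intro tendsto_ennrealI tendsto_intros l0) auto
   then show "(\<lambda>k. ennreal (l k powr (- s) * c) / ennreal ((2 * pi) ^ CARD('n))) \<longlonglongrightarrow> ennreal c / ennreal ((2 * pi) ^ CARD('n))"
    using c by (simp add: divide_ennreal del: power_mult_distrib)
  qed
  finally have "ennreal ((2 * pi) ^ CARD('n)) * energy2 (dil 1) (dil 1) \<le> ennreal ((2 * pi) ^ CARD('n)) * (ennreal c / ennreal ((2 * pi) ^ CARD('n)))" by (rule mult_left_mono) simp
  also have "\<dots> = ennreal c" using c by (simp add: divide_ennreal ennreal_mult[symmetric] del: power_mult_distrib)
  finally show ?thesis .
 qed
 have fin1: "energy2 (dil 1) (dil 1) < \<infinity>"
 proof (rule ccontr)
  assume "\<not> energy2 (dil 1) (dil 1) < \<infinity>"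
  then have "energy2 (dil 1) (dil 1) = top" by (simp add: less_top[symmetric] infinity_ennreal_def)
  with self show False by (simp add: ennreal_mult_top top_unique del: power_mult_distrib)
 qed
 have gap: "gap \<nu> (dil 1) + ennreal c \<le> ennreal ((2 * pi) ^ CARD('n)) * energy2 \<nu> \<nu>"
  if \<nu>: "prob_space \<nu>" "sets \<nu> = sets borel" and E: "AE x in \<nu>. x \<in> ?E" and fin: "energy2 \<nu> \<nu> < \<infinity>" for \<nu>
 proof -
  note [measurable] = cos_transform_measurable[OF \<nu>] cos_transform_measurable[OF dil_prob]
  have k: "gap \<nu> (dil (l k)) + ennreal (l k powr (- s) * c) \<le> ennreal ((2 * pi) ^ CARD('n)) * energy2 \<nu> \<nu>" for k
  proof -
   let ?L = "ennreal (l k powr (- s) * c)"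
   obtain e K where e: "\<And>n. e n > 0" "e \<longlonglongrightarrow> 0" and K: "\<And>x n. x \<in> ?E \<Longrightarrow> \<bar>\<integral>y. V (e n) (x - y) \<partial>dil (l k)\<bar> \<le> K"
    "\<And>x. x \<in> ?E \<Longrightarrow> (\<lambda>n. \<integral>y. V (e n) (x - y) \<partial>dil (l k)) \<longlonglongrightarrow> l k powr (- s) * c"
    using cl[OF l1] by blast
   define q where "q \<xi> = (cos_transform \<nu> \<xi> - cos_transform (dil (l k)) \<xi>)^2 + (sin_transform \<nu> \<xi> - sin_transform (dil (l k)) \<xi>)^2" for \<xi>
   have [measurable]: "q \<in> borel_measurable borel" unfolding q_def by measurable
   define Q where "Q n = (\<integral>\<^sup>+\<xi>. ennreal (w \<xi> * exp (- (e n * norm \<xi>)) * q \<xi>) \<partial>lborel)" for n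
   have Q: "gap \<nu> (dil (l k)) \<le> liminf Q"
   proof -
    have "(\<lambda>n. ennreal (w \<xi> * exp (- (e n * norm \<xi>)) * q \<xi>)) \<longlonglongrightarrow> ennreal (w \<xi> * exp (- (0 * norm \<xi>)) * q \<xi>)" for \<xi>
     by (intro tendsto_ennrealI tendsto_intros e(2))
    then have "gap \<nu> (dil (l k)) = (\<integral>\<^sup>+\<xi>. liminf (\<lambda>n. ennreal (w \<xi> * exp (- (e n * norm \<xi>)) * q \<xi>)) \<partial>lborel)"
     unfolding gap_def q_def[symmetric] by (intro nn_integral_cong lim_imp_Liminf[OF sequentially_bot, symmetric]) simp
    also have "\<dots> \<le> liminf Q" unfolding Q_def by (rule nn_integral_liminf) measurable
    finally show ?thesis .
   qed
   have Jd: "(\<lambda>n. 2 * ennreal (J (e n) \<nu> (dil (l k)))) \<longlonglongrightarrow> 2 * ?L"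
    by (intro ennreal_tendsto_cmult tendsto_ennrealI J_tendsto_dil[OF \<nu> E K]) auto
   have lk: "l k > 0" using l1[of k] by simp
   have finl: "energy2 (dil (l k)) (dil (l k)) < \<infinity>"
    unfolding energy_dil_scaling[OF lk] using fin1 by (simp add: ennreal_mult_less_top)
   have Ja: "(\<lambda>n. ennreal (J (e n) \<nu> \<nu>) + ennreal (J (e n) (dil (l k)) (dil (l k)))) \<longlonglongrightarrow>
     ennreal ((2 * pi) ^ CARD('n)) * energy2 \<nu> \<nu> + ennreal ((2 * pi) ^ CARD('n)) * energy2 (dil (l k)) (dil (l k))"
    by (intro tendsto_add J_tendsto_energy \<nu> fin e dil_prob finl)
   have "gap \<nu> (dil (l k)) + 2 * ?L \<le> ennreal ((2 * pi) ^ CARD('n)) * energy2 \<nu> \<nu> + ennreal ((2 * pi) ^ CARD('n)) * energy2 (dil (l k)) (dil (l k))"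
   proof (rule liminf_add_le_ennreal[OF Q Jd Ja])
    show "Q n + 2 * ennreal (J (e n) \<nu> (dil (l k))) \<le> ennreal (J (e n) \<nu> \<nu>) + ennreal (J (e n) (dil (l k)) (dil (l k)))" for n
     unfolding Q_def q_def by (rule eq_refl[OF J_square[OF \<nu> dil_prob e(1)]])
   qed (simp add: ennreal_mult_eq_top_iff)
   \<comment> \<open>Scaling bounds the energy of \<open>dil (l k)\<close> by one copy of
     \<open>?L\<close>, leaving one of the two copies on the left after cancellation.\<close>
   also have "\<dots> \<le> ennreal ((2 * pi) ^ CARD('n)) * energy2 \<nu> \<nu> + ?L"
   proof (rule add_left_mono)
    have "ennreal ((2 * pi) ^ CARD('n)) * energy2 (dil (l k)) (dil (l k)) = ennreal (l k powr (- s)) * (ennreal ((2 * pi) ^ CARD('n)) * energy2 (dil 1) (dil 1))"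
     unfolding energy_dil_scaling[OF lk] by (simp only: mult_ac)
    also have "\<dots> \<le> ennreal (l k powr (- s)) * ennreal c" by (rule mult_left_mono[OF self]) simp
    also have "\<dots> = ?L" using c by (simp add: ennreal_mult)
    finally show "ennreal ((2 * pi) ^ CARD('n)) * energy2 (dil (l k)) (dil (l k)) \<le> ?L" .
   qed
   finally have "?L + (gap \<nu> (dil (l k)) + ?L) \<le> ?L + ennreal ((2 * pi) ^ CARD('n)) * energy2 \<nu> \<nu>"
    by (simp only: mult_2 add_ac)
   then show ?thesis by (simp add: ennreal_add_left_cancel_le del: power_mult_distrib)
  qed
  obtain m m1 where m: "\<And>r. (m has_real_derivative m1 r) (at r)" "\<And>\<xi>. (\<integral>y. cos (\<xi> \<bullet> y) \<partial>\<mu>) = m (norm \<xi>)"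
   using iso_char_ode[OF iso s_pos] by blast
  \<comment> \<open>The transforms of the dilations converge pointwise because m is continuous;
    Fatou in k then has the direction that is needed.\<close>
  have "gap \<nu> (dil 1) \<le> liminf (\<lambda>k. gap \<nu> (dil (l k)))"
  proof -
   have c1: "(\<lambda>k. cos_transform (dil (l k)) \<xi>) \<longlonglongrightarrow> cos_transform (dil 1) \<xi>" for \<xi>
    unfolding dil_transforms[OF m(2)] by (intro isCont_tendsto_compose[OF DERIV_isCont[OF m(1)]] tendsto_intros l0)
   have "(\<lambda>k. ennreal (w \<xi> * ((cos_transform \<nu> \<xi> - cos_transform (dil (l k)) \<xi>)^2 + (sin_transform \<nu> \<xi> - sin_transform (dil (l k)) \<xi>)^2)))
     \<longlonglongrightarrow> ennreal (w \<xi> * ((cos_transform \<nu> \<xi> - cos_transform (dil 1) \<xi>)^2 + (sin_transform \<nu> \<xi> - sin_transform (dil 1) \<xi>)^2))" for \<xi>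
    by (simp only: dil_transforms(2)[OF m(2)]) (intro tendsto_ennrealI tendsto_intros c1)
   then have "gap \<nu> (dil 1) = (\<integral>\<^sup>+\<xi>. liminf (\<lambda>k. ennreal (w \<xi> * ((cos_transform \<nu> \<xi> - cos_transform (dil (l k)) \<xi>)^2 + (sin_transform \<nu> \<xi> - sin_transform (dil (l k)) \<xi>)^2))) \<partial>lborel)"
    unfolding gap_def by (intro nn_integral_cong lim_imp_Liminf[OF sequentially_bot, symmetric])
   also have "\<dots> \<le> liminf (\<lambda>k. gap \<nu> (dil (l k)))" unfolding gap_def by (rule nn_integral_liminf) measurable
   finally show ?thesis .
  qed
  then show ?thesis
   by (rule liminf_add_le_ennreal[OF _ lc tendsto_const k]) simp
 qed
 show ?thesis using c self gap by blast
qed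

end
end

section \<open>Measures determined by their transforms on a cone\<close>

text \<open>Finite sums of real exponentials: an algebra containing the constants and separating
  points, as Stone-Weierstrass requires.\<close>

inductive exp_span :: "(real^'n \<Rightarrow> real) \<Rightarrow> bool" where
 exp_span_exp: "exp_span (\<lambda>x. c * exp (v \<bullet> x))"
| exp_span_add: "exp_span f \<Longrightarrow> exp_span g \<Longrightarrow> exp_span (\<lambda>x. f x + g x)"

lemma exp_span_continuous: "exp_span f \<Longrightarrow> continuous_on S f"
 by (induction rule: exp_span.induct) (auto intro!: continuous_intros)

lemma exp_span_mult_exp: "exp_span g \<Longrightarrow> exp_span (\<lambda>x. c * exp (v \<bullet> x) * g x)"
proof (induction rule: exp_span.induct)
 case (exp_span_exp c' v')
 have "(\<lambda>x. c * exp (v \<bullet> x) * (c' * exp (v' \<bullet> x))) = (\<lambda>x. (c * c') * exp ((v + v') \<bullet> x))"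
  by (simp add: fun_eq_iff inner_add_left exp_add mult_ac)
 then show ?case by (simp only: exp_span.exp_span_exp)
next
 case (exp_span_add f g)
 then show ?case using exp_span.exp_span_add[OF exp_span_add.IH] by (simp only: distrib_left)
qed

lemma exp_span_mult: "exp_span f \<Longrightarrow> exp_span g \<Longrightarrow> exp_span (\<lambda>x. f x * g x)"
proof (induction rule: exp_span.induct)
 case (exp_span_exp c v)
 then show ?case by (rule exp_span_mult_exp)
next
 case (exp_span_add f h)
 then show ?case using exp_span.exp_span_add[of "\<lambda>x. f x * g x" "\<lambda>x. h x * g x"] by (simp only: distrib_right)
qed

lemma integrable_continuous_compact:
 fixes \<nu> :: "(real^'n) measure" and f :: "real^'n \<Rightarrow> real"
 assumes "prob_space \<nu>" "sets \<nu> = sets borel" "compact E" "AE x in \<nu>. x \<in> E" "continuous_on UNIV f"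
 shows "integrable \<nu> f"
proof -
 interpret prob_space \<nu> by fact
 have "bounded (f ` E)" using assms(3,5) by (intro compact_imp_bounded compact_continuous_image) (auto intro: continuous_on_subset)
 then obtain b where b: "\<And>x. x \<in> E \<Longrightarrow> norm (f x) \<le> b" by (auto simp: bounded_iff)
 have "f \<in> borel_measurable \<nu>" using borel_measurable_continuous_onI[OF assms(5)] by (simp add: measurable_cong_sets[OF assms(2) refl])
 moreover have "AE x in \<nu>. norm (f x) \<le> b" using assms(4) by eventually_elim (rule b)
 ultimately show ?thesis by (intro integrable_const_bound)
qed

context
 fixes M N :: "(real^'n) measure" and E :: "(real^'n) set"
 assumes p1: "prob_space M" "sets M = sets borel" and p2: "prob_space N" "sets N = sets borel"
  and E: "compact E" and E1: "AE x in M. x \<in> E" and E2: "AE x in N. x \<in> E"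
begin

lemma integrable_both: "continuous_on UNIV f \<Longrightarrow> integrable M f" "continuous_on UNIV f \<Longrightarrow> integrable N (f :: real^'n \<Rightarrow> real)"
 by (auto intro: integrable_continuous_compact[OF p1 E E1] integrable_continuous_compact[OF p2 E E2])

text \<open>Closed sets generate the Borel sets and are stable under intersection; their indicators
  are limits of the bounded continuous functions max 0 (1 - n dist (x, A)).\<close>

lemma eq_from_continuous:
 assumes eq: "\<And>f. continuous_on UNIV (f :: real^'n \<Rightarrow> real) \<Longrightarrow> (\<integral>x. f x \<partial>M) = (\<integral>x. f x \<partial>N)"
 shows "M = N"
proof -
 interpret p1: prob_space M by fact
 interpret p2: prob_space N by fact
 have s1: "sets M = sigma_sets UNIV (Collect closed)" and s2: "sets N = sigma_sets UNIV (Collect closed)"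
  using p1(2) p2(2) by (simp_all add: borel_eq_closed)
 have m: "emeasure M A = emeasure N A" if A: "closed A" for A
 proof (cases "A = {}")
  case False
  define f where "f n x = max 0 (1 - real n * infdist x A)" for n x
  have fc: "continuous_on UNIV (f n)" for n unfolding f_def by (intro continuous_intros)
  have lim: "(\<lambda>n. f n x) \<longlonglongrightarrow> indicator A x" for x
  proof (cases "x \<in> A")
   case False
   then have pos: "infdist x A > 0" using A \<open>A \<noteq> {}\<close> by (metis in_closed_iff_infdist_zero infdist_nonneg order_le_less)
   obtain N :: nat where N: "1 / infdist x A < real N" using reals_Archimedean2 by blast
   have "f n x = 0" if "n \<ge> N" for n
   proof -
    have "1 / infdist x A < real n" using N that by simp
    then have "1 < real n * infdist x A" using pos by (simp add: pos_divide_less_eq)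
    then show ?thesis by (simp add: f_def)
   qed
   then have "\<forall>\<^sub>F n in sequentially. f n x = 0" unfolding eventually_sequentially by blast
   then show ?thesis using False by (simp add: tendsto_eventually)
  qed (simp add: f_def)
  have meas: "(\<lambda>n. \<integral>x. f n x \<partial>\<nu>) \<longlonglongrightarrow> measure \<nu> A" if "prob_space \<nu>" "sets \<nu> = sets borel" for \<nu>
  proof -
   interpret prob_space \<nu> by fact
   have fm: "f n \<in> borel_measurable \<nu>" for n using borel_measurable_continuous_onI[OF fc] by (simp add: measurable_cong_sets[OF that(2) refl])
   have Am: "A \<in> sets \<nu>" using A that(2) by simp
   have "(\<lambda>n. \<integral>x. f n x \<partial>\<nu>) \<longlonglongrightarrow> (\<integral>x. indicator A x \<partial>\<nu>)"
   proof (rule integral_dominated_convergence[where w="\<lambda>_. 1"])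
    show "AE x in \<nu>. norm (f n x) \<le> 1" for n by (auto simp: f_def infdist_nonneg)
   qed (use fm Am lim in auto)
   then show ?thesis using Am by simp
  qed
  have "measure M A = measure N A" using LIMSEQ_unique[OF meas[OF p1] meas[OF p2, folded eq[OF fc]]] .
  then show ?thesis by (simp add: p1.emeasure_eq_measure p2.emeasure_eq_measure)
 qed simp
 show ?thesis
 proof (rule measure_eqI_generator_eq[where E="Collect closed" and \<Omega>=UNIV and A="\<lambda>_. UNIV"])
  show "Int_stable (Collect closed)" by (auto simp: Int_stable_def)
  show "emeasure M X = emeasure N X" if "X \<in> Collect closed" for X using that m by simp
 qed (use s1 s2 in auto)
qed

text \<open>Uniform approximation is available on the compact set E only, which is enough because
  both measures are carried by E.\<close>

lemma eq_from_exponentials: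
 assumes eq: "\<And>v. (\<integral>x. exp (v \<bullet> x) \<partial>M) = (\<integral>x. exp (v \<bullet> x) \<partial>N)"
 shows "M = N"
proof (rule eq_from_continuous)
 have sp: "(\<integral>x. g x \<partial>M) = (\<integral>x. g x \<partial>N)" if "exp_span g" for g
  using that
 proof (induction rule: exp_span.induct)
  case (exp_span_add f g)
  then show ?case using integrable_both[OF exp_span_continuous[of f]] integrable_both[OF exp_span_continuous[of g]] by simp
 qed (simp add: eq)
 fix f :: "real^'n \<Rightarrow> real" assume f: "continuous_on UNIV f"
 have "\<bar>(\<integral>x. f x \<partial>M) - (\<integral>x. f x \<partial>N)\<bar> \<le> 0 + e" if e: "e > 0" for e
 proof -
  have "\<exists>g. exp_span g \<and> (\<forall>x\<in>E. \<bar>f x - g x\<bar> < e / 2)"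
  proof (rule Stone_Weierstrass_HOL[OF E])
   show "exp_span (\<lambda>x. c)" for c using exp_span_exp[of c 0] by simp
   show "\<exists>g. exp_span g \<and> g x \<noteq> g y" if "x \<in> E \<and> y \<in> E \<and> x \<noteq> y" for x y
   proof (intro exI conjI)
    show "exp_span (\<lambda>z. 1 * exp ((x - y) \<bullet> z))" by (rule exp_span_exp)
    have "(x - y) \<bullet> (x - y) \<noteq> 0" using that by simp
    then show "1 * exp ((x - y) \<bullet> x) \<noteq> 1 * exp ((x - y) \<bullet> y)" by (simp add: inner_diff_right)
   qed
   show "continuous_on E f" using f by (rule continuous_on_subset) simp
  qed (use e exp_span_continuous exp_span_add exp_span_mult in auto)
  then obtain g where g: "exp_span g" "\<And>x. x \<in> E \<Longrightarrow> \<bar>f x - g x\<bar> < e / 2" by blast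
  have gc: "continuous_on UNIV g" by (rule exp_span_continuous[OF g(1)])
  have close: "\<bar>(\<integral>x. f x \<partial>\<nu>) - (\<integral>x. g x \<partial>\<nu>)\<bar> \<le> e / 2" if p: "prob_space \<nu>" "sets \<nu> = sets borel" and AE: "AE x in \<nu>. x \<in> E" for \<nu>
  proof -
   interpret prob_space \<nu> by fact
   have i: "integrable \<nu> f" "integrable \<nu> g" using integrable_continuous_compact[OF p E AE] f gc by auto
   have "\<bar>(\<integral>x. f x \<partial>\<nu>) - (\<integral>x. g x \<partial>\<nu>)\<bar> = norm (\<integral>x. f x - g x \<partial>\<nu>)" using i by simp
   also have "\<dots> \<le> (\<integral>x. norm (f x - g x) \<partial>\<nu>)" by (rule integral_norm_bound)
   also have "\<dots> \<le> e / 2"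
    by (rule integral_le_const) (use i AE g(2) in \<open>auto elim!: eventually_mono intro: less_imp_le\<close>)
   finally show ?thesis .
  qed
  show ?thesis using close[OF p1 E1] close[OF p2 E2] sp[OF g(1)] by linarith
 qed
 then have "\<bar>(\<integral>x. f x \<partial>M) - (\<integral>x. f x \<partial>N)\<bar> \<le> 0" by (rule field_le_epsilon)
 then show "(\<integral>x. f x \<partial>M) = (\<integral>x. f x \<partial>N)" by simp
qed

text \<open>The partial sums of the exponential series are dominated by exp |v . x|, which is
  integrable since the supports are compact.\<close>

lemma eq_from_moments:
 assumes eq: "\<And>v k. (\<integral>x. (v \<bullet> x) ^ k \<partial>M) = (\<integral>x. (v \<bullet> x) ^ k \<partial>N)"
 shows "M = N"
proof (rule eq_from_exponentials)
 fix v
 have lim: "(\<lambda>n. \<Sum>k<n. (\<integral>x. (v \<bullet> x) ^ k \<partial>\<nu>) / fact k) \<longlonglongrightarrow> (\<integral>x. exp (v \<bullet> x) \<partial>\<nu>)"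
  if p: "prob_space \<nu>" "sets \<nu> = sets borel" and AE: "AE x in \<nu>. x \<in> E" for \<nu>
 proof -
  have i: "integrable \<nu> (\<lambda>x. (v \<bullet> x) ^ k)" for k
   by (rule integrable_continuous_compact[OF p E AE]) (intro continuous_intros)
  have ie: "integrable \<nu> (\<lambda>x. exp \<bar>v \<bullet> x\<bar>)"
   by (rule integrable_continuous_compact[OF p E AE]) (intro continuous_intros)
  have m: "(\<lambda>x. v \<bullet> x) \<in> borel_measurable \<nu>" by (simp add: measurable_cong_sets[OF p(2) refl])
  have "(\<lambda>n. \<integral>x. (\<Sum>k<n. (v \<bullet> x) ^ k / fact k) \<partial>\<nu>) \<longlonglongrightarrow> (\<integral>x. exp (v \<bullet> x) \<partial>\<nu>)"
  proof (rule integral_dominated_convergence[OF _ _ ie])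
   show "(\<lambda>x. \<Sum>k<n. (v \<bullet> x) ^ k / fact k) \<in> borel_measurable \<nu>" for n using m by measurable
   show "(\<lambda>x. exp (v \<bullet> x)) \<in> borel_measurable \<nu>" using m by measurable
   show "AE x in \<nu>. (\<lambda>n. \<Sum>k<n. (v \<bullet> x) ^ k / fact k) \<longlonglongrightarrow> exp (v \<bullet> x)"
    using exp_converges[where 'a=real] by (intro AE_I2) (simp add: sums_def divide_inverse mult.commute)
   show "AE x in \<nu>. norm (\<Sum>k<n. (v \<bullet> x) ^ k / fact k) \<le> exp \<bar>v \<bullet> x\<bar>" for n
   proof (intro AE_I2)
    fix x
    have "norm (\<Sum>k<n. (v \<bullet> x) ^ k / fact k) \<le> (\<Sum>k<n. \<bar>v \<bullet> x\<bar> ^ k /\<^sub>R fact k)"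
     by (rule order_trans[OF norm_sum]) (simp add: power_abs abs_mult divide_inverse mult.commute)
    also have "\<dots> \<le> (\<Sum>k. \<bar>v \<bullet> x\<bar> ^ k /\<^sub>R fact k)"
     by (rule sum_le_suminf[OF summable_exp_generic]) auto
    finally show "norm (\<Sum>k<n. (v \<bullet> x) ^ k / fact k) \<le> exp \<bar>v \<bullet> x\<bar>" by (simp add: exp_def)
   qed
  qed
  then show ?thesis using i by simp
 qed
 show "(\<integral>x. exp (v \<bullet> x) \<partial>M) = (\<integral>x. exp (v \<bullet> x) \<partial>N)"
  using LIMSEQ_unique[OF lim[OF p1 E1] lim[OF p2 E2, folded eq]] .
qed

text \<open>For any v the k-th moment in direction \<xi>0 + t v is a polynomial in t whose leading
  coefficient is the k-th moment in direction v. For small t the direction lies in G, so the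
  difference polynomial of the two measures has infinitely many roots and all its coefficients
  vanish.\<close>

lemma eq_from_moments_open:
 assumes G: "open G" "\<xi>0 \<in> G" and eq: "\<And>v k. v \<in> G \<Longrightarrow> (\<integral>x. (v \<bullet> x) ^ k \<partial>M) = (\<integral>x. (v \<bullet> x) ^ k \<partial>N)"
 shows "M = N"
proof (rule eq_from_moments)
 fix v :: "real^'n" and k
 obtain \<rho> where \<rho>: "\<rho> > 0" "ball \<xi>0 \<rho> \<subseteq> G" using G open_contains_ball by blast
 define d where "d j = real (k choose j) * ((\<integral>x. (v \<bullet> x) ^ j * (\<xi>0 \<bullet> x) ^ (k - j) \<partial>M) - (\<integral>x. (v \<bullet> x) ^ j * (\<xi>0 \<bullet> x) ^ (k - j) \<partial>N))" for j
 have exp: "(\<integral>x. ((\<xi>0 + t *\<^sub>R v) \<bullet> x) ^ k \<partial>\<nu>) = (\<Sum>j\<le>k. real (k choose j) * t ^ j * (\<integral>x. (v \<bullet> x) ^ j * (\<xi>0 \<bullet> x) ^ (k - j) \<partial>\<nu>))"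
  if "\<And>f. continuous_on UNIV f \<Longrightarrow> integrable \<nu> (f :: real^'n \<Rightarrow> real)" for t \<nu>
 proof -
  have i: "integrable \<nu> (\<lambda>x. (v \<bullet> x) ^ j * (\<xi>0 \<bullet> x) ^ (k - j))" for j by (rule that) (intro continuous_intros)
  have "((\<xi>0 + t *\<^sub>R v) \<bullet> x) ^ k = (\<Sum>j\<le>k. real (k choose j) * t ^ j * ((v \<bullet> x) ^ j * (\<xi>0 \<bullet> x) ^ (k - j)))" for x
  proof -
   have "((\<xi>0 + t *\<^sub>R v) \<bullet> x) ^ k = (t * (v \<bullet> x) + \<xi>0 \<bullet> x) ^ k" by (simp add: inner_add_left add.commute)
   then show ?thesis unfolding binomial_ring power_mult_distrib by (simp only: mult.assoc)
  qed
  then show ?thesis using i by simp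
 qed
 have e1: "(\<integral>x. ((\<xi>0 + t *\<^sub>R v) \<bullet> x) ^ k \<partial>M) = (\<Sum>j\<le>k. real (k choose j) * t ^ j * (\<integral>x. (v \<bullet> x) ^ j * (\<xi>0 \<bullet> x) ^ (k - j) \<partial>M))" for t
  by (rule exp) (rule integrable_both(1))
 have e2: "(\<integral>x. ((\<xi>0 + t *\<^sub>R v) \<bullet> x) ^ k \<partial>N) = (\<Sum>j\<le>k. real (k choose j) * t ^ j * (\<integral>x. (v \<bullet> x) ^ j * (\<xi>0 \<bullet> x) ^ (k - j) \<partial>N))" for t
  by (rule exp) (rule integrable_both(2))
 have z: "(\<Sum>j\<le>k. d j * t ^ j) = 0" if "\<bar>t\<bar> * norm v < \<rho>" for t
 proof -
  have "\<xi>0 + t *\<^sub>R v \<in> G" using that \<rho>(2) by (intro subsetD[OF \<rho>(2)]) (simp add: dist_norm)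
  from eq[OF this, of k] have "(\<Sum>j\<le>k. real (k choose j) * t ^ j * (\<integral>x. (v \<bullet> x) ^ j * (\<xi>0 \<bullet> x) ^ (k - j) \<partial>M)) -
   (\<Sum>j\<le>k. real (k choose j) * t ^ j * (\<integral>x. (v \<bullet> x) ^ j * (\<xi>0 \<bullet> x) ^ (k - j) \<partial>N)) = 0"
   unfolding e1 e2 by simp
  then show ?thesis
   unfolding sum_subtractf[symmetric] d_def right_diff_distrib left_diff_distrib by (simp only: mult_ac)
 qed
 have "infinite {0<..<\<rho> / (norm v + 1)}" using \<rho>(1) by (intro infinite_Ioo divide_pos_pos) (auto simp: add_nonneg_pos)
 moreover have "{0<..<\<rho> / (norm v + 1)} \<subseteq> {t. (\<Sum>j\<le>k. d j * t ^ j) = 0}"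
 proof (intro subsetI CollectI z)
  fix t assume t: "t \<in> {0<..<\<rho> / (norm v + 1)}"
  have "\<bar>t\<bar> * norm v \<le> t * (norm v + 1)" using t by (simp add: mult_left_mono)
  also have "\<dots> < \<rho>" using t by (simp add: pos_less_divide_eq add_nonneg_pos)
  finally show "\<bar>t\<bar> * norm v < \<rho>" .
 qed
 ultimately have "infinite {t. (\<Sum>j\<le>k. d j * t ^ j) = 0}" using finite_subset by blast
 then have "d k = 0" using polyfun_finite_roots[of d k] by blast
 then show "(\<integral>x. (v \<bullet> x) ^ k \<partial>M) = (\<integral>x. (v \<bullet> x) ^ k \<partial>N)" by (simp add: d_def)
qed

text \<open>For v in G the whole line through v consists of points of G, their negatives and 0;
  parity of cos and sin therefore gives equal transforms along it. These are the characteristic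
  functions of the distributions of v . x, so Levy's uniqueness theorem makes the distributions, and
  with them all moments in direction v, equal.\<close>

lemma eq_from_transforms_cone:
 assumes G: "open G" "\<xi>0 \<in> G" and cone: "\<And>t \<xi>. t > 0 \<Longrightarrow> \<xi> \<in> G \<Longrightarrow> t *\<^sub>R \<xi> \<in> G"
  and eq: "\<And>\<xi>. \<xi> \<in> G \<Longrightarrow> cos_transform M \<xi> = cos_transform N \<xi>" "\<And>\<xi>. \<xi> \<in> G \<Longrightarrow> sin_transform M \<xi> = sin_transform N \<xi>"
 shows "M = N"
proof (rule eq_from_moments_open[OF G])
 fix v k assume v: "v \<in> G"
 have neg: "cos_transform \<nu> (- \<xi>) = cos_transform \<nu> \<xi>" "sin_transform \<nu> (- \<xi>) = - sin_transform \<nu> \<xi>" for \<nu> :: "(real^'n) measure" and \<xi>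
  by (simp_all add: cos_transform_def sin_transform_def)
 have one: "cos_transform \<nu> 0 = 1" "sin_transform \<nu> 0 = 0" if "prob_space \<nu>" for \<nu> :: "(real^'n) measure"
  using prob_space.prob_space[OF that] by (simp_all add: cos_transform_def sin_transform_def)
 have all: "cos_transform M (t *\<^sub>R v) = cos_transform N (t *\<^sub>R v) \<and> sin_transform M (t *\<^sub>R v) = sin_transform N (t *\<^sub>R v)" for t
 proof -
  consider "t > 0" | "t = 0" | "- t > 0" by linarith
  then show ?thesis
  proof cases
   case 1
   then show ?thesis using eq cone v by simp
  next
   case 2
   then show ?thesis using one p1 p2 by simp
  next
   case 3
   then have "(- t) *\<^sub>R v \<in> G" using cone v by blast
   then show ?thesis using eq[of "(- t) *\<^sub>R v"] neg[of M "t *\<^sub>R v"] neg[of N "t *\<^sub>R v"] by simp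
  qed
 qed
 have vm: "(\<lambda>x. v \<bullet> x) \<in> borel_measurable \<nu>" if "sets \<nu> = sets borel" for \<nu> by (simp add: measurable_cong_sets[OF that refl])
 have ch: "char (distr \<nu> borel (\<lambda>x. v \<bullet> x)) t = Complex (cos_transform \<nu> (t *\<^sub>R v)) (sin_transform \<nu> (t *\<^sub>R v))"
  if p: "prob_space \<nu>" "sets \<nu> = sets borel" for \<nu> t
 proof -
  interpret prob_space \<nu> by fact
  have "char (distr \<nu> borel (\<lambda>x. v \<bullet> x)) t = (\<integral>x. iexp (t * (v \<bullet> x)) \<partial>\<nu>)"
   unfolding char_def by (subst integral_distr) (use vm[OF p(2)] in auto)
  also have "\<dots> = (\<integral>x. cis (t * (v \<bullet> x)) \<partial>\<nu>)" by (simp add: cis_conv_exp)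
  finally have c: "char (distr \<nu> borel (\<lambda>x. v \<bullet> x)) t = (\<integral>x. cis (t * (v \<bullet> x)) \<partial>\<nu>)" .
  have "continuous_on UNIV cis" unfolding cis_conv_exp by (intro continuous_intros)
  then have "cis \<in> borel_measurable borel" by (rule borel_measurable_continuous_onI)
  then have i: "integrable \<nu> (\<lambda>x. cis (t * (v \<bullet> x)))"
   by (intro integrable_const_bound[of _ 1]) (use vm[OF p(2)] in auto)
  show ?thesis unfolding c
   by (rule complex_eqI) (simp_all add: integral_Re[OF i, symmetric] integral_Im[OF i, symmetric] cos_transform_def sin_transform_def)
 qed
 have "distr M borel (\<lambda>x. v \<bullet> x) = distr N borel (\<lambda>x. v \<bullet> x)"
 proof (rule Levy_uniqueness)
  show "char (distr M borel (\<lambda>x. v \<bullet> x)) = char (distr N borel (\<lambda>x. v \<bullet> x))" using all by (simp add: fun_eq_iff ch[OF p1] ch[OF p2])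
 qed (use vm[OF p1(2)] vm[OF p2(2)] p1(1) p2(1) in \<open>auto intro!: prob_space.real_distribution_distr\<close>)
 then have "(\<integral>y. y ^ k \<partial>distr M borel (\<lambda>x. v \<bullet> x)) = (\<integral>y. y ^ k \<partial>distr N borel (\<lambda>x. v \<bullet> x))" by simp
 then show "(\<integral>x. (v \<bullet> x) ^ k \<partial>M) = (\<integral>x. (v \<bullet> x) ^ k \<partial>N)"
  using vm[OF p1(2)] vm[OF p2(2)] by (simp add: integral_distr)
qed

end

lemma transforms_continuous:
 fixes \<nu> :: "(real^'n) measure"
 assumes p: "prob_space \<nu>" "sets \<nu> = sets borel"
 shows "continuous_on UNIV (cos_transform \<nu>)" "continuous_on UNIV (sin_transform \<nu>)"
proof -
 interpret prob_space \<nu> by fact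
 have lim: "(\<lambda>n. \<integral>x. g (z n \<bullet> x) \<partial>\<nu>) \<longlonglongrightarrow> (\<integral>x. g (\<xi> \<bullet> x) \<partial>\<nu>)" if z: "z \<longlonglongrightarrow> \<xi>" and g: "continuous_on UNIV g" "\<And>t. \<bar>g t\<bar> \<le> 1" for z \<xi> and g :: "real \<Rightarrow> real"
 proof (rule integral_dominated_convergence[where w="\<lambda>_. 1"])
  have [measurable]: "g \<in> borel_measurable borel" by (rule borel_measurable_continuous_onI[OF g(1)])
  have m: "(\<lambda>x. g (v \<bullet> x)) \<in> borel_measurable \<nu>" for v
   unfolding measurable_cong_sets[OF p(2) refl] by measurable
  show "(\<lambda>x. g (\<xi> \<bullet> x)) \<in> borel_measurable \<nu>" "(\<lambda>x. g (z n \<bullet> x)) \<in> borel_measurable \<nu>" for n by (rule m)+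
  show "AE x in \<nu>. (\<lambda>n. g (z n \<bullet> x)) \<longlonglongrightarrow> g (\<xi> \<bullet> x)"
  proof (intro AE_I2)
   fix x
   have "(\<lambda>n. z n \<bullet> x) \<longlonglongrightarrow> \<xi> \<bullet> x" by (intro tendsto_intros z)
   then show "(\<lambda>n. g (z n \<bullet> x)) \<longlonglongrightarrow> g (\<xi> \<bullet> x)"
    using continuous_on_tendsto_compose[OF g(1), of "\<lambda>n. z n \<bullet> x" "\<xi> \<bullet> x" sequentially] by simp
  qed
 qed (use g in auto)
 have c: "continuous_on UNIV (\<lambda>\<xi>. \<integral>x. g (\<xi> \<bullet> x) \<partial>\<nu>)" if "continuous_on UNIV g" "\<And>t. \<bar>g t\<bar> \<le> 1" for g :: "real \<Rightarrow> real"
  unfolding continuous_on_sequentially comp_def using lim[OF _ that] by blast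
 show "continuous_on UNIV (cos_transform \<nu>)" "continuous_on UNIV (sin_transform \<nu>)"
  unfolding cos_transform_def[abs_def] sin_transform_def[abs_def] by (intro c continuous_intros; simp)+
qed

context riesz_kernel
begin

text \<open>The angular profile may vanish on part of the sphere, so a zero gap says nothing there.
  On the set G where w > 0 the transforms agree almost everywhere, hence everywhere by continuity,
  and homogeneity of w makes G an open cone.\<close>

lemma gap_zero_imp_eq:
 assumes p1: "prob_space M" "sets M = sets borel" and p2: "prob_space N" "sets N = sets borel"
  and E: "compact E" "AE x in M. x \<in> E" "AE x in N. x \<in> E" and gap: "gap M N = 0"
 shows "M = N"
proof -
 define q where "q \<xi> = (cos_transform M \<xi> - cos_transform N \<xi>)^2 + (sin_transform M \<xi> - sin_transform N \<xi>)^2" for \<xi>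
 note [measurable] = cos_transform_measurable[OF p1] cos_transform_measurable[OF p2]
 have [measurable]: "q \<in> borel_measurable borel" unfolding q_def by measurable
 define G where "G = - {0} \<inter> w -` {0<..}"
 have wc: "continuous_on (- {0}) w" using homogeneous_continuous(1)[OF Psi_cont] by (simp add: w_def[abs_def])
 have G: "open G" unfolding G_def by (rule continuous_open_preimage[OF wc]) auto
 have "(\<integral>\<^sup>+\<xi>. ennreal (w \<xi> * q \<xi>) \<partial>lborel) = 0" using gap unfolding gap_def q_def .
 then have "AE \<xi> in lborel. ennreal (w \<xi> * q \<xi>) = 0" by (subst (asm) nn_integral_0_iff_AE) auto
 then have ae: "AE \<xi> in lborel. w \<xi> * q \<xi> = 0"
 proof eventually_elim
  case (elim \<xi>)
  have "w \<xi> * q \<xi> \<ge> 0" using w_nonneg by (simp add: q_def)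
  then show ?case using elim by (simp only: ennreal_eq_0_iff antisym)
 qed
 have qc: "continuous_on UNIV q" unfolding q_def by (intro continuous_intros transforms_continuous p1 p2)
 have "open (q -` (- {0}))" using continuous_open_preimage[OF qc open_UNIV, of "- {0}"] open_Compl[OF closed_singleton[of 0]] by simp
 then have oD: "open (G \<inter> q -` (- {0}))" using G by (rule open_Int[rotated])
 have "G \<inter> q -` (- {0}) = {}"
 proof (rule ccontr)
  assume "G \<inter> q -` (- {0}) \<noteq> {}"
  then have "\<not> negligible (G \<inter> q -` (- {0}))" using open_not_negligible[OF oD] by blast
  moreover have "G \<inter> q -` (- {0}) \<in> null_sets lborel"
  proof (rule AE_iff_null_sets[THEN iffD2])
   show "G \<inter> q -` (- {0}) \<in> sets lborel" using oD by simp
   show "AE x in lborel. x \<notin> G \<inter> q -` (- {0})" using ae by eventually_elim (auto simp: G_def)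
  qed
  then have "negligible (G \<inter> q -` (- {0}))" by (simp add: negligible_iff_null_sets null_sets_completionI)
  ultimately show False by blast
 qed
 then have q0: "q \<xi> = 0" if "\<xi> \<in> G" for \<xi> using that by auto
 \<comment> \<open>If w vanished identically, so would every \<open>V \<epsilon>\<close>,
   contradicting its limit (2 pi)^d W, which is positive away from 0.\<close>
 have "G \<noteq> {}"
 proof
  assume "G = {}"
  then have w0: "w \<xi> = 0" for \<xi> using w_nonneg[of \<xi>] by (cases "\<xi> = 0") (auto simp: G_def w_def[of 0] order_le_less)
  then have V0: "V \<epsilon> x = 0" for \<epsilon> x by (simp add: V_def)
  define x :: "real^'n" where "x = axis undefined 1"
  have x: "x \<noteq> 0" by (simp add: x_def axis_eq_0_iff)
  have "(\<lambda>n. V (inverse (real (Suc n))) x) \<longlonglongrightarrow> (2 * pi) ^ CARD('n) * W x"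
   by (rule V_tendsto[OF x _ LIMSEQ_inverse_real_of_nat]) simp
  then have "(2 * pi) ^ CARD('n) * W x = 0" unfolding V0 by (simp add: LIMSEQ_const_iff)
  then show False using W_pos[OF x] by simp
 qed
 then obtain \<xi>0 where \<xi>0: "\<xi>0 \<in> G" by blast
 have cone: "t *\<^sub>R \<xi> \<in> G" if "t > 0" "\<xi> \<in> G" for t \<xi>
  using that unfolding G_def by (auto simp: w_def sgn_scaleR powr_mult zero_less_mult_iff)
 show ?thesis
 proof (rule eq_from_transforms_cone[OF p1 p2 E G \<xi>0 cone])
  show "cos_transform M \<xi> = cos_transform N \<xi>" "sin_transform M \<xi> = sin_transform N \<xi>" if "\<xi> \<in> G" for \<xi>
   using q0[OF that] unfolding q_def by (simp_all add: sum_power2_eq_zero_iff)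
 qed
qed

end

section \<open>Pushforwards to ellipsoids\<close>

text \<open>The density is carried over by B = T^-1 with factor 1 / |det T|, which combines with the
  volume of the ball into the volume of the ellipsoid; what is left of the normalising constant is
  the Gamma quotient.\<close>

lemma mu_iso_ball_distr:
 fixes T B :: "real^'n^'n"
 assumes s: "real CARD('n) - 2 < s" and TB: "T ** B = mat 1" "B ** T = mat 1" and det: "det T \<noteq> 0"
 shows "distr (mu_iso s) borel (\<lambda>x. T *v x) =
  density lborel (\<lambda>x. ennreal (indicator ((\<lambda>x. T *v x) ` cball 0 1) x / measure lborel ((\<lambda>x. T *v x) ` cball 0 1)
   * Gamma (1 + s / 2) / (Gamma (1 + real CARD('n) / 2) * Gamma (1 + (s - real CARD('n)) / 2))
   * (1 - (norm (B *v x))\<^sup>2) powr ((s - real CARD('n)) / 2)))"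
proof -
 let ?d = "real CARD('n)" and ?E = "(\<lambda>x. T *v x) ` cball 0 1"
 define \<beta> where "\<beta> = (s - ?d) / 2"
 define fr where "fr x = indicator (cball 0 1) x * (1 - (norm x)\<^sup>2) powr \<beta>" for x :: "real^'n"
 define c0 where "c0 = surface_const TYPE('n) * Beta (?d / 2) (\<beta> + 1) / 2"
 have mu: "mu_iso s = density lborel (\<lambda>x::real^'n. ennreal (fr x / c0))"
  using mu_iso_ball[OF s] unfolding fr_def c0_def \<beta>_def .
 have [measurable]: "cball (0::real^'n) 1 \<in> sets borel" by simp
 have [measurable]: "fr \<in> borel_measurable borel" unfolding fr_def by measurable
 have [measurable]: "(\<lambda>x. M *v x) \<in> borel_measurable borel" for M :: "real^'n^'n" by (rule measurable_matrix_vector_mult)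
 have c0: "c0 > 0" unfolding c0_def \<beta>_def by (rule c0_pos[OF s])
 have BT: "B *v (T *v x) = x" "T *v (B *v x) = x" for x
  by (simp_all add: matrix_vector_mul_assoc TB)
 have E: "x \<in> ?E \<longleftrightarrow> B *v x \<in> cball 0 1" for x
  using BT by (metis (no_types, lifting) image_iff)
 have EB: "?E = (\<lambda>x. B *v x) -` cball 0 1" by (intro set_eqI) (simp only: E vimage_eq)
 have Em[measurable]: "?E \<in> sets borel" unfolding EB using measurable_sets[OF \<open>(\<lambda>x. B *v x) \<in> borel_measurable borel\<close>, of "cball 0 1"] by simp
 define b where "b = measure lborel (ball (0::real^'n) 1)"
 have b: "b > 0" unfolding b_def by (rule emeasure_lborel_unit_ball(2))
 have cb: "emeasure lborel (cball (0::real^'n) 1) = ennreal b"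
  using emeasure_lborel_cball_finite[of "0::real^'n" 1] unfolding b_def
  by (simp add: emeasure_eq_ennreal_measure less_top[symmetric] content_cball content_ball)
 have mE: "measure lborel ?E = \<bar>det T\<bar> * b"
 proof -
  have "(\<integral>\<^sup>+x. indicator ?E (T *v x) \<partial>lborel) = (\<integral>\<^sup>+x. indicator (cball 0 1) (x::real^'n) \<partial>lborel)"
   by (intro nn_integral_cong) (simp add: indicator_def E BT)
  then have "ennreal b = ennreal (1 / \<bar>det T\<bar>) * emeasure lborel ?E"
   using nn_integral_lborel_matrix[OF det, of "indicator ?E"] cb by simp
  then have "ennreal (\<bar>det T\<bar>) * ennreal b = (ennreal (\<bar>det T\<bar>) * ennreal (1 / \<bar>det T\<bar>)) * emeasure lborel ?E"
   by (simp only: mult.assoc)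
  also have "ennreal (\<bar>det T\<bar>) * ennreal (1 / \<bar>det T\<bar>) = 1" using det by (simp add: ennreal_mult[symmetric])
  finally have "emeasure lborel ?E = ennreal (\<bar>det T\<bar> * b)" using b by (simp add: ennreal_mult)
  then show ?thesis using b by (simp add: measure_def)
 qed
 \<comment> \<open>The surface constant is d times the volume of the ball, and the factor d / 2
   turns Gamma (d / 2) into Gamma (1 + d / 2); the arguments of the Beta function add up to 1 + s /
   2.\<close>
 have c0_eq: "c0 = b * (Gamma (1 + ?d / 2) * Gamma (1 + \<beta>)) / Gamma (1 + s / 2)"
 proof -
  have 1: "Gamma (1 + ?d / 2) = ?d / 2 * Gamma (?d / 2)" by (subst add.commute, rule Gamma_plus1) auto
  have 2: "?d / 2 + (1 + \<beta>) = 1 + s / 2" by (simp add: \<beta>_def field_simps)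
  show ?thesis unfolding c0_def surface_const_def b_def[symmetric] Beta_def add.commute[of \<beta> 1] 2 1 by (simp add: mult_ac)
 qed
 have G: "Gamma (1 + s / 2) \<noteq> 0" "Gamma (1 + ?d / 2) * Gamma (1 + \<beta>) \<noteq> 0"
  using c0 unfolding c0_eq by auto
 have dens: "indicator ?E x / measure lborel ?E * Gamma (1 + s / 2) / (Gamma (1 + ?d / 2) * Gamma (1 + \<beta>)) * (1 - (norm (B *v x))\<^sup>2) powr \<beta>
   = fr (B *v x) / c0 * (1 / \<bar>det T\<bar>)" for x
 proof -
  have "indicator ?E x = (indicator (cball 0 1) (B *v x) :: real)" by (simp add: indicator_def E)
  then show ?thesis unfolding mE c0_eq fr_def using b det G by (simp add: field_simps)
 qed
 define F where "F y = ennreal (fr (B *v y) / c0)" for y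
 have [measurable]: "F \<in> borel_measurable borel" unfolding F_def by measurable
 have "distr (mu_iso s) borel (\<lambda>x. T *v x) = distr (density lborel (\<lambda>x. F (T *v x))) borel (\<lambda>x. T *v x)"
  by (simp add: mu F_def BT)
 also have "\<dots> = density (distr lborel borel (\<lambda>x. T *v x)) F" by (rule density_distr[symmetric]) measurable
 also have "\<dots> = density lborel (\<lambda>x. ennreal (1 / \<bar>det T\<bar>) * F x)"
  unfolding distr_lborel_matrix[OF det] by (rule density_density_eq) measurable
 also have "\<dots> = density lborel (\<lambda>x. ennreal (fr (B *v x) / c0 * (1 / \<bar>det T\<bar>)))"
  using c0 by (intro arg_cong2[where f=density] refl ext) (simp add: F_def fr_def ennreal_mult[symmetric])
 finally show ?thesis unfolding \<beta>_def[symmetric] dens .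
qed

text \<open>The area formula recast as an equality of measures, so that a density can be moved
  between the sphere and its image by \<open>density_distr\<close>.\<close>

lemma hausdorff_measure_linear_sphere_distr:
 fixes T B :: "real^'n^'n"
 assumes d2: "CARD('n) \<ge> 2" and TB: "T ** B = mat 1" "B ** T = mat 1"
 shows "density (hausdorff_measure (real CARD('n) - 1)) (indicator ((\<lambda>x. T *v x) ` sphere 0 1)) =
  distr (density (hausdorff_measure (real CARD('n) - 1)) (\<lambda>x. ennreal (\<bar>det T\<bar> * norm (transpose B *v x)) * indicator (sphere 0 1) x)) borel (\<lambda>x. T *v x)"
  (is "?L = ?R")
proof (rule measure_eqI)
 let ?k = "real CARD('n) - 1"
 let ?S = "sphere (0::real^'n) 1"
 note [measurable_cong] = sets_hausdorff_measure
 have [measurable]: "(\<lambda>x. M *v x) \<in> borel_measurable borel" for M :: "real^'n^'n" by (rule measurable_matrix_vector_mult)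
 have BT: "B *v (T *v x) = x" "T *v (B *v x) = x" for x by (simp_all add: matrix_vector_mul_assoc TB)
 have [measurable]: "?S \<in> sets borel" by simp
 have "x \<in> (\<lambda>x. T *v x) ` X \<longleftrightarrow> B *v x \<in> X" for x X using BT by (metis (no_types, lifting) image_iff)
 then have TS: "(\<lambda>x. T *v x) ` X = (\<lambda>x. B *v x) -` X" for X by (intro set_eqI) (simp only: vimage_eq)
 have TSm[measurable]: "(\<lambda>x. T *v x) ` ?S \<in> sets borel"
  unfolding TS using measurable_sets[of "\<lambda>x. B *v x" borel borel ?S] by simp
 show "sets ?L = sets ?R" by (simp add: sets_hausdorff_measure)
 fix A assume "A \<in> sets ?L"
 then have A[measurable]: "A \<in> sets borel" by (simp add: sets_hausdorff_measure)
 have pre[measurable]: "(\<lambda>x. T *v x) -` A \<in> sets borel" using measurable_sets[of "\<lambda>x. T *v x" borel borel A] by simp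
 have "emeasure ?L A = emeasure (hausdorff_measure ?k) (A \<inter> (\<lambda>x. T *v x) ` ?S)"
  by (subst emeasure_density) (auto simp: sets_hausdorff_measure indicator_inter_arith[symmetric] Int_commute)
 also have "A \<inter> (\<lambda>x. T *v x) ` ?S = (\<lambda>x. T *v x) ` (?S \<inter> (\<lambda>x. T *v x) -` A)" by auto
 also have "emeasure (hausdorff_measure ?k) \<dots> = hausdorff_outer ?k \<dots>"
 proof (rule emeasure_hausdorff_measure)
  show "(\<lambda>x. T *v x) ` (?S \<inter> (\<lambda>x. T *v x) -` A) \<in> sets borel"
   unfolding TS using measurable_sets[of "\<lambda>x. B *v x" borel borel "?S \<inter> (\<lambda>x. T *v x) -` A"] by simp
 qed
 also have "\<dots> = (\<integral>\<^sup>+x. ennreal (\<bar>det T\<bar> * norm (transpose B *v x)) * indicator (?S \<inter> (\<lambda>x. T *v x) -` A) x \<partial>hausdorff_measure ?k)"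
  by (rule hausdorff_measure_linear_sphere[OF refl d2 TB]) auto
 also have "\<dots> = (\<integral>\<^sup>+x. (ennreal (\<bar>det T\<bar> * norm (transpose B *v x)) * indicator ?S x) * indicator ((\<lambda>x. T *v x) -` A) x \<partial>hausdorff_measure ?k)"
  by (simp add: indicator_inter_arith mult.assoc)
 also have "\<dots> = emeasure (density (hausdorff_measure ?k) (\<lambda>x. ennreal (\<bar>det T\<bar> * norm (transpose B *v x)) * indicator ?S x)) ((\<lambda>x. T *v x) -` A)"
  by (rule emeasure_density[symmetric]) measurable
 also have "\<dots> = emeasure ?R A"
  by (subst emeasure_distr) (auto simp: sets_hausdorff_measure space_hausdorff_measure)
 finally show "emeasure ?L A = emeasure ?R A" .
qed

text \<open>The uniform measure on the sphere, pushed forward, has density inverse to the area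
  factor |det T| |B^T x|. That factor is known at the point x of the sphere, while the density is
  wanted at T x; \<open>g\<close> stands for any function on the target whose pullback supplies
  it.\<close>

lemma mu_iso_sphere_distr:
 fixes T B :: "real^'n^'n" and g :: "real^'n \<Rightarrow> real"
 assumes d2: "CARD('n) \<ge> 2" and s: "s = real CARD('n) - 2" and TB: "T ** B = mat 1" "B ** T = mat 1" and det: "det T \<noteq> 0"
  and g[measurable]: "g \<in> borel_measurable borel" and gT: "\<And>x. norm x = 1 \<Longrightarrow> g (T *v x) = norm (transpose B *v x)"
 shows "distr (mu_iso s) borel (\<lambda>x. T *v x) = density (hausdorff_measure (real CARD('n) - 1))
   (\<lambda>x. indicator ((\<lambda>x. T *v x) ` sphere 0 1) x / (emeasure (hausdorff_measure (real CARD('n) - 1)) (sphere (0::real^'n) 1) * ennreal \<bar>det T\<bar>)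
    * ennreal (inverse (g x)))"
proof -
 let ?H = "hausdorff_measure (real CARD('n) - 1) :: (real^'n) measure"
 let ?S = "sphere (0::real^'n) 1"
 let ?TS = "(\<lambda>x. T *v x) ` ?S"
 define h where "h = emeasure ?H ?S"
 note [measurable_cong] = sets_hausdorff_measure
 have [measurable]: "?S \<in> sets borel" by simp
 have "compact ?TS"
  by (intro compact_continuous_image compact_sphere linear_continuous_on linear_conv_bounded_linear[THEN iffD1] matrix_vector_mul_linear)
 then have [measurable]: "?TS \<in> sets borel" by (intro borel_closed compact_imp_closed)
 have hH: "h = hausdorff_outer (real CARD('n) - 1) ?S" unfolding h_def by (rule emeasure_hausdorff_measure) simp
 have h0: "h \<noteq> 0" and hf: "h \<noteq> top"
  using hausdorff_sphere_pos[OF refl d2] hausdorff_sphere_finite[OF refl d2] unfolding hH by auto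
 then obtain r where r: "h = ennreal r" "r > 0" by (cases h) (auto simp: less_le)
 have mu: "mu_iso s = density ?H (\<lambda>x. indicator ?S x / h)"
  by (simp add: mu_iso_def s h_def Let_def)
 define \<rho> where "\<rho> x = ennreal (\<bar>det T\<bar> * norm (transpose B *v x)) * indicator ?S x" for x
 have [measurable]: "\<rho> \<in> borel_measurable borel"
  unfolding \<rho>_def using measurable_matrix_vector_mult[of "transpose B"] by measurable
 define F where "F y = ennreal (inverse (g y)) / (h * ennreal \<bar>det T\<bar>)" for y
 have [measurable]: "F \<in> borel_measurable borel" unfolding F_def by measurable
 have pt: "\<rho> x * F (T *v x) = indicator ?S x / h" for x
 proof (cases "x \<in> ?S")
  case True
  then have x: "norm x = 1" by simp
  define p where "p = norm (transpose B *v x)"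
  have "transpose T *v (transpose B *v x) = transpose (B ** T) *v x"
   by (simp only: matrix_vector_mul_assoc matrix_transpose_mul)
  then have "transpose T *v (transpose B *v x) = x" by (simp only: TB transpose_mat matrix_vector_mul_lid)
  then have "transpose B *v x \<noteq> 0" using x by (intro notI) (simp only: matrix_vector_mult_0_right norm_zero)
  then have p: "p > 0" by (simp add: p_def)
  define t where "t = \<bar>det T\<bar>"
  have t: "t > 0" using det by (simp add: t_def)
  have "ennreal (t * p) * (ennreal (inverse p) / (ennreal r * ennreal t)) = ennreal (t * p * (inverse p / (r * t)))"
   using p t r by (simp add: ennreal_mult[symmetric] divide_ennreal)
  also have "t * p * (inverse p / (r * t)) = 1 / r" using p t r by (simp add: field_simps)
  also have "ennreal (1 / r) = 1 / ennreal r" using r by (simp add: divide_ennreal[symmetric])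
  finally show ?thesis using True unfolding \<rho>_def F_def gT[OF x] p_def[symmetric] t_def[symmetric] r(1) by simp
 qed (simp add: \<rho>_def)
 have "density ?H (\<lambda>x. indicator ?TS x / (h * ennreal \<bar>det T\<bar>) * ennreal (inverse (g x))) = density ?H (\<lambda>x. indicator ?TS x * F x)"
  by (intro arg_cong2[where f=density] refl ext) (simp add: F_def divide_ennreal_def mult_ac)
 also have "\<dots> = density (density ?H (indicator ?TS)) F" by (rule density_density_eq[symmetric]) measurable
 also have "\<dots> = density (distr (density ?H \<rho>) borel (\<lambda>x. T *v x)) F"
  unfolding hausdorff_measure_linear_sphere_distr[OF d2 TB] \<rho>_def ..
 also have "\<dots> = distr (density (density ?H \<rho>) (\<lambda>x. F (T *v x))) borel (\<lambda>x. T *v x)" by (rule density_distr) measurable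
 also have "density (density ?H \<rho>) (\<lambda>x. F (T *v x)) = mu_iso s"
  unfolding mu pt[symmetric] by (rule density_density_eq) measurable
 finally show ?thesis unfolding h_def ..
qed

lemma frontier_matrix_image:
 fixes T B :: "real^'n^'n"
 assumes TB: "T ** B = mat 1" "B ** T = mat 1"
 shows "frontier ((\<lambda>x. T *v x) ` S) = (\<lambda>x. T *v x) ` frontier S"
proof -
 have BT: "B *v (T *v x) = x" "T *v (B *v x) = x" for x by (simp_all add: matrix_vector_mul_assoc TB)
 have b: "bij (\<lambda>x. T *v x)" by (rule bij_betw_byWitness[where f'="\<lambda>x. B *v x"]) (auto simp: BT)
 have "linear (\<lambda>x. T *v x)" by (rule matrix_vector_mul_linear)
 then have "closure ((\<lambda>x. T *v x) ` S) = (\<lambda>x. T *v x) ` closure S" "interior ((\<lambda>x. T *v x) ` S) = (\<lambda>x. T *v x) ` interior S"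
  using b by (auto intro!: closure_injective_linear_image[symmetric] interior_bijective_linear_image simp: bij_is_inj)
 then show ?thesis unfolding frontier_def using b by (simp add: image_set_diff bij_is_inj)
qed

context riesz_kernel
begin

text \<open>A competitor of finite constrained energy is carried by E and has finite energy, so
  \<open>energy_gap\<close> applies to it; otherwise there is nothing to compare. Since c bounds the
  energy of the candidate and the gap is nonnegative, minimality is immediate, and a competitor that
  does no worse must have gap 0.\<close>

theorem ellipsoid_minimizer:
 fixes T B :: "real^'n^'n"
 assumes iso: "iso_measure s \<mu>" and TB: "T ** B = mat 1"
 defines "E \<equiv> (\<lambda>x. T *v x) ` cball 0 1" and "\<mu>E \<equiv> distr \<mu> borel (\<lambda>x. T *v x)"
 shows "\<mu>E \<in> prob_measures"
  and "\<nu> \<in> prob_measures \<Longrightarrow> energyE s \<Phi> E \<mu>E \<le> energyE s \<Phi> E \<nu>"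
  and "\<nu> \<in> prob_measures \<Longrightarrow> energyE s \<Phi> E \<nu> \<le> energyE s \<Phi> E \<mu>E \<Longrightarrow> \<nu> = \<mu>E"
proof -
 have dil: "dil \<mu> T 1 = \<mu>E" by (simp add: dil_def[OF iso TB] \<mu>E_def)
 have p: "prob_space \<mu>E" "sets \<mu>E = sets borel" using dil_prob[OF iso TB, of 1] unfolding dil by auto
 then show "\<mu>E \<in> prob_measures" by (simp add: prob_measures_def)
 have AE: "AE x in \<mu>E. x \<in> E" using dil_AE[OF iso TB] unfolding dil E_def .
 have cE: "compact E" unfolding E_def
  by (intro compact_continuous_image compact_cball linear_continuous_on linear_conv_bounded_linear[THEN iffD1] matrix_vector_mul_linear)
 then have [measurable]: "E \<in> sets borel" by (intro borel_closed compact_imp_closed)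
 obtain c where c: "c \<ge> 0" "ennreal ((2 * pi) ^ CARD('n)) * energy2 \<mu>E \<mu>E \<le> ennreal c"
  and gap: "\<And>\<nu>. prob_space \<nu> \<Longrightarrow> sets \<nu> = sets borel \<Longrightarrow> AE x in \<nu>. x \<in> E \<Longrightarrow> energy2 \<nu> \<nu> < \<infinity> \<Longrightarrow>
    gap \<nu> \<mu>E + ennreal c \<le> ennreal ((2 * pi) ^ CARD('n)) * energy2 \<nu> \<nu>"
  using energy_gap[OF iso TB] unfolding dil E_def[symmetric] by blast
 define \<kappa> where "\<kappa> = ennreal ((2 * pi) ^ CARD('n))"
 have \<kappa>: "\<kappa> \<noteq> 0" "\<kappa> \<noteq> top" by (simp_all add: \<kappa>_def)
 have eE: "energyE s \<Phi> E \<nu> = energy2 \<nu> \<nu>" if "AE x in \<nu>. x \<in> E" for \<nu>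
 proof -
  have "(\<integral>\<^sup>+x. (if x \<in> E then 0 else \<infinity>) \<partial>\<nu>) = (\<integral>\<^sup>+x. 0 \<partial>\<nu>)"
   by (rule nn_integral_cong_AE) (use that in \<open>auto elim!: eventually_mono\<close>)
  then show ?thesis by (simp add: energyE_def)
 qed
 have fin: "(AE x in \<nu>. x \<in> E) \<and> energy2 \<nu> \<nu> < \<infinity>" if "sets \<nu> = sets borel" "energyE s \<Phi> E \<nu> < \<infinity>" for \<nu>
 proof
  note [measurable_cong] = that(1)
  have "AE x in \<nu>. (if x \<in> E then 0 else \<infinity> :: ennreal) \<noteq> \<infinity>"
   by (rule nn_integral_PInf_AE) (measurable, use that(2) in \<open>auto simp: energyE_def\<close>)
  then show "AE x in \<nu>. x \<in> E" by eventually_elim (auto split: if_splits)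
  show "energy2 \<nu> \<nu> < \<infinity>" using that(2) by (auto simp: energyE_def)
 qed
 have "\<kappa> * energy2 \<mu>E \<mu>E < top" using c(2) unfolding \<kappa>_def by (rule le_less_trans) simp
 then have finE: "energy2 \<mu>E \<mu>E < \<infinity>" using \<kappa> by (auto simp: ennreal_mult_less_top)
 show "energyE s \<Phi> E \<mu>E \<le> energyE s \<Phi> E \<nu>" if "\<nu> \<in> prob_measures"
 proof (cases "energyE s \<Phi> E \<nu> < \<infinity>")
  case True
  have \<nu>: "prob_space \<nu>" "sets \<nu> = sets borel" using that by (auto simp: prob_measures_def)
  note f = fin[OF \<nu>(2) True]
  have "\<kappa> * energy2 \<mu>E \<mu>E \<le> gap \<nu> \<mu>E + ennreal c" using c(2) unfolding \<kappa>_def by (rule order_trans) (simp add: add_increasing)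
  also have "\<dots> \<le> \<kappa> * energy2 \<nu> \<nu>" using gap[OF \<nu>] f unfolding \<kappa>_def by blast
  finally have "energy2 \<mu>E \<mu>E \<le> energy2 \<nu> \<nu>" using \<kappa> by (simp add: ennreal_mult_le_mult_iff)
  then show ?thesis using eE[OF AE] eE f by simp
 qed (simp add: less_top[symmetric])
 show "\<nu> = \<mu>E" if "\<nu> \<in> prob_measures" and le: "energyE s \<Phi> E \<nu> \<le> energyE s \<Phi> E \<mu>E"
 proof -
  have \<nu>: "prob_space \<nu>" "sets \<nu> = sets borel" using that by (auto simp: prob_measures_def)
  have "energyE s \<Phi> E \<nu> < \<infinity>" using le finE unfolding eE[OF AE] by (rule le_less_trans)
  note f = fin[OF \<nu>(2) this]
  have "gap \<nu> \<mu>E + ennreal c \<le> \<kappa> * energy2 \<nu> \<nu>" using gap[OF \<nu>] f unfolding \<kappa>_def by blast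
  also have "\<dots> \<le> \<kappa> * energy2 \<mu>E \<mu>E" using le eE[OF AE] eE f by (intro mult_left_mono) auto
  also have "\<dots> \<le> 0 + ennreal c" using c(2) unfolding \<kappa>_def by simp
  finally have "ennreal c + gap \<nu> \<mu>E \<le> ennreal c + 0" by (simp add: add.commute)
  then have "gap \<nu> \<mu>E = 0" unfolding ennreal_add_left_cancel_le by simp
  then show ?thesis by (rule gap_zero_imp_eq[OF \<nu> p cE conjunct1[OF f] AE])
 qed
qed

end

theorem theorem1p1:
 fixes s :: real
  and \<Phi> :: "real^'n \<Rightarrow> real"
  and R D :: "real^'n^'n"
 defines "d \<equiv> real CARD('n)"
 defines "E \<equiv> (\<lambda>x. (R ** D) *v x) ` cball 0 1"
 defines "\<mu>E \<equiv> distr (mu_iso s) borel (\<lambda>x. (R ** D) *v x)"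
 assumes d2: "CARD('n) \<ge> 2"
  and s_pos: "0 < s" and s_lt: "s < d" and s_ge: "d - 2 \<le> s"
  and Phi_cont: "continuous_on (sphere 0 1) \<Phi>"
  and Phi_even: "\<forall>x\<in>sphere 0 1. \<Phi> (- x) = \<Phi> x"
  and Phi_pos: "\<forall>x\<in>sphere 0 1. 0 < \<Phi> x"
  and hat: "hat_cont_nonneg s \<Phi>"
  and R_SO: "orthogonal_matrix R" "det R = 1"
  and D_diag: "\<forall>i j. i \<noteq> j \<longrightarrow> D $ i $ j = 0"
  and D_pos: "\<forall>i. 0 < D $ i $ i"
 shows "\<mu>E \<in> prob_measures
    \<and> (\<forall>\<nu>\<in>prob_measures. energyE s \<Phi> E \<mu>E \<le> energyE s \<Phi> E \<nu>)
    \<and> (\<forall>\<nu>\<in>prob_measures. (\<forall>\<rho>\<in>prob_measures. energyE s \<Phi> E \<nu> \<le> energyE s \<Phi> E \<rho>) \<longrightarrow> \<nu> = \<mu>E)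
    \<and> (d - 2 < s \<longrightarrow>
      \<mu>E = density lborel (\<lambda>x. ennreal (indicator E x / measure lborel E
          * Gamma (1 + s / 2) / (Gamma (1 + d / 2) * Gamma (1 + (s - d) / 2))
          * (1 - (norm (matrix_inv D *v (transpose R *v x)))\<^sup>2) powr ((s - d) / 2))))
    \<and> (s = d - 2 \<longrightarrow>
      \<mu>E = density (hausdorff_measure (d - 1))
          (\<lambda>x. indicator (frontier E) x
           / (emeasure (hausdorff_measure (d - 1)) (sphere (0::real^'n) 1) * ennreal (det D))
           * ennreal (inverse (norm ((matrix_inv D ** matrix_inv D) *v (transpose R *v x))))))"
proof -
 obtain \<Psi> where \<Psi>: "continuous_on (sphere 0 1) \<Psi>" "\<forall>\<xi>\<in>sphere 0 1. 0 \<le> \<Psi> \<xi>"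
  "\<And>\<phi>. schwartz \<phi> \<Longrightarrow> (\<integral>x. complex_of_real (Wfun s \<Phi> x) * fourier \<phi> x \<partial>lborel) =
    (\<integral>\<xi>. complex_of_real (norm \<xi> powr (s - real CARD('n)) * \<Psi> (sgn \<xi>)) * \<phi> \<xi> \<partial>lborel)"
  using hat unfolding hat_cont_nonneg_def by blast
 interpret riesz_kernel s \<Phi> \<Psi>
  by unfold_locales (use s_pos s_lt Phi_cont Phi_pos \<Psi> in \<open>auto simp: d_def\<close>)
 have iso: "iso_measure s (mu_iso s :: (real^'n) measure)"
  by (rule iso_measure_mu_iso) (use d2 s_ge in \<open>auto simp: d_def\<close>)
 have detD: "det D > 0"
  using D_diag D_pos det_diagonal[of D] by (simp add: prod_pos)
 define X where "X = matrix_inv D"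
 have "invertible D" using detD by (simp add: invertible_det_nz)
 note X = matrix_inv_mult[OF this, folded X_def]
 have RR: "R ** transpose R = mat 1" "transpose R ** R = mat 1" using R_SO(1) by (auto simp: orthogonal_matrix_def)
 define T where "T = R ** D"
 define B where "B = X ** transpose R"
 have TB: "T ** B = mat 1"
  unfolding T_def B_def by (metis X(1) RR(1) matrix_mul_assoc matrix_mul_rid)
 have BT: "B ** T = mat 1"
  unfolding T_def B_def by (metis X(2) RR(2) matrix_mul_assoc matrix_mul_rid)
 have detT: "det T = det D" using R_SO(2) by (simp add: T_def det_mul)
 have Xt: "transpose X = X"
 proof -
  have "transpose D = D" using D_diag by (simp add: transpose_def vec_eq_iff) metis
  then have "transpose X ** D = mat 1" using arg_cong[OF X(1), of transpose] by (simp add: matrix_transpose_mul)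
  then show ?thesis by (metis X(1) matrix_mul_assoc matrix_mul_lid matrix_mul_rid)
 qed
 \<comment> \<open>The transpose of B is R D^-1, because D^-1 is symmetric, and R preserves
   norms.\<close>
 have nB: "norm (transpose B *v x) = norm (X *v x)" for x
 proof -
  have "transpose B *v x = R *v (X *v x)"
   by (simp only: B_def matrix_transpose_mul transpose_transpose Xt matrix_vector_mul_assoc)
  moreover have "orthogonal_transformation (\<lambda>x. R *v x)" using R_SO(1) by (simp add: orthogonal_transformation_matrix)
  ultimately show ?thesis by (simp only: orthogonal_transformation_norm)
 qed
 have E: "E = (\<lambda>x. T *v x) ` cball 0 1" and \<mu>E: "\<mu>E = distr (mu_iso s) borel (\<lambda>x. T *v x)"
  by (simp_all add: E_def \<mu>E_def T_def)
 note min = ellipsoid_minimizer[OF iso TB, folded E \<mu>E]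
 have ball: "\<mu>E = density lborel (\<lambda>x. ennreal (indicator E x / measure lborel E
          * Gamma (1 + s / 2) / (Gamma (1 + d / 2) * Gamma (1 + (s - d) / 2))
          * (1 - (norm (matrix_inv D *v (transpose R *v x)))\<^sup>2) powr ((s - d) / 2)))" if "d - 2 < s"
 proof -
  have "matrix_inv D *v (transpose R *v x) = B *v x" for x by (simp only: B_def X_def matrix_vector_mul_assoc)
  then show ?thesis
   using mu_iso_ball_distr[OF _ TB BT, of s] that detD detT unfolding \<mu>E E d_def by (simp only:)
 qed
 have sphere: "\<mu>E = density (hausdorff_measure (d - 1))
          (\<lambda>x. indicator (frontier E) x
           / (emeasure (hausdorff_measure (d - 1)) (sphere (0::real^'n) 1) * ennreal (det D))
           * ennreal (inverse (norm ((matrix_inv D ** matrix_inv D) *v (transpose R *v x)))))" if s: "s = d - 2"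
 proof -
  have fE: "frontier E = (\<lambda>x. T *v x) ` sphere 0 1" unfolding E frontier_matrix_image[OF TB BT] by simp
  let ?g = "\<lambda>x. norm ((matrix_inv D ** matrix_inv D) *v (transpose R *v x))"
  \<comment> \<open>On the image, D^-1 D^-1 R^T (R D x) = D^-1 x, whose norm equals that of B^T x.
    This is how the expression with D^-2 R^T in the boundary density comes out of the area
    factor.\<close>
  have g: "?g (T *v x) = norm (transpose B *v x)" for x
  proof -
   have "(X ** X) *v (transpose R *v (T *v x)) = X *v ((B ** T) *v x)"
    by (simp only: B_def matrix_vector_mul_assoc matrix_mul_assoc)
   then show ?thesis unfolding nB X_def[symmetric] BT by (simp only: matrix_vector_mul_lid)
  qed
  have gm: "?g \<in> borel_measurable borel" unfolding matrix_vector_mul_assoc using measurable_matrix_vector_mult by measurable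
  show ?thesis
   using mu_iso_sphere_distr[OF d2 s[unfolded d_def] TB BT _ gm g] detD unfolding \<mu>E fE d_def detT by simp
 qed
 show ?thesis using min ball sphere by blast
qed

end
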